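(* Let $G$ be a finite group with $G\neq\{1\}$. In $\mathbb{A}_G$ we have the equation \[ 1+\sum_{n\geq 2}(-1)^n\,\mathrm{ch}_{G\wr S_n}\bigl(\widetilde{H}_{n-2}(\overline{Q_n^\sim(G)};\mathbb{Q})\bigr)=\Bigl(1+\sum_{c\in G_*}\frac{|c|}{|G|}p_1(c)\Bigr)(\mathrm{Exp}_G\circ L)^{-1}. \]
   Context: Posets. Write $[n]=\{1,\dots,n\}$. $G$ acts on $G\times[n]$ by left multiplication on the first factor, and $G\wr S_n$ denotes the group of permutations of $G\times[n]$ commuting with this action. The Dowling lattice $Q_n(G)$ ($n\ge1$) is the poset of pairs $(J,\pi)$ where $J$ is a $G$-stable subset of $G\times[n]$ and $\pi$ is a set partition of $(G\times[n])\setminus J$ (into nonempty parts; the empty set has one partition, the empty one) whose parts are permuted freely by $G$ (for all $1\neq g\in G$, $K\in\pi$: $K\neq g.K\in\pi$). The order is: $(J,\pi)\le(J',\pi')$ iff $J\subseteq J'$ and every $K\in\pi$ satisfies either $K\subseteq J'$ or $K$ is contained in a single part of $\pi'$. Its minimum $\hat0$ has $J=\emptyset$ and all parts singletons; its maximum is $\hat1=(G\times[n],\emptyset)$. The group $G\wr S_n$ acts on it. For $n\ge2$ and $G\neq\{1\}$, $Q_n^\sim(G)$ is the $(G\wr S_n)$-stable sub-poset of pairs $(J,\pi)$ with $\frac{|J|}{|G|}\neq1$; it contains $\hat0,\hat1$, and is a geometric lattice (hence pure and Cohen-Macaulay) of length $n$. Homology. For a bounded poset $P$, $\overline P=P\setminus\{\hat0,\hat1\}$,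 and $\widetilde H_i(\overline P;\mathbb{Q})$ is the reduced homology of its order complex, with the induced group action as a representation over $\mathbb{Q}$. Characters. Let $G_*$ be the set of conjugacy classes of $G$. $\Lambda_G=\mathbb{Q}[p_i(c)\mid i\ge1,c\in G_*]$, graded by $\deg p_i(c)=i$, and $\mathbb{A}_G=\mathbb{Q}[\![p_i(c)]\!]$ is its completion with respect to the grading; $\mathbb{A}_{G,+}$ is the ideal of elements with zero degree-$0$ term. For $G=\{1\}$ write $p_i=p_i(\{1\})$. For a representation $M$ of $G\wr S_n$ over $\mathbb{Q}$, \[ \mathrm{ch}_{G\wr S_n}(M)=\frac{1}{|G|^nn!}\sum_{x\in G\wr S_n}\mathrm{tr}(x,M)\,\Psi(x),\qquad \Psi(x)=\prod_{i,c}p_i(c)^{a_i(c)}, \] where $a_i(c)$ is the number of cycles of length $i$ and type $c$ of $x$: a cycle of the permutation of $[n]$ induced by $x$, of length $i$ and containing $m$, has type the conjugacy class of the $h\in G$ with $x^i.(1,m)=(h,m)$. Plethysm. The right plethystic action $\circ:\mathbb{A}_G\times\mathbb{A}_{\{1\},+}\to\mathbb{A}_G$ is determined by: $f\mapsto f\circ g$ is a continuous $\mathbb{Q}$-algebra homomorphism for each $g$; $g\mapsto p_i(c)\circ g$ extends to a continuous $\mathbb{Q}$-algebra homomorphism $\mathbb{A}_{\{1\}}\to\mathbb{A}_G$; and $p_i(c)\circ p_j=p_{ij}(c^j)$, where $c^j$ is the class of $j$th powers of elements of $c$. Series. $\mathrm{Exp}_G=\sum_{n\ge0}\mathrm{ch}_{G\wr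 S_n}(\mathbf 1)=\exp\bigl(\sum_{i\ge1,c\in G_*}\frac{|c|\,p_i(c)}{|G|\,i}\bigr)$, with $\mathbf 1$ the trivial representation; and $L=\sum_{e\ge1}\frac{\mu(e)}{e}\log(1+p_e)\in\mathbb{A}_{\{1\},+}$, with $\mu$ the number-theoretic Möbius function. The exponent $-1$ denotes multiplicative inverse. *)

theory Defs
  imports
    "HOL-Algebra.Algebra"
    "HOL-Combinatorics.Permutations"
    "HOL-Combinatorics.Orbits"
    "HOL-Library.Poly_Mapping"
    "HOL-Library.Disjoint_Sets"
    "HOL-Computational_Algebra.Primes"
    "HOL-Computational_Algebra.Squarefree"
begin

section \<open>Formal power series over the rationals in arbitrarily many variables\<close>

text \<open>A series is an arbitrary rational-valued function on the monomials
  \<^typ>\<open>'v \<Rightarrow>\<^sub>0 nat\<close>; a monomial has finitely many divisors, so the Cauchy product is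
  defined.\<close>

typedef 'v mps = "UNIV :: (('v \<Rightarrow>\<^sub>0 nat) \<Rightarrow> rat) set"
  morphisms mps_coeff Abs_mps
  by simp

setup_lifting type_definition_mps

lemma mps_eqI: "(\<And>m. mps_coeff f m = mps_coeff g m) \<Longrightarrow> f = g"
  by (metis ext mps_coeff_inject)

lemma mps_coeff_Abs [simp]: "mps_coeff (Abs_mps f) = f"
  by (simp add: Abs_mps_inverse)

lemma finite_monomial_divisors: "finite {u. \<exists>v. u + v = (m :: 'v \<Rightarrow>\<^sub>0 nat)}"
proof (rule finite_subset)
  let ?F = "{h. \<forall>x. (x \<in> Poly_Mapping.keys m \<longrightarrow> h x \<in> {..Poly_Mapping.lookup m x})
    \<and> (x \<notin> Poly_Mapping.keys m \<longrightarrow> h x = (0::nat))}"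
  let ?N = "{..Sum (Poly_Mapping.lookup m ` Poly_Mapping.keys m)}"
  have sub: "?F \<subseteq> {h. \<forall>x. (x \<in> Poly_Mapping.keys m \<longrightarrow> h x \<in> ?N)
    \<and> (x \<notin> Poly_Mapping.keys m \<longrightarrow> h x = 0)}"
  proof (intro subsetI CollectI allI conjI impI)
    fix h x assume h: "h \<in> ?F" and x: "x \<in> Poly_Mapping.keys m"
    have "h x \<le> Poly_Mapping.lookup m x" using h x by auto
    also have "\<dots> \<le> Sum (Poly_Mapping.lookup m ` Poly_Mapping.keys m)"
      using x by (intro member_le_sum[where f = "\<lambda>y. y"]) auto
    finally show "h x \<in> ?N" by simp
  qed auto
  have "finite ?F"
    by (rule finite_subset[OF sub]) (rule finite_set_of_finite_funs, auto)
  then show "finite (Abs_poly_mapping ` ?F)"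
    by (rule finite_imageI)
  show "{u. \<exists>v. u + v = m} \<subseteq> Abs_poly_mapping ` ?F"
  proof
    fix u assume "u \<in> {u. \<exists>v. u + v = m}"
    then obtain v where v: "u + v = m" by auto
    have "Poly_Mapping.lookup u x \<le> Poly_Mapping.lookup m x" for x
      by (simp add: v[symmetric] Poly_Mapping.lookup_add)
    then have "Poly_Mapping.lookup u \<in> ?F"
      by (auto simp: in_keys_iff) (metis le_zero_eq)
    moreover have "u = Abs_poly_mapping (Poly_Mapping.lookup u)"
      by (simp add: lookup_inverse)
    ultimately show "u \<in> Abs_poly_mapping ` ?F" by blast
  qed
qed

lemma finite_monomial_splits: "finite {(u, v). u + v = (m :: 'v \<Rightarrow>\<^sub>0 nat)}"
proof (rule finite_subset)
  let ?D = "{u. \<exists>v. u + v = m}"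
  show "{(u, v). u + v = m} \<subseteq> ?D \<times> ?D"
    by (auto, metis add.commute)
  show "finite (?D \<times> ?D)"
    using finite_monomial_divisors by blast
qed

instantiation mps :: (type) comm_ring_1
begin

lift_definition zero_mps :: "'a mps" is "\<lambda>_. 0" .
lift_definition one_mps :: "'a mps" is "\<lambda>m. if m = 0 then 1 else 0" .
lift_definition plus_mps :: "'a mps \<Rightarrow> 'a mps \<Rightarrow> 'a mps" is "\<lambda>f g m. f m + g m" .
lift_definition minus_mps :: "'a mps \<Rightarrow> 'a mps \<Rightarrow> 'a mps" is "\<lambda>f g m. f m - g m" .
lift_definition uminus_mps :: "'a mps \<Rightarrow> 'a mps" is "\<lambda>f m. - f m" .
lift_definition times_mps :: "'a mps \<Rightarrow> 'a mps \<Rightarrow> 'a mps" is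
  "\<lambda>f g m. \<Sum>(u, v) | u + v = m. f u * g v" .

instance
proof
  fix a b c :: "'a mps"
  show "a + b + c = a + (b + c)" by transfer (simp add: add.assoc)
  show "a + b = b + a" by transfer (simp add: add.commute)
  show "0 + a = a" by transfer simp
  show "- a + a = 0" by transfer simp
  show "a - b = a + - b" by transfer simp
  show "(0 :: 'a mps) \<noteq> 1" by transfer (metis zero_neq_one)
  show "a * b = b * a"
    apply transfer
    apply (rule ext)
    apply (rule sum.reindex_bij_witness[of _ "\<lambda>(u, v). (v, u)" "\<lambda>(u, v). (v, u)"])
        apply (auto simp: add.commute mult.commute)
    done
  show "1 * a = a"
  proof (transfer, rule ext)
    fix f :: "('a \<Rightarrow>\<^sub>0 nat) \<Rightarrow> rat" and m :: "'a \<Rightarrow>\<^sub>0 nat"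
    have "(\<Sum>(u, v) | u + v = m. (if u = 0 then 1 else 0) * f v)
        = (\<Sum>(u, v) \<in> {(0 :: 'a \<Rightarrow>\<^sub>0 nat, m)}. (if u = 0 then 1 else 0) * f v)"
      by (rule sum.mono_neutral_right[OF finite_monomial_splits]) (auto split: if_splits)
    then show "(\<Sum>(u, v) | u + v = m. (if u = 0 then 1 else 0) * f v) = f m" by simp
  qed
  show "(a + b) * c = a * c + b * c"
    by transfer (simp add: fun_eq_iff case_prod_unfold algebra_simps sum.distrib)
  show "a * b * c = a * (b * c)"
  proof (transfer, rule ext)
    fix f g h :: "('a \<Rightarrow>\<^sub>0 nat) \<Rightarrow> rat" and m
    let ?S = "\<lambda>m :: 'a \<Rightarrow>\<^sub>0 nat. {(u, v). u + v = m}"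
    have "(\<Sum>(w, z)\<in>?S m. (\<Sum>(u, v)\<in>?S w. f u * g v) * h z)
        = (\<Sum>p\<in>?S m. \<Sum>q\<in>?S (fst p). f (fst q) * g (snd q) * h (snd p))"
      by (simp add: case_prod_unfold sum_distrib_right)
    also have "\<dots> = (\<Sum>(p, q)\<in>Sigma (?S m) (\<lambda>p. ?S (fst p)). f (fst q) * g (snd q) * h (snd p))"
      by (rule sum.Sigma) (auto simp: finite_monomial_splits)
    also have "\<dots> = (\<Sum>(p, q)\<in>Sigma (?S m) (\<lambda>p. ?S (snd p)). f (fst p) * (g (fst q) * h (snd q)))"
      by (rule sum.reindex_bij_witness[of _
          "\<lambda>(p, q). ((fst p + fst q, snd q), (fst p, fst q))"
          "\<lambda>(p, q). ((fst q, snd q + snd p), (snd q, snd p))"])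
        (auto simp: algebra_simps)
    also have "\<dots> = (\<Sum>p\<in>?S m. \<Sum>q\<in>?S (snd p). f (fst p) * (g (fst q) * h (snd q)))"
      by (rule sum.Sigma[symmetric]) (auto simp: finite_monomial_splits)
    also have "\<dots> = (\<Sum>(u, w)\<in>?S m. f u * (\<Sum>(v, z)\<in>?S w. g v * h z))"
      by (simp add: case_prod_unfold sum_distrib_left)
    finally show "(\<Sum>(w, z)\<in>?S m. (\<Sum>(u, v)\<in>?S w. f u * g v) * h z)
        = (\<Sum>(u, w)\<in>?S m. f u * (\<Sum>(v, z)\<in>?S w. g v * h z))" .
  qed
qed

end

definition mps_const :: "rat \<Rightarrow> 'v mps" where
  "mps_const a = Abs_mps (\<lambda>m. if m = 0 then a else 0)"

definition mps_var :: "'v \<Rightarrow> 'v mps" where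
  "mps_var v = Abs_mps (\<lambda>m. if m = Poly_Mapping.single v 1 then 1 else 0)"

text \<open>The sum of a family of series in which every monomial has a nonzero coefficient in
  only finitely many members. All infinite sums below are of this kind. (A coefficient
  to which infinitely many members contribute is set to \<^term>\<open>0 :: rat\<close>.)\<close>

definition formal_sum :: "('i \<Rightarrow> 'v mps) \<Rightarrow> 'i set \<Rightarrow> 'v mps" where
  "formal_sum f I =
     Abs_mps (\<lambda>m. \<Sum>i | i \<in> I \<and> mps_coeff (f i) m \<noteq> 0. mps_coeff (f i) m)"

definition mps_inverse :: "'v mps \<Rightarrow> 'v mps" where
  "mps_inverse f = (THE g. f * g = 1)"

text \<open>\<open>mps_subst s f\<close> is the image of \<open>f\<close> under the continuous algebra homomorphism
  that sends each variable \<open>v\<close> to \<open>s v\<close>.\<close>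

definition mps_subst :: "('v \<Rightarrow> 'w mps) \<Rightarrow> 'v mps \<Rightarrow> 'w mps" where
  "mps_subst s f =
     formal_sum (\<lambda>m. mps_const (mps_coeff f m) *
       (\<Prod>v\<in>Poly_Mapping.keys m. s v ^ Poly_Mapping.lookup m v)) UNIV"

lemma mps_const_0 [simp]: "mps_const 0 = 0" and mps_const_1 [simp]: "mps_const 1 = 1"
  unfolding mps_const_def zero_mps_def one_mps_def by (simp_all add: fun_eq_iff)

lemma mps_coeff_0 [simp]: "mps_coeff 0 m = 0"
  by transfer simp

lemma mps_subst_var: "mps_subst s (mps_var v) = s v"
proof (rule mps_eqI)
  fix u
  let ?m = "Poly_Mapping.single v (1 :: nat)"
  let ?t = "\<lambda>m. mps_const (mps_coeff (mps_var v) m) *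
    (\<Prod>w\<in>Poly_Mapping.keys m. s w ^ Poly_Mapping.lookup m w)"
  have t: "?t m = (if m = ?m then s v else 0)" for m
    by (simp add: mps_var_def)
  have "{m. mps_coeff (?t m) u \<noteq> 0} = (if mps_coeff (s v) u = 0 then {} else {?m})"
    unfolding t by auto
  then show "mps_coeff (mps_subst s (mps_var v)) u = mps_coeff (s v) u"
    unfolding mps_subst_def formal_sum_def by (simp add: t)
qed


section \<open>Conjugacy classes, the rings of the characteristic and plethysm\<close>

definition conj_class :: "('a, 'b) monoid_scheme \<Rightarrow> 'a \<Rightarrow> 'a set" where
  "conj_class G h = {g \<otimes>\<^bsub>G\<^esub> h \<otimes>\<^bsub>G\<^esub> inv\<^bsub>G\<^esub> g | g. g \<in> carrier G}"

definition conj_classes :: "('a, 'b) monoid_scheme \<Rightarrow> 'a set set" where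
  "conj_classes G = conj_class G ` carrier G"

definition class_pow :: "('a, 'b) monoid_scheme \<Rightarrow> 'a set \<Rightarrow> nat \<Rightarrow> 'a set" where
  "class_pow G c j = (\<lambda>h. h [^]\<^bsub>G\<^esub> j) ` c"

text \<open>The ring $\mathbb{A}_G$ consists of the series of type \<^typ>\<open>(nat \<times> 'a set) mps\<close> that
  involve only variables \<open>(i, c)\<close> with \<open>i \<ge> 1\<close> and \<open>c\<close> a conjugacy class of \<open>G\<close>; for such an
  index \<open>mps_var (i, c)\<close> is $p_i(c)$. For the trivial group the single class is dropped from
  the notation, as in $p_i = p_i(\{1\})$: the elements of $\mathbb{A}_{\{1\}}$ are the series of
  type \<^typ>\<open>nat mps\<close> in the variables of index \<open>\<ge> 1\<close>.\<close>

abbreviation pvar :: "nat \<Rightarrow> 'a set \<Rightarrow> (nat \<times> 'a set) mps" where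
  "pvar i c \<equiv> mps_var (i, c)"

text \<open>\<open>pleth_gen G i c g\<close> is $p_i(c) \circ g$: the map $g \mapsto p_i(c) \circ g$ is the continuous
  algebra homomorphism that sends $p_j$ to $p_{ij}(c^j)$.\<close>

definition pleth_gen ::
  "('a, 'b) monoid_scheme \<Rightarrow> nat \<Rightarrow> 'a set \<Rightarrow> nat mps \<Rightarrow> (nat \<times> 'a set) mps" where
  "pleth_gen G i c g = mps_subst (\<lambda>j. pvar (i * j) (class_pow G c j)) g"

definition pleth ::
  "('a, 'b) monoid_scheme \<Rightarrow> (nat \<times> 'a set) mps \<Rightarrow> nat mps \<Rightarrow> (nat \<times> 'a set) mps" where
  "pleth G f g = mps_subst (\<lambda>(i, c). pleth_gen G i c g) f"

lemma pleth_pvar: "pleth G (pvar i c) g = pleth_gen G i c g"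
  by (simp add: pleth_def mps_subst_var)

lemma pleth_pvar_var: "pleth G (pvar i c) (mps_var j) = pvar (i * j) (class_pow G c j)"
  by (simp add: pleth_pvar pleth_gen_def mps_subst_var)

definition moebius_mu :: "nat \<Rightarrow> int" where
  "moebius_mu n = (if squarefree n then (-1) ^ card (prime_factors n) else 0)"

text \<open>$\log(1 + u)$ for a series \<open>u\<close> without constant term.\<close>

definition log1p_series :: "'v mps \<Rightarrow> 'v mps" where
  "log1p_series u = formal_sum (\<lambda>k. mps_const ((-1) ^ (k - 1) / of_nat k) * u ^ k) {1..}"

definition L_series :: "nat mps" where
  "L_series =
     formal_sum (\<lambda>e. mps_const (of_int (moebius_mu e) / of_nat e) * log1p_series (mps_var e)) {1..}"


section \<open>Wreath products and the characteristic of a representation\<close>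

definition act :: "('a, 'b) monoid_scheme \<Rightarrow> 'a \<Rightarrow> 'a \<times> nat \<Rightarrow> 'a \<times> nat" where
  "act G g z = (g \<otimes>\<^bsub>G\<^esub> fst z, snd z)"

definition wreath :: "('a, 'b) monoid_scheme \<Rightarrow> nat \<Rightarrow> ('a \<times> nat \<Rightarrow> 'a \<times> nat) set" where
  "wreath G n = {x. x permutes (carrier G \<times> {1..n}) \<and>
     (\<forall>g\<in>carrier G. \<forall>z\<in>carrier G \<times> {1..n}. x (act G g z) = act G g (x z))}"

text \<open>The permutation of \<open>{1..n}\<close> induced by an element of the wreath product.\<close>

definition induced_perm ::
  "('a, 'b) monoid_scheme \<Rightarrow> ('a \<times> nat \<Rightarrow> 'a \<times> nat) \<Rightarrow> nat \<Rightarrow> nat" where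
  "induced_perm G x m = snd (x (\<one>\<^bsub>G\<^esub>, m))"

definition cycle_count ::
  "('a, 'b) monoid_scheme \<Rightarrow> nat \<Rightarrow> ('a \<times> nat \<Rightarrow> 'a \<times> nat) \<Rightarrow> nat \<Rightarrow> 'a set \<Rightarrow> nat" where
  "cycle_count G n x i c =
     card {C \<in> orbit (induced_perm G x) ` {1..n}. card C = i \<and>
       (\<exists>m\<in>C. \<exists>h\<in>carrier G. (x ^^ i) (\<one>\<^bsub>G\<^esub>, m) = (h, m) \<and> conj_class G h = c)}"

definition Psi ::
  "('a, 'b) monoid_scheme \<Rightarrow> nat \<Rightarrow> ('a \<times> nat \<Rightarrow> 'a \<times> nat) \<Rightarrow> (nat \<times> 'a set) mps" where
  "Psi G n x = (\<Prod>i\<in>{1..n}. \<Prod>c\<in>conj_classes G. pvar i c ^ cycle_count G n x i c)"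

text \<open>Rational vector spaces are \<^typ>\<open>(rat, 'v) module\<close> records. Their ring fields \<open>mult\<close>
  and \<open>one\<close> play no role.\<close>

definition lin_basis :: "(rat, 'v) module \<Rightarrow> 'v set \<Rightarrow> bool" where
  "lin_basis M B \<longleftrightarrow> finite B \<and> B \<subseteq> carrier M \<and>
     (\<forall>v\<in>carrier M. \<exists>!a. a \<in> B \<rightarrow>\<^sub>E UNIV \<and> v = (\<Oplus>\<^bsub>M\<^esub>b\<in>B. a b \<odot>\<^bsub>M\<^esub> b))"

definition lin_coord :: "(rat, 'v) module \<Rightarrow> 'v set \<Rightarrow> 'v \<Rightarrow> 'v \<Rightarrow> rat" where
  "lin_coord M B v = (THE a. a \<in> B \<rightarrow>\<^sub>E UNIV \<and> v = (\<Oplus>\<^bsub>M\<^esub>b\<in>B. a b \<odot>\<^bsub>M\<^esub> b))"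

text \<open>The trace of an endomorphism of a finite-dimensional space (independent of the basis).\<close>

definition lin_trace :: "(rat, 'v) module \<Rightarrow> ('v \<Rightarrow> 'v) \<Rightarrow> rat" where
  "lin_trace M f = (let B = (SOME B. lin_basis M B) in \<Sum>b\<in>B. lin_coord M B (f b) b)"

text \<open>The characteristic of the representation on the space \<open>M\<close> in which \<open>x\<close> acts by \<open>\<rho> x\<close>.\<close>

definition ch ::
  "('a, 'b) monoid_scheme \<Rightarrow> nat \<Rightarrow> (rat, 'v) module
    \<Rightarrow> (('a \<times> nat \<Rightarrow> 'a \<times> nat) \<Rightarrow> 'v \<Rightarrow> 'v) \<Rightarrow> (nat \<times> 'a set) mps" where
  "ch G n M \<rho> = mps_const (1 / (of_nat (order G) ^ n * fact n)) *
     (\<Sum>x\<in>wreath G n. mps_const (lin_trace M (\<rho> x)) * Psi G n x)"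

definition rat_space :: "(rat, rat) module" where
  "rat_space = \<lparr>carrier = UNIV, monoid.mult = (*), one = 1, ring.zero = 0, add = (+), smult = (*)\<rparr>"

definition Exp_series :: "('a, 'b) monoid_scheme \<Rightarrow> (nat \<times> 'a set) mps" where
  "Exp_series G = formal_sum (\<lambda>n. ch G n rat_space (\<lambda>x v. v)) UNIV"


section \<open>Reduced homology of posets\<close>

definition proper_part :: "'p gorder \<Rightarrow> 'p gorder" where
  "proper_part P = P\<lparr>carrier := carrier P - {\<bottom>\<^bsub>P\<^esub>, \<top>\<^bsub>P\<^esub>}\<rparr>"

text \<open>The faces of the order complex, including the empty one.\<close>

definition order_complex :: "'p gorder \<Rightarrow> 'p set set" where
  "order_complex P = {\<sigma>. finite \<sigma> \<and> \<sigma> \<subseteq> carrier P \<and> Complete_Partial_Order.chain (le P) \<sigma>}"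

text \<open>The augmented rational simplicial chains of degree \<open>i \<ge> -1\<close>: a face with \<open>k\<close> vertices has
  degree \<open>k - 1\<close>.\<close>

definition chain_group :: "'p gorder \<Rightarrow> int \<Rightarrow> ('p set \<Rightarrow>\<^sub>0 rat) set" where
  "chain_group P i =
     {z. Poly_Mapping.keys z \<subseteq> {\<sigma> \<in> order_complex P. int (card \<sigma>) = i + 1}}"

text \<open>The vertices of a face are ordered increasingly, so the sign of the face omitting \<open>x\<close> is
  given by the number of vertices below \<open>x\<close>.\<close>

definition boundary :: "'p gorder \<Rightarrow> ('p set \<Rightarrow>\<^sub>0 rat) \<Rightarrow> ('p set \<Rightarrow>\<^sub>0 rat)" where
  "boundary P z = (\<Sum>\<sigma>\<in>Poly_Mapping.keys z. \<Sum>x\<in>\<sigma>.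
     Poly_Mapping.single (\<sigma> - {x}) ((-1) ^ card {y\<in>\<sigma>. y \<sqsubset>\<^bsub>P\<^esub> x} * Poly_Mapping.lookup z \<sigma>))"

definition cycle_space :: "'p gorder \<Rightarrow> int \<Rightarrow> (rat, 'p set \<Rightarrow>\<^sub>0 rat) module" where
  "cycle_space P i =
     \<lparr>carrier = {z \<in> chain_group P i. boundary P z = 0}, monoid.mult = undefined, one = undefined,
      ring.zero = 0, add = (+), smult = (\<lambda>r. Poly_Mapping.map ((*) r))\<rparr>"

definition quotient_space :: "(rat, 'v) module \<Rightarrow> 'v set \<Rightarrow> (rat, 'v set) module" where
  "quotient_space M N =
     \<lparr>carrier = a_rcosets\<^bsub>M\<^esub> N, monoid.mult = undefined, one = undefined,
      ring.zero = N, add = (<+>\<^bsub>M\<^esub>), smult = (\<lambda>r C. N <+>\<^bsub>M\<^esub> ((\<lambda>v. r \<odot>\<^bsub>M\<^esub> v) ` C))\<rparr>"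

definition reduced_homology ::
  "'p gorder \<Rightarrow> int \<Rightarrow> (rat, ('p set \<Rightarrow>\<^sub>0 rat) set) module" where
  "reduced_homology P i = quotient_space (cycle_space P i) (boundary P ` chain_group P (i + 1))"

text \<open>The action of an order automorphism \<open>\<phi>\<close> on chains, and on homology classes (which
  are cosets). An automorphism preserves the vertex order, so there are no signs.\<close>

definition chain_map :: "('p \<Rightarrow> 'p) \<Rightarrow> ('p set \<Rightarrow>\<^sub>0 rat) \<Rightarrow> ('p set \<Rightarrow>\<^sub>0 rat)" where
  "chain_map \<phi> z = (\<Sum>\<sigma>\<in>Poly_Mapping.keys z. Poly_Mapping.single (\<phi> ` \<sigma>) (Poly_Mapping.lookup z \<sigma>))"

definition homology_map ::
  "('p \<Rightarrow> 'p) \<Rightarrow> ('p set \<Rightarrow>\<^sub>0 rat) set \<Rightarrow> ('p set \<Rightarrow>\<^sub>0 rat) set" where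
  "homology_map \<phi> C = chain_map \<phi> ` C"


section \<open>Dowling lattices\<close>

type_synonym 'a dowling_elt = "('a \<times> nat) set \<times> ('a \<times> nat) set set"

definition dowling_elts :: "('a, 'b) monoid_scheme \<Rightarrow> nat \<Rightarrow> 'a dowling_elt set" where
  "dowling_elts G n = {(J, \<pi>). J \<subseteq> carrier G \<times> {1..n} \<and>
     (\<forall>g\<in>carrier G. act G g ` J = J) \<and>
     partition_on (carrier G \<times> {1..n} - J) \<pi> \<and>
     (\<forall>g\<in>carrier G. \<forall>K\<in>\<pi>. act G g ` K \<in> \<pi>) \<and>
     (\<forall>g\<in>carrier G - {\<one>\<^bsub>G\<^esub>}. \<forall>K\<in>\<pi>. K \<noteq> act G g ` K)}"

fun dowling_le :: "'a dowling_elt \<Rightarrow> 'a dowling_elt \<Rightarrow> bool" where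
  "dowling_le (J, \<pi>) (J', \<pi>') \<longleftrightarrow>
     J \<subseteq> J' \<and> (\<forall>K\<in>\<pi>. K \<subseteq> J' \<or> (\<exists>K'\<in>\<pi>'. K \<subseteq> K'))"

definition dowling_lattice :: "('a, 'b) monoid_scheme \<Rightarrow> nat \<Rightarrow> 'a dowling_elt gorder" where
  "dowling_lattice G n = \<lparr>carrier = dowling_elts G n, eq = (=), le = dowling_le\<rparr>"

text \<open>The sub-poset $Q_n^\sim(G)$.\<close>

definition dowling_tilde :: "('a, 'b) monoid_scheme \<Rightarrow> nat \<Rightarrow> 'a dowling_elt gorder" where
  "dowling_tilde G n = (dowling_lattice G n)
     \<lparr>carrier := {(J, \<pi>) \<in> carrier (dowling_lattice G n).
        (of_nat (card J) / of_nat (order G) :: rat) \<noteq> 1}\<rparr>"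

definition dowling_act :: "('a \<times> nat \<Rightarrow> 'a \<times> nat) \<Rightarrow> 'a dowling_elt \<Rightarrow> 'a dowling_elt" where
  "dowling_act x = (\<lambda>(J, \<pi>). (x ` J, (`) x ` \<pi>))"

end

theory Submission
  imports Defs
begin

text \<open>
  The poset is semimodular, so its proper part has homology only in the top degree and, by the Hopf
  trace formula and Philip Hall's theorem, $(-1)^n$ times the trace of $x$ on this homology is the
  value $\mu(\hat0, \hat1)$ of the Moebius function of the sub-poset of elements fixed by $x$.

  This Moebius function has a closed form. Let $x$ act on a free $G$-set with $a_v$ cycles of type
  $v$, and put $Z_v = i |G| / |c|$ for $v = (i, c)$. There are numbers $A_v$ such that for every
  $\kappa$ the products $\prod_v \prod_{t < a_v} (\kappa A_v Z_v - t Z_v)$ of the block sets of all free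
  equivariant partitions of a given $G$-set sum to $\kappa$ to the power of its number of cycles. For
  $\kappa = -1$ this solves the recursion of the Moebius function of the full Dowling lattice. The
  excluded elements, those with $J$ a single $G$-orbit, are compensated by one further term for
  every $G$-orbit that is fixed by $x$ and consists of singleton blocks.

  On the other side, the derivations $(1 + p_v) \partial / \partial p_v$ multiply $\mathrm{Exp}_G \circ L$
  by the same constants $A_v$. Hence this series is the product of the $(1 + p_v)^{A_v}$, and the
  coefficients of its inverse are the values of the Moebius function found above.
\<close>

text \<open>The blocks of an \<open>x\<close>-stable free partition again form a free G-set with a
  commuting injection. Everything is therefore developed for an abstract system of this kind (locale
  \<open>gaut\<close>), so that the elements above a given one are described by the same identity,
  applied to its blocks. The identity in \<kappa> comes from adding one cycle to the set. The cycle
  is either attached to existing blocks or receives blocks of its own of some quotient type v. The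
  factor \<kappa> A_v Z_v - a_v Z_v of the second case is made so that its subtracted part cancels
  the number of attachments; what remains is \<kappa> times the sum of A_v Z_v over the quotient
  types. That sum is 1 by Moebius inversion over roots in G, and the same Moebius sum arises from mu
  in L, which is why one family A_v serves both sides. No basis of the homology is used. A
  contraction below the top degree, chosen without regard to the group, gives a projection onto the
  cycles from which the trace is read. Deleting the single orbits does not destroy semimodularity,
  since the joins are formed by linking two points with different labels, and such points never make
  up one G-orbit.\<close>

abbreviation lookup :: "('v \<Rightarrow>\<^sub>0 'c::zero) \<Rightarrow> 'v \<Rightarrow> 'c" where
  "lookup \<equiv> Poly_Mapping.lookup"

abbreviation keys :: "('v \<Rightarrow>\<^sub>0 'c::zero) \<Rightarrow> 'v set" where
  "keys \<equiv> Poly_Mapping.keys"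

abbreviation single :: "'v \<Rightarrow> 'c \<Rightarrow> 'v \<Rightarrow>\<^sub>0 'c::zero" where
  "single \<equiv> Poly_Mapping.single"

section \<open>Acyclicity of semimodular posets\<close>

locale fin_poset =
  fixes A :: "'p set" and le :: "'p \<Rightarrow> 'p \<Rightarrow> bool"
  assumes fin: "finite A"
    and po_refl: "x \<in> A \<Longrightarrow> le x x"
    and po_antisym: "x \<in> A \<Longrightarrow> y \<in> A \<Longrightarrow> le x y \<Longrightarrow> le y x \<Longrightarrow> x = y"
    and po_trans: "x \<in> A \<Longrightarrow> y \<in> A \<Longrightarrow> z \<in> A \<Longrightarrow> le x y \<Longrightarrow> le y z \<Longrightarrow> le x z"
begin

definition less :: "'p \<Rightarrow> 'p \<Rightarrow> bool" where
  "less x y \<longleftrightarrow> le x y \<and> x \<noteq> y"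

definition comparable :: "'p \<Rightarrow> 'p \<Rightarrow> bool" where
  "comparable x y \<longleftrightarrow> le x y \<or> le y x"

definition faces :: "'p set \<Rightarrow> nat \<Rightarrow> 'p set set" where
  "faces Y k = {C. C \<subseteq> Y \<and> (\<forall>x\<in>C. \<forall>y\<in>C. comparable x y) \<and> card C = k}"

definition chains :: "'p set \<Rightarrow> nat \<Rightarrow> ('p set \<Rightarrow> rat) set" where
  "chains Y k = {c. \<forall>C. c C \<noteq> 0 \<longrightarrow> C \<in> faces Y k}"

definition eps :: "'p set \<Rightarrow> 'p \<Rightarrow> rat" where
  "eps C x = (-1) ^ card {y \<in> C. less y x}"

text \<open>The boundary is read off at its faces: \<open>E\<close> receives a term from every face
  with one vertex more, and \<open>eps E x\<close> counts the vertices below the inserted one. The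
  sum runs over all of \<open>A\<close>, so that one operator serves the chains of every subset
  \<open>Y\<close>.\<close>

definition bd :: "('p set \<Rightarrow> rat) \<Rightarrow> 'p set \<Rightarrow> rat" where
  "bd c E = (\<Sum>x\<in>A - E. eps E x * c (insert x E))"

text \<open>The index counts vertices: this is the vanishing of reduced homology in degree
  \<open>k - 1\<close>, and \<open>k = 0\<close> concerns the empty face.\<close>

definition acyclic_at :: "'p set \<Rightarrow> nat \<Rightarrow> bool" where
  "acyclic_at Y k \<longleftrightarrow> (\<forall>c\<in>chains Y k. bd c = (\<lambda>_. 0) \<longrightarrow> (\<exists>w\<in>chains Y (Suc k). bd w = c))"

definition link :: "'p set \<Rightarrow> 'p \<Rightarrow> 'p set" where
  "link Y y = {z \<in> Y. z \<noteq> y \<and> comparable z y}"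

text \<open>\<open>slice y\<close> takes the part of a chain at the faces through \<open>y\<close>
  into the link, and \<open>cone y\<close> joins a chain of the link with \<open>y\<close>. Both
  carry the sign of the insertion of \<open>y\<close>; it squares to one, so slicing undoes the
  join.\<close>

definition slice :: "'p \<Rightarrow> ('p set \<Rightarrow> rat) \<Rightarrow> 'p set \<Rightarrow> rat" where
  "slice y c E = (if y \<in> E then 0 else eps E y * c (insert y E))"

definition cone :: "'p \<Rightarrow> ('p set \<Rightarrow> rat) \<Rightarrow> 'p set \<Rightarrow> rat" where
  "cone y w C = (if y \<in> C then eps (C - {y}) y * w (C - {y}) else 0)"

lemma comparable_sym: "comparable x y \<longleftrightarrow> comparable y x"
  by (auto simp: comparable_def)

lemma eps_square: "eps C x * eps C x = 1"
  by (simp add: eps_def power_mult_distrib[symmetric])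

lemma eps_insert:
  assumes "finite E" "x \<notin> E"
  shows "eps (insert x E) y = (if less x y then - eps E y else eps E y)"
proof (cases "less x y")
  case True
  then have "{z \<in> insert x E. less z y} = insert x {z \<in> E. less z y}" by auto
  with True assms show ?thesis by (simp add: eps_def)
next
  case False
  then have "{z \<in> insert x E. less z y} = {z \<in> E. less z y}" by auto
  with False show ?thesis by (simp add: eps_def)
qed

text \<open>Of two comparable distinct elements only the larger gains an element below it when the
  other one is inserted, so exactly one of the two orders of insertion picks up a sign.\<close>

lemma eps_swap:
  assumes "finite E" "x \<notin> E" "y \<notin> E" "x \<noteq> y" "x \<in> A" "y \<in> A" "comparable x y"
  shows "eps E x * eps (insert x E) y = - (eps E y * eps (insert y E) x)"
  using assms po_antisym[of x y] by (auto simp: eps_insert comparable_def less_def)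

lemma faces_finite: "C \<in> faces Y k \<Longrightarrow> Y \<subseteq> A \<Longrightarrow> finite C"
  using fin by (auto simp: faces_def intro: finite_subset)

lemma faces_insertD:
  assumes "insert x E \<in> faces Y k" "Y \<subseteq> A"
  shows "finite E" "x \<in> Y" "y \<in> E \<Longrightarrow> comparable x y"
  using faces_finite[OF assms] assms(1) by (simp_all add: faces_def)

lemma chainsD: "c \<in> chains Y k \<Longrightarrow> c C \<noteq> 0 \<Longrightarrow> C \<in> faces Y k"
  by (simp add: chains_def)

lemma chains_mono: "Y \<subseteq> Y' \<Longrightarrow> chains Y k \<subseteq> chains Y' k"
  by (fastforce simp: chains_def faces_def)

lemma bd_add: "bd (\<lambda>C. c C + d C) = (\<lambda>E. bd c E + bd d E)"
  by (simp add: fun_eq_iff bd_def algebra_simps sum.distrib)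

lemma bd_diff: "bd (\<lambda>C. c C - d C) = (\<lambda>E. bd c E - bd d E)"
  by (simp add: fun_eq_iff bd_def algebra_simps sum_subtractf)

lemma bd_chains:
  assumes "c \<in> chains Y (Suc k)" "Y \<subseteq> A"
  shows "bd c \<in> chains Y k"
  unfolding chains_def
proof (intro CollectI allI impI)
  fix E assume "bd c E \<noteq> 0"
  then obtain x where x: "x \<in> A - E" "c (insert x E) \<noteq> 0"
    unfolding bd_def by (metis (no_types, lifting) mult_zero_right sum.neutral)
  then have "insert x E \<in> faces Y (Suc k)" using assms chainsD by blast
  moreover from this have "finite (insert x E)" using assms(2) by (rule faces_finite)
  ultimately show "E \<in> faces Y k" using x by (auto simp: faces_def)
qed

text \<open>Exchanging the two inserted vertices maps the double sum to its negative, and over the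
  rationals such a sum is zero. At incomparable pairs \<open>c\<close> vanishes, so
  \<open>eps_swap\<close> is applied to comparable ones.\<close>

lemma bd_bd:
  assumes "c \<in> chains Y k" "Y \<subseteq> A"
  shows "bd (bd c) = (\<lambda>_. 0)"
proof
  fix E
  let ?f = "\<lambda>x y. eps E x * (eps (insert x E) y * c (insert y (insert x E)))"
  let ?D = "{p. fst p \<in> A - E \<and> snd p \<in> A - E \<and> fst p \<noteq> snd p}"
  have finD: "finite ?D" by (rule finite_subset[of _ "A \<times> A"]) (use fin in auto)
  have "bd (bd c) E = (\<Sum>x\<in>A - E. \<Sum>y\<in>A - insert x E. ?f x y)"
    by (simp add: bd_def sum_distrib_left)
  also have "\<dots> = (\<Sum>(x, y)\<in>Sigma (A - E) (\<lambda>x. A - insert x E). ?f x y)"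
    by (rule sum.Sigma) (use fin in auto)
  also have "Sigma (A - E) (\<lambda>x. A - insert x E) = ?D" by auto
  finally have 1: "bd (bd c) E = (\<Sum>(x, y)\<in>?D. ?f x y)" .
  have "(\<Sum>(x, y)\<in>?D. ?f x y) = (\<Sum>(x, y)\<in>?D. ?f y x)"
    by (rule sum.reindex_bij_witness[of _ prod.swap prod.swap]) auto
  also have "\<dots> = (\<Sum>(x, y)\<in>?D. - ?f x y)"
  proof (rule sum.cong[OF refl], clarsimp)
    fix x y assume xy: "x \<in> A" "x \<notin> E" "y \<in> A" "y \<notin> E" "x \<noteq> y"
    have ic: "insert x (insert y E) = insert y (insert x E)" by (rule insert_commute)
    show "?f y x = - ?f x y"
    proof (cases "c (insert y (insert x E)) = 0")
      case True
      then show ?thesis by (simp only: ic mult_zero_right minus_zero)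
    next
      case False
      then have "insert y (insert x E) \<in> faces Y k" using assms chainsD by blast
      from faces_insertD[OF this assms(2)] have "finite E" "comparable x y"
        using comparable_sym by auto
      then have "eps E x * eps (insert x E) y = - (eps E y * eps (insert y E) x)"
        using xy by (intro eps_swap)
      then show ?thesis by (simp only: ic mult.assoc[symmetric] mult_minus_left minus_minus)
    qed
  qed
  also have "\<dots> = - (\<Sum>(x, y)\<in>?D. ?f x y)" by (simp add: case_prod_unfold sum_negf)
  finally have "(\<Sum>(x, y)\<in>?D. ?f x y) = 0" by (rule equal_neg_zero[THEN iffD1])
  with 1 show "bd (bd c) E = 0" by (simp only:)
qed

text \<open>The homotopy formula of a cone. On a face without \<open>y\<close> only the insertion of
  \<open>y\<close> survives and the signs square away. On a face through \<open>y\<close> the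
  insertions rebuild \<open>bd w\<close> up to sign, except for the insertion of \<open>y\<close>
  itself, which accounts for \<open>w E\<close>.\<close>

lemma bd_cone:
  assumes y: "y \<in> A" and w: "w \<in> chains Y k" "Y \<subseteq> A"
    and comp: "\<And>z. z \<in> Y \<Longrightarrow> comparable z y"
  shows "bd (cone y w) E =
    (if y \<in> E then w E - eps (E - {y}) y * bd w (E - {y}) else w E)"
proof (cases "y \<in> E")
  case False
  have "bd (cone y w) E = (\<Sum>x\<in>{y}. eps E x * cone y w (insert x E))"
    unfolding bd_def by (rule sum.mono_neutral_right) (use fin y False in \<open>auto simp: cone_def\<close>)
  also have "\<dots> = w E" using False by (simp add: cone_def mult.assoc[symmetric] eps_square)
  finally show ?thesis using False by simp
next
  case True
  define E' where "E' = E - {y}"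
  have E: "E = insert y E'" "y \<notin> E'" using True by (auto simp: E'_def)
  have "eps E x * cone y w (insert x E) = - (eps E' y) * (eps E' x * w (insert x E'))"
    if x: "x \<in> A - E" for x
  proof -
    have ins: "insert x E - {y} = insert x E'" using x E by auto
    have c: "cone y w (insert x E) = eps (insert x E') y * w (insert x E')"
      using True by (simp add: cone_def ins)
    show ?thesis
    proof (cases "w (insert x E') = 0")
      case False
      then have "insert x E' \<in> faces Y k" using w chainsD by blast
      from faces_insertD[OF this w(2)] have "finite E'" "comparable x y"
        using comp by auto
      then have sw: "eps E' x * eps (insert x E') y = - (eps E' y * eps E x)"
        using eps_swap[of E' x y] x E y by auto
      have "eps E x * eps (insert x E') y =
          (eps E' x * eps (insert x E') y) * (eps E x * eps E' x)"
        using eps_square[of E' x] by (metis mult.assoc mult.commute mult.right_neutral)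
      also have "\<dots> = - (eps E' y * eps E' x) * (eps E x * eps E x)"
        unfolding sw by (simp add: mult_ac)
      also have "\<dots> = - (eps E' y * eps E' x)" unfolding eps_square by simp
      finally show ?thesis unfolding c by (simp add: mult.assoc[symmetric])
    qed (simp add: c)
  qed
  then have "bd (cone y w) E = - (eps E' y) * (\<Sum>x\<in>A - E. eps E' x * w (insert x E'))"
    unfolding bd_def sum_distrib_left by (rule sum.cong[OF refl])
  moreover have "bd w E' = eps E' y * w E + (\<Sum>x\<in>A - E. eps E' x * w (insert x E'))"
  proof -
    have "A - E' - {y} = A - E" using E by auto
    then show ?thesis unfolding bd_def using fin y E by (subst sum.remove[of _ y]) auto
  qed
  moreover have "w E = eps E' y * (eps E' y * w E)"
    by (simp add: mult.assoc[symmetric] eps_square)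
  ultimately show ?thesis using True by (simp add: E'_def[symmetric] algebra_simps)
qed

lemma cone_chains:
  assumes "w \<in> chains Y k" "Y \<subseteq> Y'" "y \<in> Y'" "Y' \<subseteq> A" and comp: "\<And>z. z \<in> Y \<Longrightarrow> comparable z y"
  shows "cone y w \<in> chains Y' (Suc k)"
  unfolding chains_def
proof (intro CollectI allI impI)
  fix C assume "cone y w C \<noteq> 0"
  then have y: "y \<in> C" and "w (C - {y}) \<noteq> 0" by (auto simp: cone_def split: if_splits)
  then have f: "C - {y} \<in> faces Y k" using assms chainsD by blast
  have "Y \<subseteq> A" using assms(2,4) by (rule subset_trans)
  with f have "finite (C - {y})" by (rule faces_finite)
  then have "card C = Suc k" using f y card_Suc_Diff1[of C y] by (simp add: faces_def)
  moreover have "C \<subseteq> Y'" using f assms(2,3) by (auto simp: faces_def)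
  moreover have "comparable x z" if "x \<in> C" "z \<in> C" for x z
  proof (cases "x = y \<or> z = y")
    case False
    then show ?thesis using f that by (simp add: faces_def)
  next
    case True
    have "comparable y y" using assms(3,4) po_refl by (auto simp: comparable_def)
    moreover have "comparable t y" if "t \<in> C - {y}" for t using f comp that by (auto simp: faces_def)
    ultimately show ?thesis using True that comparable_sym by blast
  qed
  ultimately show "C \<in> faces Y' (Suc k)" by (simp add: faces_def)
qed

lemma acyclic_cone:
  assumes "a \<in> Y" "Y \<subseteq> A" and comp: "\<And>z. z \<in> Y \<Longrightarrow> comparable z a"
  shows "acyclic_at Y k"
  unfolding acyclic_at_def
proof (intro ballI impI)
  fix c assume c: "c \<in> chains Y k" "bd c = (\<lambda>_. 0)"
  have "bd (cone a c) = c"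
    using bd_cone[OF _ c(1) assms(2) comp] assms c(2) by (auto simp: fun_eq_iff)
  with cone_chains[OF c(1) subset_refl assms(1,2) comp]
  show "\<exists>w\<in>chains Y (Suc k). bd w = c" by blast
qed

lemma acyclic_0:
  assumes "a \<in> Y" "Y \<subseteq> A"
  shows "acyclic_at Y 0"
  unfolding acyclic_at_def
proof (intro ballI impI)
  fix c assume c: "c \<in> chains Y 0" "bd c = (\<lambda>_. 0)"
  have "c \<in> chains {a} 0"
    unfolding chains_def
  proof (intro CollectI allI impI)
    fix C assume "c C \<noteq> 0"
    then have "C \<in> faces Y 0" using c chainsD by blast
    moreover from this have "finite C" using assms faces_finite by blast
    ultimately show "C \<in> faces {a} 0" by (simp add: faces_def)
  qed
  moreover have "acyclic_at {a} 0"
    by (rule acyclic_cone[of a]) (use assms po_refl in \<open>auto simp: comparable_def\<close>)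
  ultimately obtain w where "w \<in> chains {a} (Suc 0)" "bd w = c"
    using c unfolding acyclic_at_def by blast
  then show "\<exists>w\<in>chains Y (Suc 0). bd w = c" using chains_mono[of "{a}" Y] assms by blast
qed

text \<open>The Mayer-Vietoris step for gluing the star of \<open>y\<close> to
  \<open>Y - {y}\<close> along the link. The slice of a cycle at \<open>y\<close> is a cycle of the
  link; the boundary of the cone over a filling of it cancels every face through \<open>y\<close>,
  and what is left is a cycle of \<open>Y - {y}\<close>.\<close>

lemma acyclic_remove:
  assumes Y: "y \<in> Y" "Y \<subseteq> A" and link: "acyclic_at (link Y y) k"
    and rest: "acyclic_at (Y - {y}) (Suc k)"
  shows "acyclic_at Y (Suc k)"
  unfolding acyclic_at_def
proof (intro ballI impI)
  fix c assume c: "c \<in> chains Y (Suc k)" and cyc: "bd c = (\<lambda>_. 0)"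
  let ?L = "link Y y"
  have L: "?L \<subseteq> A" "?L \<subseteq> Y" "\<And>z. z \<in> ?L \<Longrightarrow> comparable z y" using Y by (auto simp: link_def)
  have y: "y \<in> A" using Y by auto
  have s: "slice y c \<in> chains ?L k"
    unfolding chains_def
  proof (intro CollectI allI impI)
    fix E assume "slice y c E \<noteq> 0"
    then have *: "y \<notin> E" "c (insert y E) \<noteq> 0" by (auto simp: slice_def split: if_splits)
    then have "insert y E \<in> faces Y (Suc k)" using c chainsD by blast
    moreover from this have "finite (insert y E)" using Y(2) by (rule faces_finite)
    ultimately show "E \<in> faces ?L k" using * by (auto simp: faces_def link_def)
  qed
  \<comment> \<open>Slicing commutes with \<open>bd\<close> up to a sign: at a face without
    \<open>y\<close>, the boundary of the slice is a multiple of the boundary of \<open>c\<close> at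
    the same face with \<open>y\<close> inserted.\<close>
  have "bd (slice y c) E = 0" for E
  proof (cases "y \<in> E")
    case True
    then show ?thesis by (simp add: bd_def slice_def)
  next
    case False
    have "bd (slice y c) E = (\<Sum>x\<in>A - insert y E. eps E x * slice y c (insert x E))"
      unfolding bd_def by (rule sum.mono_neutral_right) (use fin False in \<open>auto simp: slice_def\<close>)
    also have "\<dots> = (\<Sum>x\<in>A - insert y E. - eps E y * (eps (insert y E) x * c (insert x (insert y E))))"
    proof (rule sum.cong[OF refl])
      fix x assume x: "x \<in> A - insert y E"
      then have sl: "slice y c (insert x E) = eps (insert x E) y * c (insert x (insert y E))"
        using False by (auto simp: slice_def insert_commute)
      show "eps E x * slice y c (insert x E) = - eps E y * (eps (insert y E) x * c (insert x (insert y E)))"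
      proof (cases "c (insert x (insert y E)) = 0")
        case False
        then have f: "insert x (insert y E) \<in> faces Y (Suc k)" using c chainsD by blast
        from faces_insertD[OF this Y(2)] have "finite E" "comparable x y" by auto
        then have "eps E x * eps (insert x E) y = - (eps E y * eps (insert y E) x)"
          using x y \<open>y \<notin> E\<close> by (intro eps_swap) auto
        then show ?thesis unfolding sl by (simp add: mult.assoc[symmetric])
      qed (simp add: sl)
    qed
    also have "\<dots> = - eps E y * bd c (insert y E)" unfolding bd_def sum_distrib_left ..
    finally show ?thesis by (simp add: cyc)
  qed
  then have "bd (slice y c) = (\<lambda>_. 0)" by auto
  with s link obtain w where w: "w \<in> chains ?L (Suc k)" "bd w = slice y c"
    unfolding acyclic_at_def by blast
  have wy: "w E = 0" if "y \<in> E" for E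
    using w(1) that by (auto simp: chains_def faces_def link_def)
  let ?W = "cone y w"
  have W: "?W \<in> chains Y (Suc (Suc k))" by (rule cone_chains[OF w(1) L(2) Y L(3)])
  let ?d = "\<lambda>E. c E + bd ?W E"
  have d0: "?d E = 0" if "y \<in> E" for E
  proof -
    have "bd ?W E = - (eps (E - {y}) y * slice y c (E - {y}))"
      using that wy[OF that] by (simp add: bd_cone[OF y w(1) L(1,3)] w(2))
    also have "\<dots> = - c E"
      using that by (simp add: slice_def mult.assoc[symmetric] eps_square insert_absorb)
    finally show ?thesis by simp
  qed
  have "?d \<in> chains (Y - {y}) (Suc k)"
    unfolding chains_def
  proof (intro CollectI allI impI)
    fix E assume nz: "?d E \<noteq> 0"
    then have "c E \<noteq> 0 \<or> bd ?W E \<noteq> 0" by auto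
    then have "E \<in> faces Y (Suc k)" using c bd_chains[OF W Y(2)] chainsD by blast
    moreover have "y \<notin> E" using nz d0 by blast
    ultimately show "E \<in> faces (Y - {y}) (Suc k)" by (auto simp: faces_def)
  qed
  moreover have "bd ?d = (\<lambda>_. 0)" by (simp add: bd_add cyc bd_bd[OF W Y(2)])
  ultimately obtain v where v: "v \<in> chains (Y - {y}) (Suc (Suc k))" "bd v = ?d"
    using rest unfolding acyclic_at_def by blast
  have "bd (\<lambda>C. v C - ?W C) = c" by (simp add: bd_diff v(2))
  moreover have "(\<lambda>C. v C - ?W C) \<in> chains Y (Suc (Suc k))"
    unfolding chains_def
  proof (intro CollectI allI impI)
    fix C assume "v C - ?W C \<noteq> 0"
    then have "v C \<noteq> 0 \<or> ?W C \<noteq> 0" by auto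
    then show "C \<in> faces Y (Suc (Suc k))"
      using chains_mono[of "Y - {y}" Y] v(1) W chainsD by blast
  qed
  ultimately show "\<exists>w\<in>chains Y (Suc (Suc k)). bd w = c" by blast
qed

end

text \<open>The last assumption is the semimodular law for joins with one suitable \<open>a\<close>
  under each \<open>h\<close>. The join is taken inside the interval below \<open>h\<close>, but it
  is least among the upper bounds in all of \<open>A\<close>.\<close>

locale semimodular_poset = fin_poset +
  fixes r :: "'a \<Rightarrow> nat" and b :: 'a
  assumes bot: "b \<in> A" "x \<in> A \<Longrightarrow> le b x" "r b = 0"
    and rank_strict: "x \<in> A \<Longrightarrow> y \<in> A \<Longrightarrow> less x y \<Longrightarrow> r x < r y"
    and atom_join: "h \<in> A \<Longrightarrow> h \<noteq> b \<Longrightarrow> \<exists>a\<in>A. a \<noteq> b \<and> le a h \<and>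
      (\<forall>y\<in>A. le y h \<longrightarrow> (\<exists>j\<in>A. le j h \<and> le y j \<and> le a j \<and> r j \<le> Suc (r y) \<and>
        (\<forall>z\<in>A. le y z \<longrightarrow> le a z \<longrightarrow> le j z)))"
begin

definition below :: "'a \<Rightarrow> 'a set" where
  "below h = {z \<in> A. z \<noteq> b \<and> less z h}"

lemma below_subset: "below h \<subseteq> A"
  by (auto simp: below_def)

lemma less_trans': "x \<in> A \<Longrightarrow> y \<in> A \<Longrightarrow> z \<in> A \<Longrightarrow> less x y \<Longrightarrow> less y z \<Longrightarrow> less x z"
  unfolding less_def using po_trans po_antisym by metis

text \<open>\<open>f\<close> is the join with \<open>a\<close>, and its values lie in the cone of
  elements above \<open>a\<close>. Elements not above \<open>a\<close> are removed one at a time,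
  highest rank first: everything in \<open>Y\<close> strictly above the removed \<open>y\<close> is
  then above \<open>a\<close>, hence above \<open>f y\<close>, so the link of \<open>y\<close> is a
  cone with apex \<open>f y\<close>.\<close>

lemma acyclic_closure:
  assumes "Y \<subseteq> A" "a \<in> Y"
    and f: "\<And>y. y \<in> Y \<Longrightarrow> f y \<in> Y \<and> le y (f y) \<and> le a (f y) \<and> (\<forall>z\<in>Y. le y z \<longrightarrow> le a z \<longrightarrow> le (f y) z)"
  shows "acyclic_at Y k"
  using assms
proof (induction "card {y \<in> Y. \<not> le a y}" arbitrary: Y k)
  case 0
  have "finite {y \<in> Y. \<not> le a y}" using 0 fin by (auto intro: finite_subset)
  with 0 have "\<And>y. y \<in> Y \<Longrightarrow> le a y" by auto
  then show ?case using 0 by (intro acyclic_cone[of a]) (auto simp: comparable_def)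
next
  case (Suc n Y k)
  let ?N = "{y \<in> Y. \<not> le a y}"
  have finN: "finite ?N" using Suc.prems fin by (auto intro: finite_subset)
  have "?N \<noteq> {}" using Suc.hyps(2) by (metis card.empty nat.distinct(1))
  then have "Max (r ` ?N) \<in> r ` ?N" using finN by (intro Max_in) auto
  then obtain y where y0: "y \<in> ?N" "r y = Max (r ` ?N)" by auto
  have ymax: "r z \<le> r y" if "z \<in> ?N" for z
    unfolding y0(2) by (rule Max_ge) (use finN that in auto)
  have yY: "y \<in> Y" "\<not> le a y" using y0 by auto
  have fy: "f y \<in> Y" "le y (f y)" "le a (f y)" using Suc.prems(3)[OF yY(1)] by auto
  then have ne: "f y \<noteq> y" using yY by auto
  have "acyclic_at (Y - {y}) k"
  proof (rule Suc.hyps(1))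
    have "{z \<in> Y - {y}. \<not> le a z} = ?N - {y}" by auto
    then show "n = card {z \<in> Y - {y}. \<not> le a z}" using Suc.hyps(2) y0(1) finN by simp
    have "le a a" using Suc.prems po_refl by auto
    then show "a \<in> Y - {y}" using Suc.prems yY by auto
    fix z assume "z \<in> Y - {y}"
    then show "f z \<in> Y - {y} \<and> le z (f z) \<and> le a (f z) \<and> (\<forall>x\<in>Y - {y}. le z x \<longrightarrow> le a x \<longrightarrow> le (f z) x)"
      using Suc.prems(3)[of z] yY by auto
  qed (use Suc.prems in auto)
  moreover have "acyclic_at (link Y y) k" for k
  proof (rule acyclic_cone)
    show "f y \<in> link Y y" using fy ne by (auto simp: link_def comparable_def)
    show "link Y y \<subseteq> A" using Suc.prems by (auto simp: link_def)
    fix z assume z: "z \<in> link Y y"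
    then have zA: "z \<in> Y" "z \<noteq> y" by (auto simp: link_def)
    show "comparable z (f y)"
    proof (cases "le z y")
      case True
      then have "le z (f y)" using po_trans[of z y "f y"] fy zA yY Suc.prems by auto
      then show ?thesis by (simp add: comparable_def)
    next
      case False
      then have "le y z" using z by (auto simp: link_def comparable_def)
      moreover from this have "r y < r z" using zA yY Suc.prems by (intro rank_strict) (auto simp: less_def)
      then have "le a z" using ymax[of z] zA by (metis (mono_tags, lifting) mem_Collect_eq not_le)
      ultimately have "le (f y) z" using Suc.prems(3)[OF yY(1)] zA by blast
      then show ?thesis by (simp add: comparable_def)
    qed
  qed
  note this = acyclic_remove[OF yY(1) Suc.prems(1) this]
  ultimately show ?case
    using acyclic_0[OF Suc.prems(2,1)] by (cases k) auto
qed

text \<open>The elements whose join with \<open>a\<close> is not \<open>h\<close> form an acyclic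
  set by \<open>acyclic_closure\<close>. The others all have rank \<open>r h - 1\<close>, so they
  are pairwise incomparable; they are put back one by one, and the link of each is the whole open
  interval below it, where the induction applies with one vertex less.\<close>

theorem acyclic_below:
  assumes "h \<in> A" "Suc i < r h"
  shows "acyclic_at (below h) i"
  using assms
proof (induction "r h" arbitrary: h i rule: less_induct)
  case less
  have "h \<noteq> b" using less.prems bot by auto
  from atom_join[OF less.prems(1) this] obtain a where a: "a \<in> A" "a \<noteq> b" "le a h"
    and "\<forall>y\<in>A. le y h \<longrightarrow> (\<exists>j\<in>A. le j h \<and> le y j \<and> le a j \<and> r j \<le> Suc (r y) \<and>
        (\<forall>z\<in>A. le y z \<longrightarrow> le a z \<longrightarrow> le j z))" by auto
  then obtain f where f: "\<And>y. y \<in> A \<Longrightarrow> le y h \<Longrightarrow> f y \<in> A \<and> le (f y) h \<and> le y (f y) \<and> le a (f y) \<and>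
      r (f y) \<le> Suc (r y)"
    and fmin: "\<And>y z. y \<in> A \<Longrightarrow> le y h \<Longrightarrow> z \<in> A \<Longrightarrow> le y z \<Longrightarrow> le a z \<Longrightarrow> le (f y) z"
    by metis
  \<comment> \<open>The join of \<open>a\<close> with the bottom has rank at most one, and
    \<open>a\<close> lies below it.\<close>
  have "r a \<le> 1"
  proof -
    have "f b \<in> A" "le a (f b)" "r (f b) \<le> 1" using f[of b] bot less.prems by auto
    then show ?thesis using rank_strict[of a "f b"] a by (cases "a = f b") (auto simp: less_def)
  qed
  then have ah: "a \<in> below h" using a less.prems by (auto simp: below_def less_def)
  let ?Y = "{y \<in> below h. f y \<noteq> h}" and ?M = "{y \<in> below h. f y = h}"
  have Y: "y \<in> A" "le y h" "y \<noteq> b" "y \<noteq> h" if "y \<in> below h" for y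
    using that by (auto simp: below_def less_def)
  have fb: "f y \<noteq> b" if "y \<in> below h" for y
    using f[of y] Y[OF that] po_antisym[of a b] bot a by metis
  \<comment> \<open>The join with \<open>a\<close> raises the rank by at most one, so an element
    whose join is \<open>h\<close> lies just one rank below \<open>h\<close>.\<close>
  have rM: "Suc (r y) = r h" if "y \<in> ?M" for y
    using that f[of y] Y[of y] rank_strict[of y h] less.prems by (force simp: less_def)
  have "a \<in> ?Y"
  proof -
    have "le (f a) a" using fmin[of a a] a po_refl by auto
    then have "f a = a" using f[of a] a po_antisym by blast
    then show ?thesis using ah Y[OF ah] by auto
  qed
  have "acyclic_at ?Y k" for k
  proof (rule acyclic_closure[of _ a f])
    fix y assume y: "y \<in> ?Y"
    then have yb: "y \<in> below h" by auto
    note fy = f[OF Y(1,2)[OF yb]]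
    have "le (f (f y)) (f y)" using fmin[of "f y" "f y"] fy po_refl by auto
    moreover have "le (f y) (f (f y))" "f (f y) \<in> A" using f[of "f y"] fy by auto
    ultimately have "f (f y) = f y" using po_antisym fy by blast
    then have "f y \<in> ?Y" using fy fb[OF yb] y by (auto simp: below_def less_def)
    then show "f y \<in> ?Y \<and> le y (f y) \<and> le a (f y) \<and> (\<forall>z\<in>?Y. le y z \<longrightarrow> le a z \<longrightarrow> le (f y) z)"
      using fy fmin[OF Y(1,2)[OF yb]] Y(1) by auto
  qed (use \<open>a \<in> ?Y\<close> in \<open>auto simp: below_def\<close>)
  then have base: "acyclic_at ?Y i" .
  have finM: "finite ?M" using fin by (auto simp: below_def)
  have "acyclic_at (?Y \<union> S) i" if "S \<subseteq> ?M" for S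
    using finite_subset[OF that finM] that
  proof (induction S rule: finite_induct)
    case empty
    then show ?case using base by simp
  next
    case (insert m S)
    let ?Z = "?Y \<union> insert m S"
    have m: "m \<in> ?M" "m \<in> below h" using insert by auto
    have Z: "?Z \<subseteq> below h" using insert.prems by auto
    have diff: "?Z - {m} = ?Y \<union> S" using insert m by auto
    \<comment> \<open>By rank nothing of \<open>below h\<close> lies above \<open>m\<close>, and the
      elements below \<open>m\<close> have too small a rank to be in \<open>?M\<close>, so all of
      them are already in \<open>?Y\<close>.\<close>
    have link: "link ?Z m = below m"
    proof (intro equalityI subsetI)
      fix z assume z: "z \<in> link ?Z m"
      then have zb: "z \<in> below h" "z \<noteq> m" "comparable z m" using Z by (auto simp: link_def)
      have "\<not> le m z"
      proof
        assume "le m z"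
        then have "r m < r z" using Y(1) zb m by (intro rank_strict) (auto simp: less_def)
        moreover have "r z < r h" using Y[OF zb(1)] less.prems by (intro rank_strict) (auto simp: less_def)
        ultimately show False using rM[OF m(1)] by simp
      qed
      then show "z \<in> below m" using zb Y[OF zb(1)] by (auto simp: below_def less_def comparable_def)
    next
      fix z assume z: "z \<in> below m"
      then have zA: "z \<in> A" "z \<noteq> b" "less z m" by (auto simp: below_def)
      have "less z h" using less_trans'[of z m h] zA Y[OF m(2)] less.prems by (auto simp: less_def)
      then have zb: "z \<in> below h" using zA by (auto simp: below_def)
      have "r z < r m" using zA Y[OF m(2)] by (intro rank_strict) auto
      then have "z \<notin> ?M" using rM[of z] rM[OF m(1)] by auto
      with zb zA show "z \<in> link ?Z m" by (auto simp: link_def less_def comparable_def)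
    qed
    show ?case
    proof (cases i)
      case 0
      show ?thesis unfolding 0 by (rule acyclic_0[of a]) (use \<open>a \<in> ?Y\<close> Z below_subset in auto)
    next
      case (Suc k)
      have "acyclic_at (link ?Z m) k" unfolding link
        by (rule less.hyps) (use rM[OF m(1)] Suc less.prems Y[OF m(2)] in auto)
      moreover have "acyclic_at (?Z - {m}) (Suc k)" unfolding diff using insert Suc by auto
      moreover have "m \<in> ?Z" "?Z \<subseteq> A" using Z below_subset by auto
      ultimately show ?thesis unfolding Suc by (metis acyclic_remove)
    qed
  qed
  from this[of ?M] have "acyclic_at (?Y \<union> ?M) i" by simp
  moreover have "?Y \<union> ?M = below h" by auto
  ultimately show ?case by simp
qed

text \<open>The rank maps a chain of the open interval injectively into \<open>{1..<r h}\<close>.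
  The case \<open>k = 0\<close> covers the empty face when \<open>r h = 0\<close>.\<close>

lemma faces_below_card:
  assumes "C \<in> faces (below h) k" "h \<in> A"
  shows "k < r h \<or> k = 0"
proof -
  have s: "C \<subseteq> below h" "\<And>x y. x \<in> C \<Longrightarrow> y \<in> C \<Longrightarrow> comparable x y" "card C = k"
    using assms by (auto simp: faces_def)
  have "inj_on r C"
  proof (rule inj_onI)
    fix x y assume xy: "x \<in> C" "y \<in> C" "r x = r y"
    then have "x \<in> A" "y \<in> A" using s(1) by (auto simp: below_def)
    then show "x = y" using rank_strict[of x y] rank_strict[of y x] s(2)[OF xy(1,2)] xy(3)
      by (auto simp: comparable_def less_def)
  qed
  moreover have "r ` C \<subseteq> {1..<r h}"
  proof
    fix n assume "n \<in> r ` C"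
    then obtain x where x: "x \<in> C" "n = r x" by auto
    then have "x \<in> A" "x \<noteq> b" "less x h" using s(1) by (auto simp: below_def)
    then show "n \<in> {1..<r h}"
      using rank_strict[of b x] rank_strict[of x h] bot assms(2) x by (auto simp: less_def)
  qed
  ultimately have "k \<le> r h - 1" using s(3) card_inj_on_le[of r C "{1..<r h}"] by simp
  then show ?thesis by auto
qed

end

section \<open>Traces on spaces of chains\<close>

abbreviation pm_scale :: "rat \<Rightarrow> ('s \<Rightarrow>\<^sub>0 rat) \<Rightarrow> 's \<Rightarrow>\<^sub>0 rat" where
  "pm_scale r \<equiv> Poly_Mapping.map ((*) r)"

lemma lookup_pm_scale [simp]: "lookup (pm_scale r z) s = r * lookup z s"
  by (simp add: Poly_Mapping.map.rep_eq when_def)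

lemma lookup_sum_pm: "lookup (sum f I) s = (\<Sum>i\<in>I. lookup (f i) s)"
  by (induction I rule: infinite_finite_induct) (auto simp: lookup_add)

lemma vector_space_pm: "vector_space (pm_scale :: rat \<Rightarrow> ('s \<Rightarrow>\<^sub>0 rat) \<Rightarrow> _)"
  by standard (rule poly_mapping_eqI, simp add: lookup_add algebra_simps)+

text \<open>The shape of the top homology: there are no chains one degree higher, so the space of
  boundaries is \<open>{0}\<close> and the cosets are the singletons \<open>{z}\<close> of cycles
  \<open>z\<close>. \<open>W\<close> is the space of these cycles, where ordinary linear algebra is
  available.\<close>

locale singleton_module =
  fixes M :: "(rat, ('s \<Rightarrow>\<^sub>0 rat) set) module" and W :: "('s \<Rightarrow>\<^sub>0 rat) set"
  assumes carrier: "carrier M = (\<lambda>z. {z}) ` W"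
    and zero: "\<zero>\<^bsub>M\<^esub> = {0}"
    and add: "u \<in> W \<Longrightarrow> v \<in> W \<Longrightarrow> {u} \<oplus>\<^bsub>M\<^esub> {v} = {u + v}"
    and smult: "u \<in> W \<Longrightarrow> r \<odot>\<^bsub>M\<^esub> {u} = {pm_scale r u}"
    and W_zero: "0 \<in> W" and W_add: "u \<in> W \<Longrightarrow> v \<in> W \<Longrightarrow> u + v \<in> W"
    and W_scale: "u \<in> W \<Longrightarrow> pm_scale r u \<in> W"
begin

lemma W_sum: "(\<And>i. i \<in> I \<Longrightarrow> f i \<in> W) \<Longrightarrow> sum f I \<in> W"
  by (induction I rule: infinite_finite_induct) (auto intro: W_zero W_add)

lemma comm_monoid_add: "comm_monoid (add_monoid M)"
  by (rule comm_monoidI) (auto simp: carrier zero add W_zero W_add add_ac)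

lemma finsum_singletons:
  assumes "finite I" "\<And>i. i \<in> I \<Longrightarrow> g i \<in> W"
  shows "finsum M (\<lambda>i. {g i}) I = {sum g I}"
  using assms
proof (induction I rule: finite_induct)
  case empty
  have "finsum M (\<lambda>i. {g i}) {} = \<one>\<^bsub>add_monoid M\<^esub>"
    unfolding finsum_def by (rule comm_monoid.finprod_empty[OF comm_monoid_add])
  then show ?case by (simp add: zero)
next
  case (insert i I)
  have "finsum M (\<lambda>i. {g i}) (insert i I) = {g i} \<oplus>\<^bsub>M\<^esub> finsum M (\<lambda>i. {g i}) I"
    unfolding finsum_def using comm_monoid.finprod_insert[OF comm_monoid_add, of I i "\<lambda>i. {g i}"] insert
    by (auto simp: carrier)
  also have "\<dots> = {g i + sum g I}"
    using insert W_sum[of I g] by (simp add: add)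
  finally show ?case using insert by simp
qed

lemma finsum_comb:
  assumes "finite B" "B \<subseteq> W"
  shows "(\<Oplus>\<^bsub>M\<^esub>b\<in>(\<lambda>z. {z}) ` B. a b \<odot>\<^bsub>M\<^esub> b) = {\<Sum>b\<in>B. pm_scale (a {b}) b}"
proof -
  let ?S = "(\<lambda>z. {z}) ` B"
  have "(\<Oplus>\<^bsub>M\<^esub>b\<in>?S. a b \<odot>\<^bsub>M\<^esub> b) = (\<Oplus>\<^bsub>M\<^esub>b\<in>?S. {pm_scale (a b) (the_elem b)})"
    unfolding finsum_def
    by (rule comm_monoid.finprod_cong'[OF comm_monoid_add])
      (use assms in \<open>auto simp: smult carrier intro!: imageI W_scale dest: subsetD\<close>)
  also have "\<dots> = {\<Sum>b\<in>?S. pm_scale (a b) (the_elem b)}"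
    by (rule finsum_singletons) (use assms in \<open>auto intro!: W_scale dest: subsetD\<close>)
  also have "(\<Sum>b\<in>?S. pm_scale (a b) (the_elem b)) = (\<Sum>b\<in>B. pm_scale (a {b}) b)"
    by (subst sum.reindex) (auto simp: inj_on_def)
  finally show ?thesis .
qed

text \<open>\<open>lin_trace\<close> picks its basis by \<open>SOME\<close>, so the existence of one
  has to be known before the choice says anything.\<close>

lemma lin_basis_exists:
  assumes S: "finite S" and keys: "\<And>z. z \<in> W \<Longrightarrow> keys z \<subseteq> S"
  shows "\<exists>B. lin_basis M B"
proof -
  interpret V: vector_space "pm_scale :: rat \<Rightarrow> ('s \<Rightarrow>\<^sub>0 rat) \<Rightarrow> _" by (rule vector_space_pm)
  obtain B where B: "B \<subseteq> W" "V.independent B" "W \<subseteq> V.span B"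
    using V.maximal_independent_subset[of W] by blast
  let ?T = "(\<lambda>s. single s (1 :: rat)) ` S"
  have "W \<subseteq> V.span ?T"
  proof
    fix z assume z: "z \<in> W"
    have "z = (\<Sum>s\<in>S. pm_scale (lookup z s) (single s 1))"
    proof (rule poly_mapping_eqI)
      fix s
      have "(\<Sum>t\<in>S. lookup z t * (lookup (single t 1) s)) =
          (\<Sum>t\<in>S. if t = s then lookup z t else 0)"
        by (rule sum.cong) (auto simp: lookup_single when_def)
      also have "\<dots> = lookup z s"
        using S keys[OF z] by (simp add: sum.delta) (auto simp: in_keys_iff)
      finally show "lookup z s =
          lookup (\<Sum>s\<in>S. pm_scale (lookup z s) (single s 1)) s"
        by (simp only: lookup_sum_pm lookup_pm_scale)
    qed
    also have "\<dots> \<in> V.span ?T"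
      by (intro V.span_sum V.span_scale V.span_base) auto
    finally show "z \<in> V.span ?T" .
  qed
  then have finB: "finite B"
    using V.independent_span_bound[of ?T B] B S by auto
  have "lin_basis M ((\<lambda>z. {z}) ` B)" (is "lin_basis M ?B")
    unfolding lin_basis_def
  proof (intro conjI ballI)
    show "finite ?B" "?B \<subseteq> carrier M" using finB B by (auto simp: carrier)
    fix v assume "v \<in> carrier M"
    then obtain z where z: "z \<in> W" "v = {z}" by (auto simp: carrier)
    then obtain u where u: "z = (\<Sum>b\<in>B. pm_scale (u b) b)"
      using B V.span_finite[OF finB] by auto
    show "\<exists>!a. a \<in> ?B \<rightarrow>\<^sub>E UNIV \<and> v = (\<Oplus>\<^bsub>M\<^esub>b\<in>?B. a b \<odot>\<^bsub>M\<^esub> b)"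
    proof (rule ex1I)
      let ?a = "\<lambda>c\<in>?B. u (the_elem c)"
      show "?a \<in> ?B \<rightarrow>\<^sub>E UNIV \<and> v = (\<Oplus>\<^bsub>M\<^esub>b\<in>?B. ?a b \<odot>\<^bsub>M\<^esub> b)"
        unfolding finsum_comb[OF finB B(1)] z u by (auto intro!: sum.cong)
    next
      fix a assume a: "a \<in> ?B \<rightarrow>\<^sub>E UNIV \<and> v = (\<Oplus>\<^bsub>M\<^esub>b\<in>?B. a b \<odot>\<^bsub>M\<^esub> b)"
      then have "z = (\<Sum>b\<in>B. pm_scale (a {b}) b)"
        unfolding finsum_comb[OF finB B(1)] z by auto
      then have "(\<Sum>b\<in>B. pm_scale (a {b} - u b) b) = 0"
        unfolding V.scale_left_diff_distrib sum_subtractf using u by simp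
      then have "a {b} - u b = 0" if "b \<in> B" for b
        by (rule V.independentD[OF B(2) finB subset_refl _ that])
      then show "a = (\<lambda>c\<in>?B. u (the_elem c))"
        using a by (auto simp: fun_eq_iff PiE_def extensional_def restrict_def)
    qed
  qed
  then show ?thesis by blast
qed

text \<open>The trace is obtained without knowing a basis of \<open>W\<close>. By
  \<open>proj\<close> the vectors \<open>p s\<close> define a linear retraction of the space with
  basis \<open>S\<close> onto \<open>W\<close>, and the trace of an endomorphism of \<open>W\<close>
  equals the trace of its composite with this retraction, because trace(AB) = trace(BA).\<close>

lemma lin_trace_eq:
  assumes S: "finite S" and keys: "\<And>z. z \<in> W \<Longrightarrow> keys z \<subseteq> S"
    and p: "\<And>s. s \<in> S \<Longrightarrow> p s \<in> W"
    and proj: "\<And>z. z \<in> W \<Longrightarrow> z = (\<Sum>s\<in>S. pm_scale (lookup z s) (p s))"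
    and F: "\<And>z. z \<in> W \<Longrightarrow> F z \<in> W"
    and F_sum: "\<And>a B. finite B \<Longrightarrow> B \<subseteq> W \<Longrightarrow> F (\<Sum>b\<in>B. pm_scale (a b) b) = (\<Sum>b\<in>B. pm_scale (a b) (F b))"
  shows "lin_trace M ((`) F) = (\<Sum>s\<in>S. lookup (F (p s)) s)"
proof -
  define C where "C = (SOME B. lin_basis M B)"
  have C: "lin_basis M C" unfolding C_def using lin_basis_exists[OF S keys] by (rule someI_ex)
  define B where "B = {z. {z} \<in> C}"
  have CB: "C = (\<lambda>z. {z}) ` B" using C unfolding lin_basis_def B_def carrier by auto
  have inj: "inj_on (\<lambda>z. {z}) B" by (auto simp: inj_on_def)
  have finB: "finite B" using C finite_imageD[OF _ inj] by (simp add: lin_basis_def CB)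
  have BW: "B \<subseteq> W" using C by (auto simp: lin_basis_def CB carrier)
  define \<beta> where "\<beta> z b = lin_coord M C {z} {b}" for z b
  have ex1: "\<exists>!a. a \<in> C \<rightarrow>\<^sub>E UNIV \<and> {z} = (\<Oplus>\<^bsub>M\<^esub>b\<in>C. a b \<odot>\<^bsub>M\<^esub> b)" if "z \<in> W" for z
    using C that unfolding lin_basis_def carrier by auto
  have \<beta>: "z = (\<Sum>b\<in>B. pm_scale (\<beta> z b) b)" if "z \<in> W" for z
  proof -
    have "{z} = (\<Oplus>\<^bsub>M\<^esub>b\<in>C. lin_coord M C {z} b \<odot>\<^bsub>M\<^esub> b)"
      using theI'[OF ex1[OF that]] unfolding lin_coord_def by simp
    then show ?thesis unfolding CB finsum_comb[OF finB BW] \<beta>_def by simp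
  qed
  have uniq: "a b = a' b" if eq: "(\<Sum>b\<in>B. pm_scale (a b) b) = (\<Sum>b\<in>B. pm_scale (a' b) b)" and b: "b \<in> B" for a a' b
  proof -
    let ?r = "\<lambda>a. (\<lambda>c\<in>C. a (the_elem c))"
    have r: "(\<Oplus>\<^bsub>M\<^esub>c\<in>C. ?r d c \<odot>\<^bsub>M\<^esub> c) = {\<Sum>b\<in>B. pm_scale (d b) b}" for d
      unfolding CB finsum_comb[OF finB BW] by (auto intro!: sum.cong)
    have "(\<Sum>b\<in>B. pm_scale (a b) b) \<in> W" using BW by (intro W_sum W_scale) auto
    note E = ex1[OF this]
    have mem: "?r d \<in> C \<rightarrow>\<^sub>E UNIV" for d by auto
    have "?r a = ?r a'"
      by (rule trans[OF the1_equality[OF E, symmetric] the1_equality[OF E]]) (simp_all only: mem r eq simp_thms)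
    then have "?r a {b} = ?r a' {b}" by simp
    then show ?thesis using b by (simp add: CB)
  qed
  have "lin_trace M ((`) F) = (\<Sum>c\<in>C. lin_coord M C (F ` c) c)"
    by (simp add: lin_trace_def C_def Let_def)
  also have "\<dots> = (\<Sum>b\<in>B. \<beta> (F b) b)"
    unfolding CB by (subst sum.reindex[OF inj]) (simp add: \<beta>_def CB)
  \<comment> \<open>Two expansions of \<open>F b\<close> in the chosen basis, one direct and one
    through the vectors \<open>p s\<close>, have the same coefficients.\<close>
  also have "\<dots> = (\<Sum>b\<in>B. \<Sum>s\<in>S. lookup (F b) s * \<beta> (p s) b)"
  proof (rule sum.cong[OF refl])
    fix b assume b: "b \<in> B"
    then have Fb: "F b \<in> W" using F BW by auto
    have "(\<Sum>d\<in>B. pm_scale (\<beta> (F b) d) d) = F b" by (rule \<beta>[OF Fb, symmetric])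
    also have "\<dots> = (\<Sum>s\<in>S. pm_scale (lookup (F b) s) (p s))" by (rule proj[OF Fb])
    also have "\<dots> = (\<Sum>s\<in>S. pm_scale (lookup (F b) s) (\<Sum>d\<in>B. pm_scale (\<beta> (p s) d) d))"
      by (rule sum.cong[OF refl], rule arg_cong[OF \<beta>], rule p)
    also have "\<dots> = (\<Sum>d\<in>B. pm_scale (\<Sum>s\<in>S. lookup (F b) s * \<beta> (p s) d) d)"
    proof (rule poly_mapping_eqI)
      fix k
      show "lookup (\<Sum>s\<in>S. pm_scale (lookup (F b) s) (\<Sum>d\<in>B. pm_scale (\<beta> (p s) d) d)) k =
          lookup (\<Sum>d\<in>B. pm_scale (\<Sum>s\<in>S. lookup (F b) s * \<beta> (p s) d) d) k"
        by (simp only: lookup_sum_pm lookup_pm_scale sum_distrib_left sum_distrib_right mult.assoc) (rule sum.swap)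
    qed
    finally show "\<beta> (F b) b = (\<Sum>s\<in>S. lookup (F b) s * \<beta> (p s) b)"
      by (rule uniq) (rule b)
  qed
  also have "\<dots> = (\<Sum>s\<in>S. \<Sum>b\<in>B. \<beta> (p s) b * lookup (F b) s)"
    by (subst sum.swap) (simp add: mult.commute)
  also have "\<dots> = (\<Sum>s\<in>S. lookup (F (p s)) s)"
  proof (rule sum.cong[OF refl])
    fix s assume "s \<in> S"
    then have "F (p s) = F (\<Sum>b\<in>B. pm_scale (\<beta> (p s) b) b)" by (intro arg_cong[OF \<beta>] p)
    also have "\<dots> = (\<Sum>b\<in>B. pm_scale (\<beta> (p s) b) (F b))" by (rule F_sum[OF finB BW])
    finally show "(\<Sum>b\<in>B. \<beta> (p s) b * lookup (F b) s) = lookup (F (p s)) s"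
      by (simp add: lookup_sum_pm)
  qed
  finally show ?thesis .
qed

end

section \<open>Power series and the derivations of binomial products\<close>

lemma mps_coeff_1: "mps_coeff 1 m = (if m = 0 then 1 else 0)"
  by (simp add: one_mps.rep_eq)

lemma mps_coeff_add [simp]: "mps_coeff (f + g) m = mps_coeff f m + mps_coeff g m"
  by (simp add: plus_mps.rep_eq)

lemma mps_coeff_const: "mps_coeff (mps_const a) m = (if m = 0 then a else 0)"
  by (simp add: mps_const_def)

lemma mps_coeff_times:
  "mps_coeff (f * g) m = (\<Sum>(u, v) | u + v = m. mps_coeff f u * mps_coeff g v)"
  by (simp add: times_mps.rep_eq)

lemma mps_coeff_const_times [simp]:
  fixes f :: "'v mps"
  shows "mps_coeff (mps_const a * f) m = a * mps_coeff f m"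
proof -
  have "mps_coeff (mps_const a * f) m =
      (\<Sum>(u, v)\<in>{(0, m)}. mps_coeff (mps_const a :: 'v mps) u * mps_coeff f v)"
    unfolding mps_coeff_times
    by (rule sum.mono_neutral_right[OF finite_monomial_splits])
      (auto simp: mps_coeff_const split: if_splits)
  then show ?thesis by (simp add: mps_coeff_const)
qed

lemma mps_coeff_sum: "mps_coeff (sum f I) m = (\<Sum>i\<in>I. mps_coeff (f i) m)"
  by (induction I rule: infinite_finite_induct) auto

lemma mps_const_add: "mps_const (a + b) = mps_const a + mps_const b"
  by (rule mps_eqI) (simp add: mps_coeff_const)

lemma mps_const_mult: "mps_const (a * b) = mps_const a * mps_const b"
  by (rule mps_eqI) (simp add: mps_coeff_const)

lemma mps_const_neg_one_power: "(- 1 :: 'v mps) ^ n = mps_const ((- 1) ^ n)"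
proof (induction n)
  case (Suc n)
  have "mps_const (- 1) = (- 1 :: 'v mps)"
    by (metis add.right_inverse add_eq_0_iff mps_const_0 mps_const_1 mps_const_add)
  then show ?case by (simp only: power_Suc mps_const_mult Suc)
qed simp

lemma mps_coeff_formal_sum:
  assumes "finite K" and "\<And>i. i \<in> I \<Longrightarrow> mps_coeff (f i) m \<noteq> 0 \<Longrightarrow> i \<in> K" and "K \<subseteq> I"
  shows "mps_coeff (formal_sum f I) m = (\<Sum>i\<in>K. mps_coeff (f i) m)"
  unfolding formal_sum_def mps_coeff_Abs
  by (rule sum.mono_neutral_left) (use assms in auto)

lemma mps_coeff_formal_sum_nonzero:
  assumes "mps_coeff (formal_sum f I) m \<noteq> 0"
  obtains i where "i \<in> I" "mps_coeff (f i) m \<noteq> 0"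
proof -
  have "{i. i \<in> I \<and> mps_coeff (f i) m \<noteq> 0} \<noteq> {}"
  proof
    assume e: "{i. i \<in> I \<and> mps_coeff (f i) m \<noteq> 0} = {}"
    have "mps_coeff (formal_sum f I) m = 0"
      unfolding formal_sum_def mps_coeff_Abs e by simp
    with assms show False by simp
  qed
  with that show thesis by auto
qed

lemma mps_inverse_eq:
  assumes "f * g = 1"
  shows "mps_inverse f = g"
  unfolding mps_inverse_def
proof (rule the_equality)
  fix h assume "f * h = 1"
  then have "g * (f * h) = g" by simp
  then show "h = g" using assms by (metis mult.assoc mult.commute mult.left_neutral)
qed (rule assms)

section \<open>Monomials, and functions of a monomial that are products over its variables\<close>

lemma monomial_mult_monomial:
  fixes p q :: "'v \<Rightarrow>\<^sub>0 nat"
  shows "Abs_mps (\<lambda>m. if m = p then 1 else 0) * Abs_mps (\<lambda>m. if m = q then 1 else 0) =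
    Abs_mps (\<lambda>m. if m = p + q then 1 else 0)"
proof (rule mps_eqI)
  fix m :: "'v \<Rightarrow>\<^sub>0 nat"
  have "mps_coeff (Abs_mps (\<lambda>m. if m = p then 1 else 0) * Abs_mps (\<lambda>m. if m = q then 1 else 0)) m =
      (\<Sum>x\<in>{(a, b). a + b = m}. if x = (p, q) then 1 else 0)"
    unfolding mps_coeff_times by (rule sum.cong) (auto simp: case_prod_unfold)
  also have "\<dots> = (if p + q = m then 1 else 0)"
    by (subst sum.delta[OF finite_monomial_splits]) simp
  finally show "mps_coeff (Abs_mps (\<lambda>m. if m = p then 1 else 0) * Abs_mps (\<lambda>m. if m = q then 1 else 0)) m =
      mps_coeff (Abs_mps (\<lambda>m. if m = p + q then 1 else 0)) m"
    by auto
qed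

lemma one_monomial: "1 = Abs_mps (\<lambda>m. if m = 0 then 1 else 0)"
  by (rule mps_eqI) (simp add: mps_coeff_1)

lemma mps_var_power:
  "mps_var v ^ k = Abs_mps (\<lambda>m. if m = single v k then 1 else 0)"
proof (induction k)
  case (Suc k)
  show ?case
    unfolding power_Suc Suc by (simp add: mps_var_def monomial_mult_monomial single_add[symmetric])
qed (simp add: one_monomial)

lemma keys_add_single_one: "keys (m + single v (1 :: nat)) =
    insert v (keys m)"
  by (auto simp: in_keys_iff lookup_add lookup_single when_def split: if_splits)

lemma monomial_induct [case_names zero add]:
  fixes m :: "'v \<Rightarrow>\<^sub>0 nat"
  assumes "P 0" and "\<And>m v. P m \<Longrightarrow> P (m + single v 1)"
  shows "P m"
proof (induction "\<Sum>v\<in>keys m. lookup m v" arbitrary: m rule: less_induct)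
  case less
  show ?case
  proof (cases "m = 0")
    case False
    then obtain v where v: "v \<in> keys m" by fastforce
    define m' where "m' = m - single v 1"
    have mm: "m = m' + single v 1"
      using v by (intro poly_mapping_eqI)
        (auto simp: m'_def lookup_add lookup_minus lookup_single when_def in_keys_iff)
    have "keys m' \<subseteq> keys m"
      unfolding mm keys_add_single_one by auto
    then have "(\<Sum>w\<in>keys m'. lookup m' w) =
        (\<Sum>w\<in>keys m. lookup m' w)"
      by (intro sum.mono_neutral_left) (auto simp: in_keys_iff)
    also have "\<dots> < (\<Sum>w\<in>keys m. lookup m w)"
      using v by (intro sum_strict_mono_ex1)
        (auto simp: m'_def lookup_minus lookup_single when_def in_keys_iff)
    finally show ?thesis using less assms(2) mm by metis
  qed (simp add: assms(1))
qed

definition mprod :: "('v \<Rightarrow> nat \<Rightarrow> 'b) \<Rightarrow> ('v \<Rightarrow>\<^sub>0 nat) \<Rightarrow> 'b :: comm_monoid_mult" where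
  "mprod f m = (\<Prod>v\<in>keys m. f v (lookup m v))"

lemma mprod_0 [simp]: "mprod f 0 = 1"
  by (simp add: mprod_def)

lemma mprod_superset:
  assumes "\<And>v. f v 0 = 1" "finite S" "keys m \<subseteq> S"
  shows "mprod f m = (\<Prod>v\<in>S. f v (lookup m v))"
  unfolding mprod_def
  by (rule prod.mono_neutral_left) (use assms in \<open>auto simp: in_keys_iff\<close>)

text \<open>\<open>R\<close> collects the factors of all other variables. It is handed out in place
  of a quotient of the two products, because \<open>f v\<close> may vanish.\<close>

lemma mprod_add_single:
  assumes "\<And>v. f v 0 = 1"
  obtains R where "mprod f m = R * f v (lookup m v)"
    and "mprod f (m + single v 1) = R * f v (Suc (lookup m v))"
proof -
  let ?S = "insert v (keys m)" and ?m' = "m + single v 1"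
  have r: "(\<Prod>w\<in>?S - {v}. f w (lookup ?m' w)) =
      (\<Prod>w\<in>?S - {v}. f w (lookup m w))"
    by (rule prod.cong) (auto simp: lookup_add lookup_single)
  have "mprod f ?m' = (\<Prod>w\<in>?S - {v}. f w (lookup m w)) * f v (Suc (lookup m v))"
    unfolding mprod_def keys_add_single_one r[symmetric]
    by (subst prod.remove[of _ v]) (auto simp: lookup_add mult_ac)
  moreover have "mprod f m = (\<Prod>w\<in>?S - {v}. f w (lookup m w)) * f v (lookup m v)"
  proof -
    have "mprod f m = (\<Prod>w\<in>?S. f w (lookup m w))"
      by (rule mprod_superset) (use assms in auto)
    then show ?thesis by (subst (asm) prod.remove[of _ v]) (auto simp: mult_ac)
  qed
  ultimately show thesis using that by blast
qed

text \<open>The derivation $(1 + p_v) \partial / \partial p_v$, whose eigenvectors are the products of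
  binomial series $(1 + p_v)^{A_v}$.\<close>

definition theta :: "'v \<Rightarrow> 'v mps \<Rightarrow> 'v mps" where
  "theta v f = Abs_mps (\<lambda>u. (of_nat (lookup u v) + 1) * mps_coeff f (u + single v 1)
     + of_nat (lookup u v) * mps_coeff f u)"

lemma mps_coeff_theta: "mps_coeff (theta v f) u =
    (of_nat (lookup u v) + 1) * mps_coeff f (u + single v 1)
     + of_nat (lookup u v) * mps_coeff f u"
  by (simp add: theta_def)

lemma theta_const_times: "theta v (mps_const a * f) = mps_const a * theta v f"
  by (rule mps_eqI) (simp add: mps_coeff_theta ring_distribs mult.left_commute)

lemma theta_sum: "theta v (sum f I) = (\<Sum>i\<in>I. theta v (f i))"
  by (rule mps_eqI)
    (simp add: mps_coeff_theta mps_coeff_sum sum_distrib_left sum.distrib)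

lemma theta_one [simp]: "theta v 1 = 0"
proof (rule mps_eqI)
  fix u
  have "u + single v (1 :: nat) \<noteq> 0"
    by (metis keys_add_single_one insert_not_empty keys_zero)
  then show "mps_coeff (theta v 1) u = mps_coeff 0 u"
    by (simp add: mps_coeff_theta mps_coeff_1)
qed

text \<open>Adding \<open>v\<close> to the left part is a bijection from the splittings of
  \<open>u\<close> onto those splittings of \<open>u + single v 1\<close> whose left part contains
  \<open>v\<close>; the weight \<open>lookup a v\<close> kills the others. This is one half of the
  product rule.\<close>

lemma sum_splits_add_single:
  fixes F :: "('v \<Rightarrow>\<^sub>0 nat) \<Rightarrow> ('v \<Rightarrow>\<^sub>0 nat) \<Rightarrow> rat"
  shows "(\<Sum>(a, b) | a + b = u + single v 1. of_nat (lookup a v) * F a b) =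
    (\<Sum>(a, b) | a + b = u. (of_nat (lookup a v) + 1) * F (a + single v 1) b)"
proof -
  let ?e = "single v (1 :: nat)"
  have e: "a - ?e + ?e = a" if "lookup a v \<noteq> 0" for a
    using that by (intro poly_mapping_eqI) (auto simp: lookup_add lookup_minus lookup_single when_def)
  let ?A = "{(a, b). a + b = u + ?e}" and ?B = "{(a, b). a + b = u}" and ?h = "\<lambda>(a, b). (a + ?e, b)"
  have img: "?h ` ?B = {p \<in> ?A. lookup (fst p) v \<noteq> 0}"
  proof (intro equalityI subsetI)
    fix p assume "p \<in> ?h ` ?B"
    then show "p \<in> {p \<in> ?A. lookup (fst p) v \<noteq> 0}"
      by (auto simp: lookup_add add_ac)
  next
    fix p assume p: "p \<in> {p \<in> ?A. lookup (fst p) v \<noteq> 0}"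
    obtain a b where ab: "p = (a, b)" by (cases p)
    with p have *: "a + b = u + ?e" "a - ?e + ?e = a" using e[of a] by auto
    have "(a - ?e + b) + ?e = u + ?e" by (metis * add.assoc add.commute)
    then have "(a - ?e, b) \<in> ?B" by simp
    then show "p \<in> ?h ` ?B" using * by (intro image_eqI[of _ _ "(a - ?e, b)"]) (simp_all add: ab)
  qed
  have inj: "inj_on ?h ?B" by (auto simp: inj_on_def)
  have "(\<Sum>(a, b)\<in>?A. of_nat (lookup a v) * F a b) =
      (\<Sum>(a, b)\<in>?h ` ?B. of_nat (lookup a v) * F a b)"
    unfolding img by (rule sum.mono_neutral_right[OF finite_monomial_splits]) auto
  also have "\<dots> = (\<Sum>(a, b)\<in>?B. (of_nat (lookup a v) + 1) * F (a + ?e) b)"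
    unfolding sum.reindex[OF inj] by (rule sum.cong) (auto simp: lookup_add add_ac)
  finally show ?thesis .
qed

text \<open>For the derivative, the exponent of \<open>v\<close> is shared between the two factors,
  and each share is treated by \<open>sum_splits_add_single\<close>. The other summand of
  \<open>theta\<close> multiplies a coefficient by the exponent of \<open>v\<close>, which is
  additive.\<close>

lemma theta_times: "theta v (f * g) = theta v f * g + f * theta v g"
proof (rule mps_eqI)
  fix u
  let ?e = "single v (1 :: nat)" and ?l = "\<lambda>a. of_nat (lookup a v) :: rat"
  let ?f = "mps_coeff f" and ?g = "mps_coeff g"
  have swap: "(\<Sum>(a, b) | a + b = w. H a b) = (\<Sum>(a, b) | a + b = w. H b a)"
    for w :: "'a \<Rightarrow>\<^sub>0 nat" and H :: "_ \<Rightarrow> _ \<Rightarrow> rat"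
    by (rule sum.reindex_bij_witness[of _ "\<lambda>(a, b). (b, a)" "\<lambda>(a, b). (b, a)"]) (auto simp: add_ac)
  have 1: "(?l u + 1) * mps_coeff (f * g) (u + ?e) =
      (\<Sum>(a, b) | a + b = u + ?e. ?l a * (?f a * ?g b)) + (\<Sum>(a, b) | a + b = u + ?e. ?l b * (?f a * ?g b))"
    unfolding mps_coeff_times sum_distrib_left sum.distrib[symmetric]
  proof (rule sum.cong, goal_cases)
    case (2 p)
    obtain a b where ab: "p = (a, b)" by (cases p)
    with 2 have "a + b = u + ?e" by simp
    then have "lookup (a + b) v = lookup (u + ?e) v" by simp
    then have "?l a + ?l b = ?l u + 1"
      by (simp add: lookup_add flip: of_nat_add)
    then show ?case by (simp add: ab) (metis distrib_right)
  qed simp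
  have 2: "(\<Sum>(a, b) | a + b = u + ?e. ?l a * (?f a * ?g b)) =
      (\<Sum>(a, b) | a + b = u. (?l a + 1) * (?f (a + ?e) * ?g b))"
    by (rule sum_splits_add_single)
  have "(\<Sum>(a, b) | a + b = u + ?e. ?l b * (?f a * ?g b)) =
      (\<Sum>(a, b) | a + b = u + ?e. ?l a * (?f b * ?g a))"
    by (rule swap)
  also have "\<dots> = (\<Sum>(a, b) | a + b = u. (?l a + 1) * (?f b * ?g (a + ?e)))"
    by (rule sum_splits_add_single)
  also have "\<dots> = (\<Sum>(a, b) | a + b = u. (?l b + 1) * (?f a * ?g (b + ?e)))"
    by (rule swap)
  finally have 3: "(\<Sum>(a, b) | a + b = u + ?e. ?l b * (?f a * ?g b)) = \<dots>" .
  have 4: "?l u * mps_coeff (f * g) u =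
      (\<Sum>(a, b) | a + b = u. ?l a * (?f a * ?g b)) + (\<Sum>(a, b) | a + b = u. ?l b * (?f a * ?g b))"
    unfolding mps_coeff_times sum_distrib_left sum.distrib[symmetric]
    by (rule sum.cong) (auto simp: lookup_add distrib_right)
  show "mps_coeff (theta v (f * g)) u = mps_coeff (theta v f * g + f * theta v g) u"
    unfolding mps_coeff_theta[of v "f * g"] 1 2 3 4
    unfolding mps_coeff_add mps_coeff_times mps_coeff_theta sum.distrib[symmetric]
    by (rule sum.cong) (auto simp: algebra_simps)
qed

lemma theta_power_const:
  assumes "theta v f = mps_const a"
  shows "theta v (f ^ k) = mps_const (of_nat k * a) * f ^ (k - 1)"
proof (induction k)
  case (Suc k)
  have "theta v (f ^ Suc k) = mps_const a * f ^ k + f * (mps_const (of_nat k * a) * f ^ (k - 1))"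
    by (simp add: theta_times assms Suc)
  also have "f * (mps_const (of_nat k * a) * f ^ (k - 1)) = mps_const (of_nat k * a) * f ^ k"
    by (cases k) (auto simp: mult_ac)
  finally show ?case by (simp add: mps_const_add distrib_right)
qed simp

lemma theta_prod:
  assumes "finite S"
  shows "theta v (prod f S) = (\<Sum>w\<in>S. theta v (f w) * prod f (S - {w}))"
  using assms
proof (induction S rule: finite_induct)
  case (insert w S)
  have "prod f (insert w S - {t}) = f w * prod f (S - {t})" if "t \<in> S" for t
  proof -
    have "insert w S - {t} = insert w (S - {t})" "w \<notin> S - {t}" using insert that by auto
    with insert(1) show ?thesis by simp
  qed
  then have "(\<Sum>t\<in>S. theta v (f t) * prod f (insert w S - {t})) = f w * (\<Sum>t\<in>S. theta v (f t) * prod f (S - {t}))"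
    by (simp add: sum_distrib_left mult_ac)
  then show ?case using insert by (simp add: theta_times)
qed simp

text \<open>The eigenvalue equation at \<open>m\<close> gives the coefficient at
  \<open>m + single v 1\<close> from the one at \<open>m\<close> by the recursion (k + 1) binom(A, k
  + 1) = (A - k) binom(A, k), so the constant term determines everything.\<close>

lemma theta_eigenvector_unique:
  assumes "mps_coeff F 0 = 1" and eig: "\<And>v. theta v F = mps_const (A v) * F"
  shows "mps_coeff F m = mprod (\<lambda>v k. A v gchoose k) m"
proof (induction m rule: monomial_induct)
  case (add m v)
  let ?k = "lookup m v"
  have "mps_coeff (theta v F) m = A v * mps_coeff F m"
    by (simp add: eig)
  then have 1: "(of_nat ?k + 1) * mps_coeff F (m + single v 1) = (A v - of_nat ?k) * mps_coeff F m"
    by (simp add: mps_coeff_theta algebra_simps)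
  have 2: "(of_nat ?k + 1) * (A v gchoose Suc ?k) = (A v - of_nat ?k) * (A v gchoose ?k)"
    using gbinomial_mult_1[of "A v" ?k] by (simp add: algebra_simps)
  obtain R where R: "mprod (\<lambda>v k. A v gchoose k) m = R * (A v gchoose ?k)"
    "mprod (\<lambda>v k. A v gchoose k) (m + single v 1) = R * (A v gchoose Suc ?k)"
    using mprod_add_single[of "\<lambda>v k. A v gchoose k" m v] gbinomial_0(1) by metis
  have "(of_nat ?k + 1) * mps_coeff F (m + single v 1) = (of_nat ?k + 1) * (R * (A v gchoose Suc ?k))"
  proof -
    have "(A v - of_nat ?k) * (R * (A v gchoose ?k)) = R * ((A v - of_nat ?k) * (A v gchoose ?k))" by (rule mult.left_commute)
    also have "\<dots> = (of_nat ?k + 1) * (R * (A v gchoose Suc ?k))" unfolding 2[symmetric] by (rule mult.left_commute)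
    finally show ?thesis unfolding 1 add R .
  qed
  moreover have "(of_nat ?k + 1 :: rat) \<noteq> 0" using of_nat_0_le_iff[of ?k, where 'a = rat] by linarith
  ultimately show ?case unfolding R by (metis mult_left_cancel)
qed (simp add: assms(1))

lemma theta_mprod_binomial:
  "theta v (Abs_mps (mprod (\<lambda>v k. A v gchoose k))) =
    mps_const (A v) * Abs_mps (mprod (\<lambda>v k. A v gchoose k))"
proof (rule mps_eqI)
  fix m :: "'a \<Rightarrow>\<^sub>0 nat"
  let ?k = "lookup m v"
  have 2: "(of_nat ?k + 1) * (A v gchoose Suc ?k) = (A v - of_nat ?k) * (A v gchoose ?k)"
    using gbinomial_mult_1[of "A v" ?k] by (simp add: algebra_simps)
  obtain R where R: "mprod (\<lambda>v k. A v gchoose k) m = R * (A v gchoose ?k)"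
    "mprod (\<lambda>v k. A v gchoose k) (m + single v 1) = R * (A v gchoose Suc ?k)"
    using mprod_add_single[of "\<lambda>v k. A v gchoose k" m v] gbinomial_0(1) by metis
  have "(of_nat ?k + 1) * (R * (A v gchoose Suc ?k)) = R * ((A v - of_nat ?k) * (A v gchoose ?k))"
    unfolding 2[symmetric] by (rule mult.left_commute)
  then show "mps_coeff (theta v (Abs_mps (mprod (\<lambda>v k. A v gchoose k)))) m =
      mps_coeff (mps_const (A v) * Abs_mps (mprod (\<lambda>v k. A v gchoose k))) m"
    unfolding mps_coeff_theta mps_coeff_Abs mps_coeff_const_times R by (simp add: algebra_simps)
qed

text \<open>Eigenvalues add under multiplication. The product of \<open>F\<close> with the series of
  opposite exponents therefore has all eigenvalues zero and constant term one, and
  \<open>theta_eigenvector_unique\<close> leaves only \<open>1\<close>.\<close>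

lemma mps_inverse_binomial:
  assumes F: "mps_coeff F 0 = 1" "\<And>v. theta v F = mps_const (A v) * F"
  shows "mps_inverse F = Abs_mps (mprod (\<lambda>v k. - A v gchoose k))"
proof (rule mps_inverse_eq)
  let ?V = "Abs_mps (mprod (\<lambda>v k. - A v gchoose k))"
  have "{(u, v). u + v = (0 :: 'a \<Rightarrow>\<^sub>0 nat)} = {(0, 0)}"
  proof (intro equalityI subsetI)
    fix p assume "p \<in> {(u, v). u + v = (0 :: 'a \<Rightarrow>\<^sub>0 nat)}"
    then obtain a b :: "'a \<Rightarrow>\<^sub>0 nat" where ab: "p = (a, b)" "a + b = 0" by auto
    have "lookup (a + b) v = 0" for v using ab by simp
    then have "a = 0 \<and> b = 0" by (auto simp: lookup_add intro!: poly_mapping_eqI)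
    then show "p \<in> {(0, 0)}" using ab by simp
  qed simp
  then have 0: "mps_coeff (F * ?V) 0 = 1" by (simp add: mps_coeff_times F)
  have "theta v (F * ?V) = mps_const 0 * (F * ?V)" for v
  proof -
    have "theta v (F * ?V) = (mps_const (A v) + mps_const (- A v)) * (F * ?V)"
      by (simp only: theta_times F theta_mprod_binomial) (simp add: algebra_simps)
    then show ?thesis by (simp flip: mps_const_add)
  qed
  from theta_eigenvector_unique[of _ "\<lambda>_. 0", OF 0 this]
  have c: "mps_coeff (F * ?V) m = mprod (\<lambda>v k. 0 gchoose k) m" for m .
  have "mprod (\<lambda>v k. (0 :: rat) gchoose k) m = (if m = 0 then 1 else 0)" for m :: "'a \<Rightarrow>\<^sub>0 nat"
  proof (cases "m = 0")
    case False
    then obtain v where "v \<in> keys m" by fastforce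
    moreover from this have "(0 :: rat) gchoose lookup m v = 0"
      by (cases "lookup m v") (auto simp: in_keys_iff)
    ultimately show ?thesis using False by (auto simp: mprod_def intro!: prod_zero)
  qed simp
  with c show "F * ?V = 1" by (intro mps_eqI) (simp add: mps_coeff_1)
qed

lemma mps_coeff_var_times:
  "mps_coeff (mps_var v * f) u =
    (if lookup u v = 0 then 0 else mps_coeff f (u - single v 1))"
proof -
  let ?e = "single v (1 :: nat)"
  have "mps_coeff (mps_var v * f) u = (\<Sum>(a, b) | a + b = u. if a = ?e then mps_coeff f b else 0)"
    unfolding mps_coeff_times by (rule sum.cong) (auto simp: mps_var_def)
  also have "\<dots> = (\<Sum>(a, b)\<in>(if lookup u v = 0 then {} else {(?e, u - ?e)}).
      if a = ?e then mps_coeff f b else 0)"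
  proof (rule sum.mono_neutral_right[OF finite_monomial_splits])
    show "(if lookup u v = 0 then {} else {(?e, u - ?e)}) \<subseteq> {(a, b). a + b = u}"
      by (auto intro!: poly_mapping_eqI simp: lookup_add lookup_minus lookup_single when_def)
    show "\<forall>p\<in>{(a, b). a + b = u} - (if lookup u v = 0 then {} else {(?e, u - ?e)}).
        (case p of (a, b) \<Rightarrow> if a = ?e then mps_coeff f b else 0) = 0"
    proof
      fix p
      assume p: "p \<in> {(a, b). a + b = u} - (if lookup u v = 0 then {} else {(?e, u - ?e)})"
      obtain a b where ab: "p = (a, b)" by (cases p)
      have "a \<noteq> ?e"
      proof
        assume a: "a = ?e"
        then have "u = ?e + b" using p ab by auto
        then have "lookup u v \<noteq> 0" "b = u - ?e" by (simp_all add: lookup_add)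
        with p ab a show False by auto
      qed
      then show "(case p of (a, b) \<Rightarrow> if a = ?e then mps_coeff f b else 0) = 0" by (simp add: ab)
    qed
  qed
  finally show ?thesis by simp
qed

section \<open>The grading with p_i(c) in degree i, and the lowest degree of a series\<close>

definition pweight :: "(nat \<times> 'c \<Rightarrow>\<^sub>0 nat) \<Rightarrow> nat" where
  "pweight m = (\<Sum>v\<in>keys m. fst v * lookup m v)"

lemma pweight_superset:
  "finite S \<Longrightarrow> keys m \<subseteq> S \<Longrightarrow> pweight m = (\<Sum>v\<in>S. fst v * lookup m v)"
  unfolding pweight_def by (rule sum.mono_neutral_left) (auto simp: in_keys_iff)

lemma pweight_0 [simp]: "pweight 0 = 0"
  by (simp add: pweight_def)

lemma pweight_single [simp]: "pweight (single v k) = fst v * k"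
  by (simp add: pweight_def)

lemma pweight_add: "pweight (m + n) = pweight m + pweight n"
proof -
  let ?S = "keys m \<union> keys n"
  have "pweight (m + n) = (\<Sum>v\<in>?S. fst v * lookup (m + n) v)"
    "pweight m = (\<Sum>v\<in>?S. fst v * lookup m v)"
    "pweight n = (\<Sum>v\<in>?S. fst v * lookup n v)"
    by (rule pweight_superset; simp add: keys_add)+
  then show ?thesis by (simp add: lookup_add algebra_simps sum.distrib)
qed

text \<open>All indices are at least one and \<open>C\<close> is finite, so a bound on the degree
  bounds both the variables and their exponents.\<close>

lemma finite_monomials_bounded_weight:
  assumes "finite C"
  shows "finite {m. keys m \<subseteq> {1..} \<times> C \<and> pweight m \<le> N}"
proof (rule finite_subset)
  let ?H = "{h. \<forall>x. (x \<in> {1..N} \<times> C \<longrightarrow> h x \<in> {..N}) \<and> (x \<notin> {1..N} \<times> C \<longrightarrow> h x = 0)}"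
  show "finite (Abs_poly_mapping ` ?H)"
    by (rule finite_imageI, rule finite_set_of_finite_funs) (simp_all add: assms)
  show "{m. keys m \<subseteq> {1..} \<times> C \<and> pweight m \<le> N} \<subseteq> Abs_poly_mapping ` ?H"
  proof
    fix m assume m: "m \<in> {m. keys m \<subseteq> {1..} \<times> C \<and> pweight m \<le> N}"
    have le: "fst v * lookup m v \<le> N" for v
    proof (cases "v \<in> keys m")
      case True
      then have "fst v * lookup m v \<le> pweight m"
        unfolding pweight_def by (intro member_le_sum) auto
      with m show ?thesis by simp
    qed (simp add: in_keys_iff)
    have "lookup m \<in> ?H"
    proof (intro CollectI allI conjI impI)
      fix v :: "nat \<times> 'a"
      { assume "v \<in> {1..N} \<times> C"
        then have "1 \<le> fst v" by auto
        then have "1 * lookup m v \<le> fst v * lookup m v" by (rule mult_le_mono1)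
        with le[of v] have "lookup m v \<le> N" by linarith
        then show "lookup m v \<in> {..N}" by simp }
      assume v: "v \<notin> {1..N} \<times> C"
      show "lookup m v = 0"
      proof (rule ccontr)
        assume nz: "lookup m v \<noteq> 0"
        then have "v \<in> {1..} \<times> C" using m by (auto simp: in_keys_iff)
        moreover have "fst v * 1 \<le> fst v * lookup m v" using nz by (intro mult_le_mono2) simp
        then have "fst v \<le> N" using le[of v] by linarith
        ultimately show False using v by (cases v) auto
      qed
    qed
    then have "Abs_poly_mapping (lookup m) \<in> Abs_poly_mapping ` ?H" by (rule imageI)
    then show "m \<in> Abs_poly_mapping ` ?H" by (simp only: lookup_inverse)
  qed
qed

text \<open>Membership in the n-th step of the degree filtration; it is what makes the substitutions
  locally finite.\<close>

definition order_ge :: "nat \<Rightarrow> (nat \<times> 'c) mps \<Rightarrow> bool" where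
  "order_ge n f \<longleftrightarrow> (\<forall>u. mps_coeff f u \<noteq> 0 \<longrightarrow> n \<le> pweight u)"

lemma order_ge_times:
  assumes "order_ge a f" "order_ge b g"
  shows "order_ge (a + b) (f * g)"
  unfolding order_ge_def
proof (intro allI impI)
  fix u assume "mps_coeff (f * g) u \<noteq> 0"
  then obtain p where "p \<in> {(x, y). x + y = u}" "(case p of (x, y) \<Rightarrow> mps_coeff f x * mps_coeff g y) \<noteq> 0"
    unfolding mps_coeff_times by (metis (no_types, lifting) sum.neutral)
  with assms show "a + b \<le> pweight u"
    by (auto simp: order_ge_def pweight_add intro!: add_mono)
qed

lemma order_ge_one: "order_ge 0 f"
  by (simp add: order_ge_def)

lemma order_ge_power: "order_ge a f \<Longrightarrow> order_ge (a * k) (f ^ k)"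
  by (induction k) (auto intro: order_ge_one order_ge_times)

lemma order_ge_prod:
  "finite S \<Longrightarrow> (\<And>v. v \<in> S \<Longrightarrow> order_ge (a v) (f v)) \<Longrightarrow> order_ge (\<Sum>v\<in>S. a v) (\<Prod>v\<in>S. f v)"
  by (induction S rule: finite_induct) (auto intro: order_ge_one order_ge_times)

lemma order_ge_mprod:
  assumes "\<And>v. v \<in> keys m \<Longrightarrow> order_ge (fst v) (s v)"
  shows "order_ge (pweight m) (mprod (\<lambda>v k. s v ^ k) m)"
  unfolding pweight_def mprod_def by (intro order_ge_prod order_ge_power assms) auto

section \<open>The coefficients of L and of its plethysms with p_i(c)\<close>

lemma single_eq_iff:
  "(1 :: nat) \<le> k \<Longrightarrow> single a k = single b l \<longleftrightarrow> a = b \<and> k = l"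
  by (metis lookup_single_eq lookup_single_not_eq not_one_le_zero)

lemma mps_coeff_log1p_var:
  assumes "1 \<le> k"
  shows "mps_coeff (log1p_series (mps_var e)) (single e k) = (-1) ^ (k - 1) / of_nat k"
  unfolding log1p_series_def
  by (subst mps_coeff_formal_sum[of "{k}"])
    (use assms in \<open>auto simp: mps_var_power single_eq_iff split: if_splits\<close>)

lemma mps_coeff_log1p_var_nonzero:
  assumes "mps_coeff (log1p_series (mps_var e)) u \<noteq> 0"
  obtains k where "1 \<le> k" "u = single e k"
  using assms unfolding log1p_series_def
  by (elim mps_coeff_formal_sum_nonzero) (auto simp: mps_var_power split: if_splits)

lemma mps_coeff_L_series:
  assumes "1 \<le> k" "1 \<le> e"
  shows "mps_coeff L_series (single e k) =
    of_int (moebius_mu e) / of_nat e * ((-1) ^ (k - 1) / of_nat k)"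
  unfolding L_series_def
proof (subst mps_coeff_formal_sum[of "{e}"])
  fix d assume "mps_coeff (mps_const (of_int (moebius_mu d) / of_nat d) * log1p_series (mps_var d))
      (single e k) \<noteq> 0"
  then have "mps_coeff (log1p_series (mps_var d)) (single e k) \<noteq> 0" by simp
  then show "d \<in> {e}"
    by (elim mps_coeff_log1p_var_nonzero) (use assms in \<open>simp add: single_eq_iff\<close>)
qed (use assms in \<open>auto simp: mps_coeff_log1p_var\<close>)

lemma mps_coeff_L_series_nonzero:
  assumes "mps_coeff L_series u \<noteq> 0"
  obtains e k where "1 \<le> e" "1 \<le> k" "u = single e k"
proof -
  from assms obtain e where "e \<in> {1..}"
    "mps_coeff (mps_const (of_int (moebius_mu e) / of_nat e) * log1p_series (mps_var e)) u \<noteq> 0"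
    unfolding L_series_def by (rule mps_coeff_formal_sum_nonzero)
  then have "mps_coeff (log1p_series (mps_var e)) u \<noteq> 0" by simp
  with \<open>e \<in> {1..}\<close> that show thesis by (auto elim: mps_coeff_log1p_var_nonzero)
qed

text \<open>Since \<open>1 \<le> i\<close>, different \<open>e\<close> lead to different variables
  \<open>(i * e, class_pow G c e)\<close>, so no two terms of \<open>L_series\<close> meet in one
  monomial.\<close>

lemma mps_coeff_pleth_gen_L:
  assumes "1 \<le> i" "1 \<le> e" "1 \<le> k"
  shows "mps_coeff (pleth_gen G i c L_series) (single (i * e, class_pow G c e) k) =
    of_int (moebius_mu e) / of_nat e * ((-1) ^ (k - 1) / of_nat k)"
  unfolding pleth_gen_def mps_subst_def
proof (subst mps_coeff_formal_sum[of "{single e k}"])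
  fix m
  assume nz: "mps_coeff (mps_const (mps_coeff L_series m) *
      (\<Prod>j\<in>keys m. pvar (i * j) (class_pow G c j) ^ lookup m j))
      (single (i * e, class_pow G c e) k) \<noteq> 0"
  then have "mps_coeff L_series m \<noteq> 0" by auto
  then obtain d l where m: "1 \<le> d" "1 \<le> l" "m = single d l"
    by (rule mps_coeff_L_series_nonzero)
  with nz assms have "single (i * e, class_pow G c e) k = single (i * d, class_pow G c d) l"
    by (auto simp: mps_var_power split: if_splits)
  then show "m \<in> {single e k}" using m assms by (simp add: single_eq_iff)
qed (use assms in \<open>auto simp: mps_var_power mps_coeff_L_series\<close>)

lemma mps_coeff_pleth_gen_L_nonzero:
  assumes "mps_coeff (pleth_gen G i c L_series) u \<noteq> 0"
  obtains e k where "1 \<le> e" "1 \<le> k" "u = single (i * e, class_pow G c e) k"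
proof -
  from assms obtain m where nz: "mps_coeff (mps_const (mps_coeff L_series m) *
      (\<Prod>j\<in>keys m. pvar (i * j) (class_pow G c j) ^ lookup m j)) u \<noteq> 0"
    unfolding pleth_gen_def mps_subst_def by (rule mps_coeff_formal_sum_nonzero)
  then have "mps_coeff L_series m \<noteq> 0" by auto
  then obtain d l where m: "1 \<le> d" "1 \<le> l" "m = single d l"
    by (rule mps_coeff_L_series_nonzero)
  with nz have "u = single (i * d, class_pow G c d) l"
    by (auto simp: mps_var_power split: if_splits)
  with m that show thesis by blast
qed

text \<open>The constant to which \<open>theta v\<close> sends the plethysm of p_w with L. Only the
  term log(1 + p_e) for which p_w composed with p_e is p_v contributes, and since (1 + p_v) d/dp_v
  log(1 + p_v) = 1, the factor mu(e) / e remains.\<close>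

definition mobius_coeff :: "('a, 'b) monoid_scheme \<Rightarrow> nat \<times> 'a set \<Rightarrow> nat \<times> 'a set \<Rightarrow> rat" where
  "mobius_coeff G v w = (let e = fst v div fst w in
     if fst w dvd fst v \<and> 1 \<le> fst v \<and> class_pow G (snd w) e = snd v
     then of_int (moebius_mu e) / of_nat e else 0)"

lemma theta_pleth_gen_L:
  assumes i: "1 \<le> i"
  shows "theta v (pleth_gen G i c L_series) = mps_const (mobius_coeff G v (i, c))"
proof (rule mps_eqI)
  fix u
  let ?f = "pleth_gen G i c L_series"
  let ?e = "fst v div i"
  let ?P = "i dvd fst v \<and> 1 \<le> fst v \<and> class_pow G c ?e = snd v"
  have single: "mps_coeff ?f (single v k) =
      (if ?P then of_int (moebius_mu ?e) / of_nat ?e * ((-1) ^ (k - 1) / of_nat k) else 0)" if k: "1 \<le> k" for k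
  proof (cases ?P)
    case True
    then have v: "v = (i * ?e, class_pow G c ?e)" and "1 \<le> ?e"
      using i by (auto simp: prod_eq_iff Suc_le_eq div_greater_zero_iff dvd_imp_le)
    have "mps_coeff ?f (single (i * ?e, class_pow G c ?e) k) =
        of_int (moebius_mu ?e) / of_nat ?e * ((-1) ^ (k - 1) / of_nat k)"
      by (rule mps_coeff_pleth_gen_L[OF i \<open>1 \<le> ?e\<close> k])
    then show ?thesis using True v by simp
  next
    case False
    have "mps_coeff ?f (single v k) = 0"
    proof (rule ccontr)
      assume "mps_coeff ?f (single v k) \<noteq> 0"
      then obtain e l where "1 \<le> e" "1 \<le> l" "single v k = single (i * e, class_pow G c e) l"
        by (rule mps_coeff_pleth_gen_L_nonzero)
      then show False using False i k by (auto simp: single_eq_iff)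
    qed
    then show ?thesis using False by (simp only: if_False)
  qed
  have other: "mps_coeff ?f u = 0" if "u \<noteq> single v (lookup u v)" "lookup u v \<noteq> 0" for u
  proof (rule ccontr)
    assume "mps_coeff ?f u \<noteq> 0"
    then obtain e l where u: "u = single (i * e, class_pow G c e) l"
      by (rule mps_coeff_pleth_gen_L_nonzero)
    with that(2) have "(i * e, class_pow G c e) = v" by (auto simp: lookup_single when_def split: if_splits)
    with u that(1) show False by simp
  qed
  show "mps_coeff (theta v ?f) u = mps_coeff (mps_const (mobius_coeff G v (i, c))) u"
  proof (cases "u = single v (lookup u v)")
    case True
    define k where "k = lookup u v"
    have u: "u = single v k" using True by (simp add: k_def)
    show ?thesis
    proof (cases k)
      case 0
      then show ?thesis unfolding mps_coeff_theta u
        using single[of 1] by (simp add: mps_coeff_const mobius_coeff_def Let_def)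
    next
      case (Suc l)
      \<comment> \<open>Multiplied by their exponents, consecutive coefficients of the logarithm are
        equal up to sign and cancel; only the constant term is left.\<close>
      have "(of_nat k + 1) * mps_coeff ?f (single v (k + 1)) +
          of_nat k * mps_coeff ?f (single v k) = 0"
      proof (cases ?P)
        case True
        define q where "q = of_int (moebius_mu ?e) / (of_nat ?e :: rat)"
        have "mps_coeff ?f (single v k) = q * ((-1) ^ l / (of_nat l + 1))"
          "mps_coeff ?f (single v (k + 1)) = q * (- ((-1) ^ l) / (of_nat l + 2))"
          using single[of k] single[of "k + 1"] True by (simp_all add: Suc q_def add.commute)
        moreover have "(of_nat l + 1 :: rat) \<noteq> 0" "(of_nat l + 2 :: rat) \<noteq> 0"
          using of_nat_0_le_iff[of l, where 'a = rat] by linarith+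
        ultimately show ?thesis by (simp add: Suc field_simps)
      next
        case False
        then show ?thesis using single[of k] single[of "k + 1"] Suc by (simp only: if_False)
      qed
      moreover have "u \<noteq> 0" using Suc u by (metis lookup_single_eq lookup_zero nat.distinct(1))
      ultimately show ?thesis by (simp add: mps_coeff_theta mps_coeff_const u flip: single_add)
    qed
  next
    case False
    have "mps_coeff ?f (u + single v 1) = 0"
    proof (rule other)
      show "u + single v 1 \<noteq> single v (lookup (u + single v 1) v)"
      proof
        assume eq: "u + single v 1 = single v (lookup (u + single v 1) v)"
        have "lookup (u + single v 1) v = lookup u v + 1"
          by (simp only: lookup_add lookup_single_eq)
        with eq have "u + single v 1 = single v (lookup u v) + single v 1"
          by (simp only: single_add)
        then show False using False by (simp only: add_right_cancel)
      qed
    qed (simp add: lookup_add)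
    moreover have "of_nat (lookup u v) * mps_coeff ?f u = 0"
      using other[OF False] by (cases "lookup u v = 0") auto
    moreover have "u \<noteq> 0" using False by auto
    ultimately show ?thesis by (simp add: mps_coeff_theta mps_coeff_const)
  qed
qed

text \<open>\<open>Y\<close> is the exponential of the sum of all p_v / Z_v, written out by
  coefficients. With \<open>Z\<close> kept abstract, the chain rule for \<open>theta\<close> is
  separated from the class sizes.\<close>

context
  fixes G :: "('a, 'b) monoid_scheme" and Y :: "(nat \<times> 'a set) mps"
    and C :: "'a set set" and Z :: "nat \<times> 'a set \<Rightarrow> rat"
  assumes finC: "finite C"
    and coeffY: "\<And>m. mps_coeff Y m =
      (if keys m \<subseteq> {1..} \<times> C then mprod (\<lambda>v k. 1 / (Z v ^ k * fact k)) m else 0)"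
begin

private abbreviation "s \<equiv> \<lambda>v. pleth_gen G (fst v) (snd v) L_series"
private abbreviation "t m \<equiv> mps_const (mps_coeff Y m) * mprod (\<lambda>v k. s v ^ k) m"
private abbreviation "M N \<equiv> {m. keys m \<subseteq> {1..} \<times> C \<and> pweight m \<le> N}"

text \<open>\<open>theta\<close> is additive over finite sums, whereas the substitution is an
  infinite one. Since p_i(c) composed with L starts in degree i, a coefficient of degree at most
  \<open>N\<close> sees only the monomials of degree at most \<open>N\<close>.\<close>

private lemma pleth_truncate:
  assumes "pweight u \<le> N"
  shows "mps_coeff (pleth G Y L_series) u = mps_coeff (\<Sum>m\<in>M N. t m) u"
proof -
  have e: "pleth G Y L_series = formal_sum t UNIV"
    unfolding pleth_def mps_subst_def mprod_def by (simp add: case_prod_unfold)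
  show ?thesis unfolding e mps_coeff_sum
  proof (rule mps_coeff_formal_sum)
    fix m assume nz: "mps_coeff (t m) u \<noteq> 0"
    then have adm: "keys m \<subseteq> {1..} \<times> C" using coeffY[of m] by (auto split: if_splits)
    have "order_ge (pweight m) (mprod (\<lambda>v k. s v ^ k) m)"
    proof (rule order_ge_mprod)
      fix v assume "v \<in> keys m"
      show "order_ge (fst v) (s v)"
        unfolding order_ge_def by (auto elim!: mps_coeff_pleth_gen_L_nonzero)
    qed
    moreover have "mps_coeff (mprod (\<lambda>v k. s v ^ k) m) u \<noteq> 0" using nz by auto
    ultimately have "pweight m \<le> pweight u" by (simp add: order_ge_def)
    with adm assms show "m \<in> M N" by simp
  qed (use finite_monomials_bounded_weight[OF finC] in auto)
qed

text \<open>The chain rule on one monomial. The exponent that differentiation brings down cancels a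
  factor of the factorial in the coefficient of \<open>Y\<close>, so every resulting term is a
  multiple of a term \<open>t\<close> with one variable less.\<close>

private lemma theta_term:
  assumes adm: "keys m \<subseteq> {1..} \<times> C"
  shows "theta v (t m) = (\<Sum>w\<in>keys m.
    mps_const (mobius_coeff G v w / Z w) * t (m - single w 1))"
proof -
  have th: "theta v (s w ^ k) = mps_const (of_nat k * mobius_coeff G v w) * s w ^ (k - 1)"
    if "w \<in> keys m" for w k
    using that adm by (intro theta_power_const) (auto simp: theta_pleth_gen_L)
  have "theta v (mprod (\<lambda>v k. s v ^ k) m) = (\<Sum>w\<in>keys m. 
      mps_const (of_nat (lookup m w) * mobius_coeff G v w) *
      (s w ^ (lookup m w - 1) * (\<Prod>x\<in>keys m - {w}. s x ^ lookup m x)))"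
    unfolding mprod_def by (simp add: theta_prod th mult.assoc)
  also have "\<dots> = (\<Sum>w\<in>keys m. 
      mps_const (of_nat (lookup m w) * mobius_coeff G v w) *
      mprod (\<lambda>v k. s v ^ k) (m - single w 1))"
  proof (rule sum.cong[OF refl])
    fix w assume w: "w \<in> keys m"
    have "mprod (\<lambda>v k. s v ^ k) (m - single w 1) =
      (\<Prod>x\<in>keys m. s x ^ lookup (m - single w 1) x)"
      by (rule mprod_superset) (auto simp: in_keys_iff lookup_minus)
    also have "\<dots> = s w ^ (lookup m w - 1) *
        (\<Prod>x\<in>keys m - {w}. s x ^ lookup (m - single w 1) x)"
      using w by (subst prod.remove[of _ w]) (auto simp: lookup_minus)
    also have "(\<Prod>x\<in>keys m - {w}. s x ^ lookup (m - single w 1) x) =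
        (\<Prod>x\<in>keys m - {w}. s x ^ lookup m x)"
      by (rule prod.cong) (auto simp: lookup_minus lookup_single)
    finally show "mps_const (of_nat (lookup m w) * mobius_coeff G v w) *
      (s w ^ (lookup m w - 1) * (\<Prod>x\<in>keys m - {w}. s x ^ lookup m x)) =
      mps_const (of_nat (lookup m w) * mobius_coeff G v w) *
      mprod (\<lambda>v k. s v ^ k) (m - single w 1)" by simp
  qed
  also have "mps_const (mps_coeff Y m) * \<dots> = (\<Sum>w\<in>keys m.
    mps_const (mobius_coeff G v w / Z w) * t (m - single w 1))"
    unfolding sum_distrib_left
  proof (rule sum.cong[OF refl])
    fix w assume w: "w \<in> keys m"
    define m' where "m' = m - single w 1"
    have m: "m = m' + single w 1" using w
      by (intro poly_mapping_eqI) (auto simp: m'_def lookup_add lookup_minus lookup_single when_def in_keys_iff)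
    have adm': "keys m' \<subseteq> {1..} \<times> C" using adm unfolding m keys_add_single_one by simp
    let ?k = "lookup m' w"
    obtain R where R: "mprod (\<lambda>v k. 1 / (Z v ^ k * fact k)) m' = R * (1 / (Z w ^ ?k * fact ?k))"
      "mprod (\<lambda>v k. 1 / (Z v ^ k * fact k)) (m' + single w 1) = R * (1 / (Z w ^ Suc ?k * fact (Suc ?k)))"
      using mprod_add_single[of "\<lambda>v k. 1 / (Z v ^ k * fact k)" m' w] by auto
    have k: "of_nat (lookup m w) = (of_nat ?k + 1 :: rat)" by (simp add: m lookup_add)
    have nz: "(of_nat ?k + 1 :: rat) \<noteq> 0"
      using of_nat_0_le_iff[of ?k, where 'a = rat] by linarith
    have "fact (Suc ?k) = (of_nat ?k + 1) * (fact ?k :: rat)" by (simp add: algebra_simps)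
    then have "mps_coeff Y m * (of_nat (lookup m w) * mobius_coeff G v w) =
        mobius_coeff G v w / Z w * mps_coeff Y m'"
    proof -
      have gen: "R * (1 / (z * y * (c * f))) * (c * q) = q / z * (R * (1 / (y * f)))"
        if "c \<noteq> 0" for z y c f q :: rat
        using that by simp
      have "mps_coeff Y m = R * (1 / (Z w * Z w ^ ?k * ((of_nat ?k + 1) * fact ?k)))"
        using coeffY[of m] adm R(2) \<open>fact (Suc ?k) = _\<close> unfolding m by (simp only: if_True power_Suc)
      moreover have "mps_coeff Y m' = R * (1 / (Z w ^ ?k * fact ?k))"
        using coeffY[of m'] adm' R(1) by (simp only: if_True)
      ultimately show ?thesis by (simp only: k gen[OF nz])
    qed
    then show "mps_const (mps_coeff Y m) * (mps_const (of_nat (lookup m w) * mobius_coeff G v w) *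
        mprod (\<lambda>v k. s v ^ k) (m - single w 1)) =
        mps_const (mobius_coeff G v w / Z w) * t (m - single w 1)"
      unfolding m'_def[symmetric] by (simp only: mps_const_mult[symmetric] mult.assoc[symmetric])
  qed
  finally show ?thesis by (simp add: theta_const_times)
qed

lemma theta_pleth_L:
  "theta v (pleth G Y L_series) =
    mps_const (\<Sum>w\<in>{1..fst v} \<times> C. mobius_coeff G v w / Z w) * pleth G Y L_series"
proof (rule mps_eqI)
  fix u :: "nat \<times> 'a set \<Rightarrow>\<^sub>0 nat"
  \<comment> \<open>\<open>theta v\<close> also reads the coefficient at
    \<open>u + single v 1\<close>, whose degree exceeds that of \<open>u\<close> by
    \<open>fst v\<close>.\<close>
  define N where "N = pweight u + fst v"
  let ?F = "pleth G Y L_series" and ?W = "{1..N} \<times> C" and ?q = "\<lambda>w. mobius_coeff G v w / Z w"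
  have "mps_coeff (theta v ?F) u = mps_coeff (theta v (\<Sum>m\<in>M N. t m)) u"
    unfolding mps_coeff_theta by (subst (1 2) pleth_truncate[of _ N]) (simp_all add: N_def pweight_add)
  also have "theta v (\<Sum>m\<in>M N. t m) = (\<Sum>m\<in>M N. \<Sum>w\<in>keys m.
      mps_const (?q w) * t (m - single w 1))"
    unfolding theta_sum by (rule sum.cong[OF refl], rule theta_term) simp
  also have "\<dots> = (\<Sum>(m, w)\<in>Sigma (M N) keys. mps_const (?q w) * t (m - single w 1))"
    by (rule sum.Sigma) (use finite_monomials_bounded_weight[OF finC] in auto)
  also have "\<dots> = (\<Sum>(w, m)\<in>Sigma ?W (\<lambda>w. M (N - fst w)). mps_const (?q w) * t m)"
  proof -
    let ?A = "Sigma (M N) keys" and ?B = "Sigma ?W (\<lambda>w. M (N - fst w))"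
      and ?h = "\<lambda>(w, m). (m + single w (1 :: nat), w)"
    have "?h ` ?B = ?A"
    proof (intro equalityI subsetI)
      fix p assume "p \<in> ?h ` ?B"
      then show "p \<in> ?A" by (auto simp: keys_add_single_one pweight_add simp del: One_nat_def)
    next
      fix p assume p: "p \<in> ?A"
      obtain m w where mw: "p = (m, w)" by (cases p)
      with p have adm: "keys m \<subseteq> {1..} \<times> C" and wt: "pweight m \<le> N"
        and w: "w \<in> keys m" by auto
      define m' where "m' = m - single w 1"
      have m: "m' + single w 1 = m" using w
        by (intro poly_mapping_eqI) (auto simp: m'_def lookup_add lookup_minus lookup_single when_def in_keys_iff)
      have "keys m' \<subseteq> {1..} \<times> C" using adm unfolding m[symmetric] keys_add_single_one by simp
      moreover have "pweight m' + fst w \<le> N" using wt unfolding m[symmetric] pweight_add by simp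
      ultimately have "(w, m') \<in> ?B" using adm w by auto
      moreover have "p = ?h (w, m')" by (simp only: mw prod.case m)
      ultimately show "p \<in> ?h ` ?B" by (rule rev_image_eqI)
    qed
    moreover have "inj_on ?h ?B" by (auto simp: inj_on_def)
    ultimately show ?thesis
      by (metis (no_types, lifting) sum.reindex_cong[of ?h ?B ?A "\<lambda>(m, w). mps_const (?q w) * t (m - single w 1)"
          "\<lambda>(w, m). mps_const (?q w) * t m"] case_prod_beta add_diff_cancel_right' fst_conv snd_conv)
  qed
  also have "\<dots> = (\<Sum>w\<in>?W. \<Sum>m\<in>M (N - fst w). mps_const (?q w) * t m)"
    by (rule sum.Sigma[symmetric]) (use finite_monomials_bounded_weight[OF finC] finC in auto)
  also have "mps_coeff \<dots> u = (\<Sum>w\<in>?W. ?q w * mps_coeff (\<Sum>m\<in>M (N - fst w). t m) u)"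
    by (simp add: mps_coeff_sum sum_distrib_left)
  also have "\<dots> = (\<Sum>w\<in>?W. ?q w * mps_coeff ?F u)"
  proof (rule sum.cong[OF refl])
    fix w assume "w \<in> ?W"
    show "?q w * mps_coeff (\<Sum>m\<in>M (N - fst w). t m) u = ?q w * mps_coeff ?F u"
    \<comment> \<open>A nonzero coefficient forces \<open>fst w \<le> fst v\<close>, so the
      truncation at \<open>N - fst w\<close> still reaches the degree of \<open>u\<close>.\<close>
    proof (cases "mobius_coeff G v w = 0")
      case False
      then have "fst w \<le> fst v" by (auto simp: mobius_coeff_def Let_def dvd_imp_le split: if_splits)
      then show ?thesis by (subst pleth_truncate[of u "N - fst w"]) (simp_all add: N_def)
    qed simp
  qed
  also have "\<dots> = (\<Sum>w\<in>?W. ?q w) * mps_coeff ?F u"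
    by (simp add: sum_distrib_right)
  also have "(\<Sum>w\<in>?W. ?q w) = (\<Sum>w\<in>{1..fst v} \<times> C. ?q w)"
  proof (rule sum.mono_neutral_right)
    show "\<forall>w\<in>?W - {1..fst v} \<times> C. ?q w = 0"
      by (auto simp: mobius_coeff_def Let_def dvd_imp_le)
  qed (use finC in \<open>auto simp: N_def\<close>)
  finally show "mps_coeff (theta v ?F) u = mps_coeff (mps_const (\<Sum>w\<in>{1..fst v} \<times> C. ?q w) * ?F) u"
    by simp
qed

lemma mps_coeff_pleth_L_0: "mps_coeff (pleth G Y L_series) 0 = 1"
proof -
  have "M 0 = {0}"
  proof (intro equalityI subsetI)
    fix m assume m: "m \<in> M 0"
    have "keys m = {}"
    proof (rule equals0I)
      fix v assume v: "v \<in> keys m"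
      then have "fst v * lookup m v \<le> pweight m"
        unfolding pweight_def by (intro member_le_sum) auto
      moreover have "fst v \<noteq> 0" using m v by auto
      moreover have "lookup m v \<noteq> 0" using v by (simp add: in_keys_iff)
      ultimately show False using m by simp
    qed
    then show "m \<in> {0}" by simp
  qed simp
  then have "mps_coeff (pleth G Y L_series) 0 = mps_coeff (t 0) 0"
    by (subst pleth_truncate[of 0 0]) simp_all
  also have "\<dots> = 1" using coeffY[of 0] by (simp add: mps_coeff_1)
  finally show ?thesis .
qed

end

section \<open>Equivariant Euler characteristics\<close>

context fin_poset
begin

section \<open>Contracting homotopies and the Hopf trace formula\<close>

definition delta :: "'p set \<Rightarrow> 'p set \<Rightarrow> rat" where
  "delta C E = (if E = C then 1 else 0)"

definition lift :: "'p set \<Rightarrow> ('p set \<Rightarrow> 'p set \<Rightarrow> rat) \<Rightarrow> ('p set \<Rightarrow> rat) \<Rightarrow> 'p set \<Rightarrow> rat" where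
  "lift V s c Q = (\<Sum>C\<in>Pow V. c C * s C Q)"

lemma finite_faces: "V \<subseteq> A \<Longrightarrow> finite (faces V k)"
  by (rule finite_subset[of _ "Pow V"]) (auto simp: faces_def intro: finite_subset[OF _ fin])

lemma finite_Pow_sub: "V \<subseteq> A \<Longrightarrow> finite (Pow V)"
  using fin by (auto intro: finite_subset)

lemma delta_chains: "C \<in> faces V k \<Longrightarrow> delta C \<in> chains V k"
  by (auto simp: chains_def delta_def)

lemma bd_delta_chains:
  assumes "C \<in> faces V (Suc k)" "V \<subseteq> A"
  shows "bd (delta C) \<in> chains V k"
  using assms by (intro bd_chains delta_chains)

lemma bd_delta_0: "C \<in> faces V 0 \<Longrightarrow> V \<subseteq> A \<Longrightarrow> bd (delta C) = (\<lambda>_. 0)"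
proof -
  assume C: "C \<in> faces V 0" "V \<subseteq> A"
  have "finite C" using C by (rule faces_finite)
  then have "C = {}" using C(1) by (simp add: faces_def)
  then show ?thesis by (auto simp: fun_eq_iff bd_def delta_def)
qed

lemma bd_sum: "bd (\<lambda>Q. \<Sum>i\<in>I. a i * f i Q) E = (\<Sum>i\<in>I. a i * bd (f i) E)"
  unfolding bd_def sum_distrib_left by (subst sum.swap) (simp add: mult.left_commute)

lemma chains_faces_sum:
  assumes "c \<in> chains V k" "V \<subseteq> A"
  shows "(\<Sum>C\<in>Pow V. c C * f C) = (\<Sum>C\<in>faces V k. c C * f C)"
  by (rule sum.mono_neutral_right[OF finite_Pow_sub[OF assms(2)]])
    (use chainsD[OF assms(1)] in \<open>auto simp: faces_def\<close>)

lemma chain_expand: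
  assumes "c \<in> chains V k" "V \<subseteq> A"
  shows "c Q = (\<Sum>C\<in>faces V k. c C * delta C Q)"
proof -
  have "(\<Sum>C\<in>faces V k. c C * delta C Q) = (\<Sum>C\<in>faces V k. if Q = C then c C else 0)"
    by (rule sum.cong) (auto simp: delta_def)
  also have "\<dots> = c Q"
    using finite_faces[OF assms(2)] chainsD[OF assms(1)] by (subst sum.delta') auto
  finally show ?thesis by simp
qed

lemma bd_expand:
  assumes "c \<in> chains V k" "V \<subseteq> A"
  shows "bd c E = (\<Sum>C\<in>faces V k. c C * bd (delta C) E)"
proof -
  have "c = (\<lambda>Q. \<Sum>C\<in>faces V k. c C * delta C Q)" by (rule ext) (rule chain_expand[OF assms])
  then have "bd c E = bd (\<lambda>Q. \<Sum>C\<in>faces V k. c C * delta C Q) E" by (rule arg_cong)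
  then show ?thesis by (simp only: bd_sum)
qed

text \<open>In the usual notation bd s + s bd = id on faces with \<open>k\<close> vertices, where
  \<open>lift V s\<close> is the linear extension of \<open>s\<close>.\<close>

definition contracts :: "'p set \<Rightarrow> ('p set \<Rightarrow> 'p set \<Rightarrow> rat) \<Rightarrow> nat \<Rightarrow> bool" where
  "contracts V s k \<longleftrightarrow> (\<forall>C\<in>faces V k. s C \<in> chains V (Suc k) \<and>
     (\<forall>Q. bd (s C) Q = delta C Q - lift V s (bd (delta C)) Q))"

lemma lift_chains:
  assumes "contracts V s k" "c \<in> chains V k" "V \<subseteq> A"
  shows "lift V s c \<in> chains V (Suc k)"
  unfolding chains_def
proof (intro CollectI allI impI)
  fix Q assume "lift V s c Q \<noteq> 0"
  then obtain C where "c C * s C Q \<noteq> 0" unfolding lift_def by (meson sum.neutral)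
  then have "C \<in> faces V k" "s C Q \<noteq> 0" using chainsD[OF assms(2)] by auto
  then show "Q \<in> faces V (Suc k)" using assms(1) chainsD unfolding contracts_def by blast
qed

lemma lift_bd_sum:
  assumes "c \<in> chains V k" "V \<subseteq> A"
  shows "(\<Sum>C\<in>faces V k. c C * lift V s (bd (delta C)) Q) = lift V s (bd c) Q"
proof -
  have "lift V s (bd c) Q = (\<Sum>E\<in>Pow V. (\<Sum>C\<in>faces V k. c C * bd (delta C) E) * s E Q)"
    unfolding lift_def bd_expand[OF assms] ..
  also have "\<dots> = (\<Sum>C\<in>faces V k. c C * lift V s (bd (delta C)) Q)"
    unfolding lift_def sum_distrib_left sum_distrib_right by (subst sum.swap) (simp only: mult.assoc)
  finally show ?thesis by simp
qed

lemma bd_lift: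
  assumes "contracts V s k" "c \<in> chains V k" "V \<subseteq> A"
  shows "bd (lift V s c) Q = c Q - lift V s (bd c) Q"
proof -
  have "lift V s c = (\<lambda>Q. \<Sum>C\<in>faces V k. c C * s C Q)"
    unfolding lift_def using chains_faces_sum[OF assms(2,3)] by auto
  then have "bd (lift V s c) Q = (\<Sum>C\<in>faces V k. c C * bd (s C) Q)" by (simp only: bd_sum)
  also have "\<dots> = (\<Sum>C\<in>faces V k. c C * delta C Q - c C * lift V s (bd (delta C)) Q)"
    by (rule sum.cong) (use assms(1) in \<open>auto simp: contracts_def right_diff_distrib\<close>)
  also have "\<dots> = c Q - lift V s (bd c) Q"
    unfolding sum_subtractf lift_bd_sum[OF assms(2,3)] chain_expand[OF assms(2,3), symmetric] ..
  finally show ?thesis .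
qed

text \<open>The operator id - s bd. It fixes every cycle, and its values are cycles as soon as
  \<open>s\<close> contracts the lower degrees.\<close>

definition proj :: "'p set \<Rightarrow> ('p set \<Rightarrow> 'p set \<Rightarrow> rat) \<Rightarrow> 'p set \<Rightarrow> 'p set \<Rightarrow> rat" where
  "proj V s C Q = delta C Q - lift V s (bd (delta C)) Q"

lemma proj_cycle:
  assumes s: "\<And>j. j < k \<Longrightarrow> contracts V s j" and C: "C \<in> faces V k" and V: "V \<subseteq> A"
  shows "proj V s C \<in> chains V k" "bd (proj V s C) = (\<lambda>_. 0)"
proof -
  have "lift V s (bd (delta C)) \<in> chains V k \<and> bd (lift V s (bd (delta C))) = bd (delta C)"
  proof (cases k)
    case 0
    then have "bd (delta C) = (\<lambda>_. 0)" using bd_delta_0 C V by blast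
    then show ?thesis by (simp add: lift_def bd_def chains_def fun_eq_iff)
  next
    case (Suc j)
    have c: "bd (delta C) \<in> chains V j" using C V Suc by (intro bd_delta_chains) auto
    have "bd (bd (delta C)) = (\<lambda>_. 0)" using delta_chains[OF C] V by (rule bd_bd)
    then have "bd (lift V s (bd (delta C))) Q = bd (delta C) Q" for Q
      using bd_lift[OF s c V, of Q] Suc by (simp add: lift_def)
    then show ?thesis using lift_chains[OF s c V] Suc by auto
  qed
  then have l: "lift V s (bd (delta C)) \<in> chains V k" "bd (lift V s (bd (delta C))) = bd (delta C)"
    by auto
  have p: "proj V s C = (\<lambda>Q. delta C Q - lift V s (bd (delta C)) Q)" by (auto simp: proj_def)
  show "bd (proj V s C) = (\<lambda>_. 0)" unfolding p bd_diff l by simp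
  show "proj V s C \<in> chains V k"
    unfolding chains_def
  proof (intro CollectI allI impI)
    fix Q assume "proj V s C Q \<noteq> 0"
    then have "delta C Q \<noteq> 0 \<or> lift V s (bd (delta C)) Q \<noteq> 0" by (auto simp: proj_def)
    then show "Q \<in> faces V k" using chainsD[OF l(1)] chainsD[OF delta_chains[OF C]] by blast
  qed
qed

text \<open>The homotopy is built degree by degree: \<open>proj V s C\<close> is a cycle by the
  degrees already treated, and acyclicity supplies a chain with this boundary as the value at
  \<open>C\<close>.\<close>

lemma contraction_exists:
  assumes V: "V \<subseteq> A" and ac: "\<And>i. i < N \<Longrightarrow> acyclic_at V i"
  shows "\<exists>s. \<forall>j<N. contracts V s j"
  using ac
proof (induction N)
  case 0
  then show ?case by auto
next
  case (Suc k)
  then obtain s where s: "\<And>j. j < k \<Longrightarrow> contracts V s j" by auto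
  have "\<exists>w\<in>chains V (Suc k). bd w = proj V s C" if "C \<in> faces V k" for C
    using Suc.prems[of k] proj_cycle[OF s that V] unfolding acyclic_at_def by blast
  then obtain w where w: "\<And>C. C \<in> faces V k \<Longrightarrow> w C \<in> chains V (Suc k) \<and> bd (w C) = proj V s C"
    by metis
  \<comment> \<open>A face has only one number of vertices, so the new values leave the lower
    degrees as they were.\<close>
  define s' where "s' C = (if C \<in> faces V k then w C else s C)" for C
  have old: "s' C = s C" if "C \<in> faces V j" "j \<noteq> k" for C j
    using that by (auto simp: s'_def faces_def)
  have lift_old: "lift V s' (bd (delta C)) Q = lift V s (bd (delta C)) Q" if C: "C \<in> faces V j" "j \<le> k" for C j Q
  proof (cases j)
    case 0
    then have "bd (delta C) = (\<lambda>_. 0)" using bd_delta_0 C(1) V by blast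
    then show ?thesis by (simp add: lift_def)
  next
    case (Suc i)
    have c: "bd (delta C) \<in> chains V i" using C V Suc by (intro bd_delta_chains) auto
    show ?thesis unfolding lift_def
    proof (rule sum.cong[OF refl])
      fix E assume "E \<in> Pow V"
      show "bd (delta C) E * s' E Q = bd (delta C) E * s E Q"
      proof (cases "bd (delta C) E = 0")
        case False
        then have "E \<in> faces V i" using c chainsD by blast
        then have "s' E = s E" using C(2) Suc by (intro old) auto
        then show ?thesis by simp
      qed simp
    qed
  qed
  have "contracts V s' j" if "j < Suc k" for j
  proof (cases "j = k")
    case True
    show ?thesis unfolding contracts_def True
    proof (intro ballI conjI allI)
      fix C Q assume C: "C \<in> faces V k"
      then have "s' C = w C" by (simp add: s'_def)
      then show "s' C \<in> chains V (Suc k)"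
        "bd (s' C) Q = delta C Q - lift V s' (bd (delta C)) Q"
        using w[OF C] lift_old[OF C order_refl] by (auto simp: proj_def)
    qed
  next
    case False
    then have "j < k" using that by simp
    show ?thesis unfolding contracts_def
    proof (intro ballI conjI allI)
      fix C Q assume C: "C \<in> faces V j"
      then have "s' C = s C" using old False by blast
      then show "s' C \<in> chains V (Suc j)"
        "bd (s' C) Q = delta C Q - lift V s' (bd (delta C)) Q"
        using s[OF \<open>j < k\<close>] C lift_old[OF C] \<open>j < k\<close> unfolding contracts_def by auto
    qed
  qed
  then show ?case by blast
qed

lemma proj_expand:
  assumes z: "z \<in> chains V k" "bd z = (\<lambda>_. 0)" and V: "V \<subseteq> A"
  shows "z Q = (\<Sum>C\<in>faces V k. z C * proj V s C Q)"
proof -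
  have "(\<Sum>C\<in>faces V k. z C * proj V s C Q) = z Q - lift V s (bd z) Q"
    unfolding proj_def right_diff_distrib sum_subtractf lift_bd_sum[OF z(1) V]
      chain_expand[OF z(1) V, symmetric] ..
  also have "lift V s (bd z) Q = 0" by (simp add: z(2) lift_def)
  finally show ?thesis by simp
qed

definition automorphic :: "'p set \<Rightarrow> ('p \<Rightarrow> 'p) \<Rightarrow> bool" where
  "automorphic V \<psi> \<longleftrightarrow> bij_betw \<psi> V V \<and> (\<forall>x\<in>V. \<forall>y\<in>V. le (\<psi> x) (\<psi> y) \<longleftrightarrow> le x y)"

lemma automorphic_less:
  "automorphic V \<psi> \<Longrightarrow> x \<in> V \<Longrightarrow> y \<in> V \<Longrightarrow> less (\<psi> x) (\<psi> y) \<longleftrightarrow> less x y"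
  unfolding automorphic_def less_def by (metis bij_betw_inv_into_left)

lemma automorphic_faces:
  assumes "automorphic V \<psi>" "C \<in> faces V k"
  shows "\<psi> ` C \<in> faces V k"
proof -
  have s: "C \<subseteq> V" "\<And>x y. x \<in> C \<Longrightarrow> y \<in> C \<Longrightarrow> comparable x y" "card C = k"
    using assms(2) by (auto simp: faces_def)
  have bij: "bij_betw \<psi> V V" using assms(1) by (simp add: automorphic_def)
  have "inj_on \<psi> C" using bij s(1) by (metis bij_betw_def inj_on_subset)
  then have "card (\<psi> ` C) = k" using s(3) by (simp add: card_image)
  moreover have "\<psi> ` C \<subseteq> V" using bij s(1) by (auto simp: bij_betw_def)
  moreover have "comparable (\<psi> x) (\<psi> y)" if "x \<in> C" "y \<in> C" for x y
  proof -
    have "x \<in> V" "y \<in> V" using that s(1) by auto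
    then show ?thesis using s(2)[OF that] assms(1) unfolding automorphic_def comparable_def by blast
  qed
  ultimately show ?thesis by (auto simp: faces_def)
qed

lemma automorphic_inj: "automorphic V \<psi> \<Longrightarrow> C \<subseteq> V \<Longrightarrow> E \<subseteq> V \<Longrightarrow> \<psi> ` C = \<psi> ` E \<longleftrightarrow> C = E"
  unfolding automorphic_def bij_betw_def by (metis inj_on_image_eq_iff)

lemma automorphic_faces_bij:
  assumes "automorphic V \<psi>" "V \<subseteq> A"
  shows "bij_betw ((`) \<psi>) (faces V k) (faces V k)"
proof -
  have inj: "inj_on ((`) \<psi>) (faces V k)"
    using automorphic_inj[OF assms(1)] by (auto simp: inj_on_def faces_def)
  moreover have "(`) \<psi> ` faces V k \<subseteq> faces V k" using automorphic_faces[OF assms(1)] by auto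
  ultimately show ?thesis
    using finite_faces[OF assms(2)] endo_inj_surj by (metis bij_betw_def)
qed

lemma eps_automorphic:
  assumes \<psi>: "automorphic V \<psi>" and E: "E \<subseteq> V" and y: "y \<in> V"
  shows "eps (\<psi> ` E) (\<psi> y) = eps E y"
proof -
  have "{z \<in> \<psi> ` E. less z (\<psi> y)} = \<psi> ` {z \<in> E. less z y}"
    using automorphic_less[OF \<psi> _ y] E by auto
  moreover have "inj_on \<psi> {z \<in> E. less z y}"
    using \<psi> E unfolding automorphic_def bij_betw_def by (auto intro: inj_on_subset)
  ultimately show ?thesis by (simp add: eps_def card_image)
qed

lemma bd_supported:
  assumes "\<And>C. c C \<noteq> 0 \<Longrightarrow> C \<subseteq> V" "V \<subseteq> A"
  shows "bd c E = (\<Sum>x\<in>V - E. eps E x * c (insert x E))"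
  unfolding bd_def by (rule sum.mono_neutral_right) (use assms fin in auto)

lemma bd_not_sub:
  assumes "\<And>C. c C \<noteq> 0 \<Longrightarrow> C \<subseteq> V" "\<not> E \<subseteq> V"
  shows "bd c E = 0"
  unfolding bd_def by (rule sum.neutral) (use assms in auto)

text \<open>\<open>d\<close> is the pullback of \<open>c\<close> along \<open>\<psi>\<close>, cut
  off outside \<open>V\<close>, where nothing is known about \<open>\<psi>\<close>.\<close>

lemma bd_automorphic:
  assumes \<psi>: "automorphic V \<psi>" and V: "V \<subseteq> A"
    and c: "\<And>C. c C \<noteq> 0 \<Longrightarrow> C \<subseteq> V" and d: "\<And>C. d C = (if C \<subseteq> V then c (\<psi> ` C) else 0)"
  shows "bd d E = (if E \<subseteq> V then bd c (\<psi> ` E) else 0)"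
proof (cases "E \<subseteq> V")
  case True
  have bij: "inj_on \<psi> V" "\<psi> ` V = V" using \<psi> by (auto simp: automorphic_def bij_betw_def)
  have "V - \<psi> ` E = \<psi> ` (V - E)"
    using bij True by (metis inj_on_image_set_diff order_refl Diff_subset)
  then have "bd c (\<psi> ` E) = (\<Sum>x\<in>\<psi> ` (V - E). eps (\<psi> ` E) x * c (insert x (\<psi> ` E)))"
    using bd_supported[where c = c and V = V and E = "\<psi> ` E"] c V by simp
  also have "\<dots> = (\<Sum>y\<in>V - E. eps (\<psi> ` E) (\<psi> y) * c (insert (\<psi> y) (\<psi> ` E)))"
    using bij by (subst sum.reindex) (auto intro: inj_on_subset)
  also have "\<dots> = (\<Sum>y\<in>V - E. eps E y * d (insert y E))"
    using True by (intro sum.cong) (simp_all add: d eps_automorphic[OF \<psi> True])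
  also have "\<dots> = bd d E" by (rule bd_supported[OF _ V, symmetric]) (simp add: d split: if_splits)
  finally show ?thesis using True by simp
next
  case False
  then show ?thesis using bd_not_sub[of d V E] by (simp add: d split: if_splits)
qed

lemma incidence_automorphic:
  assumes \<psi>: "automorphic V \<psi>" and V: "V \<subseteq> A" and C: "C \<subseteq> V" and E: "E \<subseteq> V"
  shows "bd (delta (\<psi> ` C)) (\<psi> ` E) = bd (delta C) E"
proof -
  have "\<psi> ` C \<subseteq> V" using \<psi> C by (auto simp: automorphic_def bij_betw_def)
  moreover have "delta C Q = (if Q \<subseteq> V then delta (\<psi> ` C) (\<psi> ` Q) else 0)" for Q
    using automorphic_inj[OF \<psi> _ C, of Q] C by (auto simp: delta_def)
  ultimately show ?thesis
    using bd_automorphic[OF \<psi> V, of "delta (\<psi> ` C)" "delta C" E] E by (simp add: delta_def split: if_splits)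
qed

text \<open>The trace of \<open>\<psi>\<close> against s bd on faces with \<open>k + 1\<close>
  vertices equals its trace against bd s on faces with \<open>k\<close> vertices, by cyclicity of
  the trace and because \<open>bd\<close> commutes with \<open>\<psi>\<close>. Now bd s = id - s bd
  is the projection one degree lower, so each trace is the number of fixed faces minus the previous
  trace. The homotopy itself is not chosen equivariantly.\<close>

lemma trace_proj:
  assumes V: "V \<subseteq> A" and s: "\<And>j. j < N \<Longrightarrow> contracts V s j" and \<psi>: "automorphic V \<psi>"
  shows "(\<Sum>C\<in>faces V N. proj V s C (\<psi> ` C)) =
    (-1) ^ N * (\<Sum>k\<le>N. (-1) ^ k * of_nat (card {C \<in> faces V k. \<psi> ` C = C}))"
  using s
proof (induction N)
  case 0
  have "proj V s C (\<psi> ` C) = (if \<psi> ` C = C then 1 else 0)" if "C \<in> faces V 0" for C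
    using bd_delta_0[OF that V] by (simp add: proj_def lift_def delta_def)
  then show ?case using finite_faces[OF V, of 0] by (simp add: sum.If_cases Int_def)
next
  case (Suc k)
  let ?F = "faces V k" and ?F' = "faces V (Suc k)"
  have sub: "C \<subseteq> V" if "C \<in> faces V j" for C j using that by (auto simp: faces_def)
  have ck: "contracts V s k" using Suc.prems by simp
  have "(\<Sum>C\<in>?F'. lift V s (bd (delta C)) (\<psi> ` C)) =
      (\<Sum>C\<in>?F'. \<Sum>E\<in>?F. bd (delta C) E * s E (\<psi> ` C))"
    unfolding lift_def by (rule sum.cong[OF refl], rule chains_faces_sum[OF bd_delta_chains[OF _ V] V])
  also have "\<dots> = (\<Sum>E\<in>?F. \<Sum>C\<in>?F'. bd (delta C) E * s E (\<psi> ` C))" by (rule sum.swap)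
  also have "\<dots> = (\<Sum>E\<in>?F. proj V s E (\<psi> ` E))"
  proof (rule sum.cong[OF refl])
    fix E assume E: "E \<in> ?F"
    have "proj V s E (\<psi> ` E) = bd (s E) (\<psi> ` E)"
      using ck E unfolding contracts_def proj_def by simp
    also have "\<dots> = (\<Sum>C\<in>?F'. s E C * bd (delta C) (\<psi> ` E))"
      using ck E V unfolding contracts_def by (intro bd_expand) auto
    also have "\<dots> = (\<Sum>C\<in>?F'. s E (\<psi> ` C) * bd (delta (\<psi> ` C)) (\<psi> ` E))"
      by (rule sum.reindex_bij_betw[OF automorphic_faces_bij[OF \<psi> V], symmetric])
    also have "\<dots> = (\<Sum>C\<in>?F'. bd (delta C) E * s E (\<psi> ` C))"
      by (rule sum.cong[OF refl]) (simp add: incidence_automorphic[OF \<psi> V sub sub[OF E]] mult.commute)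
    finally show "(\<Sum>C\<in>?F'. bd (delta C) E * s E (\<psi> ` C)) = proj V s E (\<psi> ` E)" by (rule sym)
  qed
  also have "\<dots> = (-1) ^ k * (\<Sum>k\<le>k. (-1) ^ k * of_nat (card {C \<in> faces V k. \<psi> ` C = C}))"
    using Suc by simp
  finally have T: "(\<Sum>C\<in>?F'. lift V s (bd (delta C)) (\<psi> ` C)) = \<dots>" .
  have "(\<Sum>C\<in>?F'. delta C (\<psi> ` C)) = of_nat (card {C \<in> ?F'. \<psi> ` C = C})"
    using finite_faces[OF V, of "Suc k"] by (simp add: delta_def sum.If_cases Int_def)
  then have "(\<Sum>C\<in>?F'. proj V s C (\<psi> ` C)) = of_nat (card {C \<in> ?F'. \<psi> ` C = C}) -
      (-1) ^ k * (\<Sum>k\<le>k. (-1) ^ k * of_nat (card {C \<in> faces V k. \<psi> ` C = C}))"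
    unfolding proj_def sum_subtractf T by simp
  also have "\<dots> = (-1) ^ Suc k * (\<Sum>k\<le>Suc k. (-1) ^ k * of_nat (card {C \<in> faces V k. \<psi> ` C = C}))"
  proof -
    have "(-1 :: rat) ^ k * (-1) ^ k = 1" by (simp add: power_mult_distrib[symmetric])
    then have "b - (-1) ^ k * a = (-1) ^ Suc k * (a + (-1) ^ Suc k * b)" for a b :: rat
      by (simp add: algebra_simps mult.assoc[symmetric])
    then show ?thesis unfolding sum.atMost_Suc .
  qed
  finally show ?case .
qed

section \<open>Euler characteristics of order complexes and Hall's theorem\<close>

definition all_faces :: "'p set \<Rightarrow> 'p set set" where
  "all_faces Y = {C. C \<subseteq> Y \<and> (\<forall>x\<in>C. \<forall>y\<in>C. comparable x y)}"

text \<open>The reduced Euler characteristic with the opposite sign: the empty face counts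
  \<open>1\<close>, while a face with \<open>k\<close> vertices has degree
  \<open>k - 1\<close>.\<close>

definition euler :: "'p set \<Rightarrow> rat" where
  "euler Y = (\<Sum>C\<in>all_faces Y. (-1) ^ card C)"

lemma finite_all_faces: "V \<subseteq> A \<Longrightarrow> finite (all_faces V)"
  by (rule finite_subset[of _ "Pow V"]) (auto simp: all_faces_def intro: finite_subset[OF _ fin])

text \<open>An automorphism preserving the chain preserves the number of its elements below a given
  one, and this number separates the elements of a finite chain.\<close>

lemma automorphic_fixed_chain:
  assumes \<psi>: "automorphic V \<psi>" and V: "V \<subseteq> A" and C: "C \<in> faces V k" and fixed: "\<psi> ` C = C" and x: "x \<in> C"
  shows "\<psi> x = x"
proof (rule ccontr)
  assume ne: "\<psi> x \<noteq> x"
  have CV: "C \<subseteq> V" using C by (auto simp: faces_def)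
  have finC: "finite C" using C V by (rule faces_finite)
  let ?d = "\<lambda>x. {y \<in> C. less y x}"
  have less: "card (?d u) < card (?d v)" if "u \<in> C" "v \<in> C" "less u v" for u v
  proof (rule psubset_card_mono)
    show "?d u \<subset> ?d v"
    proof
      have "less y v" if "y \<in> C" "less y u" for y
        using po_trans[of y u v] po_antisym[of u v] that \<open>u \<in> C\<close> \<open>v \<in> C\<close> \<open>less u v\<close> CV V
        unfolding less_def by blast
      then show "?d u \<subseteq> ?d v" by auto
      have "u \<in> ?d v" "u \<notin> ?d u" using that by (auto simp: less_def)
      then show "?d u \<noteq> ?d v" by blast
    qed
  qed (use finC in simp)
  have "?d (\<psi> x) = \<psi> ` ?d x"
  proof -
    have "?d (\<psi> x) = {y \<in> \<psi> ` C. less y (\<psi> x)}" by (simp only: fixed)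
    also have "\<dots> = \<psi> ` ?d x" using automorphic_less[OF \<psi>] CV x by auto
    finally show ?thesis .
  qed
  moreover have "inj_on \<psi> (?d x)"
    using \<psi> CV unfolding automorphic_def bij_betw_def by (auto intro: inj_on_subset)
  ultimately have eq: "card (?d (\<psi> x)) = card (?d x)" by (simp add: card_image)
  have "\<psi> x \<in> C" using fixed x by auto
  moreover from this have "comparable x (\<psi> x)" using C x by (auto simp: faces_def)
  ultimately show False using less[of x "\<psi> x"] less[of "\<psi> x" x] eq ne x
    by (auto simp: comparable_def less_def)
qed

text \<open>A face that is fixed as a set is fixed vertex by vertex, so the alternating count of
  fixed faces is a count of the chains of fixed points.\<close>

lemma trace_proj_euler:
  assumes V: "V \<subseteq> A" and s: "\<And>j. j < N \<Longrightarrow> contracts V s j" and \<psi>: "automorphic V \<psi>"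
    and top: "\<And>k. N < k \<Longrightarrow> faces V k = {}"
  shows "(\<Sum>C\<in>faces V N. proj V s C (\<psi> ` C)) = (-1) ^ N * euler {x \<in> V. \<psi> x = x}"
proof -
  let ?W = "{x \<in> V. \<psi> x = x}" and ?X = "\<lambda>k. {C \<in> faces V k. \<psi> ` C = C}"
  have W: "?W \<subseteq> A" using V by auto
  have "?X k = {C \<in> all_faces ?W. card C = k}" for k
  proof (intro equalityI subsetI)
    fix C assume "C \<in> ?X k"
    then show "C \<in> {C \<in> all_faces ?W. card C = k}"
      using automorphic_fixed_chain[OF \<psi> V, of C k] by (auto simp: faces_def all_faces_def)
  next
    fix C assume "C \<in> {C \<in> all_faces ?W. card C = k}"
    then have "C \<subseteq> ?W" "C \<in> faces V k" by (auto simp: faces_def all_faces_def)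
    moreover from this have "\<psi> ` C = C" by force
    ultimately show "C \<in> ?X k" by simp
  qed
  then have "(\<Sum>k\<le>N. (-1) ^ k * of_nat (card (?X k))) =
      (\<Sum>k\<le>N. \<Sum>C\<in>{C \<in> all_faces ?W. card C = k}. (-1 :: rat) ^ card C)"
    by (intro sum.cong) auto
  also have "\<dots> = euler ?W"
    unfolding euler_def
  proof (rule sum.group)
    show "card ` all_faces ?W \<subseteq> {..N}"
    proof
      fix k assume "k \<in> card ` all_faces ?W"
      then have "faces V k \<noteq> {}" by (auto simp: faces_def all_faces_def)
      then show "k \<in> {..N}" using top by (metis atMost_iff not_le)
    qed
  qed (use finite_all_faces[OF W] in auto)
  finally show ?thesis using trace_proj[OF V s \<psi>] by simp
qed

text \<open>Philip Hall's formula, with the values \<open>\<mu>(y, t)\<close> replaced by any solution of their recursion.\<close>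

lemma hall:
  assumes t: "t \<in> A" "\<And>y. y \<in> A \<Longrightarrow> le y t" and w: "w t = (1 :: rat)"
    and rec: "\<And>y. y \<in> A \<Longrightarrow> y \<noteq> t \<Longrightarrow> (\<Sum>z\<in>{z \<in> A. le y z}. w z) = 0"
    and y: "y \<in> A" "y \<noteq> t"
  shows "w y = - euler {z \<in> A. less y z \<and> z \<noteq> t}"
  using y
proof (induction "card {z \<in> A. less y z \<and> z \<noteq> t}" arbitrary: y rule: less_induct)
  case less
  let ?a = "\<lambda>y. {z \<in> A. less y z \<and> z \<noteq> t}"
  have fina: "finite (?a u)" for u using fin by auto
  have aA: "?a u \<subseteq> A" for u by auto
  have ltr: "less u v" if "less u x" "less x v" "u \<in> A" "x \<in> A" "v \<in> A" for u x v
    using that po_trans[of u x v] po_antisym[of x v] unfolding less_def by blast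
  have mono: "?a m \<subset> ?a y" if "m \<in> ?a y" for m
  proof
    show "?a m \<subseteq> ?a y" using ltr[of y m] that less.prems by auto
    have "m \<notin> ?a m" by (auto simp: less_def)
    then show "?a m \<noteq> ?a y" using that by blast
  qed
  have IH: "w m = - euler (?a m)" if "m \<in> ?a y" for m
    using that mono[OF that] fina by (intro less.hyps psubset_card_mono) auto
  \<comment> \<open>A nonempty chain above \<open>y\<close> consists of its least element
    \<open>m\<close> and a chain above \<open>m\<close>. The additional vertex contributes the sign
    that turns the induction hypothesis into \<open>w m\<close>.\<close>
  let ?S = "Sigma (?a y) (\<lambda>m. all_faces (?a m))" and ?h = "\<lambda>(m, C). insert m C"
  have notin: "m \<notin> C" if "C \<in> all_faces (?a m)" for m C using that by (auto simp: all_faces_def less_def)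
  have inj: "inj_on ?h ?S"
  proof (rule inj_onI, clarify)
    fix m C m' C' assume m: "m \<in> A" "m' \<in> A" and C: "C \<in> all_faces (?a m)" "C' \<in> all_faces (?a m')"
      and eq: "insert m C = insert m' C'"
    have "m = m'"
    proof (rule ccontr)
      assume ne: "m \<noteq> m'"
      then have "m \<in> C'" "m' \<in> C" using eq by auto
      then have "less m' m" "less m m'" using C by (auto simp: all_faces_def)
      then show False using po_antisym m ne by (auto simp: less_def)
    qed
    moreover from this have "C = C'" using eq notin[OF C(1)] notin[OF C(2)] by auto
    ultimately show "m = m' \<and> C = C'" by simp
  qed
  have img: "?h ` ?S = all_faces (?a y) - {{}}"
  proof (intro equalityI subsetI)
    fix Q assume "Q \<in> ?h ` ?S"
    then obtain m C where m: "m \<in> ?a y" and C: "C \<in> all_faces (?a m)" and Q: "Q = insert m C" by auto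
    have "comparable m u" if "u \<in> C" for u using that C by (auto simp: all_faces_def less_def comparable_def)
    moreover have "comparable m m" using m po_refl by (auto simp: comparable_def)
    moreover have "C \<subseteq> ?a y" using C mono[OF m] by (auto simp: all_faces_def)
    ultimately show "Q \<in> all_faces (?a y) - {{}}"
      using m C comparable_sym unfolding Q all_faces_def by auto
  next
    fix Q assume Q: "Q \<in> all_faces (?a y) - {{}}"
    have Qs: "Q \<subseteq> ?a y" "Q \<noteq> {}" using Q by (auto simp: all_faces_def)
    then have finQ: "finite Q" using fina finite_subset by blast
    \<comment> \<open>The least element is found as the one with the fewest elements of
      \<open>A\<close> below it.\<close>
    let ?f = "\<lambda>x. card {z \<in> A. less z x}"
    have "Min (?f ` Q) \<in> ?f ` Q" using finQ Qs by (intro Min_in) auto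
    then obtain m where m: "m \<in> Q" "?f m = Min (?f ` Q)" by auto
    have min: "less m u" if u: "u \<in> Q" "u \<noteq> m" for u
    proof (rule ccontr)
      assume "\<not> less m u"
      moreover have "comparable m u" using Q m u by (auto simp: all_faces_def)
      ultimately have um: "less u m" using u by (auto simp: comparable_def less_def)
      have uA: "u \<in> A" "m \<in> A" using Qs m u by auto
      have "?f u < ?f m"
      proof (rule psubset_card_mono)
        show "{z \<in> A. less z u} \<subset> {z \<in> A. less z m}"
        proof
          show "{z \<in> A. less z u} \<subseteq> {z \<in> A. less z m}" using ltr[OF _ um] uA by auto
          have "u \<in> {z \<in> A. less z m}" "u \<notin> {z \<in> A. less z u}" using um uA by (auto simp: less_def)
          then show "{z \<in> A. less z u} \<noteq> {z \<in> A. less z m}" by blast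
        qed
      qed (use fin in simp)
      moreover have "?f m \<le> ?f u" unfolding m(2) by (rule Min_le) (use finQ u in auto)
      ultimately show False by simp
    qed
    have "Q - {m} \<in> all_faces (?a m)" using min Q Qs by (auto simp: all_faces_def)
    moreover have "m \<in> ?a y" using m Qs by auto
    moreover have "Q = ?h (m, Q - {m})" using m by auto
    ultimately show "Q \<in> ?h ` ?S" by blast
  qed
  have "euler (?a y) = (\<Sum>C\<in>all_faces (?a y) - {{}}. (-1) ^ card C) + 1"
    unfolding euler_def using finite_all_faces[OF aA]
    by (subst sum.remove[of _ "{}"]) (auto simp: all_faces_def)
  also have "(\<Sum>C\<in>all_faces (?a y) - {{}}. (-1 :: rat) ^ card C) = (\<Sum>(m, C)\<in>?S. (-1) ^ card (insert m C))"
    unfolding img[symmetric] by (subst sum.reindex[OF inj]) (simp add: case_prod_unfold)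
  also have "\<dots> = (\<Sum>m\<in>?a y. \<Sum>C\<in>all_faces (?a m). (-1) ^ card (insert m C))"
    by (rule sum.Sigma[symmetric]) (use fina finite_all_faces[OF aA] in auto)
  also have "\<dots> = (\<Sum>m\<in>?a y. w m)"
  proof (rule sum.cong[OF refl])
    fix m assume m: "m \<in> ?a y"
    have "(\<Sum>C\<in>all_faces (?a m). (-1 :: rat) ^ card (insert m C)) = (\<Sum>C\<in>all_faces (?a m). - ((-1) ^ card C))"
    proof (rule sum.cong[OF refl])
      fix C assume C: "C \<in> all_faces (?a m)"
      then have "finite C" using fina finite_subset unfolding all_faces_def by blast
      then show "(-1 :: rat) ^ card (insert m C) = - ((-1) ^ card C)" using notin[OF C] by simp
    qed
    also have "\<dots> = w m" unfolding sum_negf IH[OF m] euler_def ..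
    finally show "(\<Sum>C\<in>all_faces (?a m). (-1 :: rat) ^ card (insert m C)) = w m" .
  qed
  finally have e: "euler (?a y) = (\<Sum>m\<in>?a y. w m) + 1" .
  have "{z \<in> A. le y z} = insert y (insert t (?a y))"
    using less.prems t po_refl by (auto simp: less_def)
  moreover have "y \<notin> insert t (?a y)" "t \<notin> ?a y" using less.prems by (auto simp: less_def)
  moreover have "\<not> less y y" by (simp add: less_def)
  ultimately have "w y + (1 + (\<Sum>m\<in>?a y. w m)) = 0"
    using rec[OF less.prems] fina[of y] w
      sum.insert[of "insert t (?a y)" y w] sum.insert[of "?a y" t w] by simp
  then show ?case using e by simp
qed

end

section \<open>Permutations commuting with a free group action\<close>

lemma (in group) inv_mult_cancel: "f \<in> carrier G \<Longrightarrow> r \<in> carrier G \<Longrightarrow> inv f \<otimes> (f \<otimes> r) = r"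
  using m_assoc[of "inv f" f r] by simp

lemma (in group) conj_class_conj:
  assumes "f \<in> carrier G" "r \<in> carrier G"
  shows "conj_class G (f \<otimes> r \<otimes> inv f) = conj_class G r"
proof -
  have sub: "conj_class G (f \<otimes> r \<otimes> inv f) \<subseteq> conj_class G r" if "f \<in> carrier G" "r \<in> carrier G" for f r
  proof
    fix y assume "y \<in> conj_class G (f \<otimes> r \<otimes> inv f)"
    then obtain k where k: "k \<in> carrier G" "y = k \<otimes> (f \<otimes> r \<otimes> inv f) \<otimes> inv k"
      unfolding conj_class_def by blast
    have "y = (k \<otimes> f) \<otimes> r \<otimes> inv (k \<otimes> f)"
      using k that by (simp add: m_assoc inv_mult_group)
    then show "y \<in> conj_class G r" unfolding conj_class_def using k that m_closed by blast
  qed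
  have "inv f \<otimes> (f \<otimes> r \<otimes> inv f) \<otimes> inv (inv f) = r"
    using assms by (simp add: m_assoc inv_mult_cancel)
  then show ?thesis
    using sub[OF assms] sub[of "inv f" "f \<otimes> r \<otimes> inv f"] assms by auto
qed

lemma (in group) conj_class_self: "h \<in> carrier G \<Longrightarrow> h \<in> conj_class G h"
  unfolding conj_class_def by (rule CollectI, rule exI[of _ \<one>]) simp

lemma (in group) conj_class_eq:
  assumes "h \<in> carrier G" "h' \<in> conj_class G h"
  shows "conj_class G h' = conj_class G h"
proof -
  obtain g where "g \<in> carrier G" "h' = g \<otimes> h \<otimes> inv g"
    using assms(2) unfolding conj_class_def by blast
  then show ?thesis using conj_class_conj[OF _ assms(1)] by simp
qed

lemma (in group) conj_class_subset: "h \<in> carrier G \<Longrightarrow> conj_class G h \<subseteq> carrier G"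
  by (auto simp: conj_class_def)

text \<open>The order i |G| / |c| of the centralizer of a single cycle of type (i, c) in the wreath
  product on i labels; this is the number Z_v.\<close>

definition class_weight :: "('a, 'b) monoid_scheme \<Rightarrow> nat \<times> 'a set \<Rightarrow> rat" where
  "class_weight G v = of_nat (fst v * order G) / of_nat (card (snd v))"

text \<open>An abstract system because it is instantiated at several levels: for labelled points,
  for the blocks of an invariant partition, for blocks of such blocks, and for model cycles.\<close>

locale gaut = group G for G :: "('a, 'b) monoid_scheme" (structure) +
  fixes \<alpha> :: "'a \<Rightarrow> 't \<Rightarrow> 't" and x :: "'t \<Rightarrow> 't" and T :: "'t set"
  assumes finG: "finite (carrier G)" and finT: "finite T"
    and a_closed: "g \<in> carrier G \<Longrightarrow> z \<in> T \<Longrightarrow> \<alpha> g z \<in> T"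
    and a_one: "z \<in> T \<Longrightarrow> \<alpha> \<one> z = z"
    and a_mult: "g \<in> carrier G \<Longrightarrow> h \<in> carrier G \<Longrightarrow> z \<in> T \<Longrightarrow> \<alpha> (g \<otimes> h) z = \<alpha> g (\<alpha> h z)"
    and free: "g \<in> carrier G \<Longrightarrow> z \<in> T \<Longrightarrow> \<alpha> g z = z \<Longrightarrow> g = \<one>"
    and x_closed: "z \<in> T \<Longrightarrow> x z \<in> T"
    and x_inj: "inj_on x T"
    and x_comm: "g \<in> carrier G \<Longrightarrow> z \<in> T \<Longrightarrow> x (\<alpha> g z) = \<alpha> g (x z)"
begin

lemma pow_closed: "z \<in> T \<Longrightarrow> (x ^^ k) z \<in> T"
  by (induction k) (auto intro: x_closed)

lemma pow_comm: "g \<in> carrier G \<Longrightarrow> z \<in> T \<Longrightarrow> (x ^^ k) (\<alpha> g z) = \<alpha> g ((x ^^ k) z)"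
  by (induction k) (auto simp: x_comm pow_closed)

lemma pow_inj: "z \<in> T \<Longrightarrow> z' \<in> T \<Longrightarrow> (x ^^ k) z = (x ^^ k) z' \<Longrightarrow> z = z'"
proof (induction k)
  case (Suc k)
  then have "(x ^^ k) z = (x ^^ k) z'"
    using inj_onD[OF x_inj] pow_closed by auto
  with Suc show ?case by blast
qed simp

lemma pow_add: "(x ^^ (i + j)) z = (x ^^ i) ((x ^^ j) z)"
  by (simp add: funpow_add)

lemma a_inv: "g \<in> carrier G \<Longrightarrow> z \<in> T \<Longrightarrow> \<alpha> (inv g) (\<alpha> g z) = z"
  using a_mult[of "inv g" g z] a_one by simp

lemma a_inv': "g \<in> carrier G \<Longrightarrow> z \<in> T \<Longrightarrow> \<alpha> g (\<alpha> (inv g) z) = z"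
  using a_mult[of g "inv g" z] a_one by simp

lemma a_inj: "g \<in> carrier G \<Longrightarrow> z \<in> T \<Longrightarrow> z' \<in> T \<Longrightarrow> \<alpha> g z = \<alpha> g z' \<Longrightarrow> z = z'"
  by (metis a_inv)

lemma a_eq:
  assumes "g \<in> carrier G" "h \<in> carrier G" "z \<in> T" "\<alpha> g z = \<alpha> h z"
  shows "g = h"
proof -
  have "\<alpha> (inv h \<otimes> g) z = z" using assms a_mult[of "inv h" g z] a_inv[of h z] by simp
  then have "inv h \<otimes> g = \<one>" using assms free[of "inv h \<otimes> g" z] by simp
  then show ?thesis using assms by (metis inv_closed inv_inv inv_equality)
qed

text \<open>\<open>x\<close> permutes the G-orbits. \<open>len z\<close> is the length of the cycle
  through the orbit of \<open>z\<close>, and \<open>ret z\<close> is the group element by which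
  \<open>z\<close> has moved on its first return. Another point of the same G-orbit has a conjugate
  return element, so only the class enters \<open>tp\<close>. \<open>orb z\<close> is the whole
  cycle with all its points.\<close>

definition len :: "'t \<Rightarrow> nat" where
  "len z = (LEAST i. 1 \<le> i \<and> (\<exists>g\<in>carrier G. (x ^^ i) z = \<alpha> g z))"

definition ret :: "'t \<Rightarrow> 'a" where
  "ret z = (THE g. g \<in> carrier G \<and> (x ^^ len z) z = \<alpha> g z)"

definition tp :: "'t \<Rightarrow> nat \<times> 'a set" where
  "tp z = (len z, conj_class G (ret z))"

definition orb :: "'t \<Rightarrow> 't set" where
  "orb z = {\<alpha> g ((x ^^ s) z) | g s. g \<in> carrier G}"

lemma return_exists:
  assumes "z \<in> T"
  shows "\<exists>i\<ge>1. \<exists>g\<in>carrier G. (x ^^ i) z = \<alpha> g z"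
proof -
  have "finite (range (\<lambda>i. (x ^^ i) z))"
    by (rule finite_subset[OF _ finT]) (use assms pow_closed in auto)
  then have "\<not> inj (\<lambda>i. (x ^^ i) z)" using finite_imageD infinite_UNIV_nat by blast
  then obtain i j where ij: "i < j" "(x ^^ i) z = (x ^^ j) z"
    unfolding inj_def by (metis linorder_neqE_nat)
  have "(x ^^ i) ((x ^^ (j - i)) z) = (x ^^ i) z" using ij by (simp flip: pow_add)
  then have "(x ^^ (j - i)) z = z" using pow_inj pow_closed assms by blast
  then have "(x ^^ (j - i)) z = \<alpha> \<one> z" using a_one assms by simp
  then show ?thesis using ij by (intro exI[of _ "j - i"]) auto
qed

lemma len_ret:
  assumes "z \<in> T"
  shows "1 \<le> len z" "ret z \<in> carrier G" "(x ^^ len z) z = \<alpha> (ret z) z"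
proof -
  have *: "1 \<le> len z \<and> (\<exists>g\<in>carrier G. (x ^^ len z) z = \<alpha> g z)"
    unfolding len_def by (rule LeastI_ex) (rule return_exists[OF assms])
  then show "1 \<le> len z" by simp
  from * obtain g where g: "g \<in> carrier G" "(x ^^ len z) z = \<alpha> g z" by auto
  have "ret z = g"
    unfolding ret_def
  proof (rule the_equality)
    fix f assume f: "f \<in> carrier G \<and> (x ^^ len z) z = \<alpha> f z"
    then have "\<alpha> f z = \<alpha> g z" using g(2) by (simp only:)
    then show "f = g" using f g(1) assms by (intro a_eq[of f g z]) auto
  qed (rule conjI[OF g])
  with g show "ret z \<in> carrier G" "(x ^^ len z) z = \<alpha> (ret z) z" by (simp_all only:)
qed

lemma pow_len_mult: "z \<in> T \<Longrightarrow> (x ^^ (len z * q)) z = \<alpha> (ret z [^] q) z"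
proof (induction q)
  case 0
  then show ?case by (simp add: a_one)
next
  case (Suc q)
  have "(x ^^ (len z * Suc q)) z = (x ^^ len z) ((x ^^ (len z * q)) z)"
    by (simp add: pow_add)
  also have "\<dots> = \<alpha> (ret z [^] q) (\<alpha> (ret z) z)"
    using Suc len_ret by (simp add: pow_comm)
  also have "\<dots> = \<alpha> (ret z [^] Suc q) z"
    using Suc len_ret by (simp add: a_mult)
  finally show ?case .
qed

text \<open>A full turn multiplies by \<open>ret z\<close>, and turns compose because
  \<open>x\<close> commutes with \<open>G\<close>; a nonzero remainder modulo \<open>len z\<close>
  would give a shorter return. All later counts of quotients of a cycle rest on this.\<close>

lemma return_iff:
  assumes z: "z \<in> T" and g: "g \<in> carrier G"
  shows "(x ^^ i) z = \<alpha> g z \<longleftrightarrow> len z dvd i \<and> ret z [^] (i div len z) = g"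
proof
  assume eq: "(x ^^ i) z = \<alpha> g z"
  let ?l = "len z" and ?q = "i div len z" and ?s = "i mod len z"
  let ?r = "ret z [^] ?q"
  note l = len_ret[OF z]
  have r: "?r \<in> carrier G" using l by simp
  have "(x ^^ i) z = (x ^^ ?s) ((x ^^ (?l * ?q)) z)"
    unfolding pow_add[symmetric] by simp
  also have "\<dots> = \<alpha> ?r ((x ^^ ?s) z)"
    using pow_len_mult[OF z] pow_comm[OF r z] by simp
  finally have "\<alpha> ?r ((x ^^ ?s) z) = \<alpha> g z" using eq by simp
  then have "(x ^^ ?s) z = \<alpha> (inv ?r) (\<alpha> g z)" using a_inv[OF r pow_closed[OF z]] by metis
  then have s: "(x ^^ ?s) z = \<alpha> (inv ?r \<otimes> g) z" using a_mult r g z by simp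
  have "?s = 0"
  proof (rule ccontr)
    assume "?s \<noteq> 0"
    then have "1 \<le> ?s \<and> (\<exists>g\<in>carrier G. (x ^^ ?s) z = \<alpha> g z)" using s r g by auto
    moreover have "?s < len z" using l by simp
    ultimately show False unfolding len_def using not_less_Least by blast
  qed
  then have d: "?l dvd i" by auto
  then have "(x ^^ i) z = \<alpha> ?r z" using pow_len_mult[OF z, of ?q] by simp
  then show "?l dvd i \<and> ?r = g" using d eq a_eq[OF r g z] by simp
next
  assume "len z dvd i \<and> ret z [^] (i div len z) = g"
  then show "(x ^^ i) z = \<alpha> g z" using pow_len_mult[OF z, of "i div len z"] by auto
qed

lemma return_dvd: "z \<in> T \<Longrightarrow> g \<in> carrier G \<Longrightarrow> (x ^^ i) z = \<alpha> g z \<Longrightarrow> len z dvd i"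
  by (simp add: return_iff)

lemma ret_unique: "z \<in> T \<Longrightarrow> g \<in> carrier G \<Longrightarrow> (x ^^ len z) z = \<alpha> g z \<Longrightarrow> ret z = g"
  using a_eq len_ret by metis

lemma len_ret_eqI:
  assumes z: "z \<in> T" and i: "1 \<le> i" and g: "g \<in> carrier G" "(x ^^ i) z = \<alpha> g z"
    and min: "\<And>s f. 1 \<le> s \<Longrightarrow> s < i \<Longrightarrow> f \<in> carrier G \<Longrightarrow> (x ^^ s) z \<noteq> \<alpha> f z"
  shows "len z = i" "ret z = g"
proof -
  have "len z dvd i" using return_iff[OF z g(1)] g(2) by blast
  then have "len z \<le> i" using i by (intro dvd_imp_le) auto
  then show "len z = i" using min[of "len z" "ret z"] len_ret[OF z] by force
  then show "ret z = g" using ret_unique[OF z g(1)] g(2) by simp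
qed

lemma len_ret_a:
  assumes z: "z \<in> T" and f: "f \<in> carrier G"
  shows "len (\<alpha> f z) = len z" "ret (\<alpha> f z) = f \<otimes> ret z \<otimes> inv f"
proof -
  note l = len_ret[OF z]
  have az: "\<alpha> f z \<in> T" using a_closed z f by blast
  have pw: "(x ^^ len z) (\<alpha> f z) = \<alpha> (f \<otimes> ret z \<otimes> inv f) (\<alpha> f z)"
  proof -
    have "(x ^^ len z) (\<alpha> f z) = \<alpha> f (\<alpha> (ret z) z)" using pow_comm[OF f z] l by simp
    also have "\<dots> = \<alpha> (f \<otimes> ret z) (\<alpha> (inv f) (\<alpha> f z))" using a_mult a_inv f z l by simp
    also have "\<dots> = \<alpha> (f \<otimes> ret z \<otimes> inv f) (\<alpha> f z)" using a_mult f az l by simp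
    finally show ?thesis .
  qed
  have min: "(x ^^ s) (\<alpha> f z) \<noteq> \<alpha> k (\<alpha> f z)" if s: "1 \<le> s" "s < len z" and k: "k \<in> carrier G" for s k
  proof
    assume "(x ^^ s) (\<alpha> f z) = \<alpha> k (\<alpha> f z)"
    then have "\<alpha> f ((x ^^ s) z) = \<alpha> k (\<alpha> f z)" using pow_comm[OF f z] by simp
    then have "(x ^^ s) z = \<alpha> (inv f) (\<alpha> k (\<alpha> f z))" using a_inv[OF f pow_closed[OF z]] by metis
    also have "\<dots> = \<alpha> (inv f \<otimes> k \<otimes> f) z" using a_mult a_closed f k z by simp
    finally have "len z dvd s" by (rule return_dvd[OF z, rotated]) (use f k in simp)
    then show False using s by (auto dest: dvd_imp_le)
  qed
  show "len (\<alpha> f z) = len z" "ret (\<alpha> f z) = f \<otimes> ret z \<otimes> inv f"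
    using len_ret_eqI[OF az l(1) _ pw min] f l(2) by auto
qed

lemma len_ret_x:
  assumes z: "z \<in> T"
  shows "len (x z) = len z" "ret (x z) = ret z"
proof -
  note l = len_ret[OF z]
  have xz: "x z \<in> T" using x_closed z by blast
  have sw: "(x ^^ s) (x z) = x ((x ^^ s) z)" for s by (rule funpow_swap1[symmetric])
  have pw: "(x ^^ len z) (x z) = \<alpha> (ret z) (x z)" unfolding sw using l x_comm z by simp
  have min: "(x ^^ s) (x z) \<noteq> \<alpha> k (x z)" if s: "1 \<le> s" "s < len z" and k: "k \<in> carrier G" for s k
  proof
    assume "(x ^^ s) (x z) = \<alpha> k (x z)"
    then have "x ((x ^^ s) z) = x (\<alpha> k z)" unfolding sw using x_comm k z by simp
    then have "(x ^^ s) z = \<alpha> k z" using inj_onD[OF x_inj] pow_closed a_closed k z by blast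
    then have "len z dvd s" by (rule return_dvd[OF z k])
    then show False using s by (auto dest: dvd_imp_le)
  qed
  show "len (x z) = len z" "ret (x z) = ret z"
    using len_ret_eqI[OF xz l(1,2) pw min] by auto
qed

lemma tp_a: "z \<in> T \<Longrightarrow> f \<in> carrier G \<Longrightarrow> tp (\<alpha> f z) = tp z"
  by (simp add: tp_def len_ret_a conj_class_conj len_ret)

lemma tp_pow: "z \<in> T \<Longrightarrow> tp ((x ^^ s) z) = tp z"
  by (induction s) (auto simp: tp_def len_ret_x pow_closed)

lemma tp_in: "z \<in> T \<Longrightarrow> tp z \<in> {1..} \<times> conj_classes G"
  using len_ret[of z] by (auto simp: tp_def conj_classes_def)

lemma orb_self: "z \<in> T \<Longrightarrow> z \<in> orb z"
  unfolding orb_def by (rule CollectI, rule exI[of _ \<one>], rule exI[of _ 0]) (simp add: a_one)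

lemma orb_subset: "z \<in> T \<Longrightarrow> orb z \<subseteq> T"
  unfolding orb_def using a_closed pow_closed by blast

lemma orb_a: "z \<in> T \<Longrightarrow> w \<in> orb z \<Longrightarrow> f \<in> carrier G \<Longrightarrow> \<alpha> f w \<in> orb z"
  unfolding orb_def using a_mult pow_closed m_closed by (smt (verit, best) mem_Collect_eq)

lemma orb_x: "z \<in> T \<Longrightarrow> w \<in> orb z \<Longrightarrow> x w \<in> orb z"
proof -
  assume z: "z \<in> T" and "w \<in> orb z"
  then obtain g s where "g \<in> carrier G" "w = \<alpha> g ((x ^^ s) z)" unfolding orb_def by blast
  then have "x w = \<alpha> g ((x ^^ Suc s) z)" "g \<in> carrier G" using x_comm pow_closed z by auto
  then show ?thesis unfolding orb_def by blast
qed

lemma orb_pow: "z \<in> T \<Longrightarrow> w \<in> orb z \<Longrightarrow> (x ^^ s) w \<in> orb z"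
  by (induction s) (auto intro: orb_x)

lemma orb_repr:
  assumes z: "z \<in> T" and w: "w \<in> orb z"
  obtains g s where "g \<in> carrier G" "s < len z" "w = \<alpha> g ((x ^^ s) z)"
proof -
  obtain g i where g: "g \<in> carrier G" "w = \<alpha> g ((x ^^ i) z)" using w unfolding orb_def by blast
  let ?q = "i div len z" and ?s = "i mod len z"
  note l = len_ret[OF z]
  have "(x ^^ i) z = (x ^^ ?s) ((x ^^ (len z * ?q)) z)" unfolding pow_add[symmetric] by simp
  also have "\<dots> = \<alpha> (ret z [^] ?q) ((x ^^ ?s) z)"
    using pow_len_mult[OF z] l z by (simp add: pow_comm)
  finally have "w = \<alpha> (g \<otimes> ret z [^] ?q) ((x ^^ ?s) z)"
    using g l pow_closed[OF z] by (simp add: a_mult)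
  moreover have "g \<otimes> ret z [^] ?q \<in> carrier G" "?s < len z" using g l by simp_all
  ultimately show thesis using that by metis
qed

lemma orb_subset_orb: "z \<in> T \<Longrightarrow> w \<in> orb z \<Longrightarrow> orb w \<subseteq> orb z"
  unfolding orb_def[of w] using orb_a orb_pow by blast

lemma orb_eq:
  assumes z: "z \<in> T" and w: "w \<in> orb z"
  shows "orb w = orb z"
proof
  show "orb w \<subseteq> orb z" by (rule orb_subset_orb[OF z w])
  obtain g s where g: "g \<in> carrier G" "s < len z" "w = \<alpha> g ((x ^^ s) z)" using orb_repr[OF z w] .
  note l = len_ret[OF z]
  have "(x ^^ (len z - s)) w = \<alpha> g ((x ^^ (len z - s + s)) z)"
    unfolding g(3) using g(1) pow_closed[OF z] by (simp add: pow_comm pow_add)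
  also have "\<dots> = \<alpha> (g \<otimes> ret z) z" using g l z by (simp add: a_mult)
  finally have "\<alpha> (inv (g \<otimes> ret z)) ((x ^^ (len z - s)) w) = z" using a_inv g l z by simp
  then have "z \<in> orb w" unfolding orb_def using g l by (metis (mono_tags, lifting) inv_closed m_closed mem_Collect_eq)
  moreover have "w \<in> T" using orb_subset z w by blast
  ultimately show "orb z \<subseteq> orb w" using orb_subset_orb by blast
qed

text \<open>Two coinciding points would give a return of \<open>z\<close> after
  \<open>s' - s < len z\<close> steps; for equal steps freeness of the action identifies the group
  elements.\<close>

lemma orb_distinct:
  assumes z: "z \<in> T" and le: "s \<le> s'" "s' < len z" and g: "g \<in> carrier G" "g' \<in> carrier G"
    and eq: "\<alpha> g ((x ^^ s) z) = \<alpha> g' ((x ^^ s') z)"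
  shows "s = s'" "g = g'"
proof -
  have "(x ^^ s) (\<alpha> g z) = (x ^^ s) (\<alpha> g' ((x ^^ (s' - s)) z))"
    using eq le g z pow_closed by (simp add: pow_comm flip: pow_add)
  then have "\<alpha> g z = \<alpha> g' ((x ^^ (s' - s)) z)"
    using pow_inj a_closed pow_closed g z by blast
  then have "(x ^^ (s' - s)) z = \<alpha> (inv g') (\<alpha> g z)" using a_inv[OF g(2) pow_closed[OF z]] by metis
  then have "(x ^^ (s' - s)) z = \<alpha> (inv g' \<otimes> g) z" using a_mult g z by simp
  then have "len z dvd s' - s" by (rule return_dvd[OF z, rotated]) (use g in simp)
  then show s: "s = s'" using le by (auto dest: dvd_imp_le)
  then show "g = g'" using eq a_eq[OF g pow_closed[OF z]] by simp
qed

lemma card_orb: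
  assumes z: "z \<in> T"
  shows "card (orb z) = order G * len z"
proof -
  let ?f = "\<lambda>(g, s). \<alpha> g ((x ^^ s) z)" and ?S = "carrier G \<times> {..<len z}"
  have "orb z = ?f ` ?S"
  proof (intro equalityI subsetI)
    fix w assume "w \<in> orb z"
    then obtain g s where "g \<in> carrier G" "s < len z" "w = \<alpha> g ((x ^^ s) z)" using orb_repr[OF z] by blast
    then show "w \<in> ?f ` ?S" by (intro image_eqI[of _ _ "(g, s)"]) auto
  qed (auto simp: orb_def)
  moreover have "inj_on ?f ?S"
  proof -
    show ?thesis
    proof (rule inj_onI)
      fix p q assume p: "p \<in> ?S" "q \<in> ?S" "?f p = ?f q"
      obtain g s g' s' where pq: "p = (g, s)" "q = (g', s')" by (cases p, cases q)
      show "p = q"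
        using orb_distinct[OF z, of s s' g g'] orb_distinct[OF z, of s' s g' g] p by (cases "s \<le> s'") (auto simp: pq)
    qed
  qed
  ultimately show ?thesis by (simp add: card_image order_def card_cartesian_product)
qed

definition stable :: "'t set \<Rightarrow> bool" where
  "stable U \<longleftrightarrow> U \<subseteq> T \<and> (\<forall>g\<in>carrier G. \<forall>z\<in>U. \<alpha> g z \<in> U) \<and> (\<forall>z\<in>U. x z \<in> U)"

lemma stable_gaut: "stable U \<Longrightarrow> gaut G \<alpha> x U"
  unfolding stable_def
  using finG finT a_closed a_one a_mult free x_closed x_inj x_comm is_group
  by (intro gaut.intro gaut_axioms.intro) (auto intro: finite_subset inj_on_subset)

lemma stable_T: "stable T"
  using a_closed x_closed by (auto simp: stable_def)

lemma stable_orb: "z \<in> T \<Longrightarrow> stable (orb z)"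
  using orb_a orb_x orb_subset unfolding stable_def by blast

lemma stable_orb_sub: "stable U \<Longrightarrow> z \<in> U \<Longrightarrow> orb z \<subseteq> U"
proof
  fix w assume U: "stable U" "z \<in> U" and "w \<in> orb z"
  then obtain g s where "g \<in> carrier G" "w = \<alpha> g ((x ^^ s) z)" unfolding orb_def by blast
  moreover have "(x ^^ s) z \<in> U" using U by (induction s) (auto simp: stable_def)
  ultimately show "w \<in> U" using U by (auto simp: stable_def)
qed

text \<open>Stability only asks for closure under forward steps. By \<open>orb_eq\<close> the sets
  \<open>orb z\<close> are the classes of an equivalence relation, and a stable set contains each of
  them that it meets; so differences are stable as well.\<close>

lemma stable_Diff:
  assumes "stable U" "stable V"
  shows "stable (U - V)"
proof -
  have stay: "w \<in> V" if "w \<in> T" "u \<in> orb w" "u \<in> V" for u w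
    using orb_eq[OF that(1,2)] orb_self[OF that(1)] stable_orb_sub[OF assms(2) that(3)] by blast
  have "\<alpha> g z \<notin> V" "x z \<notin> V" if "z \<in> U - V" "g \<in> carrier G" for g z
    using stay[of z "\<alpha> g z"] stay[of z "x z"] orb_a[of z z g] orb_x[of z z] orb_self[of z] that assms
    unfolding stable_def by blast+
  moreover have "\<one> \<in> carrier G" by simp
  ultimately show ?thesis using assms unfolding stable_def by (meson DiffD1 DiffI Diff_subset order_trans)
qed

lemma stable_Un: "stable U \<Longrightarrow> stable V \<Longrightarrow> stable (U \<union> V)"
  by (auto simp: stable_def)

lemma orbit_induct [consumes 1, case_names empty orbit]:
  assumes "stable U" "P {}"
    and "\<And>U z. stable U \<Longrightarrow> z \<in> T \<Longrightarrow> orb z \<inter> U = {} \<Longrightarrow> P U \<Longrightarrow> P (U \<union> orb z)"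
  shows "P U"
  using assms(1)
proof (induction "card U" arbitrary: U rule: less_induct)
  case less
  show ?case
  proof (cases "U = {}")
    case False
    then obtain z where z: "z \<in> U" by blast
    have zT: "z \<in> T" using z less.prems by (auto simp: stable_def)
    have sub: "orb z \<subseteq> U" by (rule stable_orb_sub[OF less.prems z])
    have st: "stable (U - orb z)" by (rule stable_Diff[OF less.prems stable_orb[OF zT]])
    have "finite U" using less.prems finT by (auto simp: stable_def intro: finite_subset)
    then have "card (U - orb z) < card U" using orb_self[OF zT] z by (intro psubset_card_mono) auto
    then have "P (U - orb z)" using less.hyps st by blast
    then have "P ((U - orb z) \<union> orb z)" using assms(3)[OF st zT] by blast
    moreover have "(U - orb z) \<union> orb z = U" using sub by auto
    ultimately show ?thesis by simp
  qed (simp add: assms(2))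
qed

text \<open>The monomial of cycle types, with cycles counted through their points: a cycle of type
  \<open>v\<close> has \<open>order G * fst v\<close> of them. On stable sets the division is exact
  by \<open>lookup_ty_mult\<close>.\<close>

definition ty :: "'t set \<Rightarrow> (nat \<times> 'a set) \<Rightarrow>\<^sub>0 nat" where
  "ty U = (\<Sum>v\<in>tp ` U. single v (card {z \<in> U. tp z = v} div (order G * fst v)))"

lemma lookup_ty:
  assumes "finite U"
  shows "lookup (ty U) v = card {z \<in> U. tp z = v} div (order G * fst v)"
proof -
  have "lookup (sum f I) k = (\<Sum>i\<in>I. lookup (f i) k)"
    for f :: "nat \<times> 'a set \<Rightarrow> (nat \<times> 'a set \<Rightarrow>\<^sub>0 nat)" and I k
    by (induction I rule: infinite_finite_induct) (auto simp: lookup_add)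
  then have "lookup (ty U) v =
      (\<Sum>w\<in>tp ` U. if w = v then card {z \<in> U. tp z = v} div (order G * fst v) else 0)"
    unfolding ty_def by (auto simp: lookup_single when_def intro!: sum.cong)
  also have "\<dots> = (if v \<in> tp ` U then card {z \<in> U. tp z = v} div (order G * fst v) else 0)"
    using assms by (subst sum.delta) auto
  also have "\<dots> = card {z \<in> U. tp z = v} div (order G * fst v)"
  proof (cases "v \<in> tp ` U")
    case False
    then have e: "{z \<in> U. tp z = v} = {}" by auto
    show ?thesis using False unfolding e by simp
  qed simp
  finally show ?thesis .
qed

lemma tp_orb: "z \<in> T \<Longrightarrow> w \<in> orb z \<Longrightarrow> tp w = tp z"
  unfolding orb_def using tp_a tp_pow pow_closed by fastforce

lemma finite_orb: "z \<in> T \<Longrightarrow> finite (orb z)"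
  using orb_subset finT finite_subset by blast

lemma order_pos: "order G > 0"
  using finG by (simp add: order_gt_0_iff_finite)

lemma ty_empty [simp]: "ty {} = 0"
  by (simp add: ty_def)

lemma card_add_orbit:
  assumes U: "finite U" and z: "z \<in> T" and disj: "orb z \<inter> U = {}"
  shows "card {w \<in> U \<union> orb z. tp w = v} = card {w \<in> U. tp w = v} + (if tp z = v then order G * len z else 0)"
proof -
  have "{w \<in> U \<union> orb z. tp w = v} = {w \<in> U. tp w = v} \<union> (if tp z = v then orb z else {})"
    using tp_orb[OF z] by auto
  moreover have "card ({w \<in> U. tp w = v} \<union> orb z) = card {w \<in> U. tp w = v} + card (orb z)"
    by (rule card_Un_disjoint) (use U disj finite_orb[OF z] in auto)
  ultimately show ?thesis using card_orb[OF z] by (cases "tp z = v") simp_all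
qed

lemma ty_add_orbit:
  assumes U: "finite U" and z: "z \<in> T" and disj: "orb z \<inter> U = {}"
  shows "ty (U \<union> orb z) = ty U + single (tp z) 1"
proof (rule poly_mapping_eqI)
  fix v
  have p: "order G * len z \<noteq> 0" using order_pos len_ret[OF z] by simp
  have "lookup (ty (U \<union> orb z)) v =
      (card {w \<in> U. tp w = v} + (if tp z = v then order G * len z else 0)) div (order G * fst v)"
    using U finite_orb[OF z] by (simp only: lookup_ty finite_Un card_add_orbit[OF assms])
  also have "\<dots> = card {w \<in> U. tp w = v} div (order G * fst v) + (if tp z = v then 1 else 0)"
  proof (cases "tp z = v")
    case True
    then have "fst v = len z" by (auto simp: tp_def)
    then show ?thesis using p True by (simp add: div_add_self2)
  qed simp
  finally show "lookup (ty (U \<union> orb z)) v = lookup (ty U + single (tp z) 1) v"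
    using U by (simp add: lookup_add lookup_single lookup_ty when_def)
qed

definition ncyc :: "'t set \<Rightarrow> nat" where
  "ncyc U = card (orb ` U)"

lemma ncyc_add_orbit:
  assumes U: "stable U" and z: "z \<in> T" and disj: "orb z \<inter> U = {}"
  shows "ncyc (U \<union> orb z) = Suc (ncyc U)"
proof -
  have "orb w = orb z" if "w \<in> orb z" for w using orb_eq[OF z that] .
  then have "orb ` orb z = {orb z}" using orb_self[OF z] by blast
  then have e: "orb ` (U \<union> orb z) = insert (orb z) (orb ` U)" by (simp add: image_Un)
  have "orb z \<notin> orb ` U"
  proof
    assume "orb z \<in> orb ` U"
    then obtain w where w: "w \<in> U" "orb z = orb w" by auto
    then have "w \<in> orb z" using orb_self[of w] U by (auto simp: stable_def)
    then show False using w disj by auto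
  qed
  moreover have "finite U" using U finT by (auto simp: stable_def intro: finite_subset)
  ultimately show ?thesis unfolding ncyc_def e by simp
qed

lemma stable_finite: "stable U \<Longrightarrow> finite U"
  using finT by (auto simp: stable_def intro: finite_subset)

lemma lookup_ty_mult:
  assumes "stable U"
  shows "lookup (ty U) v * (order G * fst v) = card {z \<in> U. tp z = v}"
  using assms
proof (induction rule: orbit_induct)
  case (orbit U z)
  have "fst (tp z) = len z" by (simp add: tp_def)
  then show ?case
    unfolding ty_add_orbit[OF stable_finite[OF orbit(1)] orbit(2,3)]
      card_add_orbit[OF stable_finite[OF orbit(1)] orbit(2,3)]
    using orbit(4) by (auto simp: lookup_add lookup_single when_def algebra_simps)
qed simp

lemma pweight_ty:
  assumes "stable U"
  shows "order G * pweight (ty U) = card U"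
  using assms
proof (induction rule: orbit_induct)
  case (orbit U z)
  have "fst (tp z) = len z" by (simp add: tp_def)
  moreover have "card (U \<union> orb z) = card U + order G * len z"
    using stable_finite[OF orbit(1)] finite_orb[OF orbit(2)] orbit(3) card_orb[OF orbit(2)]
    by (subst card_Un_disjoint) auto
  ultimately show ?case
    unfolding ty_add_orbit[OF stable_finite[OF orbit(1)] orbit(2,3)] pweight_add
    using orbit(4) by (simp add: algebra_simps)
qed simp

lemma keys_ty: "stable U \<Longrightarrow> keys (ty U) \<subseteq> {1..} \<times> conj_classes G"
proof (induction rule: orbit_induct)
  case (orbit U z)
  then show ?case
    unfolding ty_add_orbit[OF stable_finite[OF orbit(1)] orbit(2,3)] keys_add_single_one
    using tp_in[of z] by auto
qed simp

text \<open>Translation by \<open>f\<close> carries the points with return element \<open>h\<close>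
  to those with return element f h f^-1, so the points of one type are spread evenly over the
  conjugacy class. This is how the weights Z_v enter all counts.\<close>

lemma card_len_ret:
  assumes U: "stable U" and h: "h \<in> carrier G"
  shows "(of_nat (card {z \<in> U. len z = i \<and> ret z = h}) :: rat) =
    of_nat (lookup (ty U) (i, conj_class G h)) * class_weight G (i, conj_class G h)"
proof -
  let ?c = "conj_class G h" and ?S = "\<lambda>h. {z \<in> U. len z = i \<and> ret z = h}"
  have UT: "U \<subseteq> T" using U by (simp add: stable_def)
  have fin: "finite U" by (rule stable_finite[OF U])
  have finc: "finite ?c" using conj_class_subset[OF h] finG finite_subset by blast
  have eq: "card (?S h') = card (?S h)" if h': "h' \<in> ?c" for h'
  proof -
    obtain f where f: "f \<in> carrier G" "h' = f \<otimes> h \<otimes> inv f" using h' unfolding conj_class_def by blast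
    have "\<alpha> f ` ?S h = ?S h'"
    proof (intro equalityI subsetI)
      fix w assume "w \<in> \<alpha> f ` ?S h"
      then show "w \<in> ?S h'" using U UT f by (auto simp: stable_def len_ret_a subsetD)
    next
      fix w assume w: "w \<in> ?S h'"
      then have wT: "w \<in> T" using UT by auto
      have "\<alpha> (inv f) w \<in> ?S h"
      proof -
        have "inv f \<otimes> h' \<otimes> inv (inv f) = h" using f h by (simp add: m_assoc inv_mult_cancel)
        then show ?thesis using U w wT f by (auto simp: stable_def len_ret_a)
      qed
      moreover have "w = \<alpha> f (\<alpha> (inv f) w)" using a_inv' f wT by simp
      ultimately show "w \<in> \<alpha> f ` ?S h" by blast
    qed
    moreover have "inj_on (\<alpha> f) (?S h)"
      by (rule inj_onI, rule a_inj[OF f(1)]) (use UT in auto)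
    ultimately show ?thesis using card_image[of "\<alpha> f" "?S h"] by (simp only:)
  qed
  have "{z \<in> U. tp z = (i, ?c)} = (\<Union>h'\<in>?c. ?S h')"
  proof (intro equalityI subsetI)
    fix z assume z: "z \<in> {z \<in> U. tp z = (i, ?c)}"
    then have "z \<in> T" using UT by auto
    then have "ret z \<in> conj_class G (ret z)" using conj_class_self len_ret by blast
    then show "z \<in> (\<Union>h'\<in>?c. ?S h')" using z by (auto simp: tp_def)
  next
    fix z assume "z \<in> (\<Union>h'\<in>?c. ?S h')"
    then have "z \<in> U" "len z = i" "ret z \<in> ?c" by auto
    then show "z \<in> {z \<in> U. tp z = (i, ?c)}" using conj_class_eq[OF h] by (simp add: tp_def)
  qed
  then have "card {z \<in> U. tp z = (i, ?c)} = (\<Sum>h'\<in>?c. card (?S h'))"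
    using finc fin by (simp only:) (rule card_UN_disjoint, auto)
  also have "\<dots> = card ?c * card (?S h)" using eq by simp
  finally have 1: "lookup (ty U) (i, ?c) * (order G * i) = card ?c * card (?S h)"
    using lookup_ty_mult[OF U, of "(i, ?c)"] by simp
  have "card ?c \<noteq> 0" using finc conj_class_self[OF h] by auto
  moreover have "of_nat (card ?c) * (of_nat (card (?S h)) :: rat) =
      of_nat (lookup (ty U) (i, ?c)) * of_nat (i * order G)"
    unfolding of_nat_mult[symmetric] 1[symmetric] by (simp only: mult.commute[of i])
  ultimately show ?thesis by (simp add: class_weight_def field_simps)
qed

end

lemma len_ret_equivariant:
  assumes "gaut G \<alpha> x T" "gaut G \<alpha>' x' T'" and inj: "inj_on f T" and img: "f ` T \<subseteq> T'"
    and eqa: "\<And>g z. g \<in> carrier G \<Longrightarrow> z \<in> T \<Longrightarrow> f (\<alpha> g z) = \<alpha>' g (f z)"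
    and eqx: "\<And>z. z \<in> T \<Longrightarrow> f (x z) = x' (f z)"
    and z: "z \<in> T"
  shows "gaut.len G \<alpha>' x' (f z) = gaut.len G \<alpha> x z" "gaut.ret G \<alpha>' x' (f z) = gaut.ret G \<alpha> x z"
proof -
  interpret A: gaut G \<alpha> x T by fact
  interpret B: gaut G \<alpha>' x' T' by fact
  have pw: "f ((x ^^ s) z) = (x' ^^ s) (f z)" if "z \<in> T" for s z
    using that by (induction s) (auto simp: eqx A.pow_closed)
  have fz: "f z \<in> T'" using img z by auto
  note l = A.len_ret[OF z]
  have 1: "(x' ^^ A.len z) (f z) = \<alpha>' (A.ret z) (f z)" using pw[OF z] l eqa z by metis
  have 2: "(x' ^^ s) (f z) \<noteq> \<alpha>' k (f z)" if s: "1 \<le> s" "s < A.len z" "k \<in> carrier G" for s k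
  proof
    assume "(x' ^^ s) (f z) = \<alpha>' k (f z)"
    then have "f ((x ^^ s) z) = f (\<alpha> k z)" using pw[OF z] eqa[OF s(3) z] by simp
    then have "(x ^^ s) z = \<alpha> k z" using inj_onD[OF inj] A.pow_closed A.a_closed z s by blast
    then have "A.len z dvd s" by (rule A.return_dvd[OF z s(3)])
    then show False using s by (auto dest: dvd_imp_le)
  qed
  show "B.len (f z) = A.len z" "B.ret (f z) = A.ret z" using B.len_ret_eqI[OF fz l(1,2) 1 2] by blast+
qed

lemma ty_equivariant:
  assumes "gaut G \<alpha> x T" "gaut G \<alpha>' x' T'" and f: "bij_betw f T T'"
    and eqa: "\<And>g z. g \<in> carrier G \<Longrightarrow> z \<in> T \<Longrightarrow> f (\<alpha> g z) = \<alpha>' g (f z)"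
    and eqx: "\<And>z. z \<in> T \<Longrightarrow> f (x z) = x' (f z)"
  shows "gaut.ty G \<alpha>' x' T' = gaut.ty G \<alpha> x T"
proof -
  interpret A: gaut G \<alpha> x T by fact
  interpret B: gaut G \<alpha>' x' T' by fact
  have inj: "inj_on f T" and img: "f ` T = T'" using f by (auto simp: bij_betw_def)
  have "B.len (f z) = A.len z" "B.ret (f z) = A.ret z" if "z \<in> T" for z
    using len_ret_equivariant[OF assms(1,2) inj _ eqa eqx that] img by auto
  then have tp: "B.tp (f z) = A.tp z" if "z \<in> T" for z using that by (simp add: A.tp_def B.tp_def)
  show ?thesis
  proof (rule poly_mapping_eqI)
    fix v
    have "{z \<in> T'. B.tp z = v} = f ` {z \<in> T. A.tp z = v}" using img tp by auto
    moreover have "inj_on f {z \<in> T. A.tp z = v}" using inj by (rule inj_on_subset) auto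
    ultimately have "card {z \<in> T'. B.tp z = v} = card {z \<in> T. A.tp z = v}" by (simp add: card_image)
    then show "lookup (B.ty T') v = lookup (A.ty T) v"
      by (simp add: A.lookup_ty[OF A.finT] B.lookup_ty[OF B.finT])
  qed
qed

section \<open>Moebius sums over roots in a group\<close>

lemma moebius_mu_prime_mult:
  fixes p d :: nat
  assumes "Factorial_Ring.prime p" "\<not> p dvd d" "squarefree d"
  shows "moebius_mu (p * d) = - moebius_mu d"
proof -
  have "d \<noteq> 0" using assms(2) by (metis dvd_0_right)
  have cop: "coprime p d" using assms by (simp add: prime_imp_coprime)
  then have "squarefree (p * d)" by (rule squarefree_mult_coprime[OF _ squarefree_prime[OF assms(1)] assms(3)])
  moreover have "prime_factors (p * d) = insert p (prime_factors d)"
    using assms(1) \<open>d \<noteq> 0\<close> by (subst prime_factors_product) (auto simp: prime_factorization_prime)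
  moreover have "p \<notin> prime_factors d" using assms(2) by auto
  ultimately show ?thesis using assms(3) by (simp add: moebius_mu_def)
qed

text \<open>Only squarefree divisors count. For a prime \<open>p\<close> dividing \<open>n\<close>,
  multiplication by \<open>p\<close> pairs those prime to \<open>p\<close> with the remaining ones
  and reverses the sign.\<close>

lemma sum_moebius_mu:
  assumes "n > 0"
  shows "(\<Sum>d | d dvd n. moebius_mu d) = (if n = 1 then 1 else 0)"
proof (cases "n = 1")
  case True
  then have "{d. d dvd n} = {1}" by auto
  then show ?thesis using True by (simp add: moebius_mu_def)
next
  case False
  then obtain p where p: "Factorial_Ring.prime p" "p dvd n" using prime_factor_nat by blast
  let ?S = "{d. d dvd n \<and> squarefree d}" and ?Q = "{d. d dvd n \<and> squarefree d \<and> \<not> p dvd d}"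
  have fin: "finite {d. d dvd n}" using assms by simp
  have "(\<Sum>d | d dvd n. moebius_mu d) = sum moebius_mu ?S"
    by (rule sum.mono_neutral_right[OF fin]) (auto simp: moebius_mu_def)
  also have "?S = ?Q \<union> (*) p ` ?Q"
  proof (intro equalityI subsetI)
    fix d assume d: "d \<in> ?S"
    show "d \<in> ?Q \<union> (*) p ` ?Q"
    proof (cases "p dvd d")
      case True
      then obtain e where e: "d = p * e" by (auto elim: dvdE)
      have "\<not> p dvd e"
      proof
        assume "p dvd e"
        then have "p ^ 2 dvd d" unfolding e power2_eq_square by (rule mult_dvd_mono[OF dvd_refl])
        then show False using d p by (auto simp: squarefree_def)
      qed
      moreover have "squarefree e" "e dvd n" using d unfolding e by (auto dest: squarefree_multD dvd_mult_right)
      ultimately show ?thesis using e by auto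
    qed (use d in auto)
  next
    fix d assume "d \<in> ?Q \<union> (*) p ` ?Q"
    then show "d \<in> ?S"
    proof
      assume "d \<in> (*) p ` ?Q"
      then obtain e where e: "d = p * e" "e dvd n" "squarefree e" "\<not> p dvd e" by auto
      then have "coprime p e" using p by (simp add: prime_imp_coprime)
      then show "d \<in> ?S" using e p squarefree_mult_coprime[OF _ squarefree_prime[OF p(1)] e(3)]
        divides_mult[of p n e] by auto
    qed auto
  qed
  also have "sum moebius_mu \<dots> = sum moebius_mu ?Q + sum moebius_mu ((*) p ` ?Q)"
    by (rule sum.union_disjoint) (use fin in \<open>auto intro!: finite_imageI finite_subset[OF _ fin]\<close>)
  also have "sum moebius_mu ((*) p ` ?Q) = (\<Sum>d\<in>?Q. - moebius_mu d)"
    using p(1) by (subst sum.reindex) (auto simp: inj_on_def prime_gt_0_nat moebius_mu_prime_mult intro!: sum.cong)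
  finally show ?thesis using False by (simp add: sum_negf)
qed

text \<open>The exponent A_v, in the form in which \<open>theta_pleth_L\<close> produces it as an
  eigenvalue when \<open>Y\<close> is \<open>Exp_series\<close>.\<close>

definition binom_exp :: "('a, 'b) monoid_scheme \<Rightarrow> nat \<times> 'a set \<Rightarrow> rat" where
  "binom_exp G v = (\<Sum>w\<in>{1..fst v} \<times> conj_classes G. mobius_coeff G v w / class_weight G w)"

text \<open>The product A_v Z_v; by \<open>bcoef_class\<close> it is an integer, a count of roots in
  \<open>G\<close> weighted with the Moebius function.\<close>

definition bcoef :: "('a, 'b) monoid_scheme \<Rightarrow> nat \<times> 'a set \<Rightarrow> rat" where
  "bcoef G v = binom_exp G v * class_weight G v"

context group
begin

lemma conj_pow:
  assumes "k \<in> carrier G" "g \<in> carrier G"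
  shows "(k \<otimes> g \<otimes> inv k) [^] (e :: nat) = k \<otimes> g [^] e \<otimes> inv k"
proof (induction e)
  case (Suc e)
  have "(k \<otimes> g [^] e \<otimes> inv k) \<otimes> (k \<otimes> g \<otimes> inv k) = k \<otimes> (g [^] e \<otimes> g) \<otimes> inv k"
    using assms by (simp add: m_assoc inv_mult_cancel)
  then show ?case using Suc by simp
qed (use assms in simp)

lemma class_pow_class:
  assumes "g \<in> carrier G"
  shows "class_pow G (conj_class G g) e = conj_class G (g [^] e)"
  unfolding class_pow_def conj_class_def using conj_pow[OF _ assms] by (auto simp: image_iff) metis

definition nroots :: "nat \<Rightarrow> 'a \<Rightarrow> nat" where
  "nroots e h = card {g \<in> carrier G. g [^] e = h}"

lemma conj_classes_eqI: "c \<in> conj_classes G \<Longrightarrow> g \<in> c \<Longrightarrow> conj_class G g = c"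
  unfolding conj_classes_def using conj_class_eq by auto

text \<open>Both sides count the elements whose \<open>e\<close>-th power is conjugate to
  \<open>h\<close>, once by their own class and once by the value of the power. Conjugate elements
  have equally many roots.\<close>

lemma class_pow_sum:
  assumes fin: "finite (carrier G)" and h: "h \<in> carrier G"
  shows "(\<Sum>c | c \<in> conj_classes G \<and> class_pow G c e = conj_class G h. card c) =
    card (conj_class G h) * nroots e h"
proof -
  let ?d = "conj_class G h" and ?R = "\<lambda>h. {g \<in> carrier G. g [^] e = h}"
  let ?C = "{c. c \<in> conj_classes G \<and> class_pow G c e = ?d}"
  have finC: "finite ?C" using fin by (simp add: conj_classes_def)
  have sub: "c \<subseteq> carrier G" if "c \<in> conj_classes G" for c
    using that conj_class_subset by (auto simp: conj_classes_def)
  have "\<Union>?C = (\<Union>h'\<in>?d. ?R h')"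
  proof (intro equalityI subsetI)
    fix g assume "g \<in> \<Union>?C"
    then obtain c where c: "c \<in> conj_classes G" "class_pow G c e = ?d" "g \<in> c" by auto
    then have "g [^] e \<in> ?d" unfolding class_pow_def by auto
    then show "g \<in> (\<Union>h'\<in>?d. ?R h')" using sub[OF c(1)] c(3) by auto
  next
    fix g assume "g \<in> (\<Union>h'\<in>?d. ?R h')"
    then have g: "g \<in> carrier G" "g [^] e \<in> ?d" by auto
    then have "class_pow G (conj_class G g) e = ?d"
      using class_pow_class conj_class_eq[OF h] by simp
    then show "g \<in> \<Union>?C" using g conj_class_self by (auto simp: conj_classes_def)
  qed
  moreover have "card (\<Union>?C) = (\<Sum>c\<in>?C. card c)"
  proof (rule card_Union_disjoint)
    show "pairwise disjnt ?C"
      unfolding pairwise_def disjnt_def using conj_classes_eqI by blast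
    show "\<And>c. c \<in> ?C \<Longrightarrow> finite c" using sub fin finite_subset by blast
  qed
  moreover have "card (\<Union>h'\<in>?d. ?R h') = (\<Sum>h'\<in>?d. card (?R h'))"
    using fin conj_class_subset[OF h] by (intro card_UN_disjoint) (auto intro: finite_subset)
  moreover have "card (?R h') = card (?R h)" if h': "h' \<in> ?d" for h'
  proof -
    obtain k where k: "k \<in> carrier G" "h' = k \<otimes> h \<otimes> inv k" using h' unfolding conj_class_def by blast
    have to_fro: "inv k \<otimes> (k \<otimes> g \<otimes> inv k) \<otimes> inv (inv k) = g" if "g \<in> carrier G" for g
      using k that by (simp add: m_assoc inv_mult_cancel)
    have fro_to: "k \<otimes> (inv k \<otimes> g \<otimes> inv (inv k)) \<otimes> inv k = g" if "g \<in> carrier G" for g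
      using k that inv_mult_cancel[of "inv k"] by (simp add: m_assoc)
    have "bij_betw (\<lambda>g. k \<otimes> g \<otimes> inv k) (?R h) (?R h')"
    proof (rule bij_betw_byWitness[of _ "\<lambda>g. inv k \<otimes> g \<otimes> inv (inv k)"])
      show "\<forall>g\<in>?R h. inv k \<otimes> (k \<otimes> g \<otimes> inv k) \<otimes> inv (inv k) = g" using to_fro by auto
      show "\<forall>g\<in>?R h'. k \<otimes> (inv k \<otimes> g \<otimes> inv (inv k)) \<otimes> inv k = g" using fro_to by auto
      show "(\<lambda>g. k \<otimes> g \<otimes> inv k) ` ?R h \<subseteq> ?R h'" using k conj_pow by auto
      show "(\<lambda>g. inv k \<otimes> g \<otimes> inv (inv k)) ` ?R h' \<subseteq> ?R h"
        using k(1) conj_pow[of "inv k"] to_fro[OF h] k(2) by auto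
    qed
    then show ?thesis by (simp add: bij_betw_same_card)
  qed
  ultimately show ?thesis by (simp add: nroots_def)
qed

text \<open>For e = j / i the weights combine to mu(e) |c| / |d|, where d is the class of
  \<open>h\<close>, since |G|, i and e cancel. Then \<open>class_pow_sum\<close> turns the class
  sizes into a number of roots.\<close>

lemma bcoef_class:
  assumes fin: "finite (carrier G)" and h: "h \<in> carrier G" and j: "1 \<le> j"
  shows "bcoef G (j, conj_class G h) =
    (\<Sum>i | i dvd j. of_int (moebius_mu (j div i)) * of_nat (nroots (j div i) h))"
proof -
  let ?d = "conj_class G h" and ?C = "conj_classes G"
  have finC: "finite ?C" using fin by (simp add: conj_classes_def)
  have "finite ?d" using fin conj_class_subset[OF h] finite_subset by blast
  then have d0: "(of_nat (card ?d) :: rat) \<noteq> 0" using conj_class_self[OF h] by auto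
  have o0: "(of_nat (order G) :: rat) \<noteq> 0" using fin order_gt_0_iff_finite by simp
  have summand: "(\<Sum>c\<in>?C. mobius_coeff G (j, ?d) (i, c) / class_weight G (i, c)) * class_weight G (j, ?d) =
      (if i dvd j then of_int (moebius_mu (j div i)) * of_nat (nroots (j div i) h) else 0)"
    if i: "i \<in> {1..j}" for i
  proof (cases "i dvd j")
    case False
    then show ?thesis by (simp add: mobius_coeff_def)
  next
    case True
    let ?e = "j div i"
    let ?m = "of_int (moebius_mu ?e) :: rat"
    have e: "of_nat j = (of_nat ?e * of_nat i :: rat)" using True by (simp flip: of_nat_mult)
    have e0: "(of_nat ?e :: rat) \<noteq> 0" "(of_nat i :: rat) \<noteq> 0" using True i j by (auto simp: dvd_div_eq_0_iff)
    have "mobius_coeff G (j, ?d) (i, c) / class_weight G (i, c) * class_weight G (j, ?d) =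
        (if class_pow G c ?e = ?d then ?m * of_nat (card c) / of_nat (card ?d) else 0)" for c
      using True j e0 d0 o0 by (simp add: mobius_coeff_def class_weight_def Let_def e)
    then have "(\<Sum>c\<in>?C. mobius_coeff G (j, ?d) (i, c) / class_weight G (i, c)) * class_weight G (j, ?d) =
        (\<Sum>c\<in>?C. if class_pow G c ?e = ?d then ?m * of_nat (card c) / of_nat (card ?d) else 0)"
      unfolding sum_distrib_right by simp
    also have "\<dots> = (\<Sum>c | c \<in> ?C \<and> class_pow G c ?e = ?d. ?m * of_nat (card c) / of_nat (card ?d))"
      using finC by (simp add: sum.If_cases Int_def)
    also have "\<dots> = ?m / of_nat (card ?d) * of_nat (\<Sum>c | c \<in> ?C \<and> class_pow G c ?e = ?d. card c)"
      by (simp add: sum_distrib_left)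
    also have "\<dots> = ?m * of_nat (nroots ?e h)"
      unfolding class_pow_sum[OF fin h] using d0 by simp
    finally show ?thesis using True by simp
  qed
  have "bcoef G (j, ?d) = (\<Sum>i\<in>{1..j}. (\<Sum>c\<in>?C. mobius_coeff G (j, ?d) (i, c) / class_weight G (i, c)) * class_weight G (j, ?d))"
    unfolding bcoef_def binom_exp_def by (simp add: sum.cartesian_product sum_distrib_right)
  also have "\<dots> = (\<Sum>i\<in>{1..j}. if i dvd j then of_int (moebius_mu (j div i)) * of_nat (nroots (j div i) h) else 0)"
    by (rule sum.cong) (simp_all only: summand)
  also have "\<dots> = (\<Sum>i | i dvd j. of_int (moebius_mu (j div i)) * of_nat (nroots (j div i) h))"
  proof -
    have "{i \<in> {1..j}. i dvd j} = {i. i dvd j}"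
      using j dvd_imp_le[of _ j] by (auto simp: Suc_le_eq intro: Nat.gr0I)
    then show ?thesis by (simp add: sum.If_cases Int_def)
  qed
  finally show ?thesis .
qed

text \<open>The types of the quotients of a cycle of length \<open>j\<close> and return element \<open>h\<close>.\<close>

definition quotient_types :: "nat \<Rightarrow> 'a \<Rightarrow> (nat \<times> 'a) set" where
  "quotient_types j h = {(i, g). i dvd j \<and> g \<in> carrier G \<and> g [^] (j div i) = h}"

lemma finite_quotient_types:
  "finite (carrier G) \<Longrightarrow> 1 \<le> j \<Longrightarrow> finite (quotient_types j h)"
  by (rule finite_subset[of _ "{i. i dvd j} \<times> carrier G"]) (auto simp: quotient_types_def)

text \<open>Moebius inversion. The (i/l)-th roots of the (j/i)-th roots of \<open>h\<close> are its
  (j/l)-th roots, so the sum becomes one over \<open>l\<close> of the number of (j/l)-th roots,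
  weighted with the sum of mu over the divisors of j/l. Only \<open>l = j\<close> survives, and
  \<open>h\<close> has one first root.\<close>

lemma sum_bcoef:
  assumes fin: "finite (carrier G)" and h: "h \<in> carrier G" and j: "1 \<le> j"
  shows "(\<Sum>(i, g)\<in>quotient_types j h. bcoef G (i, conj_class G g)) = 1"
proof -
  let ?D = "{i. i dvd j}" and ?R = "\<lambda>e h. {g \<in> carrier G. g [^] e = h}"
  have finD: "finite ?D" using j by simp
  have pos: "1 \<le> i" if "i dvd j" for i using that j by (auto simp: Suc_le_eq intro: Nat.gr0I)
  have comp: "(\<Sum>g\<in>?R (j div i) h. nroots (i div l) g) = nroots (j div l) h"
    if i: "i dvd j" and l: "l dvd i" for i l
  proof -
    have e: "(i div l) * (j div i) = j div l"
      using i l pos[OF i] by (auto elim!: dvdE simp: mult_ac)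
    have "?R (j div l) h = (\<Union>g\<in>?R (j div i) h. ?R (i div l) g)"
      by (auto simp: nat_pow_pow e)
    then have "nroots (j div l) h = card (\<Union>g\<in>?R (j div i) h. ?R (i div l) g)" by (simp add: nroots_def)
    also have "\<dots> = (\<Sum>g\<in>?R (j div i) h. card (?R (i div l) g))"
      using fin by (intro card_UN_disjoint) auto
    finally show ?thesis by (simp add: nroots_def)
  qed
  have "(\<Sum>(i, g)\<in>quotient_types j h. bcoef G (i, conj_class G g)) =
      (\<Sum>i\<in>?D. \<Sum>g\<in>?R (j div i) h. bcoef G (i, conj_class G g))"
  proof -
    have "quotient_types j h = Sigma ?D (\<lambda>i. ?R (j div i) h)" by (auto simp: quotient_types_def)
    then show ?thesis using finD fin by (simp add: sum.Sigma)
  qed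
  also have "\<dots> = (\<Sum>i\<in>?D. \<Sum>l | l dvd i. of_int (moebius_mu (i div l)) * of_nat (nroots (j div l) h))"
  proof (rule sum.cong[OF refl])
    fix i assume i: "i \<in> ?D"
    have "(\<Sum>g\<in>?R (j div i) h. bcoef G (i, conj_class G g)) =
        (\<Sum>g\<in>?R (j div i) h. \<Sum>l | l dvd i. of_int (moebius_mu (i div l)) * of_nat (nroots (i div l) g))"
      using pos i by (intro sum.cong bcoef_class[OF fin]) auto
    also have "\<dots> = (\<Sum>l | l dvd i. of_int (moebius_mu (i div l)) * of_nat (\<Sum>g\<in>?R (j div i) h. nroots (i div l) g))"
      by (subst sum.swap) (simp add: sum_distrib_left)
    also have "\<dots> = (\<Sum>l | l dvd i. of_int (moebius_mu (i div l)) * of_nat (nroots (j div l) h))"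
      using i comp by (intro sum.cong) auto
    finally show "(\<Sum>g\<in>?R (j div i) h. bcoef G (i, conj_class G g)) = \<dots>" .
  qed
  also have "\<dots> = (\<Sum>(i, l)\<in>Sigma ?D (\<lambda>i. {l. l dvd i}). of_int (moebius_mu (i div l)) * of_nat (nroots (j div l) h))"
    by (rule sum.Sigma) (use pos finD in \<open>auto simp: Suc_le_eq\<close>)
  \<comment> \<open>Writing \<open>i = l * d\<close> separates the Moebius function from the
    roots.\<close>
  also have "\<dots> = (\<Sum>(l, d)\<in>Sigma ?D (\<lambda>l. {d. d dvd j div l}). of_int (moebius_mu d) * of_nat (nroots (j div l) h))"
  proof -
    let ?A = "Sigma ?D (\<lambda>i. {l. l dvd i})" and ?B = "Sigma ?D (\<lambda>l. {d. d dvd j div l})"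
      and ?f = "\<lambda>(l, d). (l * d, l)"
    have pB: "l > 0" "l dvd j" if "(l, d) \<in> ?B" for l d
    proof -
      show l: "l dvd j" using that by (simp only: mem_Sigma_iff mem_Collect_eq)
      show "l > 0" using pos[OF l] by simp
    qed
    have inj: "inj_on ?f ?B"
    proof (rule inj_onI)
      fix p p' assume p: "p \<in> ?B" "p' \<in> ?B" "?f p = ?f p'"
      obtain l d l' d' where ld: "p = (l, d)" "p' = (l', d')" by (cases p, cases p')
      then have "l > 0" using pB(1) p(1) by simp
      then show "p = p'" using p(3) by (auto simp: ld)
    qed
    have "?f ` ?B = ?A"
    proof (intro equalityI subsetI)
      fix p assume "p \<in> ?f ` ?B"
      then obtain l d where p: "p = (l * d, l)" "(l, d) \<in> ?B" by auto
      then have "l * d dvd l * (j div l)" by (intro mult_dvd_mono) auto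
      then show "p \<in> ?A" using p pB[OF p(2)] by simp
    next
      fix p assume "p \<in> ?A"
      then obtain i l where p: "p = (i, l)" "i dvd j" "l dvd i" by auto
      then have "p = ?f (l, i div l)" by simp
      moreover have "(l, i div l) \<in> ?B" using p dvd_trans[of l i j] by (auto intro: div_dvd_div[THEN iffD2])
      ultimately show "p \<in> ?f ` ?B" by blast
    qed
    then have "(\<Sum>(i, l)\<in>?A. of_int (moebius_mu (i div l)) * of_nat (nroots (j div l) h)) =
        (\<Sum>(i, l)\<in>?f ` ?B. of_int (moebius_mu (i div l)) * (of_nat (nroots (j div l) h) :: rat))" by simp
    also have "\<dots> = (\<Sum>(l, d)\<in>?B. of_int (moebius_mu d) * of_nat (nroots (j div l) h))"
      unfolding sum.reindex[OF inj]
    proof (rule sum.cong[OF refl])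
      fix p assume p: "p \<in> ?B"
      obtain l d where ld: "p = (l, d)" by (cases p)
      then have "l > 0" using pB(1) p by simp
      then show "((\<lambda>(i, l). of_int (moebius_mu (i div l)) * (of_nat (nroots (j div l) h) :: rat)) \<circ> ?f) p =
          (case p of (l, d) \<Rightarrow> of_int (moebius_mu d) * of_nat (nroots (j div l) h))"
        by (simp add: ld)
    qed
    finally show ?thesis .
  qed
  also have "\<dots> = (\<Sum>l\<in>?D. \<Sum>d | d dvd j div l. of_int (moebius_mu d) * of_nat (nroots (j div l) h))"
  proof (rule sum.Sigma[symmetric])
    have "j div l > 0" if "l dvd j" for l using that j pos by (auto simp: div_greater_zero_iff dvd_imp_le Suc_le_eq)
    then show "\<forall>l\<in>?D. finite {d. d dvd j div l}" by auto
  qed (rule finD)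
  also have "\<dots> = (\<Sum>l\<in>?D. if l = j then 1 else 0)"
  proof (rule sum.cong[OF refl])
    fix l assume l: "l \<in> ?D"
    have gt: "j div l > 0" using l j pos by (auto simp: div_greater_zero_iff dvd_imp_le Suc_le_eq)
    have eq1: "j div l = 1 \<longleftrightarrow> l = j" using l j pos[of l] by (auto elim!: dvdE)
    have "(\<Sum>d | d dvd j div l. of_int (moebius_mu d) * of_nat (nroots (j div l) h)) =
        of_int (\<Sum>d | d dvd j div l. moebius_mu d) * (of_nat (nroots (j div l) h) :: rat)"
      by (simp add: sum_distrib_right)
    also have "\<dots> = (if l = j then 1 else 0)"
    proof (cases "l = j")
      case True
      have "{g \<in> carrier G. g [^] (1 :: nat) = h} = {h}" using h by auto
      then have "nroots 1 h = 1" by (simp only: nroots_def) simp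
      then show ?thesis unfolding sum_moebius_mu[OF gt] using True j by simp
    next
      case False
      then show ?thesis unfolding sum_moebius_mu[OF gt] using eq1 by simp
    qed
    finally show "(\<Sum>d | d dvd j div l. of_int (moebius_mu d) * of_nat (nroots (j div l) h)) = (if l = j then 1 else (0 :: rat))" .
  qed
  also have "\<dots> = 1" using finD by (simp add: sum.delta)
  finally show ?thesis .
qed

end

section \<open>Free equivariant partitions\<close>

text \<open>A new cycle of blocks of type \<open>v\<close> next to \<open>a\<close> old ones brings
  the factor \<open>\<kappa> * bcoef G v - a * class_weight G v\<close>. By
  \<open>card_len_ret\<close> the subtracted number counts the old blocks with one given length and
  return element of type \<open>v\<close>; \<open>sum_free_partitions_step\<close> shows what it
  cancels.\<close>

definition gval :: "('a, 'b) monoid_scheme \<Rightarrow> rat \<Rightarrow> (nat \<times> 'a set \<Rightarrow>\<^sub>0 nat) \<Rightarrow> rat" where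
  "gval G \<kappa> = mprod (\<lambda>v a. \<Prod>t<a. \<kappa> * bcoef G v - of_nat t * class_weight G v)"

lemma gval_0 [simp]: "gval G \<kappa> 0 = 1"
  by (simp add: gval_def)

lemma gval_add_single:
  "gval G \<kappa> (m + single v 1) =
    gval G \<kappa> m * (\<kappa> * bcoef G v - of_nat (lookup m v) * class_weight G v)"
proof -
  let ?f = "\<lambda>v a. \<Prod>t<a. \<kappa> * bcoef G v - of_nat t * class_weight G v"
  obtain R where "mprod ?f m = R * ?f v (lookup m v)"
    "mprod ?f (m + single v 1) = R * ?f v (Suc (lookup m v))"
    using mprod_add_single[of ?f m v] by auto
  then show ?thesis by (simp add: gval_def lessThan_Suc mult_ac)
qed

lemma image_funpow: "((`) f ^^ s) K = (f ^^ s) ` K" for f :: "'c \<Rightarrow> 'c"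
  by (induction s) (simp_all add: image_comp)

lemma partition_on_unique: "partition_on U \<rho> \<Longrightarrow> K \<in> \<rho> \<Longrightarrow> K' \<in> \<rho> \<Longrightarrow> z \<in> K \<Longrightarrow> z \<in> K' \<Longrightarrow> K = K'"
  by (auto simp: partition_on_def disjoint_def)

lemma partition_on_block: "partition_on U \<rho> \<Longrightarrow> z \<in> U \<Longrightarrow> \<exists>K\<in>\<rho>. z \<in> K"
  by (auto simp: partition_on_def)

lemma partition_on_sub: "partition_on U \<rho> \<Longrightarrow> K \<in> \<rho> \<Longrightarrow> K \<subseteq> U"
  by (auto simp: partition_on_def)

lemma partition_on_ne: "partition_on U \<rho> \<Longrightarrow> K \<in> \<rho> \<Longrightarrow> K \<noteq> {}"
  by (auto simp: partition_on_def)

context gaut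
begin

text \<open>With \<open>U\<close> the complement of the first component, these are the second
  components of the Dowling elements fixed by \<open>x\<close>.\<close>

definition free_partitions :: "'t set \<Rightarrow> 't set set set" where
  "free_partitions U = {\<rho>. partition_on U \<rho> \<and> (\<forall>g\<in>carrier G. \<forall>K\<in>\<rho>. \<alpha> g ` K \<in> \<rho>) \<and>
     (\<forall>K\<in>\<rho>. x ` K \<in> \<rho>) \<and> (\<forall>g\<in>carrier G. \<forall>K\<in>\<rho>. \<alpha> g ` K = K \<longrightarrow> g = \<one>)}"

lemma x_surj: "stable U \<Longrightarrow> x ` U = U"
  using stable_finite[of U] x_inj by (intro endo_inj_surj) (auto simp: stable_def intro: inj_on_subset)

lemma a_surj: "stable U \<Longrightarrow> g \<in> carrier G \<Longrightarrow> \<alpha> g ` U = U"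
  using stable_finite[of U] a_inj by (intro endo_inj_surj) (auto simp: stable_def intro!: inj_onI)

text \<open>Invariance and freeness of the partition are exactly what makes its blocks a system of
  the same kind, so that all results can be applied to blocks.\<close>

lemma blocks_gaut:
  assumes "stable U" "\<rho> \<in> free_partitions U"
  shows "gaut G (\<lambda>g. (`) (\<alpha> g)) ((`) x) \<rho>"
proof -
  have U: "U \<subseteq> T" using assms(1) by (simp add: stable_def)
  have p: "partition_on U \<rho>" and st: "\<And>g K. g \<in> carrier G \<Longrightarrow> K \<in> \<rho> \<Longrightarrow> \<alpha> g ` K \<in> \<rho>"
    "\<And>K. K \<in> \<rho> \<Longrightarrow> x ` K \<in> \<rho>" and fr: "\<And>g K. g \<in> carrier G \<Longrightarrow> K \<in> \<rho> \<Longrightarrow> \<alpha> g ` K = K \<Longrightarrow> g = \<one>"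
    using assms(2) by (auto simp: free_partitions_def)
  have KT: "K \<subseteq> T" if "K \<in> \<rho>" for K using partition_on_sub[OF p that] U by blast
  show ?thesis
  proof (intro gaut.intro gaut_axioms.intro is_group finG)
    show "finite \<rho>" using p stable_finite[OF assms(1)] finite_elements by blast
    fix K assume K: "K \<in> \<rho>"
    show "\<alpha> \<one> ` K = K" using KT[OF K] a_one by force
    show "\<alpha> (g \<otimes> h) ` K = \<alpha> g ` \<alpha> h ` K" if "g \<in> carrier G" "h \<in> carrier G" for g h
      using KT[OF K] a_mult[OF that] by (force simp: image_image intro!: image_cong)
    show "x ` \<alpha> g ` K = \<alpha> g ` x ` K" if "g \<in> carrier G" for g
      using KT[OF K] x_comm[OF that] by (force simp: image_image intro!: image_cong)
  next
    show "inj_on ((`) x) \<rho>"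
    proof (rule inj_onI)
      fix K K' assume "K \<in> \<rho>" "K' \<in> \<rho>" "x ` K = x ` K'"
      then show "K = K'" using inj_on_image_eq_iff[OF x_inj KT KT] by simp
    qed
  qed (use st fr in auto)
qed

lemma free_partitionsD:
  assumes "\<rho> \<in> free_partitions U"
  shows "partition_on U \<rho>" "g \<in> carrier G \<Longrightarrow> K \<in> \<rho> \<Longrightarrow> \<alpha> g ` K \<in> \<rho>" "K \<in> \<rho> \<Longrightarrow> x ` K \<in> \<rho>"
    "g \<in> carrier G \<Longrightarrow> K \<in> \<rho> \<Longrightarrow> \<alpha> g ` K = K \<Longrightarrow> g = \<one>"
  using assms by (auto simp: free_partitions_def)

lemma free_partitions_pow:
  assumes "\<rho> \<in> free_partitions U" "K \<in> \<rho>"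
  shows "(x ^^ s) ` K \<in> \<rho>"
proof (induction s)
  case (Suc s)
  have "(x ^^ Suc s) ` K = x ` ((x ^^ s) ` K)" by (simp add: image_comp)
  then show ?case using free_partitionsD(3)[OF assms(1) Suc] by simp
qed (use assms in simp)

lemma finite_free_partitions: "stable U \<Longrightarrow> finite (free_partitions U)"
proof (rule finite_subset)
  show "free_partitions U \<subseteq> Pow (Pow U)" by (auto simp: free_partitions_def partition_on_def)
qed (simp add: stable_finite)

abbreviation "btp \<equiv> gaut.tp G (\<lambda>g. (`) (\<alpha> g)) ((`) x)"
abbreviation "blen \<equiv> gaut.len G (\<lambda>g. (`) (\<alpha> g)) ((`) x)"
abbreviation "bret \<equiv> gaut.ret G (\<lambda>g. (`) (\<alpha> g)) ((`) x)"
abbreviation "bty \<equiv> gaut.ty G (\<lambda>g. (`) (\<alpha> g)) ((`) x)"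

text \<open>Freeness comes from the target: a group element fixing a fibre fixes a point of
  \<open>R\<close>. The partitions in \<open>orbit_partition_exists\<close> and
  \<open>attached_bij\<close> are constructed as fibres.\<close>

lemma fibre_partition:
  assumes U: "stable U" and R: "gaut G \<beta> y R" and q: "\<And>z. z \<in> U \<Longrightarrow> q z \<in> R"
    and qa: "\<And>g z. g \<in> carrier G \<Longrightarrow> z \<in> U \<Longrightarrow> q (\<alpha> g z) = \<beta> g (q z)"
    and qx: "\<And>z. z \<in> U \<Longrightarrow> q (x z) = y (q z)"
  defines "\<Phi> \<equiv> \<lambda>r. {z \<in> U. q z = r}"
  shows "\<Phi> ` q ` U \<in> free_partitions U" "bty (\<Phi> ` q ` U) = gaut.ty G \<beta> y (q ` U)"
proof -
  interpret R: gaut G \<beta> y R by fact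
  have UT: "U \<subseteq> T" using U by (simp add: stable_def)
  have Ua: "\<alpha> g z \<in> U" if "g \<in> carrier G" "z \<in> U" for g z using U that by (simp add: stable_def)
  have Ux: "x z \<in> U" if "z \<in> U" for z using U that by (simp add: stable_def)
  have act: "\<alpha> g ` \<Phi> r = \<Phi> (\<beta> g r)" if g: "g \<in> carrier G" and r: "r \<in> R" for g r
  proof (intro equalityI subsetI)
    fix w assume "w \<in> \<alpha> g ` \<Phi> r"
    then show "w \<in> \<Phi> (\<beta> g r)" using g Ua qa by (auto simp: \<Phi>_def)
  next
    fix w assume w: "w \<in> \<Phi> (\<beta> g r)"
    then have "w \<in> U" "w \<in> T" using UT by (auto simp: \<Phi>_def)
    moreover have "q (\<alpha> (inv g) w) = r" using w g qa[of "inv g" w] R.a_inv[OF g r] by (auto simp: \<Phi>_def)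
    ultimately have "\<alpha> (inv g) w \<in> \<Phi> r" using Ua g by (auto simp: \<Phi>_def)
    moreover have "w = \<alpha> g (\<alpha> (inv g) w)" using a_inv'[OF g \<open>w \<in> T\<close>] by simp
    ultimately show "w \<in> \<alpha> g ` \<Phi> r" by blast
  qed
  have actx: "x ` \<Phi> r = \<Phi> (y r)" if r: "r \<in> R" for r
  proof (intro equalityI subsetI)
    fix w assume "w \<in> x ` \<Phi> r"
    then show "w \<in> \<Phi> (y r)" using Ux qx by (auto simp: \<Phi>_def)
  next
    fix w assume w: "w \<in> \<Phi> (y r)"
    then have "w \<in> x ` U" using x_surj[OF U] by (auto simp: \<Phi>_def)
    then obtain z where z: "z \<in> U" "w = x z" by auto
    then have "y (q z) = y r" using w qx by (auto simp: \<Phi>_def)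
    then have "q z = r" using inj_onD[OF R.x_inj] q z r by auto
    then show "w \<in> x ` \<Phi> r" using z by (auto simp: \<Phi>_def)
  qed
  have qU: "q ` U \<subseteq> R" using q by auto
  have part: "partition_on U (\<Phi> ` q ` U)"
    by (rule partition_onI) (auto simp: \<Phi>_def disjnt_def)
  have inj: "inj_on \<Phi> (q ` U)" by (rule inj_onI) (auto simp: \<Phi>_def)
  show fp: "\<Phi> ` q ` U \<in> free_partitions U"
    unfolding free_partitions_def
  proof (intro CollectI conjI ballI impI part)
    fix g K assume g: "g \<in> carrier G" and "K \<in> \<Phi> ` q ` U"
    then obtain z where z: "z \<in> U" "K = \<Phi> (q z)" by auto
    have e: "\<alpha> g ` K = \<Phi> (q (\<alpha> g z))" using act[OF g] q z qa g by simp
    then show "\<alpha> g ` K \<in> \<Phi> ` q ` U" using Ua[OF g z(1)] by auto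
    assume "\<alpha> g ` K = K"
    then have "q (\<alpha> g z) = q z" using e z inj Ua[OF g z(1)] by (auto dest: inj_onD)
    then show "g = \<one>" using R.free[OF g q[OF z(1)]] qa[OF g z(1)] by simp
  next
    fix K assume "K \<in> \<Phi> ` q ` U"
    then obtain z where z: "z \<in> U" "K = \<Phi> (q z)" by auto
    have "x ` K = \<Phi> (q (x z))" using actx q z qx by simp
    then show "x ` K \<in> \<Phi> ` q ` U" using Ux[OF z(1)] by auto
  qed
  have "gaut G \<beta> y (q ` U)"
  proof (rule R.stable_gaut)
    show "R.stable (q ` U)" unfolding R.stable_def using qU Ua Ux qa qx by (auto simp flip: qa qx)
  qed
  then show "bty (\<Phi> ` q ` U) = gaut.ty G \<beta> y (q ` U)"
  proof (rule ty_equivariant[OF _ blocks_gaut[OF U fp]])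
    show "bij_betw \<Phi> (q ` U) (\<Phi> ` q ` U)" using inj by (simp add: bij_betw_def)
    fix z assume "z \<in> q ` U"
    then have "z \<in> R" using qU by blast
    then show "\<Phi> (y z) = x ` \<Phi> z" "\<And>g. g \<in> carrier G \<Longrightarrow> \<Phi> (\<beta> g z) = \<alpha> g ` \<Phi> z"
      using act actx by simp_all
  qed
qed

lemma pow_mult_gen:
  assumes "z \<in> T" "k \<in> carrier G" "(x ^^ l) z = \<alpha> k z"
  shows "(x ^^ (l * q)) z = \<alpha> (k [^] q) z"
proof (induction q)
  case 0
  then show ?case using assms by (simp add: a_one)
next
  case (Suc q)
  have "(x ^^ (l * Suc q)) z = (x ^^ l) ((x ^^ (l * q)) z)" by (simp add: pow_add)
  also have "\<dots> = \<alpha> (k [^] q) (\<alpha> k z)" using Suc assms by (simp add: pow_comm)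
  also have "\<dots> = \<alpha> (k [^] Suc q) z" using assms by (simp add: a_mult)
  finally show ?case .
qed

text \<open>\<open>orb z0\<close> is generated by \<open>z0\<close> with the single relation
  \<open>(x ^^ len z0) z0 = \<alpha> (ret z0) z0\<close>, so an equivariant map out of it may send
  \<open>z0\<close> to any \<open>r\<close> satisfying the same relation.\<close>

lemma equivariant_extension:
  assumes z0: "z0 \<in> T" and R: "gaut G \<beta> y R" and r: "r \<in> R" "(y ^^ len z0) r = \<beta> (ret z0) r"
  shows "\<exists>q. (\<forall>w\<in>orb z0. q w \<in> R \<and> (\<forall>g\<in>carrier G. q (\<alpha> g w) = \<beta> g (q w)) \<and> q (x w) = y (q w)) \<and> q z0 = r"
proof -
  interpret R: gaut G \<beta> y R by fact
  let ?w = "\<lambda>g s. \<alpha> g ((x ^^ s) z0)" and ?r = "\<lambda>g s. \<beta> g ((y ^^ s) r)"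
  note l = len_ret[OF z0]
  \<comment> \<open>Two expressions for the same point differ by a return of \<open>z0\<close>,
    which by \<open>return_iff\<close> is a multiple of the defining relation and hence holds for
    \<open>r\<close> too.\<close>
  have wd: "?r g s = ?r g' s'" if le: "s \<le> s'" and g: "g \<in> carrier G" "g' \<in> carrier G" and eq: "?w g s = ?w g' s'" for g s g' s'
  proof -
    have "(x ^^ s) (\<alpha> g z0) = (x ^^ s) (\<alpha> g' ((x ^^ (s' - s)) z0))"
      using eq le g z0 pow_closed by (simp add: pow_comm flip: pow_add)
    then have "\<alpha> g z0 = \<alpha> g' ((x ^^ (s' - s)) z0)"
      using pow_inj a_closed pow_closed g z0 by blast
    then have "(x ^^ (s' - s)) z0 = \<alpha> (inv g') (\<alpha> g z0)" using a_inv[OF g(2) pow_closed[OF z0]] by metis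
    then have "(x ^^ (s' - s)) z0 = \<alpha> (inv g' \<otimes> g) z0" using a_mult g z0 by simp
    then have d: "len z0 dvd s' - s" "ret z0 [^] ((s' - s) div len z0) = inv g' \<otimes> g"
      using return_iff[OF z0 m_closed[OF inv_closed[OF g(2)] g(1)], THEN iffD1] by blast+
    have "(y ^^ (s' - s)) r = \<beta> (inv g' \<otimes> g) r"
      using R.pow_mult_gen[OF r(1) l(2) r(2), of "(s' - s) div len z0"] d by simp
    then have "\<beta> g' ((y ^^ (s' - s)) r) = \<beta> g r"
      using g r R.a_mult[of g' "inv g' \<otimes> g" r] inv_mult_cancel[of "inv g'" g] by simp
    then have "(y ^^ s) (\<beta> g' ((y ^^ (s' - s)) r)) = (y ^^ s) (\<beta> g r)" by simp
    then show ?thesis using g r le R.pow_closed by (simp add: R.pow_comm flip: R.pow_add)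
  qed
  have wd': "?r g s = ?r g' s'" if "g \<in> carrier G" "g' \<in> carrier G" "?w g s = ?w g' s'" for g s g' s'
    using wd[of s s' g g'] wd[of s' s g' g] that by (cases "s \<le> s'") auto
  define q where "q w = (let p = SOME p. fst p \<in> carrier G \<and> w = ?w (fst p) (snd p) in ?r (fst p) (snd p))" for w
  have q: "q (?w g s) = ?r g s" if g: "g \<in> carrier G" for g s
  proof -
    let ?P = "\<lambda>p. fst p \<in> carrier G \<and> ?w g s = ?w (fst p) (snd p)"
    have "?P (SOME p. ?P p)" by (rule someI[of ?P "(g, s)"]) (simp add: g)
    then show ?thesis
      unfolding q_def Let_def using wd'[OF g, of "fst (SOME p. ?P p)" s "snd (SOME p. ?P p)"] by simp
  qed
  have "q w \<in> R \<and> (\<forall>g\<in>carrier G. q (\<alpha> g w) = \<beta> g (q w)) \<and> q (x w) = y (q w)" if w: "w \<in> orb z0" for w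
  proof -
    obtain g s where g: "g \<in> carrier G" "w = ?w g s" using w unfolding orb_def by blast
    have "q w \<in> R" using g q R.pow_closed R.a_closed r by simp
    moreover have "q (\<alpha> f w) = \<beta> f (q w)" if f: "f \<in> carrier G" for f
    proof -
      have "\<alpha> f w = ?w (f \<otimes> g) s" using f g z0 a_mult pow_closed by simp
      moreover have "?r (f \<otimes> g) s = \<beta> f (?r g s)" using f g r R.a_mult R.pow_closed by simp
      ultimately show ?thesis using q[of "f \<otimes> g" s] q[OF g(1), of s] f g by simp
    qed
    moreover have "q (x w) = y (q w)"
    proof -
      have "x w = ?w g (Suc s)" using g z0 x_comm pow_closed by simp
      then show ?thesis using q[OF g(1), of "Suc s"] q[OF g(1), of s] g r R.x_comm R.pow_closed by simp
    qed
    ultimately show ?thesis by blast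
  qed
  moreover have "q z0 = r" using q[of \<one> 0] a_one z0 R.a_one r by simp
  ultimately show ?thesis by blast
qed

end

text \<open>The cycle of length \<open>i\<close> with return element \<open>g\<close>.\<close>

definition cyc_act :: "('a, 'b) monoid_scheme \<Rightarrow> 'a \<Rightarrow> 'a \<times> nat \<Rightarrow> 'a \<times> nat" where
  "cyc_act G f p = (f \<otimes>\<^bsub>G\<^esub> fst p, snd p)"

definition cyc_rot :: "('a, 'b) monoid_scheme \<Rightarrow> nat \<Rightarrow> 'a \<Rightarrow> 'a \<times> nat \<Rightarrow> 'a \<times> nat" where
  "cyc_rot G i g p = (if Suc (snd p) < i then (fst p, Suc (snd p)) else (fst p \<otimes>\<^bsub>G\<^esub> g, 0))"

text \<open>At the wrap-around the rotation multiplies by \<open>g\<close> on the right, which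
  commutes with the left action. After \<open>i\<close> steps the unit has become \<open>g\<close>,
  that is, \<open>g\<close> applied to the unit.\<close>

lemma cycle_gaut:
  assumes "group G" "finite (carrier G)" "g \<in> carrier G" "1 \<le> i"
  shows "gaut G (cyc_act G) (cyc_rot G i g) (carrier G \<times> {..<i})"
    "gaut.len G (cyc_act G) (cyc_rot G i g) (\<one>\<^bsub>G\<^esub>, 0) = i"
    "gaut.ret G (cyc_act G) (cyc_rot G i g) (\<one>\<^bsub>G\<^esub>, 0) = g"
proof -
  interpret group G by fact
  show ga: "gaut G (cyc_act G) (cyc_rot G i g) (carrier G \<times> {..<i})"
  proof (intro gaut.intro gaut_axioms.intro assms(1,2))
    show "inj_on (cyc_rot G i g) (carrier G \<times> {..<i})"
      using assms by (auto simp: inj_on_def cyc_rot_def split: if_splits)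
    fix f p assume "f \<in> carrier G" "p \<in> carrier G \<times> {..<i}" "cyc_act G f p = p"
    then show "f = \<one>\<^bsub>G\<^esub>" by (auto simp: cyc_act_def)
  qed (use assms in \<open>auto simp: cyc_act_def cyc_rot_def m_assoc\<close>)
  interpret R: gaut G "cyc_act G" "cyc_rot G i g" "carrier G \<times> {..<i}" by fact
  have pw: "(cyc_rot G i g ^^ s) (\<one>\<^bsub>G\<^esub>, 0) = (\<one>\<^bsub>G\<^esub>, s)" if "s < i" for s
    using that by (induction s) (auto simp: cyc_rot_def)
  have "(cyc_rot G i g ^^ i) (\<one>\<^bsub>G\<^esub>, 0) = cyc_rot G i g ((cyc_rot G i g ^^ (i - 1)) (\<one>\<^bsub>G\<^esub>, 0))"
    using assms(4) by (cases i) auto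
  also have "\<dots> = cyc_act G g (\<one>\<^bsub>G\<^esub>, 0)"
    using pw[of "i - 1"] assms by (simp add: cyc_rot_def cyc_act_def)
  finally have 1: "(cyc_rot G i g ^^ i) (\<one>\<^bsub>G\<^esub>, 0) = cyc_act G g (\<one>\<^bsub>G\<^esub>, 0)" .
  have 2: "(cyc_rot G i g ^^ s) (\<one>\<^bsub>G\<^esub>, 0) \<noteq> cyc_act G f (\<one>\<^bsub>G\<^esub>, 0)" if "1 \<le> s" "s < i" for s f
    using pw that by (simp add: cyc_act_def)
  have 0: "(\<one>\<^bsub>G\<^esub>, 0) \<in> carrier G \<times> {..<i}" using assms by auto
  show "gaut.len G (cyc_act G) (cyc_rot G i g) (\<one>\<^bsub>G\<^esub>, 0) = i"
    "gaut.ret G (cyc_act G) (cyc_rot G i g) (\<one>\<^bsub>G\<^esub>, 0) = g"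
    using R.len_ret_eqI[OF 0 assms(4,3) 1 2] by auto
qed

context gaut
begin

section \<open>Free partitions of a single cycle and the quotients of that cycle\<close>

lemma pow_surj: "stable U \<Longrightarrow> (x ^^ s) ` U = U"
proof (induction s)
  case (Suc s)
  have "(x ^^ Suc s) ` U = x ` ((x ^^ s) ` U)" by (simp add: image_comp)
  then show ?case using Suc x_surj by simp
qed simp

lemma a_image_Int:
  assumes U: "stable U" and K: "K \<subseteq> T" and g: "g \<in> carrier G"
  shows "\<alpha> g ` (K \<inter> U) = \<alpha> g ` K \<inter> U"
proof (intro equalityI subsetI)
  fix w assume "w \<in> \<alpha> g ` (K \<inter> U)"
  then show "w \<in> \<alpha> g ` K \<inter> U" using U g by (auto simp: stable_def)
next
  fix w assume "w \<in> \<alpha> g ` K \<inter> U"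
  then obtain z where z: "z \<in> K" "w = \<alpha> g z" "w \<in> U" by auto
  then have "\<alpha> (inv g) w \<in> U" using U g by (simp add: stable_def)
  then show "w \<in> \<alpha> g ` (K \<inter> U)" using z K a_inv[OF g, of z] by auto
qed

lemma pow_image_Int:
  assumes U: "stable U" and K: "K \<subseteq> T"
  shows "(x ^^ s) ` (K \<inter> U) = (x ^^ s) ` K \<inter> U"
proof (intro equalityI subsetI)
  fix w assume "w \<in> (x ^^ s) ` (K \<inter> U)"
  then show "w \<in> (x ^^ s) ` K \<inter> U" using pow_surj[OF U, of s] by auto
next
  fix w assume "w \<in> (x ^^ s) ` K \<inter> U"
  then obtain z where z: "z \<in> K" "w = (x ^^ s) z" "w \<in> U" by auto
  then obtain u where u: "u \<in> U" "w = (x ^^ s) u" using pow_surj[OF U, of s] by blast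
  have "z = u" using pow_inj[of z u s] z u K U by (auto simp: stable_def)
  then show "w \<in> (x ^^ s) ` (K \<inter> U)" using z u by auto
qed

definition block :: "'t set set \<Rightarrow> 't \<Rightarrow> 't set" where
  "block \<rho> z = (THE K. K \<in> \<rho> \<and> z \<in> K)"

lemma block_eq: "partition_on U \<rho> \<Longrightarrow> K \<in> \<rho> \<Longrightarrow> z \<in> K \<Longrightarrow> block \<rho> z = K"
  unfolding block_def by (rule the_equality) (auto dest: partition_on_unique)

lemma block_in:
  assumes "partition_on U \<rho>" "z \<in> U"
  shows "block \<rho> z \<in> \<rho>" "z \<in> block \<rho> z"
proof -
  obtain K where "K \<in> \<rho>" "z \<in> K" using partition_on_block[OF assms] by blast
  then show "block \<rho> z \<in> \<rho>" "z \<in> block \<rho> z" using block_eq[OF assms(1)] by simp_all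
qed

lemma shift_block:
  assumes "\<rho> \<in> free_partitions U" "K \<in> \<rho>" "g \<in> carrier G"
  shows "\<alpha> g ` (x ^^ s) ` K \<in> \<rho>"
  using free_partitionsD(2)[OF assms(1,3)] free_partitions_pow[OF assms(1,2)] by blast

text \<open>Both translates of the block contain the point to which \<open>z\<close> returns, so
  they coincide.\<close>

lemma block_return:
  assumes U: "stable U" and \<rho>: "\<rho> \<in> free_partitions U" and z: "z \<in> U"
  shows "(x ^^ len z) ` block \<rho> z = \<alpha> (ret z) ` block \<rho> z"
proof -
  have zT: "z \<in> T" using U z by (auto simp: stable_def)
  note p = free_partitionsD(1)[OF \<rho>]
  note l = len_ret[OF zT]
  note b = block_in[OF p z]
  have 1: "(x ^^ len z) ` block \<rho> z \<in> \<rho>" by (rule free_partitions_pow[OF \<rho> b(1)])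
  have 2: "\<alpha> (ret z) ` block \<rho> z \<in> \<rho>" by (rule free_partitionsD(2)[OF \<rho> l(2) b(1)])
  have 3: "(x ^^ len z) z \<in> (x ^^ len z) ` block \<rho> z" using b(2) by (rule imageI)
  have 4: "(x ^^ len z) z \<in> \<alpha> (ret z) ` block \<rho> z" unfolding l(3) using b(2) by (rule imageI)
  show ?thesis by (rule partition_on_unique[OF p 1 2 3 4])
qed

lemma orbit_partition_eq:
  assumes z: "z \<in> T" and \<rho>: "\<rho> \<in> free_partitions (orb z)"
  shows "\<rho> = {\<alpha> f ` (x ^^ s) ` block \<rho> z | f s. f \<in> carrier G}"
proof -
  note p = free_partitionsD(1)[OF \<rho>]
  note b = block_in[OF p orb_self[OF z]]
  show ?thesis
  proof (intro equalityI subsetI)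
    fix K assume K: "K \<in> \<rho>"
    then obtain w where w: "w \<in> K" using partition_on_ne[OF p] by blast
    then have "w \<in> orb z" using partition_on_sub[OF p K] by blast
    then obtain f s where f: "f \<in> carrier G" "w = \<alpha> f ((x ^^ s) z)" unfolding orb_def by blast
    have "w \<in> \<alpha> f ` (x ^^ s) ` block \<rho> z" using f b by blast
    then have "K = \<alpha> f ` (x ^^ s) ` block \<rho> z"
      using partition_on_unique[OF p K shift_block[OF \<rho> b(1) f(1)] w] by blast
    then show "K \<in> {\<alpha> f ` (x ^^ s) ` block \<rho> z | f s. f \<in> carrier G}" using f by blast
  next
    fix K assume "K \<in> {\<alpha> f ` (x ^^ s) ` block \<rho> z | f s. f \<in> carrier G}"
    then show "K \<in> \<rho>" using shift_block[OF \<rho> b(1)] by blast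
  qed
qed

text \<open>A translate of \<open>z\<close> lies in the block of \<open>z\<close> iff the same
  translation fixes the block, and by \<open>return_iff\<close> this depends only on the length and
  the return element of the block. These two data therefore determine the partition.\<close>

lemma orbit_partition_block:
  assumes z: "z \<in> T" and \<rho>: "\<rho> \<in> free_partitions (orb z)"
  shows "block \<rho> z = {\<alpha> f ((x ^^ s) z) | f s. f \<in> carrier G \<and>
    blen (block \<rho> z) dvd s \<and> bret (block \<rho> z) [^] (s div blen (block \<rho> z)) = inv f}"
proof -
  let ?K = "block \<rho> z"
  interpret B: gaut G "\<lambda>g. (`) (\<alpha> g)" "(`) x" \<rho> by (rule blocks_gaut[OF stable_orb[OF z] \<rho>])
  note p = free_partitionsD(1)[OF \<rho>]
  note b = block_in[OF p orb_self[OF z]]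
  have iff: "\<alpha> f ((x ^^ s) z) \<in> ?K \<longleftrightarrow> blen ?K dvd s \<and> bret ?K [^] (s div blen ?K) = inv f"
    if f: "f \<in> carrier G" for f s
  proof -
    have m: "\<alpha> f ((x ^^ s) z) \<in> \<alpha> f ` (x ^^ s) ` ?K" using b by blast
    have i: "(x ^^ s) ` ?K \<in> \<rho>" by (rule free_partitions_pow[OF \<rho> b(1)])
    have "\<alpha> f ((x ^^ s) z) \<in> ?K \<longleftrightarrow> \<alpha> f ` (x ^^ s) ` ?K = ?K"
      using partition_on_unique[OF p shift_block[OF \<rho> b(1) f] b(1) m] m by auto
    also have "\<dots> \<longleftrightarrow> (x ^^ s) ` ?K = \<alpha> (inv f) ` ?K"
      using B.a_inv[OF f i] B.a_inv'[OF f b(1)] by metis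
    also have "\<dots> \<longleftrightarrow> blen ?K dvd s \<and> bret ?K [^] (s div blen ?K) = inv f"
      using B.return_iff[OF b(1) inv_closed[OF f], of s] by (simp only: image_funpow)
    finally show ?thesis .
  qed
  show ?thesis
  proof (intro equalityI subsetI)
    fix w assume w: "w \<in> ?K"
    then have "w \<in> orb z" using partition_on_sub[OF p b(1)] by blast
    then obtain f s where f: "f \<in> carrier G" "w = \<alpha> f ((x ^^ s) z)" unfolding orb_def by blast
    then show "w \<in> {\<alpha> f ((x ^^ s) z) | f s. f \<in> carrier G \<and>
      blen ?K dvd s \<and> bret ?K [^] (s div blen ?K) = inv f}" using iff[OF f(1), of s] w by blast
  next
    fix w assume "w \<in> {\<alpha> f ((x ^^ s) z) | f s. f \<in> carrier G \<and>
      blen ?K dvd s \<and> bret ?K [^] (s div blen ?K) = inv f}"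
    then show "w \<in> ?K" using iff by blast
  qed
qed

text \<open>The cycle of \<open>z\<close> maps onto the model cycle of length \<open>i\<close> and
  return element \<open>g\<close>, because after \<open>len z div i\<close> turns the latter has
  moved by \<open>g [^] (len z div i) = ret z\<close>. The fibres form the partition.\<close>

lemma orbit_partition_exists:
  assumes z: "z \<in> T" and D: "(i, g) \<in> quotient_types (len z) (ret z)"
  shows "\<exists>\<rho>\<in>free_partitions (orb z). blen (block \<rho> z) = i \<and> bret (block \<rho> z) = g"
proof -
  note l = len_ret[OF z]
  have i: "i dvd len z" and g: "g \<in> carrier G" "g [^] (len z div i) = ret z"
    using D by (auto simp: quotient_types_def)
  have i1: "1 \<le> i" using i l by (cases i) auto
  let ?\<beta> = "cyc_act G" and ?y = "cyc_rot G i g" and ?R = "carrier G \<times> {..<i}" and ?r = "(\<one>, 0 :: nat)"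
  note c = cycle_gaut[OF is_group finG g(1) i1]
  interpret R: gaut G ?\<beta> ?y ?R by (rule c(1))
  have r: "?r \<in> ?R" using i1 by auto
  have yi: "(?y ^^ i) ?r = ?\<beta> g ?r" using R.len_ret(3)[OF r] by (simp only: c)
  have yl: "(?y ^^ len z) ?r = ?\<beta> (ret z) ?r"
    using R.return_iff[OF r l(2), of "len z"] i g by (simp only: c)
  obtain q where q: "\<And>w. w \<in> orb z \<Longrightarrow> q w \<in> ?R"
    "\<And>f w. f \<in> carrier G \<Longrightarrow> w \<in> orb z \<Longrightarrow> q (\<alpha> f w) = ?\<beta> f (q w)"
    "\<And>w. w \<in> orb z \<Longrightarrow> q (x w) = ?y (q w)" "q z = ?r"
    using equivariant_extension[OF z c(1) r yl] by blast
  let ?\<Phi> = "\<lambda>r. {w \<in> orb z. q w = r}" and ?\<rho> = "(\<lambda>r. {w \<in> orb z. q w = r}) ` q ` orb z"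
  have \<rho>: "?\<rho> \<in> free_partitions (orb z)"
    by (rule fibre_partition(1)[OF stable_orb[OF z] c(1)]) (use q in auto)
  note p = free_partitionsD(1)[OF \<rho>]
  have K: "?\<Phi> ?r \<in> ?\<rho>" by (rule imageI) (rule image_eqI[of _ q z], rule q(4)[symmetric], rule orb_self[OF z])
  have zK: "z \<in> ?\<Phi> ?r" using q(4) orb_self[OF z] by simp
  have bl: "block ?\<rho> z = ?\<Phi> ?r" by (rule block_eq[OF p K zK])
  interpret B: gaut G "\<lambda>g. (`) (\<alpha> g)" "(`) x" ?\<rho> by (rule blocks_gaut[OF stable_orb[OF z] \<rho>])
  have qpow: "q ((x ^^ s) z) = (?y ^^ s) ?r" for s
  proof (induction s)
    case (Suc s)
    have "q (x ((x ^^ s) z)) = ?y (q ((x ^^ s) z))" by (rule q(3)[OF orb_pow[OF z orb_self[OF z]]])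
    then show ?case using Suc by simp
  qed (simp add: q(4))
  have ret_i: "((`) x ^^ i) (?\<Phi> ?r) = \<alpha> g ` ?\<Phi> ?r"
  proof -
    have 1: "(x ^^ i) ` ?\<Phi> ?r \<in> ?\<rho>" by (rule free_partitions_pow[OF \<rho> K])
    have 2: "\<alpha> g ` ?\<Phi> ?r \<in> ?\<rho>" by (rule free_partitionsD(2)[OF \<rho> g(1) K])
    have 3: "(x ^^ i) z \<in> (x ^^ i) ` ?\<Phi> ?r" using zK by (rule imageI)
    let ?u = "\<alpha> (inv g) ((x ^^ i) z)"
    have xi: "(x ^^ i) z \<in> orb z" by (rule orb_pow[OF z orb_self[OF z]])
    have "?u \<in> orb z" using orb_a[OF z xi] g by simp
    moreover have "q ?u = ?r"
      using q(2)[OF inv_closed[OF g(1)] xi] qpow[of i] yi R.a_inv[OF g(1) r] by simp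
    ultimately have "\<alpha> g ?u \<in> \<alpha> g ` ?\<Phi> ?r" by blast
    moreover have "\<alpha> g ?u = (x ^^ i) z" by (rule a_inv'[OF g(1) pow_closed[OF z]])
    ultimately have 4: "(x ^^ i) z \<in> \<alpha> g ` ?\<Phi> ?r" by simp
    show ?thesis unfolding image_funpow by (rule partition_on_unique[OF p 1 2 3 4])
  qed
  have min: "((`) x ^^ s) (?\<Phi> ?r) \<noteq> \<alpha> f ` ?\<Phi> ?r" if s: "1 \<le> s" "s < i" and f: "f \<in> carrier G" for s f
  proof
    assume "((`) x ^^ s) (?\<Phi> ?r) = \<alpha> f ` ?\<Phi> ?r"
    then have "(x ^^ s) z \<in> \<alpha> f ` ?\<Phi> ?r" unfolding image_funpow using zK by blast
    then obtain u where u: "u \<in> orb z" "q u = ?r" "(x ^^ s) z = \<alpha> f u" by auto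
    have "(?y ^^ s) ?r = q (\<alpha> f u)" by (simp only: qpow[symmetric] u(3))
    also have "\<dots> = ?\<beta> f ?r" using q(2)[OF f u(1)] u(2) by simp
    finally have "i dvd s" using R.return_iff[OF r f, of s] by (simp only: c)
    then show False using s by (auto dest: dvd_imp_le)
  qed
  have "blen (block ?\<rho> z) = i \<and> bret (block ?\<rho> z) = g"
    unfolding bl by (rule conjI; rule B.len_ret_eqI[OF K i1 g(1) ret_i min])
  then show ?thesis using \<rho> by (rule bexI)
qed

lemma orbit_partitions_bij:
  assumes z: "z \<in> T"
  shows "bij_betw (\<lambda>\<rho>. (blen (block \<rho> z), bret (block \<rho> z))) (free_partitions (orb z))
    (quotient_types (len z) (ret z))" (is "bij_betw ?f ?A ?B")
proof -
  have "inj_on ?f ?A"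
  proof (rule inj_onI)
    fix \<rho> \<rho>' assume \<rho>: "\<rho> \<in> ?A" "\<rho>' \<in> ?A" and eq: "?f \<rho> = ?f \<rho>'"
    have "block \<rho> z = block \<rho>' z"
      using orbit_partition_block[OF z \<rho>(1)] orbit_partition_block[OF z \<rho>(2)] eq by simp
    then show "\<rho> = \<rho>'"
      using orbit_partition_eq[OF z \<rho>(1)] orbit_partition_eq[OF z \<rho>(2)] by simp
  qed
  moreover have "?f ` ?A \<subseteq> ?B"
  proof
    fix p assume "p \<in> ?f ` ?A"
    then obtain \<rho> where \<rho>: "\<rho> \<in> ?A" and p: "p = ?f \<rho>" by auto
    interpret B: gaut G "\<lambda>g. (`) (\<alpha> g)" "(`) x" \<rho> by (rule blocks_gaut[OF stable_orb[OF z] \<rho>])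
    have b: "block \<rho> z \<in> \<rho>" by (rule block_in[OF free_partitionsD(1)[OF \<rho>] orb_self[OF z]])
    have "((`) x ^^ len z) (block \<rho> z) = \<alpha> (ret z) ` block \<rho> z"
      unfolding image_funpow by (rule block_return[OF stable_orb[OF z] \<rho> orb_self[OF z]])
    then have "blen (block \<rho> z) dvd len z \<and> bret (block \<rho> z) [^] (len z div blen (block \<rho> z)) = ret z"
      by (rule B.return_iff[OF b len_ret(2)[OF z], THEN iffD1])
    then show "p \<in> ?B" using B.len_ret(2)[OF b] by (simp add: p quotient_types_def)
  qed
  moreover have "?B \<subseteq> ?f ` ?A"
  proof
    fix p assume "p \<in> ?B"
    then obtain \<rho> where "\<rho> \<in> ?A" "blen (block \<rho> z) = fst p" "bret (block \<rho> z) = snd p"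
      using orbit_partition_exists[OF z, of "fst p" "snd p"] by auto
    then show "p \<in> ?f ` ?A" by (intro image_eqI[of _ _ \<rho>]) auto
  qed
  ultimately show ?thesis by (auto simp: bij_betw_def)
qed

end

context gaut
begin

section \<open>The effect of one further cycle on free partitions\<close>

lemma free_partitions_Un:
  assumes U: "stable U" and V: "stable V" and disj: "U \<inter> V = {}"
    and R: "R \<in> free_partitions U" and Q: "Q \<in> free_partitions V"
  shows "R \<union> Q \<in> free_partitions (U \<union> V)"
proof -
  note p = free_partitionsD[OF R] and q = free_partitionsD[OF Q]
  have "partition_on (U \<union> V) (R \<union> Q)"
  proof (rule partition_onI)
    show "\<Union>(R \<union> Q) = U \<union> V" using p(1) q(1) by (auto simp: partition_on_def)
    fix K K' assume K: "K \<in> R \<union> Q" "K' \<in> R \<union> Q" "K \<noteq> K'"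
    show "disjnt K K'"
    proof (rule ccontr)
      assume "\<not> disjnt K K'"
      then obtain z where z: "z \<in> K" "z \<in> K'" by (auto simp: disjnt_def)
      have "z \<in> U" if "z \<in> L" "L \<in> R" for L using partition_on_sub[OF p(1) that(2)] that(1) by blast
      moreover have "z \<in> V" if "z \<in> L" "L \<in> Q" for L using partition_on_sub[OF q(1) that(2)] that(1) by blast
      ultimately have "(K \<in> R \<and> K' \<in> R) \<or> (K \<in> Q \<and> K' \<in> Q)" using K(1,2) z disj by blast
      then show False
        using partition_on_unique[OF p(1) _ _ z] partition_on_unique[OF q(1) _ _ z] K(3) by blast
    qed
  next
    show "{} \<notin> R \<union> Q" using p(1) q(1) by (auto simp: partition_on_def)
  qed
  then show ?thesis using p(2-4) q(2-4) unfolding free_partitions_def by auto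
qed

text \<open>Since every block meets \<open>V\<close>, different blocks stay different after
  intersection, and the system of blocks is unchanged up to isomorphism.\<close>

lemma free_partitions_restrict:
  assumes U: "stable U" and V: "stable V" and VU: "V \<subseteq> U" and R: "R \<in> free_partitions U"
    and meet: "\<And>K. K \<in> R \<Longrightarrow> K \<inter> V \<noteq> {}"
  shows "(\<lambda>K. K \<inter> V) ` R \<in> free_partitions V" "bty ((\<lambda>K. K \<inter> V) ` R) = bty R"
    "inj_on (\<lambda>K. K \<inter> V) R"
proof -
  note p = free_partitionsD[OF R]
  have KT: "K \<subseteq> T" if "K \<in> R" for K
    using partition_on_sub[OF p(1) that] U by (auto simp: stable_def)
  have aI: "\<alpha> g ` (K \<inter> V) = \<alpha> g ` K \<inter> V" if "g \<in> carrier G" "K \<in> R" for g K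
    by (rule a_image_Int[OF V KT[OF that(2)] that(1)])
  have xI: "x ` (K \<inter> V) = x ` K \<inter> V" if "K \<in> R" for K
    using pow_image_Int[OF V KT[OF that], of 1] by simp
  have same: "K = K'" if K: "K \<in> R" "K' \<in> R" "K \<inter> V = K' \<inter> V" for K K'
  proof -
    obtain z where "z \<in> K \<inter> V" using meet[OF K(1)] by blast
    then have "z \<in> K" "z \<in> K'" using K(3) by blast+
    then show ?thesis by (rule partition_on_unique[OF p(1) K(1,2)])
  qed
  then show inj: "inj_on (\<lambda>K. K \<inter> V) R" by (rule inj_onI)
  have "partition_on V ((\<lambda>K. K \<inter> V) ` R)"
  proof (rule partition_onI)
    show "\<Union>((\<lambda>K. K \<inter> V) ` R) = V" using p(1) VU by (auto simp: partition_on_def)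
    fix M M' assume "M \<in> (\<lambda>K. K \<inter> V) ` R" "M' \<in> (\<lambda>K. K \<inter> V) ` R" "M \<noteq> M'"
    then obtain K K' where K: "K \<in> R" "K' \<in> R" "K \<noteq> K'" "M = K \<inter> V" "M' = K' \<inter> V" by blast
    have "K \<inter> K' = {}" using partition_on_unique[OF p(1) K(1,2)] K(3) by blast
    then show "disjnt M M'" unfolding disjnt_def K(4,5) by blast
  qed (use meet in auto)
  moreover have "g = \<one>" if g: "g \<in> carrier G" and K: "K \<in> R" and eq: "\<alpha> g ` (K \<inter> V) = K \<inter> V" for g K
    by (rule p(4)[OF g K same[OF p(2)[OF g K] K trans[OF aI[OF g K, symmetric] eq]]])
  ultimately show fp: "(\<lambda>K. K \<inter> V) ` R \<in> free_partitions V"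
    unfolding free_partitions_def using p(2,3) aI xI by auto
  show "bty ((\<lambda>K. K \<inter> V) ` R) = bty R"
  proof (rule ty_equivariant[OF blocks_gaut[OF U R] blocks_gaut[OF V fp]])
    show "bij_betw (\<lambda>K. K \<inter> V) R ((\<lambda>K. K \<inter> V) ` R)" using inj by (simp add: bij_betw_def)
  qed (simp_all add: aI xI)
qed

text \<open>By \<open>return_iff\<close> the condition says that the length and return element of
  \<open>M\<close> form a quotient type of \<open>(l, k)\<close>; \<open>card_len_ret\<close> counts
  the elements for each of them.\<close>

lemma card_return:
  assumes l: "1 \<le> l" and k: "k \<in> carrier G"
  shows "(of_nat (card {M \<in> T. (x ^^ l) M = \<alpha> k M}) :: rat) =
    (\<Sum>(i, g)\<in>quotient_types l k. of_nat (lookup (ty T) (i, conj_class G g)) *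
      class_weight G (i, conj_class G g))"
proof -
  let ?D = "quotient_types l k" and ?S = "\<lambda>p. {M \<in> T. len M = fst p \<and> ret M = snd p}"
  have finD: "finite ?D" by (rule finite_quotient_types[OF finG l])
  have "{M \<in> T. (x ^^ l) M = \<alpha> k M} = (\<Union>p\<in>?D. ?S p)"
  proof (intro equalityI subsetI)
    fix M assume M: "M \<in> {M \<in> T. (x ^^ l) M = \<alpha> k M}"
    then have "M \<in> T" by simp
    then have "(len M, ret M) \<in> ?D"
      using M return_iff[of M k l] k len_ret(2) by (simp add: quotient_types_def)
    moreover have "M \<in> ?S (len M, ret M)" using M by simp
    ultimately show "M \<in> (\<Union>p\<in>?D. ?S p)" by (rule UN_I)
  next
    fix M assume "M \<in> (\<Union>p\<in>?D. ?S p)"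
    then have "M \<in> T" "(len M, ret M) \<in> ?D" by auto
    then show "M \<in> {M \<in> T. (x ^^ l) M = \<alpha> k M}"
      using return_iff[of M k l] k by (simp add: quotient_types_def)
  qed
  then have "card {M \<in> T. (x ^^ l) M = \<alpha> k M} = card (\<Union>p\<in>?D. ?S p)" by (rule arg_cong)
  also have "\<dots> = (\<Sum>p\<in>?D. card (?S p))"
    using finT by (intro card_UN_disjoint finD) auto
  finally have "(of_nat (card {M \<in> T. (x ^^ l) M = \<alpha> k M}) :: rat) = (\<Sum>p\<in>?D. of_nat (card (?S p)))"
    by simp
  also have "\<dots> = (\<Sum>(i, g)\<in>?D. of_nat (lookup (ty T) (i, conj_class G g)) *
      class_weight G (i, conj_class G g))"
  proof (rule sum.cong[OF refl])
    fix p assume p: "p \<in> ?D"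
    obtain i g where ig: "p = (i, g)" by (cases p)
    then have "g \<in> carrier G" using p by (simp add: quotient_types_def)
    then show "of_nat (card (?S p)) = (case p of (i, g) \<Rightarrow>
        of_nat (lookup (ty T) (i, conj_class G g)) * class_weight G (i, conj_class G g))"
      using card_len_ret[OF stable_T] by (simp add: ig)
  qed
  finally show ?thesis .
qed

context
  fixes U z
  assumes U: "stable U" and z: "z \<in> T" and disj: "orb z \<inter> U = {}"
begin

lemma stable_UnZ: "stable (U \<union> orb z)"
  by (rule stable_Un[OF U stable_orb[OF z]])

lemma z_UnZ: "z \<in> U \<union> orb z"
  using orb_self[OF z] by blast

text \<open>Partitions of \<open>U \<union> orb z\<close> in which the orbit \<open>orb z\<close> is separated from \<open>U\<close>.\<close>

lemma separated_bij:
  "bij_betw (\<lambda>(R, Q). R \<union> Q) (free_partitions U \<times> free_partitions (orb z))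
    {R \<in> free_partitions (U \<union> orb z). block R z \<inter> U = {}}" (is "bij_betw ?f ?A ?B")
proof -
  have dUV: "U \<inter> orb z = {}" using disj by blast
  have rec: "R = {K \<in> R \<union> Q. K \<subseteq> U}" "Q = {K \<in> R \<union> Q. K \<subseteq> orb z}"
    if R: "R \<in> free_partitions U" and Q: "Q \<in> free_partitions (orb z)" for R Q
  proof -
    note p = free_partitionsD(1)[OF R] and q = free_partitionsD(1)[OF Q]
    have no: "\<not> K \<subseteq> orb z" if "K \<in> R" for K
      using partition_on_sub[OF p that] partition_on_ne[OF p that] dUV by blast
    have no': "\<not> K \<subseteq> U" if "K \<in> Q" for K
      using partition_on_sub[OF q that] partition_on_ne[OF q that] dUV by blast
    show "R = {K \<in> R \<union> Q. K \<subseteq> U}" using no' partition_on_sub[OF p] by blast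
    show "Q = {K \<in> R \<union> Q. K \<subseteq> orb z}" using no partition_on_sub[OF q] by blast
  qed
  have inj: "inj_on ?f ?A"
  proof (rule inj_onI)
    fix p q assume pq: "p \<in> ?A" "q \<in> ?A" "?f p = ?f q"
    obtain R Q R' Q' where e: "p = (R, Q)" "q = (R', Q')" by (cases p, cases q)
    have eq: "R \<union> Q = R' \<union> Q'" using pq e by simp
    have m: "R \<in> free_partitions U" "Q \<in> free_partitions (orb z)"
      "R' \<in> free_partitions U" "Q' \<in> free_partitions (orb z)" using pq(1,2) unfolding e by blast+
    have "R = R'" using rec(1)[OF m(1,2)] rec(1)[OF m(3,4)] unfolding eq by (rule trans[OF _ sym])
    moreover have "Q = Q'" using rec(2)[OF m(1,2)] rec(2)[OF m(3,4)] unfolding eq by (rule trans[OF _ sym])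
    ultimately show "p = q" unfolding e by (rule arg_cong2)
  qed
  moreover have "?f ` ?A = ?B"
  proof (intro equalityI subsetI)
    fix \<tau> assume "\<tau> \<in> ?f ` ?A"
    then obtain R Q where R: "R \<in> free_partitions U" and Q: "Q \<in> free_partitions (orb z)" and \<tau>: "\<tau> = R \<union> Q" by auto
    have fp: "\<tau> \<in> free_partitions (U \<union> orb z)"
      unfolding \<tau> by (rule free_partitions_Un[OF U stable_orb[OF z] dUV R Q])
    note q = free_partitionsD(1)[OF Q]
    note b = block_in[OF q orb_self[OF z]]
    have "block \<tau> z = block Q z"
      by (rule block_eq[OF free_partitionsD(1)[OF fp]]) (use b \<tau> in auto)
    then have "block \<tau> z \<subseteq> orb z" using partition_on_sub[OF q b(1)] by simp
    then show "\<tau> \<in> ?B" using fp dUV by blast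
  next
    fix \<tau> assume "\<tau> \<in> ?B"
    then have fp: "\<tau> \<in> free_partitions (U \<union> orb z)" and K0: "block \<tau> z \<inter> U = {}" by auto
    note p = free_partitionsD[OF fp]
    note b = block_in[OF p(1) z_UnZ]
    have K0Z: "block \<tau> z \<subseteq> orb z" using partition_on_sub[OF p(1) b(1)] K0 by blast
    \<comment> \<open>Every point of \<open>orb z\<close> is a translate of \<open>z\<close>, so a
      block meeting the orbit is a translate of the block of \<open>z\<close> and stays
      inside.\<close>
    have dich: "K \<subseteq> orb z" if K: "K \<in> \<tau>" and w: "w \<in> K" "w \<in> orb z" for K w
    proof -
      obtain f s where f: "f \<in> carrier G" "w = \<alpha> f ((x ^^ s) z)" using w(2) unfolding orb_def by blast
      have "w \<in> \<alpha> f ` (x ^^ s) ` block \<tau> z" using f b by blast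
      then have "K = \<alpha> f ` (x ^^ s) ` block \<tau> z"
        by (rule partition_on_unique[OF p(1) K shift_block[OF fp b(1) f(1)] w(1)])
      then show ?thesis using K0Z orb_a[OF z orb_pow[OF z] f(1)] by blast
    qed
    define R Q where "R = {K \<in> \<tau>. K \<subseteq> U}" and "Q = {K \<in> \<tau>. K \<subseteq> orb z}"
    have cover: "K \<in> R \<or> K \<in> Q" if "K \<in> \<tau>" for K
      using dich[OF that] partition_on_sub[OF p(1) that] that unfolding R_def Q_def by blast
    have sub: "V \<subseteq> \<Union>{K \<in> \<tau>. K \<subseteq> V}" if V: "V = U \<or> V = orb z" for V
    proof
      fix w assume w: "w \<in> V"
      then have "w \<in> U \<union> orb z" using V by blast
      then obtain K where K: "K \<in> \<tau>" "w \<in> K" using partition_on_block[OF p(1)] by blast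
      have "K \<subseteq> V" using cover[OF K(1)] w K(2) V dUV unfolding R_def Q_def by blast
      then show "w \<in> \<Union>{K \<in> \<tau>. K \<subseteq> V}" using K by blast
    qed
    have res: "{K \<in> \<tau>. K \<subseteq> V} \<in> free_partitions V" if V: "V = U \<or> V = orb z" and st: "stable V" for V
    proof -
      have "partition_on V {K \<in> \<tau>. K \<subseteq> V}"
      proof (rule partition_onI)
        show "\<Union>{K \<in> \<tau>. K \<subseteq> V} = V" using sub[OF V] by blast
        show "{} \<notin> {K \<in> \<tau>. K \<subseteq> V}" using partition_on_ne[OF p(1)] by blast
        fix K K' assume "K \<in> {K \<in> \<tau>. K \<subseteq> V}" "K' \<in> {K \<in> \<tau>. K \<subseteq> V}" "K \<noteq> K'"
        then show "disjnt K K'" using partition_on_unique[OF p(1), of K K'] unfolding disjnt_def by blast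
      qed
      moreover have "\<alpha> g ` K \<subseteq> V" if "g \<in> carrier G" "K \<subseteq> V" for g K using st that unfolding stable_def by blast
      moreover have "x ` K \<subseteq> V" if "K \<subseteq> V" for K using st that unfolding stable_def by blast
      ultimately show ?thesis unfolding free_partitions_def using p(2-4) by auto
    qed
    have "\<tau> = R \<union> Q" using cover unfolding R_def Q_def by blast
    moreover have "(R, Q) \<in> ?A"
      unfolding R_def Q_def using res[of U] res[of "orb z"] U stable_orb[OF z] by simp
    ultimately show "\<tau> \<in> ?f ` ?A" by (intro image_eqI[of _ _ "(R, Q)"]) auto
  qed
  ultimately show ?thesis by (simp add: bij_betw_def)
qed

lemma bty_separated:
  assumes R: "R \<in> free_partitions U" and Q: "Q \<in> free_partitions (orb z)"
  shows "bty (R \<union> Q) = bty R + single (btp (block Q z)) 1"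
proof -
  have dUV: "U \<inter> orb z = {}" using disj by blast
  have fp: "R \<union> Q \<in> free_partitions (U \<union> orb z)"
    by (rule free_partitions_Un[OF U stable_orb[OF z] dUV R Q])
  interpret B: gaut G "\<lambda>g. (`) (\<alpha> g)" "(`) x" "R \<union> Q" by (rule blocks_gaut[OF stable_UnZ fp])
  note b = block_in[OF free_partitionsD(1)[OF Q] orb_self[OF z]]
  have orb: "B.orb (block Q z) = Q"
    unfolding B.orb_def image_funpow by (rule orbit_partition_eq[OF z Q, symmetric])
  have "K \<noteq> K'" if "K \<in> R" "K' \<in> Q" for K K'
    using partition_on_sub[OF free_partitionsD(1)[OF R] that(1)] partition_on_ne[OF free_partitionsD(1)[OF R] that(1)]
      partition_on_sub[OF free_partitionsD(1)[OF Q] that(2)] dUV by blast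
  then have d: "B.orb (block Q z) \<inter> R = {}" unfolding orb by blast
  have "finite R" using B.finT by simp
  moreover have "block Q z \<in> R \<union> Q" using b by simp
  ultimately show ?thesis using B.ty_add_orbit[OF _ _ d] unfolding orb by simp
qed

text \<open>Partitions of \<open>U \<union> orb z\<close> in which the orbit \<open>orb z\<close> is attached to \<open>U\<close>.\<close>

lemma attached_meet:
  assumes R: "R \<in> free_partitions (U \<union> orb z)" and K0: "block R z \<inter> U \<noteq> {}" and K: "K \<in> R"
  shows "K \<inter> U \<noteq> {}"
proof
  assume e: "K \<inter> U = {}"
  note p = free_partitionsD[OF R]
  note b = block_in[OF p(1) z_UnZ]
  obtain w where w: "w \<in> K" using partition_on_ne[OF p(1) K] by blast
  then have "w \<in> orb z" using partition_on_sub[OF p(1) K] e by blast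
  then obtain f s where f: "f \<in> carrier G" "w = \<alpha> f ((x ^^ s) z)" unfolding orb_def by blast
  have "w \<in> \<alpha> f ` (x ^^ s) ` block R z" using f b by blast
  then have Ke: "K = \<alpha> f ` (x ^^ s) ` block R z"
    by (rule partition_on_unique[OF p(1) K shift_block[OF R b(1) f(1)] w])
  obtain u where u: "u \<in> block R z" "u \<in> U" using K0 by blast
  have "(x ^^ s) u \<in> U" using pow_surj[OF U, of s] u(2) by blast
  then have "\<alpha> f ((x ^^ s) u) \<in> U" using U f by (simp add: stable_def)
  then show False using e u unfolding Ke by blast
qed

text \<open>Once the restriction \<open>R1\<close> to \<open>U\<close> is given, all that remains to
  choose is the block \<open>M\<close> of \<open>R1\<close> that \<open>z\<close> joins.
  Equivariance forces \<open>M\<close> to return in the way \<open>z\<close> does, and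
  \<open>equivariant_extension\<close> shows that this suffices.\<close>

lemma attached_bij:
  assumes R1: "R1 \<in> free_partitions U"
  shows "bij_betw (\<lambda>R. block R z \<inter> U)
    {R \<in> free_partitions (U \<union> orb z). block R z \<inter> U \<noteq> {} \<and> (\<lambda>K. K \<inter> U) ` R = R1}
    {M \<in> R1. ((`) x ^^ len z) M = \<alpha> (ret z) ` M}" (is "bij_betw ?L ?E ?M")
proof -
  note p1 = free_partitionsD[OF R1]
  note l = len_ret[OF z]
  have UT: "U \<subseteq> T" and ZT: "orb z \<subseteq> T" using U orb_subset[OF z] by (auto simp: stable_def)
  have KT: "K \<subseteq> T" if "R \<in> free_partitions (U \<union> orb z)" "K \<in> R" for R K
    using partition_on_sub[OF free_partitionsD(1)[OF that(1)] that(2)] UT ZT by blast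
  have shiftI: "\<alpha> f ` (x ^^ s) ` K \<inter> U = \<alpha> f ` (x ^^ s) ` (K \<inter> U)"
    if "R \<in> free_partitions (U \<union> orb z)" "K \<in> R" "f \<in> carrier G" for R K f s
    using a_image_Int[OF U KT[OF that(1) free_partitions_pow[OF that(1,2), of s]] that(3)]
      pow_image_Int[OF U KT[OF that(1,2)], of s] by simp
  \<comment> \<open>A translate of \<open>z\<close> belongs to \<open>K\<close> exactly if the same
    translate of \<open>?L R\<close> is \<open>K \<inter> U\<close>. So every block can be rebuilt
    from data on \<open>U\<close>.\<close>
  have determined: "K = (K \<inter> U) \<union> {w. \<exists>f s. f \<in> carrier G \<and> w = \<alpha> f ((x ^^ s) z) \<and> \<alpha> f ` (x ^^ s) ` ?L R = K \<inter> U}"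
    if R: "R \<in> ?E" and K: "K \<in> R" for R K
  proof -
    have fp: "R \<in> free_partitions (U \<union> orb z)" and K0: "?L R \<noteq> {}" using R by auto
    note p = free_partitionsD[OF fp]
    note b = block_in[OF p(1) z_UnZ]
    have iff: "\<alpha> f ((x ^^ s) z) \<in> K \<longleftrightarrow> \<alpha> f ` (x ^^ s) ` ?L R = K \<inter> U" if f: "f \<in> carrier G" for f s
    proof
      note sb = shift_block[OF fp b(1) f, of s]
      have m: "\<alpha> f ((x ^^ s) z) \<in> \<alpha> f ` (x ^^ s) ` block R z" using b by blast
      { assume "\<alpha> f ((x ^^ s) z) \<in> K"
        then have "\<alpha> f ` (x ^^ s) ` block R z = K" by (rule partition_on_unique[OF p(1) sb K m])
        then show "\<alpha> f ` (x ^^ s) ` ?L R = K \<inter> U" using shiftI[OF fp b(1) f, of s] by simp }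
      assume "\<alpha> f ` (x ^^ s) ` ?L R = K \<inter> U"
      then have e: "\<alpha> f ` (x ^^ s) ` block R z \<inter> U = K \<inter> U" using shiftI[OF fp b(1) f, of s] by simp
      obtain u where "u \<in> K \<inter> U" using attached_meet[OF fp K0 K] by blast
      then have "u \<in> \<alpha> f ` (x ^^ s) ` block R z" "u \<in> K" using e by blast+
      then have "\<alpha> f ` (x ^^ s) ` block R z = K" by (rule partition_on_unique[OF p(1) sb K])
      then show "\<alpha> f ((x ^^ s) z) \<in> K" using m by simp
    qed
    show ?thesis
    proof (intro equalityI subsetI)
      fix w assume w: "w \<in> K"
      show "w \<in> (K \<inter> U) \<union> {w. \<exists>f s. f \<in> carrier G \<and> w = \<alpha> f ((x ^^ s) z) \<and> \<alpha> f ` (x ^^ s) ` ?L R = K \<inter> U}"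
      proof (cases "w \<in> U")
        case False
        then have "w \<in> orb z" using w partition_on_sub[OF p(1) K] by blast
        then obtain f s where f: "f \<in> carrier G" "w = \<alpha> f ((x ^^ s) z)" unfolding orb_def by blast
        then show ?thesis using iff[OF f(1), of s] w by blast
      qed (use w in blast)
    next
      fix w assume "w \<in> (K \<inter> U) \<union> {w. \<exists>f s. f \<in> carrier G \<and> w = \<alpha> f ((x ^^ s) z) \<and> \<alpha> f ` (x ^^ s) ` ?L R = K \<inter> U}"
      then show "w \<in> K" using iff by blast
    qed
  qed
  have inj: "inj_on ?L ?E"
  proof (rule inj_onI)
    fix R R' assume R: "R \<in> ?E" "R' \<in> ?E" and eq: "?L R = ?L R'"
    let ?\<Psi> = "\<lambda>N M. M \<union> {w. \<exists>f s. f \<in> carrier G \<and> w = \<alpha> f ((x ^^ s) z) \<and> \<alpha> f ` (x ^^ s) ` N = M}"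
    have e: "R = ?\<Psi> (?L R) ` R1" if R: "R \<in> ?E" for R
    proof -
      have "R = (\<lambda>K. ?\<Psi> (?L R) (K \<inter> U)) ` R"
        using determined[OF R] by (simp add: image_cong[of R R "\<lambda>K. K" "\<lambda>K. ?\<Psi> (?L R) (K \<inter> U)", symmetric])
      also have "\<dots> = ?\<Psi> (?L R) ` (\<lambda>K. K \<inter> U) ` R" by (simp only: image_image)
      also have "(\<lambda>K. K \<inter> U) ` R = R1" using R by simp
      finally show ?thesis .
    qed
    show "R = R'" using e[OF R(1)] e[OF R(2)] unfolding eq by (rule trans[OF _ sym])
  qed
  moreover have "?L ` ?E \<subseteq> ?M"
  proof
    fix M assume "M \<in> ?L ` ?E"
    then obtain R where R: "R \<in> ?E" and M: "M = ?L R" by blast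
    have fp: "R \<in> free_partitions (U \<union> orb z)" and im: "(\<lambda>K. K \<inter> U) ` R = R1" using R by auto
    note b = block_in[OF free_partitionsD(1)[OF fp] z_UnZ]
    have "M \<in> R1" unfolding M im[symmetric] using b by blast
    moreover have "(x ^^ len z) ` M = \<alpha> (ret z) ` M"
    proof -
      have "(x ^^ len z) ` M = (x ^^ len z) ` block R z \<inter> U" unfolding M by (rule pow_image_Int[OF U KT[OF fp b(1)]])
      also have "\<dots> = \<alpha> (ret z) ` block R z \<inter> U" unfolding block_return[OF stable_UnZ fp z_UnZ] ..
      also have "\<dots> = \<alpha> (ret z) ` M" unfolding M by (rule a_image_Int[OF U KT[OF fp b(1)] l(2), symmetric])
      finally show ?thesis .
    qed
    ultimately show "M \<in> ?M" by (simp add: image_funpow)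
  qed
  moreover have "?M \<subseteq> ?L ` ?E"
  proof
    fix M assume "M \<in> ?M"
    then have M: "M \<in> R1" and Mr: "((`) x ^^ len z) M = \<alpha> (ret z) ` M" by auto
    have ga: "gaut G (\<lambda>g. (`) (\<alpha> g)) ((`) x) R1" by (rule blocks_gaut[OF U R1])
    obtain q where q: "\<And>w. w \<in> orb z \<Longrightarrow> q w \<in> R1"
      "\<And>f w. f \<in> carrier G \<Longrightarrow> w \<in> orb z \<Longrightarrow> q (\<alpha> f w) = \<alpha> f ` q w"
      "\<And>w. w \<in> orb z \<Longrightarrow> q (x w) = x ` q w" "q z = M"
      using equivariant_extension[OF z ga M Mr] by blast
    \<comment> \<open>On old points this is the map to their blocks, on new ones the extension
      sending \<open>z\<close> to \<open>M\<close>; its fibres are the wanted partition.\<close>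
    let ?q = "\<lambda>w. if w \<in> U then block R1 w else q w"
    have zU: "z \<notin> U" using disj orb_self[OF z] by blast
    have bU: "block R1 w \<in> R1" "w \<in> block R1 w" if "w \<in> U" for w using block_in[OF p1(1) that] by auto
    have Ua: "\<alpha> f w \<in> U \<longleftrightarrow> w \<in> U" "x w \<in> U \<longleftrightarrow> w \<in> U" if w: "w \<in> U \<union> orb z" and f: "f \<in> carrier G" for f w
      using U w f disj orb_a[OF z _ f] orb_x[OF z] unfolding stable_def by blast+
    have q1: "?q w \<in> R1" if "w \<in> U \<union> orb z" for w using that bU q(1) by auto
    have q2: "?q (\<alpha> f w) = \<alpha> f ` ?q w" if f: "f \<in> carrier G" and w: "w \<in> U \<union> orb z" for f w
    proof (cases "w \<in> U")
      case True
      have "block R1 (\<alpha> f w) = \<alpha> f ` block R1 w"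
        by (rule block_eq[OF p1(1) p1(2)[OF f bU(1)[OF True]]]) (use bU(2)[OF True] in blast)
      then show ?thesis using True Ua(1)[OF w f] by simp
    next
      case False
      then show ?thesis using q(2)[OF f] w Ua(1)[OF w f] by simp
    qed
    have q3: "?q (x w) = x ` ?q w" if w: "w \<in> U \<union> orb z" for w
    proof (cases "w \<in> U")
      case True
      have "block R1 (x w) = x ` block R1 w"
        by (rule block_eq[OF p1(1) p1(3)[OF bU(1)[OF True]]]) (use bU(2)[OF True] in blast)
      then show ?thesis using True Ua(2)[OF w one_closed] by simp
    next
      case False
      then show ?thesis using q(3) w Ua(2)[OF w one_closed] by simp
    qed
    let ?\<Phi> = "\<lambda>r. {w \<in> U \<union> orb z. ?q w = r}"
    let ?R = "?\<Phi> ` ?q ` (U \<union> orb z)"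
    have fp: "?R \<in> free_partitions (U \<union> orb z)" by (rule fibre_partition(1)[OF stable_UnZ ga q1 q2 q3])
    have \<Phi>U: "?\<Phi> N \<inter> U = N" if N: "N \<in> R1" for N
    proof -
      have "N \<subseteq> U" by (rule partition_on_sub[OF p1(1) N])
      moreover have "block R1 w = N" if "w \<in> N" for w by (rule block_eq[OF p1(1) N that])
      moreover have "w \<in> N" if "w \<in> U" "block R1 w = N" for w using bU(2)[OF that(1)] that(2) by simp
      ultimately show ?thesis by auto
    qed
    have img: "?q ` (U \<union> orb z) = R1"
    proof (intro equalityI subsetI)
      fix N assume N: "N \<in> R1"
      obtain w where w: "w \<in> N" using partition_on_ne[OF p1(1) N] by blast
      then have "w \<in> U" using partition_on_sub[OF p1(1) N] by blast
      moreover from this have "?q w = N" using block_eq[OF p1(1) N w] by simp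
      ultimately show "N \<in> ?q ` (U \<union> orb z)" by (intro image_eqI[of N ?q w]) simp_all
    qed (use q1 in blast)
    have zM: "?q z = M" using zU q(4) by simp
    have bl: "block ?R z = ?\<Phi> M"
    proof (rule block_eq[OF free_partitionsD(1)[OF fp]])
      show "?\<Phi> M \<in> ?R" unfolding img using M by (rule imageI)
      show "z \<in> ?\<Phi> M" using zM z_UnZ by blast
    qed
    then have L: "?L ?R = M" using \<Phi>U[OF M] by simp
    have "(\<lambda>K. K \<inter> U) ` ?R = R1"
    proof -
      have "(\<lambda>K. K \<inter> U) ` ?R = (\<lambda>N. ?\<Phi> N \<inter> U) ` R1" unfolding img by (simp only: image_image)
      also have "\<dots> = (\<lambda>N. N) ` R1" by (rule image_cong[OF refl \<Phi>U])
      finally show ?thesis by simp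
    qed
    moreover have "M \<noteq> {}" by (rule partition_on_ne[OF p1(1) M])
    ultimately have "?R \<in> ?E" using fp L by simp
    then show "M \<in> ?L ` ?E" by (rule image_eqI[rotated]) (rule L[symmetric])
  qed
  ultimately show ?thesis unfolding bij_betw_def by blast
qed

text \<open>The new cycle is either attached to old blocks, one way for each block with the right
  return, or it gets a new cycle of blocks of some quotient type. In the second case
  \<open>gval\<close> gains a factor whose subtracted part, summed over the quotient types, is the
  number of ways in the first case. The two cancel, and \<open>sum_bcoef\<close> reduces the rest to
  the factor \<open>\<kappa>\<close>.\<close>

lemma sum_free_partitions_step:
  "(\<Sum>R\<in>free_partitions (U \<union> orb z). gval G \<kappa> (bty R)) =
    \<kappa> * (\<Sum>R\<in>free_partitions U. gval G \<kappa> (bty R))"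
proof -
  let ?F = "free_partitions (U \<union> orb z)" and ?FU = "free_partitions U" and ?FZ = "free_partitions (orb z)"
  let ?D = "quotient_types (len z) (ret z)" and ?g = "gval G \<kappa>"
  let ?v = "\<lambda>(i, g). (i, conj_class G g)"
  let ?A1 = "{R \<in> ?F. block R z \<inter> U \<noteq> {}}" and ?A2 = "{R \<in> ?F. block R z \<inter> U = {}}"
  note l = len_ret[OF z]
  have finF: "finite ?F" "finite ?FU" using finite_free_partitions stable_UnZ U by auto
  have split: "sum (\<lambda>R. ?g (bty R)) ?F = sum (\<lambda>R. ?g (bty R)) ?A1 + sum (\<lambda>R. ?g (bty R)) ?A2"
  proof -
    have "?F = ?A1 \<union> ?A2" by blast
    then show ?thesis using sum.union_disjoint[of ?A1 ?A2 "\<lambda>R. ?g (bty R)"] finF by auto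
  qed
  have "sum (\<lambda>R. ?g (bty R)) ?A1 = (\<Sum>R1\<in>?FU. \<Sum>R | R \<in> ?A1 \<and> (\<lambda>K. K \<inter> U) ` R = R1. ?g (bty R))"
  proof (rule sum.group[symmetric])
    show "(\<lambda>R. (\<lambda>K. K \<inter> U) ` R) ` ?A1 \<subseteq> ?FU"
    proof
      fix R1 assume "R1 \<in> (\<lambda>R. (\<lambda>K. K \<inter> U) ` R) ` ?A1"
      then obtain R where R: "R \<in> ?F" "block R z \<inter> U \<noteq> {}" "R1 = (\<lambda>K. K \<inter> U) ` R" by blast
      show "R1 \<in> ?FU" unfolding R(3)
        by (rule free_partitions_restrict(1)[OF stable_UnZ U Un_upper1 R(1) attached_meet[OF R(1,2)]])
    qed
  qed (use finF in auto)
  also have "\<dots> = (\<Sum>R1\<in>?FU. ?g (bty R1) *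
      (\<Sum>p\<in>?D. of_nat (lookup (bty R1) (?v p)) * class_weight G (?v p)))"
  proof (rule sum.cong[OF refl])
    fix R1 assume R1: "R1 \<in> ?FU"
    interpret B: gaut G "\<lambda>g. (`) (\<alpha> g)" "(`) x" R1 by (rule blocks_gaut[OF U R1])
    let ?E = "{R \<in> ?F. block R z \<inter> U \<noteq> {} \<and> (\<lambda>K. K \<inter> U) ` R = R1}"
    have E: "{R. R \<in> ?A1 \<and> (\<lambda>K. K \<inter> U) ` R = R1} = ?E" by blast
    have "bty R = bty R1" if "R \<in> ?E" for R
    proof -
      have R: "R \<in> ?F" "block R z \<inter> U \<noteq> {}" "(\<lambda>K. K \<inter> U) ` R = R1" using that by blast+
      show ?thesis
        using free_partitions_restrict(2)[OF stable_UnZ U Un_upper1 R(1) attached_meet[OF R(1,2)]]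
        unfolding R(3) by (rule sym)
    qed
    then have 1: "(\<Sum>R\<in>?E. ?g (bty R)) = of_nat (card ?E) * ?g (bty R1)" by simp
    have 2: "card ?E = card {M \<in> R1. ((`) x ^^ len z) M = \<alpha> (ret z) ` M}"
      by (rule bij_betw_same_card[OF attached_bij[OF R1]])
    have 3: "of_nat (card {M \<in> R1. ((`) x ^^ len z) M = \<alpha> (ret z) ` M}) =
        (\<Sum>p\<in>?D. of_nat (lookup (bty R1) (?v p)) * class_weight G (?v p))"
      unfolding B.card_return[OF l(1,2)] by (rule sum.cong) auto
    show "(\<Sum>R | R \<in> ?A1 \<and> (\<lambda>K. K \<inter> U) ` R = R1. ?g (bty R)) = ?g (bty R1) *
      (\<Sum>p\<in>?D. of_nat (lookup (bty R1) (?v p)) * class_weight G (?v p))"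
      unfolding E 1 2 3 by (rule mult.commute)
  qed
  finally have A1: "sum (\<lambda>R. ?g (bty R)) ?A1 = \<dots>" .
  have "sum (\<lambda>R. ?g (bty R)) ?A2 = (\<Sum>p\<in>?FU \<times> ?FZ. ?g (bty (fst p \<union> snd p)))"
    using sum.reindex_bij_betw[OF separated_bij, of "\<lambda>R. ?g (bty R)"] by (simp add: case_prod_unfold)
  also have "\<dots> = (\<Sum>R\<in>?FU. \<Sum>Q\<in>?FZ. ?g (bty (R \<union> Q)))"
    by (simp add: sum.cartesian_product case_prod_unfold)
  also have "\<dots> = (\<Sum>R1\<in>?FU. ?g (bty R1) *
      (\<Sum>p\<in>?D. \<kappa> * bcoef G (?v p) - of_nat (lookup (bty R1) (?v p)) * class_weight G (?v p)))"
  proof (rule sum.cong[OF refl])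
    fix R1 assume R1: "R1 \<in> ?FU"
    let ?h = "\<lambda>v. \<kappa> * bcoef G v - of_nat (lookup (bty R1) v) * class_weight G v"
    have "(\<Sum>Q\<in>?FZ. ?g (bty (R1 \<union> Q))) = (\<Sum>Q\<in>?FZ. ?g (bty R1) * ?h (?v (blen (block Q z), bret (block Q z))))"
    proof (rule sum.cong[OF refl])
      fix Q assume Q: "Q \<in> ?FZ"
      interpret B: gaut G "\<lambda>g. (`) (\<alpha> g)" "(`) x" Q by (rule blocks_gaut[OF stable_orb[OF z] Q])
      show "?g (bty (R1 \<union> Q)) = ?g (bty R1) * ?h (?v (blen (block Q z), bret (block Q z)))"
        unfolding bty_separated[OF R1 Q] gval_add_single by (simp add: B.tp_def)
    qed
    also have "\<dots> = (\<Sum>p\<in>?D. ?g (bty R1) * ?h (?v p))"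
      by (rule sum.reindex_bij_betw[OF orbit_partitions_bij[OF z]])
    finally show "(\<Sum>Q\<in>?FZ. ?g (bty (R1 \<union> Q))) = ?g (bty R1) * (\<Sum>p\<in>?D. ?h (?v p))"
      by (simp only: sum_distrib_left)
  qed
  finally have A2: "sum (\<lambda>R. ?g (bty R)) ?A2 = \<dots>" .
  have one: "(\<Sum>p\<in>?D. bcoef G (?v p)) = 1"
    using sum_bcoef[OF finG l(2,1)] by (simp add: case_prod_unfold)
  have "sum (\<lambda>R. ?g (bty R)) ?F = (\<Sum>R1\<in>?FU. ?g (bty R1) * (\<Sum>p\<in>?D. \<kappa> * bcoef G (?v p)))"
    unfolding split A1 A2 sum.distrib[symmetric] distrib_left[symmetric] by simp
  also have "\<dots> = \<kappa> * (\<Sum>R\<in>?FU. ?g (bty R))"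
    unfolding sum_distrib_left[symmetric] one by (simp add: sum_distrib_left mult.commute)
  finally show ?thesis .
qed

end

theorem sum_free_partitions:
  assumes "stable U"
  shows "(\<Sum>R\<in>free_partitions U. gval G \<kappa> (bty R)) = \<kappa> ^ ncyc U"
  using assms
proof (induction rule: orbit_induct)
  case empty
  have "stable {}" by (simp add: stable_def)
  have "free_partitions {} = {{}}" by (auto simp: free_partitions_def partition_on_empty)
  moreover have "bty {} = 0" 
    using gaut.ty_empty[OF blocks_gaut[OF \<open>stable {}\<close>, of "{}"]] calculation by simp
  ultimately show ?case by (simp add: ncyc_def)
next
  case (orbit U z)
  then show ?case using sum_free_partitions_step[OF orbit(1-3)] ncyc_add_orbit[OF orbit(1-3)] by simp
qed

end

section \<open>Wreath products and characteristics\<close>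

text \<open>Arbitrary sets of labels, because the induction in \<open>card_wty\<close> removes the
  labels of one cycle.\<close>

definition label_wreath :: "('a, 'b) monoid_scheme \<Rightarrow> nat set \<Rightarrow> ('a \<times> nat \<Rightarrow> 'a \<times> nat) set" where
  "label_wreath G L = {x. x permutes (carrier G \<times> L) \<and>
     (\<forall>g\<in>carrier G. \<forall>z\<in>carrier G \<times> L. x (act G g z) = act G g (x z))}"

lemma wreath_label: "wreath G n = label_wreath G {1..n}"
  by (simp add: wreath_def label_wreath_def)

abbreviation wty :: "('a, 'b) monoid_scheme \<Rightarrow> nat set \<Rightarrow> ('a \<times> nat \<Rightarrow> 'a \<times> nat) \<Rightarrow> nat \<times> 'a set \<Rightarrow>\<^sub>0 nat" where
  "wty G L x \<equiv> gaut.ty G (act G) x (carrier G \<times> L)"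

text \<open>The order of the centralizer of an element of cycle type \<open>m\<close> in the wreath
  product.\<close>

definition centralizer_order :: "('a, 'b) monoid_scheme \<Rightarrow> (nat \<times> 'a set \<Rightarrow>\<^sub>0 nat) \<Rightarrow> rat" where
  "centralizer_order G = mprod (\<lambda>v k. class_weight G v ^ k * fact k)"

lemma centralizer_order_add_single:
  "centralizer_order G (m + single v 1) =
    centralizer_order G m * (class_weight G v * of_nat (Suc (lookup m v)))"
proof -
  let ?f = "\<lambda>v k. class_weight G v ^ k * fact k"
  obtain R where "mprod ?f m = R * ?f v (lookup m v)"
    "mprod ?f (m + single v 1) = R * ?f v (Suc (lookup m v))"
    using mprod_add_single[of ?f m v] by auto
  then show ?thesis by (simp add: centralizer_order_def mult_ac)
qed

locale fin_group = group G for G :: "('a, 'b) monoid_scheme" (structure) +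
  assumes finite_G: "finite (carrier G)"
begin

lemma wreath_gaut:
  assumes "finite L" "x \<in> label_wreath G L"
  shows "gaut G (act G) x (carrier G \<times> L)"
proof -
  have p: "x permutes (carrier G \<times> L)" and c: "\<And>g z. g \<in> carrier G \<Longrightarrow> z \<in> carrier G \<times> L \<Longrightarrow> x (act G g z) = act G g (x z)"
    using assms(2) by (auto simp: label_wreath_def)
  show ?thesis
  proof (intro gaut.intro gaut_axioms.intro is_group finite_G)
    show "inj_on x (carrier G \<times> L)" using permutes_inj[OF p] by (rule inj_on_subset) simp
    fix g z assume "g \<in> carrier G" "z \<in> carrier G \<times> L" "act G g z = z"
    then show "g = \<one>" by (auto simp: act_def)
  qed (use assms(1) finite_G c permutes_in_image[OF p] in \<open>auto simp: act_def m_assoc\<close>)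
qed

lemma label_wreathI:
  assumes "bij_betw x (carrier G \<times> L) (carrier G \<times> L)" "\<And>z. z \<notin> carrier G \<times> L \<Longrightarrow> x z = z"
    "\<And>g z. g \<in> carrier G \<Longrightarrow> z \<in> carrier G \<times> L \<Longrightarrow> x (act G g z) = act G g (x z)"
  shows "x \<in> label_wreath G L"
  unfolding label_wreath_def using bij_imp_permutes[OF assms(1,2)] assms(3) by simp

text \<open>The possible stretches of \<open>i\<close> successive points on a cycle of length
  \<open>i\<close>. Their labels are distinct, since points with equal labels lie in one G-orbit and
  would give an earlier return.\<close>

definition traces :: "nat set \<Rightarrow> nat \<Rightarrow> ('a \<times> nat) list set" where
  "traces L i = {ws. set ws \<subseteq> carrier G \<times> L \<and> length ws = i \<and> distinct (map snd ws)}"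

text \<open>The labels form an injective word and the group elements an arbitrary one. The factorial
  of the remaining labels is kept on the left because \<open>card_wty\<close> meets the count in
  this form.\<close>

lemma card_traces:
  assumes L: "finite L" and i: "i \<le> card L"
  shows "card (traces L i) * fact (card L - i) = order G ^ i * fact (card L)"
proof -
  let ?A = "{gs. set gs \<subseteq> carrier G \<and> length gs = i}" and ?B = "{ls. length ls = i \<and> distinct ls \<and> set ls \<subseteq> L}"
  have "bij_betw (\<lambda>ws. (map fst ws, map snd ws)) (traces L i) (?A \<times> ?B)"
  proof (rule bij_betw_byWitness[of _ "\<lambda>(gs, ls). zip gs ls"])
    show "\<forall>p\<in>?A \<times> ?B. (\<lambda>ws. (map fst ws, map snd ws)) (case p of (gs, ls) \<Rightarrow> zip gs ls) = p" by auto
    show "(\<lambda>ws. (map fst ws, map snd ws)) ` traces L i \<subseteq> ?A \<times> ?B" by (fastforce simp: traces_def)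
    show "(\<lambda>(gs, ls). zip gs ls) ` (?A \<times> ?B) \<subseteq> traces L i"
      by (fastforce simp: traces_def dest: set_zip_leftD set_zip_rightD)
  qed (auto simp: zip_map_fst_snd)
  then have "card (traces L i) = card ?A * card ?B" by (simp add: bij_betw_same_card card_cartesian_product)
  also have "card ?A = order G ^ i" by (simp add: card_lists_length_eq[OF finite_G] order_def)
  also have "card ?B = \<Prod>{card L - i + 1..card L}" by (rule card_lists_distinct_length_eq[OF L i])
  also have "\<dots> = fact (card L) div fact (card L - i)" using fact_div_fact[of "card L - i" "card L"] i by simp
  finally have "card (traces L i) = order G ^ i * (fact (card L) div fact (card L - i))" .
  moreover have "fact (card L - i) dvd (fact (card L) :: nat)" by (rule fact_dvd) simp
  ultimately show ?thesis by simp
qed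

text \<open>The list prescribes all steps of the cycle but the last; the return element
  \<open>h\<close> closes it.\<close>

definition traced :: "nat set \<Rightarrow> ('a \<times> nat) list \<Rightarrow> 'a \<Rightarrow> ('a \<times> nat \<Rightarrow> 'a \<times> nat) set" where
  "traced L ws h = {x \<in> label_wreath G L. (\<forall>s<length ws. (x ^^ s) (ws ! 0) = ws ! s) \<and>
     gaut.len G (act G) x (ws ! 0) = length ws \<and> gaut.ret G (act G) x (ws ! 0) = h}"

context
  fixes L :: "nat set" and ws :: "('a \<times> nat) list" and h :: 'a
  assumes L: "finite L" and ws: "ws \<in> traces L (length ws)" "1 \<le> length ws" and h: "h \<in> carrier G"
begin

private abbreviation "i \<equiv> length ws"
private abbreviation "M \<equiv> L - snd ` set ws"
private abbreviation "Zs \<equiv> carrier G \<times> snd ` set ws"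
private abbreviation "e \<equiv> \<lambda>p. act G (fst p) (ws ! snd p)"
private abbreviation "C \<equiv> carrier G \<times> {..<i}"

lemma ws_in: "s < i \<Longrightarrow> ws ! s \<in> carrier G \<times> L"
  using ws by (auto simp: traces_def)

lemma ws0: "ws ! 0 \<in> carrier G \<times> L"
  by (rule ws_in) (use ws(2) in linarith)

lemma e_bij: "bij_betw e C Zs"
proof -
  have "inj_on e C"
  proof (rule inj_onI)
    fix p q assume pq: "p \<in> C" "q \<in> C" "e p = e q"
    obtain a s b t where e: "p = (a, s)" "q = (b, t)" by (cases p, cases q)
    have "map snd ws ! s = map snd ws ! t" using pq e by (auto simp: act_def)
    then have "s = t" using pq e ws nth_eq_iff_index_eq[of "map snd ws" s t] by (auto simp: traces_def)
    moreover from this have "a \<otimes> fst (ws ! s) = b \<otimes> fst (ws ! s)" using pq e by (auto simp: act_def)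
    ultimately show "p = q" using pq e ws_in[of s] by auto
  qed
  moreover have "e ` C = Zs"
  proof (intro equalityI subsetI)
    fix w assume "w \<in> e ` C"
    then show "w \<in> Zs" using ws_in by (force simp: act_def)
  next
    fix w assume "w \<in> Zs"
    then have "fst w \<in> carrier G" "snd w \<in> set (map snd ws)" by (simp_all add: mem_Times_iff)
    then obtain a s where w: "w = (a, snd (ws ! s))" "a \<in> carrier G" "s < i"
      unfolding in_set_conv_nth by (metis length_map nth_map prod.collapse)
    have f: "fst (ws ! s) \<in> carrier G" using ws_in[OF w(3)] by auto
    have "w = e (a \<otimes> inv fst (ws ! s), s)" using w f by (simp add: act_def m_assoc)
    then show "w \<in> e ` C" using w f by (intro image_eqI[of w e "(a \<otimes> inv fst (ws ! s), s)"]) auto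
  qed
  ultimately show ?thesis by (simp add: bij_betw_def)
qed

lemma cycle_C: "gaut G (cyc_act G) (cyc_rot G i h) C"
  by (rule cycle_gaut(1)[OF is_group finite_G h ws(2)])

lemma e_act: "f \<in> carrier G \<Longrightarrow> p \<in> C \<Longrightarrow> e (cyc_act G f p) = act G f (e p)"
  using ws_in by (auto simp: cyc_act_def act_def m_assoc mem_Times_iff)

lemma traced_on_cycle:
  assumes x: "x \<in> traced L ws h" and p: "p \<in> C"
  shows "x (e p) = e (cyc_rot G i h p)"
proof -
  have xW: "x \<in> label_wreath G L" and pw: "\<And>s. s < i \<Longrightarrow> (x ^^ s) (ws ! 0) = ws ! s"
    and lr: "gaut.len G (act G) x (ws ! 0) = i" "gaut.ret G (act G) x (ws ! 0) = h"
    using x by (auto simp: traced_def)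
  interpret A: gaut G "act G" x "carrier G \<times> L" by (rule wreath_gaut[OF L xW])
  obtain a s where as: "p = (a, s)" "a \<in> carrier G" "s < i" using p by auto
  note z = ws0
  have xe: "x (e p) = act G a (x (ws ! s))" using A.x_comm[OF as(2) ws_in[OF as(3)]] as by simp
  have xs: "x (ws ! s) = (x ^^ Suc s) (ws ! 0)" using pw[OF as(3)] by simp
  show ?thesis
  proof (cases "Suc s < i")
    case True
    then show ?thesis unfolding xe xs using pw[OF True] as by (simp add: cyc_rot_def)
  next
    case False
    then have "Suc s = i" using as by simp
    then have "x (ws ! s) = act G h (ws ! 0)" unfolding xs using A.len_ret(3)[OF z] lr by simp
    then show ?thesis unfolding xe using False as z h by (simp add: cyc_rot_def A.a_mult)
  qed
qed

text \<open>\<open>e\<close> identifies the model cycle with the points over the labels of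
  \<open>ws\<close>. The rotation is transported along it, and \<open>y\<close> is kept on the other
  points.\<close>

definition glue :: "('a \<times> nat \<Rightarrow> 'a \<times> nat) \<Rightarrow> 'a \<times> nat \<Rightarrow> 'a \<times> nat" where
  "glue y w = (if w \<in> Zs then e (cyc_rot G i h (inv_into C e w)) else y w)"

lemma glue_e: "p \<in> C \<Longrightarrow> glue y (e p) = e (cyc_rot G i h p)"
proof -
  assume p: "p \<in> C"
  have "e p \<in> Zs" using bij_betwE[OF e_bij] p by (rule bspec)
  then show ?thesis using bij_betw_inv_into_left[OF e_bij p] by (simp only: glue_def if_True)
qed

lemma Zs_repr: "w \<in> Zs \<Longrightarrow> \<exists>p\<in>C. w = e p"
  using bij_betw_imp_surj_on[OF e_bij] by blast

lemma labels_split: "carrier G \<times> L = Zs \<union> carrier G \<times> M" "Zs \<inter> carrier G \<times> M = {}"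
  using ws by (auto simp: traces_def)

lemma glue_traced:
  assumes y: "y \<in> label_wreath G M"
  shows "glue y \<in> traced L ws h" "w \<in> carrier G \<times> M \<Longrightarrow> glue y w = y w"
proof -
  interpret R: gaut G "cyc_act G" "cyc_rot G i h" C by (rule cycle_C)
  have yp: "y permutes (carrier G \<times> M)" using y by (simp add: label_wreath_def)
  show off: "glue y w = y w" if "w \<in> carrier G \<times> M" for w using that labels_split(2) by (auto simp: glue_def)
  have rotC: "bij_betw (cyc_rot G i h) C C"
    using R.x_inj R.x_surj[OF R.stable_T] by (simp add: bij_betw_def)
  have "bij_betw (glue y) Zs Zs"
  proof -
    have "bij_betw (e \<circ> cyc_rot G i h \<circ> inv_into C e) Zs Zs"
      by (rule bij_betw_trans[OF bij_betw_inv_into[OF e_bij] bij_betw_trans[OF rotC e_bij]])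
    then show ?thesis by (rule bij_betw_cong[THEN iffD1, rotated]) (simp add: glue_def)
  qed
  moreover have "bij_betw (glue y) (carrier G \<times> M) (carrier G \<times> M)"
    using permutes_imp_bij[OF yp] by (rule bij_betw_cong[THEN iffD1, rotated]) (simp add: off)
  ultimately have bij: "bij_betw (glue y) (carrier G \<times> L) (carrier G \<times> L)"
    unfolding labels_split(1) using labels_split(2) by (intro bij_betw_combine)
  have W: "glue y \<in> label_wreath G L"
  proof (rule label_wreathI[OF bij])
    fix z assume "z \<notin> carrier G \<times> L"
    then have "z \<notin> Zs" "z \<notin> carrier G \<times> M" using labels_split(1) by auto
    then show "glue y z = z" using permutes_not_in[OF yp] by (simp add: glue_def)
  next
    fix g z assume g: "g \<in> carrier G" and z: "z \<in> carrier G \<times> L"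
    show "glue y (act G g z) = act G g (glue y z)"
    proof (cases "z \<in> Zs")
      case True
      then obtain p where p: "p \<in> C" "z = e p" using Zs_repr by blast
      have "act G g z = e (cyc_act G g p)" using e_act[OF g p(1)] p by simp
      then have "glue y (act G g z) = e (cyc_rot G i h (cyc_act G g p))" using glue_e R.a_closed[OF g p(1)] by simp
      also have "\<dots> = e (cyc_act G g (cyc_rot G i h p))" using R.x_comm[OF g p(1)] by simp
      also have "\<dots> = act G g (e (cyc_rot G i h p))" by (rule e_act[OF g R.x_closed[OF p(1)]])
      also have "\<dots> = act G g (glue y z)" using glue_e[OF p(1)] p by simp
      finally show ?thesis .
    next
      case False
      then have zM: "z \<in> carrier G \<times> M" using z labels_split(1) by auto
      then have "act G g z \<in> carrier G \<times> M" using g by (simp add: act_def mem_Times_iff)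
      moreover have "y (act G g z) = act G g (y z)" using y g zM unfolding label_wreath_def by blast
      ultimately show ?thesis using off zM by simp
    qed
  qed
  interpret A: gaut G "act G" "glue y" "carrier G \<times> L" by (rule wreath_gaut[OF L W])
  have sub: "e ` C \<subseteq> carrier G \<times> L" using e_bij labels_split(1) by (auto simp: bij_betw_def)
  have inj: "inj_on e C" using e_bij by (simp add: bij_betw_def)
  have 0: "(\<one>, 0) \<in> C" using ws(2) by auto
  have e0: "e (\<one>, 0) = ws ! 0" using ws0 by (simp add: act_def mem_Times_iff prod_eq_iff)
  note lr = len_ret_equivariant[OF cycle_C A.gaut_axioms inj sub e_act glue_e[symmetric] 0]
  have "A.len (ws ! 0) = i" "A.ret (ws ! 0) = h"
    using lr cycle_gaut(2,3)[OF is_group finite_G h ws(2)] unfolding e0 by simp_all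
  moreover have "(glue y ^^ s) (ws ! 0) = ws ! s" if "s < i" for s
    using that
  proof (induction s)
    case (Suc s)
    then have s: "(\<one>, s) \<in> C" by auto
    have "e (\<one>, s) = ws ! s" using ws_in[of s] Suc.prems by (auto simp: act_def)
    then have "glue y (ws ! s) = e (cyc_rot G i h (\<one>, s))" using glue_e[OF s, of y] by simp
    also have "\<dots> = ws ! Suc s" using ws_in[of "Suc s"] Suc.prems by (auto simp: cyc_rot_def act_def)
    finally show ?case using Suc by simp
  qed simp
  ultimately show "glue y \<in> traced L ws h" using W by (simp add: traced_def)
qed

lemma traced_rest:
  assumes x: "x \<in> traced L ws h"
  shows "bij_betw x (carrier G \<times> M) (carrier G \<times> M)"
    "wty G L x = gaut.ty G (act G) x (carrier G \<times> M) + single (i, conj_class G h) 1"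
    "gaut G (act G) x (carrier G \<times> M)"
proof -
  have xW: "x \<in> label_wreath G L" and lr: "gaut.len G (act G) x (ws ! 0) = i" "gaut.ret G (act G) x (ws ! 0) = h"
    and pw: "\<And>s. s < i \<Longrightarrow> (x ^^ s) (ws ! 0) = ws ! s" using x by (auto simp: traced_def)
  interpret A: gaut G "act G" x "carrier G \<times> L" by (rule wreath_gaut[OF L xW])
  note z = ws0
  have orb: "A.orb (ws ! 0) = Zs"
  proof (rule card_seteq[symmetric])
    show "finite (A.orb (ws ! 0))" by (rule A.finite_orb[OF z])
    show "Zs \<subseteq> A.orb (ws ! 0)"
    proof
      fix w assume "w \<in> Zs"
      then obtain p where "p \<in> C" "w = e p" using Zs_repr by blast
      then obtain a s where "a \<in> carrier G" "s < i" "w = act G a (ws ! s)" by auto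
      then have "a \<in> carrier G" "w = act G a ((x ^^ s) (ws ! 0))" using pw by auto
      then show "w \<in> A.orb (ws ! 0)" unfolding A.orb_def by blast
    qed
    have "card C = order G * i" by (simp add: card_cartesian_product order_def)
    then show "card (A.orb (ws ! 0)) \<le> card Zs"
      unfolding A.card_orb[OF z] lr using bij_betw_same_card[OF e_bij] by (simp only: order_refl)
  qed
  have "A.stable (carrier G \<times> L - A.orb (ws ! 0))" by (rule A.stable_Diff[OF A.stable_T A.stable_orb[OF z]])
  moreover have M: "carrier G \<times> L - A.orb (ws ! 0) = carrier G \<times> M" unfolding orb using labels_split by blast
  ultimately have st: "A.stable (carrier G \<times> M)" by simp
  show "bij_betw x (carrier G \<times> M) (carrier G \<times> M)"
    unfolding bij_betw_def using A.x_surj[OF st] A.x_inj by (auto intro: inj_on_subset)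
  show "gaut G (act G) x (carrier G \<times> M)" by (rule A.stable_gaut[OF st])
  have "A.ty (carrier G \<times> M \<union> A.orb (ws ! 0)) = A.ty (carrier G \<times> M) + single (A.tp (ws ! 0)) 1"
    by (rule A.ty_add_orbit[OF A.stable_finite[OF st] z]) (use orb labels_split(2) in auto)
  moreover have "carrier G \<times> M \<union> A.orb (ws ! 0) = carrier G \<times> L" unfolding orb using labels_split(1) by blast
  ultimately show "wty G L x = A.ty (carrier G \<times> M) + single (i, conj_class G h) 1"
    by (simp add: A.tp_def lr)
qed

text \<open>Over the labels of \<open>ws\<close> the element is forced, and on the remaining labels
  it is an arbitrary element of the smaller wreath product, whose type has one cycle less.\<close>

lemma card_traced:
  "card {x \<in> traced L ws h. wty G L x = m + single (i, conj_class G h) 1} =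
    card {y \<in> label_wreath G M. wty G M y = m}"
proof -
  let ?X = "{x \<in> traced L ws h. wty G L x = m + single (i, conj_class G h) 1}"
  let ?Y = "{y \<in> label_wreath G M. wty G M y = m}"
  let ?r = "\<lambda>x w. if w \<in> carrier G \<times> M then x w else w"
  have finM: "finite M" using L by simp
  have same: "wty G M y = gaut.ty G (act G) x (carrier G \<times> M)"
    if x: "x \<in> traced L ws h" and y: "y \<in> label_wreath G M" and eq: "\<And>w. w \<in> carrier G \<times> M \<Longrightarrow> y w = x w" for x y
    by (rule ty_equivariant[OF traced_rest(3)[OF x] wreath_gaut[OF finM y], of id]) (simp_all add: eq)
  have rW: "?r x \<in> label_wreath G M" if x: "x \<in> traced L ws h" for x
  proof (rule label_wreathI)
    show "bij_betw (?r x) (carrier G \<times> M) (carrier G \<times> M)"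
      using traced_rest(1)[OF x] by (rule bij_betw_cong[THEN iffD1, rotated]) simp
    fix g z assume gz: "g \<in> carrier G" "z \<in> carrier G \<times> M"
    interpret A: gaut G "act G" x "carrier G \<times> M" by (rule traced_rest(3)[OF x])
    show "?r x (act G g z) = act G g (?r x z)" using A.a_closed[OF gz] A.x_comm[OF gz] gz by simp
  qed simp
  have "bij_betw ?r ?X ?Y"
    unfolding bij_betw_def
  proof (intro conjI equalityI subsetI)
    show "inj_on ?r ?X"
    proof (rule inj_onI, rule ext)
      fix x x' w assume x: "x \<in> ?X" "x' \<in> ?X" and eq: "?r x = ?r x'"
      have tr: "x \<in> traced L ws h" "x' \<in> traced L ws h" using x by auto
      have perm: "x permutes carrier G \<times> L" "x' permutes carrier G \<times> L"
        using tr by (auto simp: traced_def label_wreath_def)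
      consider "w \<in> Zs" | "w \<in> carrier G \<times> M" | "w \<notin> carrier G \<times> L" using labels_split(1) by blast
      then show "x w = x' w"
      proof cases
        case 1
        then obtain p where "p \<in> C" "w = e p" using Zs_repr by blast
        then show ?thesis using traced_on_cycle[OF tr(1)] traced_on_cycle[OF tr(2)] by simp
      next
        case 2
        then show ?thesis using fun_cong[OF eq, of w] by simp
      next
        case 3
        then show ?thesis using perm by (simp add: permutes_not_in)
      qed
    qed
  next
    fix y assume "y \<in> ?r ` ?X"
    then obtain x where x: "x \<in> ?X" "y = ?r x" by blast
    then have t: "x \<in> traced L ws h" by simp
    have "wty G M y = gaut.ty G (act G) x (carrier G \<times> M)"
      unfolding x(2) by (rule same[OF t rW[OF t]]) simp
    also have "\<dots> = m" using traced_rest(2)[OF t] x(1) by simp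
    finally show "y \<in> ?Y" using rW[OF t] x(2) by simp
  next
    fix y assume y: "y \<in> ?Y"
    then have yW: "y \<in> label_wreath G M" by simp
    note g = glue_traced[OF yW]
    have "wty G M y = gaut.ty G (act G) (glue y) (carrier G \<times> M)"
      by (rule same[OF g(1) yW]) (simp add: g(2))
    then have "glue y \<in> ?X" using traced_rest(2)[OF g(1)] g(1) y by simp
    moreover have "?r (glue y) = y"
    proof
      fix w
      have "y permutes carrier G \<times> M" using yW by (simp add: label_wreath_def)
      then show "?r (glue y) w = y w" using g(2)[of w] permutes_not_in[of y "carrier G \<times> M" w] by simp
    qed
    ultimately show "y \<in> ?r ` ?X" by (intro image_eqI[of y ?r "glue y"]) simp_all
  qed
  then show ?thesis by (rule bij_betw_same_card)
qed

end

lemma finite_label_wreath: "finite L \<Longrightarrow> finite (label_wreath G L)"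
  by (rule finite_subset[OF _ finite_permutations[of "carrier G \<times> L"]])
    (use finite_G in \<open>auto simp: label_wreath_def\<close>)

lemma wty_props:
  assumes "finite L" "x \<in> label_wreath G L"
  shows "pweight (wty G L x) = card L" "keys (wty G L x) \<subseteq> {1..} \<times> conj_classes G"
proof -
  interpret A: gaut G "act G" x "carrier G \<times> L" by (rule wreath_gaut[OF assms])
  show "pweight (wty G L x) = card L"
    using A.pweight_ty[OF A.stable_T] A.order_pos by (simp add: card_cartesian_product order_def)
  show "keys (wty G L x) \<subseteq> {1..} \<times> conj_classes G" by (rule A.keys_ty[OF A.stable_T])
qed

text \<open>Fix a type (i, c) occurring in \<open>m\<close> and some \<open>h\<close> in
  \<open>c\<close>, and count the pairs of an element of type \<open>m\<close> and a point of length
  \<open>i\<close> and return element \<open>h\<close>. Each element has a_v Z_v such points by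
  \<open>card_len_ret\<close>. On the other side the stretch starting at the point is one of the
  \<open>traces\<close>, and \<open>card_traced\<close> reduces to \<open>card L - i\<close> labels,
  where the induction applies.\<close>

theorem card_wty:
  assumes "finite L"
  shows "of_nat (card {x \<in> label_wreath G L. wty G L x = m}) * centralizer_order G m =
    (if keys m \<subseteq> {1..} \<times> conj_classes G \<and> pweight m = card L
     then of_nat (order G ^ card L * fact (card L)) else 0)"
  using assms
proof (induction "card L" arbitrary: L m rule: less_induct)
  case less
  note L = less.prems
  show ?case
  proof (cases "keys m \<subseteq> {1..} \<times> conj_classes G \<and> pweight m = card L")
    case False
    then have e: "{x \<in> label_wreath G L. wty G L x = m} = {}" using wty_props[OF L] by auto
    show ?thesis unfolding e if_not_P[OF False] by simp
  next
    case adm: True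
    show ?thesis
    proof (cases "m = 0")
      case True
      then have "L = {}" using adm L by simp
      have e: "{x \<in> label_wreath G {}. wty G {} x = 0} = {id}"
        using gaut.ty_empty wreath_gaut[of "{}"] by (auto simp: label_wreath_def)
      show ?thesis unfolding True \<open>L = {}\<close> e by (simp add: centralizer_order_def)
    next
      case False
      then have "keys m \<noteq> {}" by simp
      then obtain v where v: "v \<in> keys m" by blast
      obtain i c where ic: "v = (i, c)" by (cases v)
      have i: "1 \<le> i" and "c \<in> conj_classes G" using adm v ic by auto
      then obtain h where h: "h \<in> carrier G" "c = conj_class G h" by (auto simp: conj_classes_def)
      define m' where "m' = m - single v 1"
      have m: "m = m' + single v 1" using v
        by (intro poly_mapping_eqI) (auto simp: m'_def lookup_add lookup_minus lookup_single when_def in_keys_iff)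
      have adm': "keys m' \<subseteq> {1..} \<times> conj_classes G" using adm unfolding m keys_add_single_one by simp
      have wt: "pweight m' + i = card L" using adm unfolding m pweight_add by (simp add: ic)
      let ?X = "{x \<in> label_wreath G L. wty G L x = m}"
      let ?P = "\<lambda>x. {z \<in> carrier G \<times> L. gaut.len G (act G) x z = i \<and> gaut.ret G (act G) x z = h}"
      let ?tr = "\<lambda>ws. {x \<in> traced L ws h. wty G L x = m}"
      have finX: "finite ?X" using finite_label_wreath[OF L] by simp
      have finT: "finite (traces L i)"
        by (rule finite_subset[OF _ finite_lists_length_eq[of "carrier G \<times> L" i]])
          (use finite_G L in \<open>auto simp: traces_def\<close>)
      have wsi: "length ws = i" "ws \<in> traces L (length ws)" if "ws \<in> traces L i" for ws using that by (auto simp: traces_def)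
      have "(of_nat (card ?X) :: rat) * (of_nat (lookup m v) * class_weight G v) =
          (\<Sum>x\<in>?X. of_nat (card (?P x)))"
      proof -
        have "(of_nat (card (?P x)) :: rat) = of_nat (lookup m v) * class_weight G v" if "x \<in> ?X" for x
        proof -
          interpret A: gaut G "act G" x "carrier G \<times> L" using wreath_gaut[OF L] that by simp
          show ?thesis using A.card_len_ret[OF A.stable_T h(1), of i] that by (simp add: ic h)
        qed
        then show ?thesis by simp
      qed
      also have "\<dots> = of_nat (card (Sigma ?X ?P))"
        using finX L finite_G by (simp add: card_SigmaI)
      \<comment> \<open>The point is exchanged for the list of its first \<open>i\<close> iterates
        and recovered as the head of that list.\<close>
      also have "card (Sigma ?X ?P) = card (Sigma (traces L i) ?tr)"
      proof (rule bij_betw_same_card[of "\<lambda>(x, z). (map (\<lambda>s. (x ^^ s) z) [0..<i], x)"],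
          rule bij_betw_byWitness[of _ "\<lambda>(ws, x). (x, ws ! 0)"])
        have fwd: "(map (\<lambda>s. (x ^^ s) z) [0..<i], x) \<in> Sigma (traces L i) ?tr" if x: "x \<in> ?X" and z: "z \<in> ?P x" for x z
        proof -
          have xW: "x \<in> label_wreath G L" and zT: "z \<in> carrier G \<times> L" using x z by auto
          interpret A: gaut G "act G" x "carrier G \<times> L" by (rule wreath_gaut[OF L xW])
          have lr: "A.len z = i" "A.ret z = h" using z by auto
          let ?ws = "map (\<lambda>s. (x ^^ s) z) [0..<i]"
          have "distinct (map snd ?ws)"
          proof -
            have ne: "s = t" if st: "s \<le> t" "t < i" "snd ((x ^^ s) z) = snd ((x ^^ t) z)" for s t
            proof -
              let ?a = "fst ((x ^^ s) z)" and ?b = "fst ((x ^^ t) z)"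
              have ab: "?a \<in> carrier G" "?b \<in> carrier G" using A.pow_closed[OF zT] by (metis mem_Times_iff)+
              have eq: "act G \<one> ((x ^^ s) z) = act G (?a \<otimes> inv ?b) ((x ^^ t) z)"
                using ab st(3) by (simp add: act_def m_assoc)
              show ?thesis by (rule A.orb_distinct(1)[OF zT st(1) _ one_closed _ eq]) (use st(2) lr ab in simp_all)
            qed
            show ?thesis unfolding distinct_conv_nth
            proof (intro allI impI)
              fix s t assume st: "s < length (map snd ?ws)" "t < length (map snd ?ws)" "s \<noteq> t"
              then show "map snd ?ws ! s \<noteq> map snd ?ws ! t" using ne[of s t] ne[of t s] by (cases "s \<le> t") auto
            qed
          qed
          moreover have "set ?ws \<subseteq> carrier G \<times> L" unfolding set_map by (rule image_subsetI, rule A.pow_closed[OF zT])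
          ultimately have "?ws \<in> traces L i" by (simp add: traces_def)
          moreover have "?ws ! 0 = z" using i by simp
          ultimately show ?thesis using x lr xW by (auto simp: traced_def)
        qed
        show "(\<lambda>(x, z). (map (\<lambda>s. (x ^^ s) z) [0..<i], x)) ` Sigma ?X ?P \<subseteq> Sigma (traces L i) ?tr"
          using fwd by fast
        show "\<forall>p\<in>Sigma ?X ?P. (case (case p of (x, z) \<Rightarrow> (map (\<lambda>s. (x ^^ s) z) [0..<i], x)) of (ws, x) \<Rightarrow> (x, ws ! 0)) = p"
          using i by auto
        show "(\<lambda>(ws, x). (x, ws ! 0)) ` Sigma (traces L i) ?tr \<subseteq> Sigma ?X ?P"
        proof
          fix p assume "p \<in> (\<lambda>(ws, x). (x, ws ! 0)) ` Sigma (traces L i) ?tr"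
          then obtain ws x where p: "p = (x, ws ! 0)" "ws \<in> traces L i" "x \<in> traced L ws h" "wty G L x = m" by auto
          have "ws ! 0 \<in> set ws" using p(2) i by (intro nth_mem) (simp add: traces_def)
          then have "ws ! 0 \<in> carrier G \<times> L" using p(2) unfolding traces_def by blast
          then show "p \<in> Sigma ?X ?P" using p wsi by (auto simp: traced_def)
        qed
        show "\<forall>p\<in>Sigma (traces L i) ?tr. (case (case p of (ws, x) \<Rightarrow> (x, ws ! 0)) of (x, z) \<Rightarrow> (map (\<lambda>s. (x ^^ s) z) [0..<i], x)) = p"
        proof
          fix p assume p: "p \<in> Sigma (traces L i) ?tr"
          obtain ws x where wx: "p = (ws, x)" by (cases p)
          have l: "length ws = i" using p wx wsi by auto
          have "map (\<lambda>s. (x ^^ s) (ws ! 0)) [0..<i] = ws"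
            by (rule nth_equalityI) (use p wx l in \<open>auto simp: traced_def\<close>)
          then show "(case (case p of (ws, x) \<Rightarrow> (x, ws ! 0)) of (x, z) \<Rightarrow> (map (\<lambda>s. (x ^^ s) z) [0..<i], x)) = p"
            by (simp add: wx)
        qed
      qed
      also have "card (Sigma (traces L i) ?tr) = (\<Sum>ws\<in>traces L i. card (?tr ws))"
        using finT finX by (intro card_SigmaI) (auto simp: traced_def intro: finite_subset[OF _ finite_label_wreath[OF L]])
      also have "of_nat \<dots> * centralizer_order G m' =
          (\<Sum>ws\<in>traces L i. of_nat (order G ^ card (L - snd ` set ws) * fact (card (L - snd ` set ws))))"
        unfolding of_nat_sum sum_distrib_right
      proof (rule sum.cong[OF refl])
        fix ws assume w: "ws \<in> traces L i"
        let ?M = "L - snd ` set ws"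
        have lab: "card (snd ` set ws) = i" "snd ` set ws \<subseteq> L"
          using w distinct_card[of "map snd ws"] by (auto simp: traces_def)
        have cM: "card ?M = card L - i" using lab card_Diff_subset[of "snd ` set ws" L] by simp
        have "card (?tr ws) = card {y \<in> label_wreath G ?M. wty G ?M y = m'}"
          using card_traced[OF L wsi(2)[OF w] _ h(1), of m'] i wsi(1)[OF w] by (simp add: m ic h)
        moreover have "of_nat (card {y \<in> label_wreath G ?M. wty G ?M y = m'}) * centralizer_order G m' =
            of_nat (order G ^ card ?M * fact (card ?M))"
          using less.hyps[of ?M m'] cM wt i L adm' by simp
        ultimately show "of_nat (card (?tr ws)) * centralizer_order G m' = of_nat (order G ^ card ?M * fact (card ?M))"
          by simp
      qed
      also have "\<dots> = (\<Sum>ws\<in>traces L i. of_nat (order G ^ (card L - i) * fact (card L - i)))"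
      proof (rule sum.cong[OF refl])
        fix ws assume w: "ws \<in> traces L i"
        have "card (snd ` set ws) = i" "snd ` set ws \<subseteq> L"
          using w distinct_card[of "map snd ws"] by (auto simp: traces_def)
        then have "card (L - snd ` set ws) = card L - i" using card_Diff_subset[of "snd ` set ws" L] by simp
        then show "(of_nat (order G ^ card (L - snd ` set ws) * fact (card (L - snd ` set ws))) :: rat) =
          of_nat (order G ^ (card L - i) * fact (card L - i))" by simp
      qed
      also have "\<dots> = of_nat (order G ^ (card L - i) * (card (traces L i) * fact (card L - i)))"
        by (simp add: mult_ac)
      also have "\<dots> = of_nat (order G ^ card L * fact (card L))"
      proof -
        have "i \<le> card L" using wt by simp
        then show ?thesis unfolding card_traces[OF L \<open>i \<le> card L\<close>]
          by (simp add: mult.assoc[symmetric] flip: power_add)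
      qed
      finally have "(of_nat (card ?X) :: rat) * (of_nat (lookup m v) * class_weight G v) * centralizer_order G m' =
        of_nat (order G ^ card L * fact (card L))" by (simp only:)
      moreover have "centralizer_order G m = centralizer_order G m' * (class_weight G v * of_nat (lookup m v))"
        unfolding m centralizer_order_add_single by (simp add: lookup_add)
      ultimately show ?thesis using adm by (simp add: mult_ac)
    qed
  qed
qed

end

text \<open>The basis behind \<open>lin_trace\<close> is an unknown choice, so it has to be shown
  that every basis of this space consists of a single nonzero number.\<close>

lemma lin_trace_rat_space: "lin_trace rat_space (\<lambda>v. v) = 1"
proof -
  have cm: "comm_monoid (add_monoid rat_space)"
    by (rule comm_monoidI) (auto simp: rat_space_def)
  have fs: "finsum rat_space f B = sum f B" if "finite B" for f :: "rat \<Rightarrow> rat" and B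
    using that
  proof (induction B rule: finite_induct)
    case empty
    then show ?case
      unfolding finsum_def using comm_monoid.finprod_empty[OF cm] by (simp add: rat_space_def)
  next
    case (insert b B)
    have "finsum rat_space f (insert b B) = f b \<oplus>\<^bsub>rat_space\<^esub> finsum rat_space f B"
      unfolding finsum_def using comm_monoid.finprod_insert[OF cm, of B b f] insert
      by (simp add: rat_space_def)
    then show ?case using insert by (simp add: rat_space_def)
  qed
  have basis: "lin_basis rat_space B \<longleftrightarrow> finite B \<and> (\<forall>v. \<exists>!a. a \<in> B \<rightarrow>\<^sub>E UNIV \<and> v = (\<Sum>b\<in>B. a b * b))" for B
    by (cases "finite B") (simp_all add: lin_basis_def fs, simp_all add: rat_space_def)
  have "lin_basis rat_space {1}"
    unfolding basis
  proof (intro conjI allI)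
    fix v :: rat
    show "\<exists>!a. a \<in> {1} \<rightarrow>\<^sub>E UNIV \<and> v = (\<Sum>b\<in>{1}. a b * b)"
    proof (rule ex1I[of _ "\<lambda>b\<in>{1}. v"])
      show "(\<lambda>b\<in>{1}. v) \<in> {1} \<rightarrow>\<^sub>E UNIV \<and> v = (\<Sum>b\<in>{1}. (\<lambda>b\<in>{1}. v) b * b)" by simp
      fix a assume "a \<in> {1} \<rightarrow>\<^sub>E UNIV \<and> v = (\<Sum>b\<in>{1}. a b * b)"
      then show "a = (\<lambda>b\<in>{1}. v)" by (auto simp: fun_eq_iff PiE_def extensional_def)
    qed
  qed simp
  define B where "B = (SOME B. lin_basis rat_space B)"
  have B: "lin_basis rat_space B" unfolding B_def using \<open>lin_basis rat_space {1}\<close> by (rule someI)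
  have fin: "finite B" and ex1: "\<And>v. \<exists>!a. a \<in> B \<rightarrow>\<^sub>E UNIV \<and> v = (\<Sum>b\<in>B. a b * b)" using B by (auto simp: basis)
  have uniq: "a b = a' b" if "(\<Sum>b\<in>B. a b * b) = (\<Sum>b\<in>B. a' b * b)" "b \<in> B" for a a' b
  proof -
    note E = ex1[of "\<Sum>b\<in>B. a b * b"]
    have r: "(\<Sum>b\<in>B. restrict d B b * b) = (\<Sum>b\<in>B. d b * b)" for d by (rule sum.cong) auto
    have mem: "restrict d B \<in> B \<rightarrow>\<^sub>E UNIV" for d :: "rat \<Rightarrow> rat" by auto
    have "restrict a B = restrict a' B"
      by (rule trans[OF the1_equality[OF E, symmetric] the1_equality[OF E]])
        (simp_all only: mem r that(1) simp_thms)
    then show ?thesis using that(2) by (metis restrict_apply')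
  qed
  obtain a where "1 = (\<Sum>b\<in>B. a b * b)" using ex1[of 1] by auto
  then obtain b where b: "b \<in> B" by fastforce
  have b0: "b \<noteq> 0"
  proof
    assume "b = 0"
    then have "(\<Sum>c\<in>B. (if c = b then 1 else 0) * c) = (\<Sum>c\<in>B. 0 * c)" by (intro sum.cong) auto
    from uniq[OF this b] show False by simp
  qed
  have "c = b" if c: "c \<in> B" for c
  proof (rule ccontr)
    assume ne: "c \<noteq> b"
    let ?a = "\<lambda>d. if d = c then 1 else 0 :: rat" and ?b = "\<lambda>d. if d = b then c / b else (0 :: rat)"
    have "(\<Sum>d\<in>B. ?a d * d) = (\<Sum>d\<in>B. if d = c then c else 0)" by (rule sum.cong) auto
    also have "\<dots> = c" using sum.delta[OF fin, of c "\<lambda>_. c"] c by simp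
    also have "c = (\<Sum>d\<in>B. if d = b then c else 0)" using sum.delta[OF fin, of b "\<lambda>_. c"] b by simp
    also have "\<dots> = (\<Sum>d\<in>B. ?b d * d)" by (rule sum.cong) (auto simp: b0)
    finally have "?a c = ?b c" by (rule uniq[OF _ c])
    then show False using ne by simp
  qed
  then have "B \<subseteq> {b}" by blast
  then have Bb: "B = {b}" using b by blast
  have "lin_coord rat_space B b \<in> B \<rightarrow>\<^sub>E UNIV \<and> b = (\<Sum>c\<in>B. lin_coord rat_space B b c * c)"
  proof -
    have "lin_coord rat_space B b = (THE a. a \<in> B \<rightarrow>\<^sub>E UNIV \<and> b = (\<Sum>c\<in>B. a c * c))"
      unfolding lin_coord_def fs[OF fin] by (simp add: rat_space_def)
    then show ?thesis using theI'[OF ex1[of b]] by (simp only:)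
  qed
  then have "lin_coord rat_space B b b = 1" using b0 by (simp add: Bb)
  then show ?thesis unfolding lin_trace_def B_def[symmetric] Let_def by (simp add: Bb)
qed

section \<open>Cycle types as monomials and the coefficients of a characteristic\<close>

lemma monomial_prod:
  "finite S \<Longrightarrow> (\<Prod>v\<in>S. mps_var v ^ k v) = Abs_mps (\<lambda>m. if m = (\<Sum>v\<in>S. single v (k v)) then 1 else 0)"
  by (induction S rule: finite_induct) (simp_all add: one_monomial mps_var_power monomial_mult_monomial)

context fin_group
begin

text \<open>Labels of the iterates of \<open>(\<one>, m)\<close> run through the orbit of
  \<open>m\<close>, and \<open>G\<close> acts transitively on the points over one label. So label
  orbits and the sets \<open>orb\<close> determine each other, and lengths agree.\<close>

lemma wreath_orbit:
  assumes x: "x \<in> wreath G n" and m: "m \<in> {1..n}"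
  shows "orbit (induced_perm G x) m = (\<lambda>s. snd ((x ^^ s) (\<one>, m))) ` UNIV"
    "card (orbit (induced_perm G x) m) = gaut.len G (act G) x (\<one>, m)"
    "carrier G \<times> orbit (induced_perm G x) m = gaut.orb G (act G) x (\<one>, m)"
proof -
  have W: "x \<in> label_wreath G {1..n}" using x by (simp add: wreath_label)
  interpret A: gaut G "act G" x "carrier G \<times> {1..n}" by (rule wreath_gaut[OF _ W]) simp
  let ?p = "induced_perm G x"
  have z: "(\<one>, m) \<in> carrier G \<times> {1..n}" using m by simp
  have pw: "(?p ^^ s) m = snd ((x ^^ s) (\<one>, m))" for s
  proof (induction s)
    case (Suc s)
    obtain a l where al: "(x ^^ s) (\<one>, m) = (a, l)" "a \<in> carrier G" "l \<in> {1..n}"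
      using A.pow_closed[OF z, of s] by (cases "(x ^^ s) (\<one>, m)") auto
    have "(a, l) = act G a (\<one>, l)" using al by (simp add: act_def)
    then have "x (a, l) = act G a (x (\<one>, l))" using A.x_comm[of a "(\<one>, l)"] al by simp
    then show ?case using Suc al by (simp add: induced_perm_def act_def)
  qed simp
  have sub: "orbit ?p m \<subseteq> (\<lambda>s. snd ((x ^^ s) (\<one>, m))) ` UNIV"
    unfolding orbit_altdef pw by auto
  have "snd ((x ^^ s) (\<one>, m)) \<in> orbit ?p m" for s
  \<comment> \<open>\<open>orbit\<close> collects positive powers, so \<open>m\<close> itself is
    reached after a full turn.\<close>
  proof (cases "s = 0")
    case True
    have "snd ((x ^^ A.len (\<one>, m)) (\<one>, m)) = m" using A.len_ret[OF z] by (simp add: act_def)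
    then have "(?p ^^ A.len (\<one>, m)) m = m" by (simp only: pw)
    moreover have "0 < A.len (\<one>, m)" using A.len_ret(1)[OF z] by simp
    ultimately have "m \<in> orbit ?p m" unfolding orbit_altdef by (metis (mono_tags, lifting) mem_Collect_eq)
    then show ?thesis using True by simp
  next
    case False
    then have "0 < s" by simp
    then show ?thesis unfolding orbit_altdef pw[symmetric] by blast
  qed
  with sub show orb: "orbit ?p m = (\<lambda>s. snd ((x ^^ s) (\<one>, m))) ` UNIV" by blast
  show eq: "carrier G \<times> orbit ?p m = A.orb (\<one>, m)"
  proof (intro equalityI subsetI)
    fix w assume "w \<in> carrier G \<times> orbit ?p m"
    then obtain a s where w: "w = (a, snd ((x ^^ s) (\<one>, m)))" "a \<in> carrier G" unfolding orb by auto
    let ?b = "fst ((x ^^ s) (\<one>, m))"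
    have b: "?b \<in> carrier G" using A.pow_closed[OF z, of s] by (metis mem_Times_iff)
    have "w = act G (a \<otimes> inv ?b) ((x ^^ s) (\<one>, m))" using w b by (simp add: act_def m_assoc)
    then show "w \<in> A.orb (\<one>, m)" unfolding A.orb_def using w b by blast
  next
    fix w assume w: "w \<in> A.orb (\<one>, m)"
    then obtain a s where as: "a \<in> carrier G" "w = act G a ((x ^^ s) (\<one>, m))" unfolding A.orb_def by blast
    have "w \<in> carrier G \<times> {1..n}" using A.orb_subset[OF z] w by blast
    then show "w \<in> carrier G \<times> orbit ?p m" using as unfolding orb by (auto simp: act_def mem_Times_iff)
  qed
  have "card (carrier G \<times> orbit ?p m) = order G * A.len (\<one>, m)" unfolding eq by (rule A.card_orb[OF z])
  then show "card (orbit ?p m) = A.len (\<one>, m)" using A.order_pos by (simp add: card_cartesian_product order_def)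
qed

text \<open>The label orbits of length \<open>i\<close> and class \<open>c\<close> divide the points
  of type \<open>(i, c)\<close> into sets of \<open>order G * i\<close> points, which is the count
  made by \<open>ty\<close>.\<close>

lemma cycle_count_ty:
  assumes x: "x \<in> wreath G n" and i: "1 \<le> i"
  shows "cycle_count G n x i c = lookup (wty G {1..n} x) (i, c)"
proof -
  have W: "x \<in> label_wreath G {1..n}" using x by (simp add: wreath_label)
  interpret A: gaut G "act G" x "carrier G \<times> {1..n}" by (rule wreath_gaut[OF _ W]) simp
  let ?o = "orbit (induced_perm G x)"
  let ?C = "{C \<in> ?o ` {1..n}. card C = i \<and>
       (\<exists>m\<in>C. \<exists>h\<in>carrier G. (x ^^ i) (\<one>, m) = (h, m) \<and> conj_class G h = c)}"
  note wo = wreath_orbit[OF x]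
  have one: "(\<one>, m) \<in> carrier G \<times> {1..n}" if "m \<in> {1..n}" for m using that by simp
  have self: "m \<in> ?o m" "?o m \<subseteq> {1..n}" if m: "m \<in> {1..n}" for m
    using A.orb_self[OF one[OF m]] A.orb_subset[OF one[OF m]] unfolding wo(3)[OF m, symmetric] by auto
  have eqo: "?o m' = ?o m" if m: "m \<in> {1..n}" and m': "m' \<in> ?o m" for m m'
  proof -
    have "m' \<in> {1..n}" using self(2)[OF m] m' by blast
    have "(\<one>, m') \<in> A.orb (\<one>, m)" unfolding wo(3)[OF m, symmetric] using m' by simp
    then have "A.orb (\<one>, m') = A.orb (\<one>, m)" by (rule A.orb_eq[OF one[OF m]])
    then have "carrier G \<times> ?o m' = carrier G \<times> ?o m" unfolding wo(3)[OF m] wo(3)[OF \<open>m' \<in> {1..n}\<close>] .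
    then show ?thesis by (auto simp: set_eq_iff)
  qed
  have tp_iff: "?o m \<in> ?C \<longleftrightarrow> A.tp (\<one>, m) = (i, c)" if m: "m \<in> {1..n}" for m
  proof
    assume "?o m \<in> ?C"
    then obtain m' h where m': "m' \<in> ?o m" "h \<in> carrier G" "(x ^^ i) (\<one>, m') = (h, m')" "conj_class G h = c"
      and ci: "card (?o m) = i" by auto
    have m'n: "m' \<in> {1..n}" using self(2)[OF m] m'(1) by blast
    have l: "A.len (\<one>, m') = i" using wo(2)[OF m'n] eqo[OF m m'(1)] ci by simp
    have "(x ^^ A.len (\<one>, m')) (\<one>, m') = act G h (\<one>, m')" using m' unfolding l by (simp add: act_def)
    then have "A.ret (\<one>, m') = h" by (rule A.ret_unique[OF one[OF m'n] m'(2)])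
    then have "A.tp (\<one>, m') = (i, c)" using l m'(4) by (simp add: A.tp_def)
    moreover have "(\<one>, m') \<in> A.orb (\<one>, m)" unfolding wo(3)[OF m, symmetric] using m' by simp
    ultimately show "A.tp (\<one>, m) = (i, c)" using A.tp_orb[OF one[OF m]] by simp
  next
    assume t: "A.tp (\<one>, m) = (i, c)"
    then have l: "A.len (\<one>, m) = i" "conj_class G (A.ret (\<one>, m)) = c" by (auto simp: A.tp_def)
    note lr = A.len_ret[OF one[OF m]]
    have "(x ^^ i) (\<one>, m) = (A.ret (\<one>, m), m)" using lr(2,3) unfolding l by (simp add: act_def)
    then show "?o m \<in> ?C" using l lr(2) self(1)[OF m] wo(2)[OF m] m by auto
  qed
  have "{z \<in> carrier G \<times> {1..n}. A.tp z = (i, c)} = (\<Union>C\<in>?C. carrier G \<times> C)"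
  proof (intro equalityI subsetI)
    fix z assume z: "z \<in> {z \<in> carrier G \<times> {1..n}. A.tp z = (i, c)}"
    obtain a m where am: "z = (a, m)" "a \<in> carrier G" "m \<in> {1..n}" using z by auto
    have "z = act G a (\<one>, m)" using am by (simp add: act_def)
    then have "A.tp (\<one>, m) = (i, c)" using A.tp_a[OF one[OF am(3)] am(2)] z by simp
    then have "?o m \<in> ?C" using tp_iff[OF am(3)] by blast
    then show "z \<in> (\<Union>C\<in>?C. carrier G \<times> C)" by (rule UN_I) (simp add: am self(1)[OF am(3)])
  next
    fix z assume "z \<in> (\<Union>C\<in>?C. carrier G \<times> C)"
    then obtain C where C: "C \<in> ?C" "z \<in> carrier G \<times> C" by blast
    obtain m0 where m0: "m0 \<in> {1..n}" "C = ?o m0" using C by blast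
    obtain a m where am: "z = (a, m)" "a \<in> carrier G" "m \<in> C" using C(2) by auto
    have m: "m \<in> {1..n}" using am m0 self(2)[OF m0(1)] by blast
    have "?o m = C" using eqo[OF m0(1)] am m0 by simp
    then have t: "A.tp (\<one>, m) = (i, c)" using tp_iff[OF m] C(1) by simp
    have "z = act G a (\<one>, m)" using am by (simp add: act_def)
    then have "A.tp z = (i, c)" using A.tp_a[OF one[OF m] am(2)] t by simp
    then show "z \<in> {z \<in> carrier G \<times> {1..n}. A.tp z = (i, c)}" using am m by simp
  qed
  then have "card {z \<in> carrier G \<times> {1..n}. A.tp z = (i, c)} = card (\<Union>C\<in>?C. carrier G \<times> C)" by (rule arg_cong)
  also have "\<dots> = (\<Sum>C\<in>?C. card (carrier G \<times> C))"
  proof (rule card_UN_disjoint)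
    show "\<forall>C\<in>?C. finite (carrier G \<times> C)"
      using finite_G self(2) finite_subset[of _ "{1..n}"] by blast
    show "\<forall>C\<in>?C. \<forall>D\<in>?C. C \<noteq> D \<longrightarrow> carrier G \<times> C \<inter> carrier G \<times> D = {}"
    proof (intro ballI impI)
      fix C D assume C: "C \<in> ?C" "D \<in> ?C" "C \<noteq> D"
      then obtain k l where kl: "k \<in> {1..n}" "C = ?o k" "l \<in> {1..n}" "D = ?o l" by blast
      have "C \<inter> D = {}" using eqo[OF kl(1)] eqo[OF kl(3)] C(3) unfolding kl(2,4) by blast
      then show "carrier G \<times> C \<inter> carrier G \<times> D = {}" by blast
    qed
  qed simp
  also have "\<dots> = (\<Sum>C\<in>?C. order G * i)"
    by (rule sum.cong) (auto simp: card_cartesian_product order_def)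
  also have "\<dots> = card ?C * (order G * i)" by simp
  finally have "lookup (A.ty (carrier G \<times> {1..n})) (i, c) * (order G * i) = card ?C * (order G * i)"
    using A.lookup_ty_mult[OF A.stable_T, of "(i, c)"] by simp
  moreover have "order G * i \<noteq> 0" using A.order_pos i by simp
  ultimately show ?thesis unfolding cycle_count_def by simp
qed

text \<open>The product in \<open>Psi\<close> stops at index \<open>n\<close>, but the total degree
  of the type is \<open>n\<close>, so no cycle is longer.\<close>

lemma Psi_monomial:
  assumes x: "x \<in> wreath G n"
  shows "mps_coeff (Psi G n x) m = (if m = wty G {1..n} x then 1 else 0)"
proof -
  let ?S = "{1..n} \<times> conj_classes G" and ?t = "wty G {1..n} x"
  have W: "x \<in> label_wreath G {1..n}" using x by (simp add: wreath_label)
  have fin: "finite ?S" using finite_G by (simp add: conj_classes_def)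
  have keys: "keys ?t \<subseteq> ?S"
  proof
    fix v assume v: "v \<in> keys ?t"
    then have "fst v * lookup ?t v \<le> pweight ?t"
      unfolding pweight_def by (intro member_le_sum) auto
    also have "\<dots> = n" using wty_props(1)[OF _ W] by simp
    finally have "fst v * lookup ?t v \<le> n" .
    moreover have "lookup ?t v \<noteq> 0" using v by (simp add: in_keys_iff)
    ultimately have "fst v \<le> n" using mult_le_mono2[of 1 "lookup ?t v" "fst v"] by linarith
    then show "v \<in> ?S" using wty_props(2)[OF _ W] v by auto
  qed
  have "Psi G n x = (\<Prod>v\<in>?S. mps_var v ^ lookup ?t v)"
    unfolding Psi_def prod.cartesian_product
  proof (rule prod.cong[OF refl])
    fix v assume "v \<in> ?S"
    then show "(case v of (i, c) \<Rightarrow> pvar i c ^ cycle_count G n x i c) = mps_var v ^ lookup ?t v"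
      by (cases v) (simp add: cycle_count_ty[OF x])
  qed
  also have "\<dots> = Abs_mps (\<lambda>m. if m = (\<Sum>v\<in>?S. single v (lookup ?t v)) then 1 else 0)"
    by (rule monomial_prod[OF fin])
  also have "(\<Sum>v\<in>?S. single v (lookup ?t v)) = ?t"
  proof (rule poly_mapping_eqI)
    fix w
    have ls: "lookup (sum f I) k = (\<Sum>i\<in>I. lookup (f i) k)"
      for f :: "nat \<times> 'a set \<Rightarrow> (nat \<times> 'a set \<Rightarrow>\<^sub>0 nat)" and I k
      by (induction I rule: infinite_finite_induct) (auto simp: lookup_add)
    have "lookup (\<Sum>v\<in>?S. single v (lookup ?t v)) w =
        (\<Sum>v\<in>?S. if v = w then lookup ?t v else 0)"
      unfolding ls by (rule sum.cong) (auto simp: lookup_single when_def)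
    also have "\<dots> = lookup ?t w"
      using fin keys by (simp add: sum.delta) (auto simp: in_keys_iff)
    finally show "lookup (\<Sum>v\<in>?S. single v (lookup ?t v)) w = lookup ?t w" .
  qed
  finally show ?thesis by simp
qed

lemma class_weight_nonzero:
  assumes "v \<in> {1..} \<times> conj_classes G"
  shows "class_weight G v \<noteq> 0"
proof -
  obtain h where h: "h \<in> carrier G" "snd v = conj_class G h" using assms by (auto simp: conj_classes_def)
  have "finite (snd v)" "snd v \<noteq> {}"
    unfolding h using conj_class_self[OF h(1)] conj_class_subset[OF h(1)] finite_G finite_subset by auto
  then have "card (snd v) \<noteq> 0" by simp
  moreover have "order G \<noteq> 0" using finite_G order_gt_0_iff_finite by simp
  ultimately show ?thesis using assms by (auto simp: class_weight_def)
qed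

lemma centralizer_order_nonzero:
  "keys m \<subseteq> {1..} \<times> conj_classes G \<Longrightarrow> centralizer_order G m \<noteq> 0"
  unfolding centralizer_order_def mprod_def using class_weight_nonzero by (auto simp: prod_zero_iff)

text \<open>The sum over the group collects the elements of each type, and by
  \<open>card_wty\<close> their proportion is the inverse of
  \<open>centralizer_order\<close>.\<close>

lemma mps_coeff_ch:
  assumes tr: "\<And>x. x \<in> wreath G n \<Longrightarrow> lin_trace M (\<rho> x) = f (wty G {1..n} x)"
  shows "mps_coeff (ch G n M \<rho>) m =
    (if keys m \<subseteq> {1..} \<times> conj_classes G \<and> pweight m = n then f m / centralizer_order G m else 0)"
proof -
  let ?W = "wreath G n" and ?N = "of_nat (order G) ^ n * fact n :: rat"
  let ?X = "{x \<in> label_wreath G {1..n}. wty G {1..n} x = m}"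
  have fin: "finite ?W" unfolding wreath_label by (rule finite_label_wreath) simp
  have "mps_coeff (ch G n M \<rho>) m = 1 / ?N * (\<Sum>x\<in>?W. if wty G {1..n} x = m then f m else 0)"
    unfolding ch_def mps_coeff_const_times mps_coeff_sum
  proof (rule arg_cong[of _ _ "(*) (1 / ?N)"], rule sum.cong[OF refl])
    fix x assume x: "x \<in> ?W"
    show "lin_trace M (\<rho> x) * mps_coeff (Psi G n x) m = (if wty G {1..n} x = m then f m else 0)"
      unfolding tr[OF x] Psi_monomial[OF x] by auto
  qed
  also have "(\<Sum>x\<in>?W. if wty G {1..n} x = m then f m else 0) = of_nat (card ?X) * f m"
    using fin by (simp add: sum.If_cases Int_def wreath_label)
  finally have c: "mps_coeff (ch G n M \<rho>) m = 1 / ?N * (of_nat (card ?X) * f m)" .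
  have "?N \<noteq> 0" using finite_G order_gt_0_iff_finite by simp
  show ?thesis
  proof (cases "keys m \<subseteq> {1..} \<times> conj_classes G \<and> pweight m = n")
    case True
    then have "of_nat (card ?X) * centralizer_order G m = ?N" using card_wty[of "{1..n}" m] by simp
    then have "of_nat (card ?X) = ?N / centralizer_order G m"
      using centralizer_order_nonzero True by (simp add: eq_divide_eq)
    then show ?thesis unfolding c if_P[OF True] using \<open>?N \<noteq> 0\<close> by simp
  next
    case False
    then have e: "?X = {}" using wty_props[of "{1..n}"] by auto
    show ?thesis unfolding c if_not_P[OF False] e by simp
  qed
qed

lemma mps_coeff_Exp:
  "mps_coeff (Exp_series G) m = (if keys m \<subseteq> {1..} \<times> conj_classes G
     then mprod (\<lambda>v k. 1 / (class_weight G v ^ k * fact k)) m else 0)"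
proof -
  have c: "mps_coeff (ch G n rat_space (\<lambda>x v. v)) m =
      (if keys m \<subseteq> {1..} \<times> conj_classes G \<and> pweight m = n then 1 / centralizer_order G m else 0)" for n
    by (rule mps_coeff_ch) (rule lin_trace_rat_space)
  have "mps_coeff (Exp_series G) m = (\<Sum>n\<in>{pweight m}. mps_coeff (ch G n rat_space (\<lambda>x v. v)) m)"
    unfolding Exp_series_def by (rule mps_coeff_formal_sum) (auto simp: c split: if_splits)
  also have "\<dots> = (if keys m \<subseteq> {1..} \<times> conj_classes G then 1 / centralizer_order G m else 0)"
    by (simp add: c)
  also have "1 / centralizer_order G m = mprod (\<lambda>v k. 1 / (class_weight G v ^ k * fact k)) m"
    unfolding centralizer_order_def mprod_def by (simp add: prod_dividef)
  finally show ?thesis .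
qed

end

section \<open>Traces on top homology\<close>

context fin_poset
begin

text \<open>\<open>N\<close> bounds the number of vertices of a face, so the top degree is
  \<open>N - 1\<close>. The contraction below it makes \<open>proj\<close> a retraction of the top
  chains onto the cycles, to which \<open>lin_trace_eq\<close> applies. The inverse
  \<open>\<psi>\<close> appears because the coefficient of the transported chain at \<open>E\<close>
  is the old one at the image of \<open>E\<close> under \<open>\<psi>\<close>.\<close>

theorem trace_homology:
  fixes P :: "'p gorder"
  assumes P: "carrier P = V" "gorder.le P = le" "eq P = (=)" and V: "V \<subseteq> A"
    and ac: "\<And>i. i < N \<Longrightarrow> acyclic_at V i" and top: "\<And>k. N < k \<Longrightarrow> faces V k = {}"
    and \<phi>\<psi>: "\<And>x. x \<in> V \<Longrightarrow> \<phi> x \<in> V" "\<And>x. x \<in> V \<Longrightarrow> \<psi> x \<in> V"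
      "\<And>x. x \<in> V \<Longrightarrow> \<phi> (\<psi> x) = x" "\<And>x. x \<in> V \<Longrightarrow> \<psi> (\<phi> x) = x"
    and mono: "\<And>x y. x \<in> V \<Longrightarrow> y \<in> V \<Longrightarrow> le (\<psi> x) (\<psi> y) \<longleftrightarrow> le x y"
  shows "lin_trace (reduced_homology P (int N - 1)) (homology_map \<phi>) =
    (-1) ^ N * euler {x \<in> V. \<phi> x = x}"
proof -
  have finV: "finite V" using V fin by (rule finite_subset)
  have auto: "automorphic V \<psi>" unfolding automorphic_def
    by (intro conjI ballI mono bij_betw_byWitness[of _ \<phi>]) (use \<phi>\<psi> in auto)
  have inv: "\<psi> ` \<phi> ` C = C" "\<phi> ` \<psi> ` C = C" "\<phi> ` C \<subseteq> V" "\<psi> ` C \<subseteq> V" if "C \<subseteq> V" for C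
    using that \<phi>\<psi> by (force simp: image_image subset_eq image_iff)+
  have oc: "C \<in> order_complex P \<longleftrightarrow> C \<in> faces V (card C)" for C
    unfolding order_complex_def faces_def Complete_Partial_Order.chain_def comparable_def P
    using finV by (auto intro: finite_subset)
  have cg: "z \<in> chain_group P (int k - 1) \<longleftrightarrow> keys z \<subseteq> faces V k" for z k
    unfolding chain_group_def by (auto simp: oc) (auto simp: faces_def)
  have cgc: "z \<in> chain_group P (int k - 1) \<longleftrightarrow> lookup z \<in> chains V k" for z k
    unfolding cg chains_def by (auto simp: in_keys_iff subset_eq)
  \<comment> \<open>\<open>boundary\<close> distributes every face to its facets, while
    \<open>bd\<close> collects at every facet. The signs agree because the omitted vertex is not
    strictly below itself.\<close>
  have lb: "lookup (boundary P z) E = bd (lookup z) E"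
    if z: "z \<in> chain_group P (int k - 1)" for z k E
  proof -
    let ?K = "keys z" and ?l = "lookup z"
    have KV: "C \<subseteq> V" if "C \<in> ?K" for C using z that unfolding cg by (auto simp: faces_def)
    have finK: "finite C" if "C \<in> ?K" for C using KV[OF that] finV by (rule finite_subset)
    let ?s = "\<lambda>C x. (-1) ^ card {y \<in> C. y \<sqsubset>\<^bsub>P\<^esub> x} :: rat"
    have sgn: "?s (insert x E) x = eps E x" if "x \<notin> E" for x
    proof -
      have "{y \<in> insert x E. y \<sqsubset>\<^bsub>P\<^esub> x} = {y \<in> E. less y x}"
        using that by (auto simp: lless_def P less_def)
      then show ?thesis by (simp add: eps_def)
    qed
    let ?S = "{(C, x). C \<in> ?K \<and> x \<in> C \<and> C - {x} = E}" and ?R = "{x \<in> A - E. insert x E \<in> ?K}"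
    have "lookup (boundary P z) E =
        (\<Sum>C\<in>?K. \<Sum>x\<in>C. if C - {x} = E then ?s C x * ?l C else 0)"
      unfolding boundary_def lookup_sum_pm by (intro sum.cong) (auto simp: lookup_single when_def)
    also have "\<dots> = (\<Sum>(C, x)\<in>Sigma ?K (\<lambda>C. C). if C - {x} = E then ?s C x * ?l C else 0)"
      by (rule sum.Sigma) (auto simp: finK)
    also have "\<dots> = (\<Sum>(C, x)\<in>?S. ?s C x * ?l C)"
      by (rule sum.mono_neutral_cong_right) (auto simp: finK split: if_splits)
    also have "\<dots> = (\<Sum>x\<in>?R. eps E x * ?l (insert x E))"
    proof (rule sum.reindex_bij_witness[of _ "\<lambda>x. (insert x E, x)" snd])
      fix p assume "p \<in> ?S"
      then obtain C x where p: "p = (C, x)" "C \<in> ?K" "x \<in> C" "C - {x} = E" by auto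
      have ins: "insert x E = C" using p by auto
      have nx: "x \<notin> E" using p by auto
      show "(insert (snd p) E, snd p) = p" using p ins by simp
      show "snd p \<in> ?R" using p ins nx KV[OF p(2)] V by auto
      show "eps E (snd p) * ?l (insert (snd p) E) = (case p of (C, x) \<Rightarrow> ?s C x * ?l C)"
        using sgn[OF nx] unfolding p(1) snd_conv prod.case ins by simp
    next
      fix x assume x: "x \<in> ?R"
      show "(insert x E, x) \<in> ?S" using x by auto
      show "snd (insert x E, x) = x" by simp
    qed
    also have "\<dots> = bd ?l E"
      unfolding bd_def by (rule sum.mono_neutral_left) (use fin in \<open>auto simp: in_keys_iff\<close>)
    finally show ?thesis .
  qed
  define W where "W = {z \<in> chain_group P (int N - 1). boundary P z = 0}"
  have W: "z \<in> W \<longleftrightarrow> lookup z \<in> chains V N \<and> bd (lookup z) = (\<lambda>_. 0)" for z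
    using lb[of z N] unfolding W_def by (auto simp: cgc poly_mapping_eq_iff fun_eq_iff)
  \<comment> \<open>No face has \<open>N + 1\<close> vertices, so the boundaries that are divided
    out are zero.\<close>
  have nz: "chain_group P (int N - 1 + 1) = {0}"
  proof -
    have "chain_group P (int N - 1 + 1) = chain_group P (int (Suc N) - 1)" by simp
    then show ?thesis using cg[of _ "Suc N"] top[of "Suc N"] by auto
  qed
  have b0: "boundary P 0 = 0" by (simp add: boundary_def)
  let ?M = "reduced_homology P (int N - 1)"
  have M: "?M = quotient_space (cycle_space P (int N - 1)) {0}"
    unfolding reduced_homology_def nz by (simp add: b0)
  have plus: "A <+>\<^bsub>cycle_space P (int N - 1)\<^esub> B = (\<Union>u\<in>A. \<Union>v\<in>B. {u + v})" for A B
    by (simp add: set_add_def set_mult_def cycle_space_def)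
  have bd0: "bd (\<lambda>_. 0) = (\<lambda>_. 0)" by (simp add: bd_def fun_eq_iff)
  interpret S: singleton_module ?M W
  proof
    show "carrier ?M = (\<lambda>z. {z}) ` W"
      unfolding M quotient_space_def by (auto simp: A_RCOSETS_def RCOSETS_def r_coset_def cycle_space_def W_def)
    show "\<zero>\<^bsub>?M\<^esub> = {0}" by (simp add: M quotient_space_def)
    show "{u} \<oplus>\<^bsub>?M\<^esub> {v} = {u + v}" for u v by (simp add: M quotient_space_def plus)
    show "r \<odot>\<^bsub>?M\<^esub> {u} = {pm_scale r u}" for u r by (simp add: M quotient_space_def plus) (simp add: cycle_space_def)
    show "0 \<in> W" unfolding W by (simp add: chains_def bd_def fun_eq_iff)
    show "u + v \<in> W" if uv: "u \<in> W" "v \<in> W" for u v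
    proof -
      have l: "lookup (u + v) = (\<lambda>C. lookup u C + lookup v C)"
        by (simp add: lookup_add fun_eq_iff)
      have "lookup (u + v) \<in> chains V N"
        unfolding chains_def l
      proof (intro CollectI allI impI)
        fix C assume "lookup u C + lookup v C \<noteq> 0"
        then have "lookup u C \<noteq> 0 \<or> lookup v C \<noteq> 0" by auto
        then show "C \<in> faces V N" using uv chainsD unfolding W by blast
      qed
      moreover have "bd (lookup (u + v)) = (\<lambda>_. 0)"
        using uv unfolding l bd_add by (simp add: W)
      ultimately show ?thesis unfolding W by blast
    qed
    show "pm_scale r u \<in> W" if "u \<in> W" for u r
    proof -
      have "bd (lookup (pm_scale r u)) E = r * bd (lookup u) E" for E
        unfolding bd_def lookup_pm_scale sum_distrib_left by (rule sum.cong) simp_all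
      then show ?thesis using that unfolding W by (simp add: chains_def fun_eq_iff)
    qed
  qed
  obtain s where s: "\<And>j. j < N \<Longrightarrow> contracts V s j" using contraction_exists[OF V ac] by auto
  let ?S = "faces V N"
  have finS: "finite ?S" by (rule finite_faces[OF V])
  define p where "p C = Abs_poly_mapping (proj V s C)" for C
  have lp: "lookup (p C) = proj V s C" if "C \<in> ?S" for C
  proof -
    have "{Q. proj V s C Q \<noteq> 0} \<subseteq> ?S"
      using chainsD[OF proj_cycle(1)[OF s that V]] by blast
    then have "finite {Q. proj V s C Q \<noteq> 0}" using finS by (rule finite_subset)
    then show ?thesis unfolding p_def by (simp add: Abs_poly_mapping_inverse)
  qed
  have lc: "lookup (chain_map \<phi> z) E = (if E \<subseteq> V then lookup z (\<psi> ` E) else 0)"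
    if z: "keys z \<subseteq> ?S" for z E
  proof -
    let ?K = "keys z" and ?l = "lookup z"
    have KV: "C \<subseteq> V" if "C \<in> ?K" for C using z that by (auto simp: faces_def)
    have "lookup (chain_map \<phi> z) E = (\<Sum>C\<in>?K. if \<phi> ` C = E then ?l C else 0)"
      unfolding chain_map_def lookup_sum_pm by (intro sum.cong) (auto simp: lookup_single when_def)
    also have "\<dots> = (\<Sum>C\<in>?K. if C = \<psi> ` E then (if E \<subseteq> V then ?l C else 0) else 0)"
    proof (rule sum.cong[OF refl])
      fix C assume C: "C \<in> ?K"
      have "\<phi> ` C = E \<longleftrightarrow> C = \<psi> ` E \<and> E \<subseteq> V"
        using inv[OF KV[OF C]] inv[of E] by metis
      then show "(if \<phi> ` C = E then ?l C else 0) = (if C = \<psi> ` E then (if E \<subseteq> V then ?l C else 0) else 0)"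
        by simp
    qed
    also have "\<dots> = (if E \<subseteq> V then ?l (\<psi> ` E) else 0)"
      by (simp add: sum.delta) (simp add: in_keys_iff)
    finally show ?thesis .
  qed
  have keysW: "keys z \<subseteq> ?S" if "z \<in> W" for z using that unfolding W_def cg by simp
  have "lin_trace ?M ((`) (chain_map \<phi>)) = (\<Sum>C\<in>?S. lookup (chain_map \<phi> (p C)) C)"
  proof (rule S.lin_trace_eq[OF finS keysW])
    show pW: "p C \<in> W" if "C \<in> ?S" for C
      unfolding W lp[OF that] using proj_cycle[OF s that V] by blast
    show "z = (\<Sum>C\<in>?S. pm_scale (lookup z C) (p C))" if z: "z \<in> W" for z
    proof (rule poly_mapping_eqI)
      fix Q
      have "lookup z Q = (\<Sum>C\<in>?S. lookup z C * proj V s C Q)"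
        using proj_expand[OF _ _ V, of "lookup z" N Q s] z unfolding W by blast
      also have "\<dots> = (\<Sum>C\<in>?S. lookup z C * lookup (p C) Q)"
        by (rule sum.cong) (simp_all add: lp)
      finally show "lookup z Q = lookup (\<Sum>C\<in>?S. pm_scale (lookup z C) (p C)) Q"
        by (simp only: lookup_sum_pm lookup_pm_scale)
    qed
    show "chain_map \<phi> z \<in> W" if z: "z \<in> W" for z
    proof -
      let ?l = "lookup z"
      have c: "?l \<in> chains V N" "bd ?l = (\<lambda>_. 0)" using z by (auto simp: W)
      have sup: "C \<subseteq> V" if "?l C \<noteq> 0" for C using chainsD[OF c(1) that] by (auto simp: faces_def)
      have "bd (lookup (chain_map \<phi> z)) E = 0" for E
        using bd_automorphic[OF auto V sup lc[OF keysW[OF z]], of E] by (simp add: c(2))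
      moreover have "lookup (chain_map \<phi> z) \<in> chains V N"
        unfolding chains_def lc[OF keysW[OF z]]
      proof (intro CollectI allI impI)
        fix E assume "(if E \<subseteq> V then ?l (\<psi> ` E) else 0) \<noteq> 0"
        then have E: "E \<subseteq> V" "?l (\<psi> ` E) \<noteq> 0" by (auto split: if_splits)
        have "\<psi> ` E \<in> (`) \<psi> ` faces V N"
          using chainsD[OF c(1) E(2)] automorphic_faces_bij[OF auto V, of N] by (simp add: bij_betw_def)
        then obtain Q where Q: "Q \<in> faces V N" "\<psi> ` E = \<psi> ` Q" by auto
        then have "E = Q" using automorphic_inj[OF auto E(1), of Q] by (simp add: faces_def)
        then show "E \<in> faces V N" using Q by simp
      qed
      ultimately show ?thesis by (simp add: W fun_eq_iff)
    qed
    show "chain_map \<phi> (\<Sum>b\<in>B. pm_scale (a b) b) = (\<Sum>b\<in>B. pm_scale (a b) (chain_map \<phi> b))"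
      if B: "finite B" "B \<subseteq> W" for a B
    proof (rule poly_mapping_eqI)
      fix E
      have "(\<Sum>b\<in>B. pm_scale (a b) b) \<in> W" using B by (intro S.W_sum S.W_scale) auto
      note k = keysW[OF this]
      have "(\<Sum>b\<in>B. a b * lookup (chain_map \<phi> b) E) =
          (\<Sum>b\<in>B. a b * (if E \<subseteq> V then lookup b (\<psi> ` E) else 0))"
      proof (rule sum.cong[OF refl])
        fix b assume "b \<in> B"
        then have "b \<in> W" using B(2) by blast
        then show "a b * lookup (chain_map \<phi> b) E = a b * (if E \<subseteq> V then lookup b (\<psi> ` E) else 0)"
          by (simp only: lc[OF keysW])
      qed
      then show "lookup (chain_map \<phi> (\<Sum>b\<in>B. pm_scale (a b) b)) E =
          lookup (\<Sum>b\<in>B. pm_scale (a b) (chain_map \<phi> b)) E"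
        unfolding lc[OF k] lookup_sum_pm lookup_pm_scale by simp
    qed
  qed
  also have "\<dots> = (\<Sum>C\<in>?S. proj V s C (\<psi> ` C))"
  proof (rule sum.cong[OF refl])
    fix C assume C: "C \<in> ?S"
    then have "p C \<in> W" unfolding W lp[OF C] using proj_cycle[OF s C V] by blast
    moreover have "C \<subseteq> V" using C by (simp add: faces_def)
    ultimately show "lookup (chain_map \<phi> (p C)) C = proj V s C (\<psi> ` C)"
      by (simp add: lc keysW lp[OF C])
  qed
  also have "\<dots> = (-1) ^ N * euler {x \<in> V. \<psi> x = x}" by (rule trace_proj_euler[OF V s auto top])
  also have "{x \<in> V. \<psi> x = x} = {x \<in> V. \<phi> x = x}" using \<phi>\<psi> by force
  finally show ?thesis by (simp add: homology_map_def[abs_def])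
qed

end

section \<open>The Moebius function of the fixed elements\<close>

lemma Union_blocks:
  assumes p: "partition_on U \<pi>" and R: "R \<subseteq> \<pi>" and K: "K \<in> \<pi>"
  shows "K \<subseteq> \<Union>R \<longleftrightarrow> K \<in> R"
proof
  assume sub: "K \<subseteq> \<Union>R"
  obtain z where z: "z \<in> K" using partition_on_ne[OF p K] by blast
  then obtain K' where K': "K' \<in> R" "z \<in> K'" using sub by blast
  have "K = K'" by (rule partition_on_unique[OF p K _ z K'(2)]) (use R K' in blast)
  then show "K \<in> R" using K' by simp
qed blast

lemma Union_blocks_collect:
  "partition_on U \<pi> \<Longrightarrow> R \<subseteq> \<pi> \<Longrightarrow> {K \<in> \<pi>. K \<subseteq> \<Union>R} = R"
  using Union_blocks by blast

abbreviation sing :: "'t set \<Rightarrow> 't set set" where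
  "sing U \<equiv> (\<lambda>t. {t}) ` U"

context gaut
begin

abbreviation "bstable \<equiv> gaut.stable G (\<lambda>g. (`) (\<alpha> g)) ((`) x)"
abbreviation "bfree \<equiv> gaut.free_partitions G (\<lambda>g. (`) (\<alpha> g)) ((`) x)"
abbreviation "bncyc \<equiv> gaut.ncyc G (\<lambda>g. (`) (\<alpha> g)) ((`) x)"

lemma finite_stable_sets: "finite {U. stable U}"
  by (rule finite_subset[of _ "Pow T"]) (auto simp: stable_def finT)

lemma ncyc_empty [simp]: "ncyc {} = 0"
  by (simp add: ncyc_def)

lemma stable_empty: "stable {}"
  by (simp add: stable_def)

text \<open>Adding or removing the orbit of one chosen point pairs the stable sets and changes the
  number of cycles in the complement by one.\<close>

lemma sum_stable_sign:
  "(\<Sum>U | stable U. (-1) ^ ncyc (T - U)) = (if T = {} then 1 else 0 :: rat)"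
proof (cases "T = {}")
  case True
  then have "U = {}" if "stable U" for U
  proof -
    have "U \<subseteq> T" using that by (simp add: stable_def)
    then show ?thesis using True by simp
  qed
  then have "{U. stable U} = {{}}" using stable_empty by blast
  then show ?thesis using True by simp
next
  case False
  then obtain z where z: "z \<in> T" by blast
  let ?S = "{U. stable U \<and> z \<notin> U}" and ?u = "\<lambda>U. U \<union> orb z"
  let ?f = "\<lambda>U. (-1) ^ ncyc (T - U) :: rat"
  have disj: "orb z \<inter> U = {}" if U: "U \<in> ?S" for U
  proof (rule ccontr)
    assume "orb z \<inter> U \<noteq> {}"
    then obtain w where w: "w \<in> orb z" "w \<in> U" by blast
    have "orb z \<subseteq> U" using stable_orb_sub[of U w] orb_eq[OF z w(1)] U w by simp
    then show False using orb_self[OF z] U by blast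
  qed
  have fin: "finite ?S" by (rule finite_subset[OF _ finite_stable_sets]) auto
  have eq: "{U. stable U} = ?S \<union> ?u ` ?S"
  proof (intro equalityI subsetI)
    fix U assume "U \<in> {U. stable U}"
    then have U: "stable U" by simp
    show "U \<in> ?S \<union> ?u ` ?S"
    proof (cases "z \<in> U")
      case True
      have "orb z \<subseteq> U" by (rule stable_orb_sub[OF U True])
      then have "U = ?u (U - orb z)" by blast
      moreover have "U - orb z \<in> ?S" using stable_Diff[OF U stable_orb[OF z]] orb_self[OF z] by simp
      ultimately show ?thesis by blast
    qed (use U in simp)
  next
    fix U assume "U \<in> ?S \<union> ?u ` ?S"
    then show "U \<in> {U. stable U}" using stable_Un stable_orb[OF z] by auto
  qed
  have inj: "inj_on ?u ?S"
  proof (rule inj_onI)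
    fix U V assume "U \<in> ?S" "V \<in> ?S" "?u U = ?u V"
    then show "U = V" using disj[of U] disj[of V] by blast
  qed
  have "(\<Sum>U | stable U. ?f U) = sum ?f ?S + sum ?f (?u ` ?S)"
    unfolding eq using fin orb_self[OF z] by (intro sum.union_disjoint) auto
  also have "sum ?f (?u ` ?S) = (\<Sum>U\<in>?S. ?f (?u U))" using inj by (simp add: sum.reindex)
  also have "\<dots> = (\<Sum>U\<in>?S. - ?f U)"
  proof (rule sum.cong[OF refl])
    fix U assume U: "U \<in> ?S"
    have st: "stable (T - ?u U)" using U stable_orb[OF z] stable_T by (intro stable_Diff stable_Un) auto
    have "T - U = (T - ?u U) \<union> orb z" using disj[OF U] orb_subset[OF z] by blast
    moreover have "ncyc ((T - ?u U) \<union> orb z) = Suc (ncyc (T - ?u U))"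
      by (rule ncyc_add_orbit[OF st z]) auto
    ultimately show "?f (?u U) = - ?f U" by simp
  qed
  finally show ?thesis using False by (simp add: sum_negf)
qed

lemma sing_free:
  assumes U: "stable U"
  shows "sing U \<in> free_partitions U" "bty (sing U) = ty U"
proof -
  have UT: "U \<subseteq> T" using U by (simp add: stable_def)
  show f: "sing U \<in> free_partitions U"
    unfolding free_partitions_def using U free UT
    by (auto simp: partition_on_singletons stable_def)
  show "bty (sing U) = ty U"
    by (rule ty_equivariant[OF stable_gaut[OF U] blocks_gaut[OF U f]]) (auto simp: bij_betw_def)
qed

lemma free_partitions_Diff:
  assumes U: "stable U" and \<rho>: "\<rho> \<in> free_partitions T" "sing U \<subseteq> \<rho>"
  shows "\<rho> - sing U \<in> free_partitions (T - U)"
proof -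
  note D = free_partitionsD[OF \<rho>(1)]
  have UT: "U \<subseteq> T" using U by (simp add: stable_def)
  have iff: "K \<in> sing U \<longleftrightarrow> K \<inter> U \<noteq> {}" if "K \<in> \<rho>" for K
  proof
    assume "K \<inter> U \<noteq> {}"
    then obtain t where t: "t \<in> K" "t \<in> U" by blast
    have "K = {t}" by (rule partition_on_unique[OF D(1) that _ t(1)]) (use \<rho>(2) t in auto)
    then show "K \<in> sing U" using t by simp
  qed auto
  have pull: "z \<in> U" if "z \<in> T" "\<alpha> g z \<in> U \<and> g \<in> carrier G \<or> x z \<in> U" for g z
    using stable_Diff[OF stable_T U] that unfolding stable_def by blast
  have sub: "K \<subseteq> T" if "K \<in> \<rho>" for K using partition_on_sub[OF D(1) that] .
  have A: "partition_on (T - U) (\<rho> - sing U)"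
  proof (rule partition_onI)
    show "\<Union>(\<rho> - sing U) = T - U"
      using partition_onD1[OF D(1)] iff by blast
    show "disjnt K L" if "K \<in> \<rho> - sing U" "L \<in> \<rho> - sing U" "K \<noteq> L" for K L
      using partition_on_unique[OF D(1), of K L] that unfolding disjnt_def by blast
    show "{} \<notin> \<rho> - sing U" using partition_onD3[OF D(1)] by blast
  qed
  have B: "\<alpha> g ` K \<in> \<rho> - sing U" if "g \<in> carrier G" "K \<in> \<rho> - sing U" for g K
  proof -
    have "\<alpha> g ` K \<in> \<rho>" using D(2) that by blast
    moreover have "\<alpha> g ` K \<inter> U = {}" using iff[of K] that pull sub[of K] by blast
    ultimately show ?thesis using iff by blast
  qed
  have C: "x ` K \<in> \<rho> - sing U" if "K \<in> \<rho> - sing U" for K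
  proof -
    have "x ` K \<in> \<rho>" using D(3) that by blast
    moreover have "x ` K \<inter> U = {}" using iff[of K] that pull sub[of K] by blast
    ultimately show ?thesis using iff by blast
  qed
  have E: "g = \<one>" if "g \<in> carrier G" "K \<in> \<rho> - sing U" "\<alpha> g ` K = K" for g K using D(4) that by blast
  show ?thesis
    unfolding free_partitions_def by (intro CollectI conjI ballI impI A) (erule B C E; assumption)+
qed

text \<open>Partitions containing the points of \<open>U\<close> as singleton blocks are those of
  the complement; this isolates the orbits that enter the correction term of
  \<open>wt\<close>.\<close>

lemma add_singletons_bij:
  assumes U: "stable U"
  shows "bij_betw (\<lambda>\<rho>. \<rho> \<union> sing U) (free_partitions (T - U)) {\<rho> \<in> free_partitions T. sing U \<subseteq> \<rho>}"
proof (rule bij_betw_byWitness[of _ "\<lambda>\<rho>. \<rho> - sing U"])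
  have UT: "U \<subseteq> T" using U by (simp add: stable_def)
  show "\<forall>\<rho>\<in>free_partitions (T - U). \<rho> \<union> sing U - sing U = \<rho>"
  proof
    fix \<rho> assume "\<rho> \<in> free_partitions (T - U)"
    then have "\<rho> \<inter> sing U = {}" using partition_on_sub[OF free_partitionsD(1)] by blast
    then show "\<rho> \<union> sing U - sing U = \<rho>" by blast
  qed
  show "\<forall>\<rho>\<in>{\<rho> \<in> free_partitions T. sing U \<subseteq> \<rho>}. \<rho> - sing U \<union> sing U = \<rho>" by blast
  have "\<rho> \<union> sing U \<in> free_partitions T" if "\<rho> \<in> free_partitions (T - U)" for \<rho>
  proof -
    have "\<rho> \<union> sing U \<in> free_partitions (T - U \<union> U)"
      by (rule free_partitions_Un[OF stable_Diff[OF stable_T U] U _ that sing_free(1)[OF U]]) blast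
    then show ?thesis using UT by (simp add: Un_absorb2)
  qed
  then show "(\<lambda>\<rho>. \<rho> \<union> sing U) ` free_partitions (T - U) \<subseteq> {\<rho> \<in> free_partitions T. sing U \<subseteq> \<rho>}" by blast
  show "(\<lambda>\<rho>. \<rho> - sing U) ` {\<rho> \<in> free_partitions T. sing U \<subseteq> \<rho>} \<subseteq> free_partitions (T - U)"
    using free_partitions_Diff[OF U] by blast
qed

text \<open>The fixed elements above \<open>(J, \<pi>)\<close> in the full Dowling lattice. Those
  whose first component is a single orbit are still present and are filtered out in
  \<open>sum_weights\<close>.\<close>

definition up :: "'t set \<Rightarrow> 't set set \<Rightarrow> ('t set \<times> 't set set) set" where
  "up J \<pi> = {(J', \<pi>'). stable J' \<and> \<pi>' \<in> free_partitions (T - J') \<and> J \<subseteq> J' \<and>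
     (\<forall>K\<in>\<pi>. K \<subseteq> J' \<or> (\<exists>K'\<in>\<pi>'. K \<subseteq> K'))}"

context
  fixes J \<pi>
  assumes J: "stable J" and \<pi>: "\<pi> \<in> free_partitions (T - J)"
begin

lemma block_sub: "K \<in> \<pi> \<Longrightarrow> K \<subseteq> T - J"
  using partition_on_sub[OF free_partitionsD(1)[OF \<pi>]] .

lemma stable_Union:
  assumes "bstable \<pi> U"
  shows "stable (J \<union> \<Union>U)"
proof -
  interpret P: gaut G "\<lambda>g. (`) (\<alpha> g)" "(`) x" \<pi> by (rule blocks_gaut[OF stable_Diff[OF stable_T J] \<pi>])
  have U: "U \<subseteq> \<pi>" "\<And>g K. g \<in> carrier G \<Longrightarrow> K \<in> U \<Longrightarrow> \<alpha> g ` K \<in> U" "\<And>K. K \<in> U \<Longrightarrow> x ` K \<in> U"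
    using assms unfolding P.stable_def by auto
  have "\<Union>U \<subseteq> T" using U(1) block_sub by blast
  then have "stable (\<Union>U)" unfolding stable_def using U(2,3) by blast
  then show ?thesis by (rule stable_Un[OF J])
qed

text \<open>Taking unions is an isomorphism from the blocks of \<open>\<rho>\<close>, which are sets
  of blocks, to the merged blocks, so that types can be computed before merging.\<close>

lemma coarsen_free:
  assumes U: "bstable \<pi> U" and \<rho>: "\<rho> \<in> bfree (\<pi> - U)"
  shows "Union ` \<rho> \<in> free_partitions (T - (J \<union> \<Union>U))"
    "bty (Union ` \<rho>) = gaut.ty G (\<lambda>g. (`) ((`) (\<alpha> g))) ((`) ((`) x)) \<rho>"
proof -
  have sTJ: "stable (T - J)" by (rule stable_Diff[OF stable_T J])
  interpret P: gaut G "\<lambda>g. (`) (\<alpha> g)" "(`) x" \<pi> by (rule blocks_gaut[OF sTJ \<pi>])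
  note p = free_partitionsD(1)[OF \<pi>]
  note D = P.free_partitionsD[OF \<rho>]
  have U\<pi>: "U \<subseteq> \<pi>" using U by (simp add: P.stable_def)
  have R: "R \<subseteq> \<pi>" "R \<subseteq> \<pi> - U" "R \<noteq> {}" if "R \<in> \<rho>" for R
    using partition_on_sub[OF D(1) that] partition_on_ne[OF D(1) that] by auto
  have Req: "R = R'" if r: "R \<in> \<rho>" "R' \<in> \<rho>" "z \<in> \<Union>R" "z \<in> \<Union>R'" for R R' z
  proof -
    obtain K K' where K: "K \<in> R" "z \<in> K" "K' \<in> R'" "z \<in> K'" using r(3,4) by blast
    have "K = K'" by (rule partition_on_unique[OF p _ _ K(2,4)]) (use K R(1)[OF r(1)] R(1)[OF r(2)] in blast)+
    then show ?thesis using partition_on_unique[OF D(1) r(1,2), of K] K by simp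
  qed
  have RU: "\<exists>z. z \<in> \<Union>R" if r: "R \<in> \<rho>" for R
  proof -
    obtain K where K: "K \<in> R" using R(3)[OF r] by blast
    then have "K \<noteq> {}" using partition_on_ne[OF p] R(1)[OF r] by blast
    then show ?thesis using K by blast
  qed
  have inj: "inj_on Union \<rho>"
  proof (rule inj_onI)
    fix R R' assume "R \<in> \<rho>" "R' \<in> \<rho>" "\<Union>R = \<Union>R'"
    then show "R = R'" using RU[of R] Req[of R R'] by auto
  qed
  have im: "f ` \<Union>R = \<Union>((`) f ` R)" for f :: "'t \<Rightarrow> 't" and R by blast
  have part: "partition_on (T - (J \<union> \<Union>U)) (Union ` \<rho>)"
  proof (rule partition_onI)
    have "\<Union>(Union ` \<rho>) = \<Union>(\<Union>\<rho>)" by blast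
    also have "\<dots> = \<Union>(\<pi> - U)" using partition_onD1[OF D(1)] by simp
    also have "\<dots> = (T - J) - \<Union>U"
    proof (intro equalityI subsetI)
      fix z assume "z \<in> \<Union>(\<pi> - U)"
      then obtain K where K: "K \<in> \<pi>" "K \<notin> U" "z \<in> K" by blast
      have "z \<notin> \<Union>U"
      proof
        assume "z \<in> \<Union>U"
        then obtain L where L: "L \<in> U" "z \<in> L" by blast
        have "K = L" by (rule partition_on_unique[OF p K(1) _ K(3) L(2)]) (use L U\<pi> in blast)
        then show False using L K by simp
      qed
      then show "z \<in> (T - J) - \<Union>U" using block_sub[OF K(1)] K(3) by blast
    next
      fix z assume "z \<in> (T - J) - \<Union>U"
      then show "z \<in> \<Union>(\<pi> - U)" using partition_onD1[OF p] by blast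
    qed
    finally show "\<Union>(Union ` \<rho>) = T - (J \<union> \<Union>U)" by blast
    show "disjnt P Q" if "P \<in> Union ` \<rho>" "Q \<in> Union ` \<rho>" "P \<noteq> Q" for P Q
    proof -
      obtain R R' where r: "R \<in> \<rho>" "P = \<Union>R" "R' \<in> \<rho>" "Q = \<Union>R'" using \<open>P \<in> _\<close> \<open>Q \<in> _\<close> by blast
      have "R \<noteq> R'" using r \<open>P \<noteq> Q\<close> by blast
      then show ?thesis unfolding disjnt_def r(2,4) using Req[OF r(1,3)] by blast
    qed
    show "{} \<notin> Union ` \<rho>" using RU by force
  qed
  show free': "Union ` \<rho> \<in> free_partitions (T - (J \<union> \<Union>U))"
    unfolding free_partitions_def
  proof (intro CollectI conjI ballI impI part)
    fix K assume "K \<in> Union ` \<rho>"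
    then obtain R where r: "R \<in> \<rho>" "K = \<Union>R" by blast
    show "x ` K \<in> Union ` \<rho>" unfolding r(2) im using D(3)[OF r(1)] by blast
    fix g assume g: "g \<in> carrier G"
    show "\<alpha> g ` K \<in> Union ` \<rho>" unfolding r(2) im using D(2)[OF g r(1)] by blast
    assume "\<alpha> g ` K = K"
    then have "\<Union>((`) (\<alpha> g) ` R) = \<Union>R" unfolding r(2) im .
    then have "(`) (\<alpha> g) ` R = R" using inj D(2)[OF g r(1)] r(1) by (simp add: inj_on_def)
    then show "g = \<one>" by (rule D(4)[OF g r(1)])
  qed
  have "P.stable (\<pi> - U)" by (rule P.stable_Diff[OF P.stable_T U])
  note g1 = P.blocks_gaut[OF this \<rho>]
  note g2 = blocks_gaut[OF stable_Diff[OF stable_T stable_Union[OF U]] free']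
  show "bty (Union ` \<rho>) = gaut.ty G (\<lambda>g. (`) ((`) (\<alpha> g))) ((`) ((`) x)) \<rho>"
    by (rule ty_equivariant[OF g1 g2]) (use inj im in \<open>auto simp: bij_betw_def\<close>)
qed

text \<open>What lies above an element is again of Dowling form, with the blocks of
  \<open>\<pi>\<close> as points: a stable set \<open>U\<close> of blocks is absorbed into
  \<open>J\<close>, and the other blocks are merged freely.\<close>

lemma coarsen_bij:
  "bij_betw (\<lambda>(U, \<rho>). (J \<union> \<Union>U, Union ` \<rho>)) (Sigma {U. bstable \<pi> U} (\<lambda>U. bfree (\<pi> - U))) (up J \<pi>)"
proof (rule bij_betw_byWitness[of _ "\<lambda>(J', \<pi>'). ({K \<in> \<pi>. K \<subseteq> J'}, (\<lambda>K'. {K \<in> \<pi>. K \<subseteq> K'}) ` \<pi>')"])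
  have sTJ: "stable (T - J)" by (rule stable_Diff[OF stable_T J])
  interpret P: gaut G "\<lambda>g. (`) (\<alpha> g)" "(`) x" \<pi> by (rule blocks_gaut[OF sTJ \<pi>])
  note p = free_partitionsD(1)[OF \<pi>]
  let ?f = "\<lambda>(U, \<rho>). (J \<union> \<Union>U, Union ` \<rho>)"
  let ?g = "\<lambda>(J', \<pi>'). ({K \<in> \<pi>. K \<subseteq> J'}, (\<lambda>K'. {K \<in> \<pi>. K \<subseteq> K'}) ` \<pi>')"
  let ?S = "Sigma {U. bstable \<pi> U} (\<lambda>U. bfree (\<pi> - U))"
  show "\<forall>q\<in>?S. ?g (?f q) = q"
  proof
    fix q assume q: "q \<in> ?S"
    obtain U \<rho> where eq: "q = (U, \<rho>)" by (cases q)
    have U: "U \<subseteq> \<pi>" and \<rho>: "\<rho> \<in> bfree (\<pi> - U)" using q eq by (auto simp: P.stable_def)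
    have "{K \<in> \<pi>. K \<subseteq> J \<union> \<Union>U} = {K \<in> \<pi>. K \<subseteq> \<Union>U}" using block_sub by blast
    also have "\<dots> = U" by (rule Union_blocks_collect[OF p U])
    finally have 1: "{K \<in> \<pi>. K \<subseteq> J \<union> \<Union>U} = U" .
    have "{K \<in> \<pi>. K \<subseteq> \<Union>R} = R" if "R \<in> \<rho>" for R
      by (rule Union_blocks_collect[OF p]) (use partition_on_sub[OF P.free_partitionsD(1)[OF \<rho>] that] in blast)
    then have "(\<lambda>K'. {K \<in> \<pi>. K \<subseteq> K'}) ` Union ` \<rho> = \<rho>" by (simp add: image_image)
    then show "?g (?f q) = q" using 1 eq by simp
  qed
  have cover: "\<exists>K\<in>\<pi>. z \<in> K \<and> K \<subseteq> K'" "{K \<in> \<pi>. K \<subseteq> K'} \<inter> {K \<in> \<pi>. K \<subseteq> J'} = {}"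
    if u: "(J', \<pi>') \<in> up J \<pi>" and z: "K' \<in> \<pi>'" "z \<in> K'" for J' \<pi>' K' z
  proof -
    note p' = free_partitionsD(1)[of \<pi>' "T - J'"]
    have pp: "partition_on (T - J') \<pi>'" using u by (auto simp: up_def intro: p')
    have zJ: "z \<in> T - J'" using partition_on_sub[OF pp z(1)] z(2) by blast
    then have "z \<in> T - J" using u by (auto simp: up_def)
    then obtain K where K: "K \<in> \<pi>" "z \<in> K" using partition_on_block[OF p] by blast
    then have "\<not> K \<subseteq> J'" using zJ by blast
    moreover have "K \<subseteq> J' \<or> (\<exists>K'\<in>\<pi>'. K \<subseteq> K')" using u K(1) by (simp add: up_def)
    ultimately obtain K'' where K'': "K'' \<in> \<pi>'" "K \<subseteq> K''" by blast
    have "K'' = K'" by (rule partition_on_unique[OF pp K''(1) z(1) _ z(2)]) (use K K'' in blast)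
    then show "\<exists>K\<in>\<pi>. z \<in> K \<and> K \<subseteq> K'" using K K'' by blast
    have "K' \<inter> J' = {}" using partition_on_sub[OF pp z(1)] by blast
    then show "{K \<in> \<pi>. K \<subseteq> K'} \<inter> {K \<in> \<pi>. K \<subseteq> J'} = {}"
      using partition_on_ne[OF p] by blast
  qed
  show "\<forall>q\<in>up J \<pi>. ?f (?g q) = q"
  proof
    fix q assume q: "q \<in> up J \<pi>"
    obtain J' \<pi>' where eq: "q = (J', \<pi>')" by (cases q)
    have u: "stable J'" "partition_on (T - J') \<pi>'" "J \<subseteq> J'" "\<And>K. K \<in> \<pi> \<Longrightarrow> K \<subseteq> J' \<or> (\<exists>K'\<in>\<pi>'. K \<subseteq> K')"
      using q eq free_partitionsD(1)[of \<pi>' "T - J'"] by (auto simp: up_def)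
    have "J \<union> \<Union>{K \<in> \<pi>. K \<subseteq> J'} = J'"
    proof (intro equalityI subsetI)
      fix z assume z: "z \<in> J'"
      show "z \<in> J \<union> \<Union>{K \<in> \<pi>. K \<subseteq> J'}"
      proof (cases "z \<in> J")
        case False
        then have "z \<in> T - J" using z u(1) by (auto simp: stable_def)
        then obtain K where K: "K \<in> \<pi>" "z \<in> K" using partition_on_block[OF p] by blast
        then have "K \<subseteq> J'" using u(4)[OF K(1)] partition_on_sub[OF u(2)] z by blast
        then show ?thesis using K by blast
      qed simp
    qed (use u(3) in blast)
    moreover have "\<Union>{K \<in> \<pi>. K \<subseteq> K'} = K'" if "K' \<in> \<pi>'" for K'
      using cover(1)[OF q[unfolded eq] that] by blast
    then have "Union ` (\<lambda>K'. {K \<in> \<pi>. K \<subseteq> K'}) ` \<pi>' = \<pi>'" by (simp add: image_image)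
    ultimately show "?f (?g q) = q" using eq by simp
  qed
  show "?f ` ?S \<subseteq> up J \<pi>"
  proof
    fix q assume "q \<in> ?f ` ?S"
    then obtain U \<rho> where q: "q = (J \<union> \<Union>U, Union ` \<rho>)" and U: "bstable \<pi> U" and \<rho>: "\<rho> \<in> bfree (\<pi> - U)" by auto
    have "\<exists>K'\<in>Union ` \<rho>. K \<subseteq> K'" if K: "K \<in> \<pi>" "\<not> K \<subseteq> J \<union> \<Union>U" for K
    proof -
      have "K \<in> \<pi> - U" using K by blast
      then obtain R where "R \<in> \<rho>" "K \<in> R" using partition_on_block[OF P.free_partitionsD(1)[OF \<rho>]] by blast
      then show ?thesis by blast
    qed
    then show "q \<in> up J \<pi>" unfolding q up_def using stable_Union[OF U] coarsen_free(1)[OF U \<rho>] by blast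
  qed
  show "?g ` up J \<pi> \<subseteq> ?S"
  proof
    fix q assume "q \<in> ?g ` up J \<pi>"
    then obtain J' \<pi>' where q: "q = ({K \<in> \<pi>. K \<subseteq> J'}, (\<lambda>K'. {K \<in> \<pi>. K \<subseteq> K'}) ` \<pi>')" and u: "(J', \<pi>') \<in> up J \<pi>" by auto
    have u': "stable J'" "\<pi>' \<in> free_partitions (T - J')" "J \<subseteq> J'" "\<And>K. K \<in> \<pi> \<Longrightarrow> K \<subseteq> J' \<or> (\<exists>K'\<in>\<pi>'. K \<subseteq> K')"
      using u by (auto simp: up_def)
    note D = free_partitionsD[OF u'(2)]
    let ?U = "{K \<in> \<pi>. K \<subseteq> J'}" and ?c = "\<lambda>K'. {K \<in> \<pi>. K \<subseteq> K'}"
    have U: "P.stable ?U"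
      unfolding P.stable_def using P.a_closed P.x_closed u'(1) unfolding stable_def by blast
    have K'T: "K' \<subseteq> T" if "K' \<in> \<pi>'" for K' using partition_on_sub[OF D(1) that] by blast
    have KT: "K \<subseteq> T" if "K \<in> \<pi>" for K using block_sub[OF that] by blast
    have cu: "\<Union>(?c K') = K'" if "K' \<in> \<pi>'" for K' using cover(1)[OF u that] by blast
    have ne: "\<exists>z. z \<in> K'" if "K' \<in> \<pi>'" for K' using partition_on_ne[OF D(1) that] by blast
    have img: "(`) f ` ?c K' = ?c (f ` K')" if K': "K' \<in> \<pi>'" and f: "inj_on f T" "(`) f ` \<pi> = \<pi>" for f K'
    proof (intro equalityI subsetI)
      fix K assume "K \<in> (`) f ` ?c K'"
      then show "K \<in> ?c (f ` K')" using f(2) by blast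
    next
      fix K assume K: "K \<in> ?c (f ` K')"
      then obtain K0 where K0: "K0 \<in> \<pi>" "K = f ` K0" using f(2) by blast
      then have "f ` K0 \<subseteq> f ` K'" using K by simp
      have "K0 \<subseteq> K'"
      proof
        fix z assume z: "z \<in> K0"
        then have "f z \<in> f ` K'" using \<open>f ` K0 \<subseteq> f ` K'\<close> by blast
        then show "z \<in> K'" using inj_on_image_mem_iff[OF f(1) _ K'T[OF K']] KT[OF K0(1)] z by blast
      qed
      then show "K \<in> (`) f ` ?c K'" using K0 by blast
    qed
    have ia: "inj_on (\<alpha> g) T" if "g \<in> carrier G" for g using a_inj[OF that] by (auto intro: inj_onI)
    have A: "partition_on (\<pi> - ?U) (?c ` \<pi>')"
    proof (rule partition_onI)
      show "\<Union>(?c ` \<pi>') = \<pi> - ?U"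
      proof (intro equalityI subsetI)
        fix K assume "K \<in> \<Union>(?c ` \<pi>')"
        then obtain K' where K': "K' \<in> \<pi>'" "K \<in> ?c K'" by blast
        obtain z where "z \<in> K'" using ne[OF K'(1)] by blast
        then show "K \<in> \<pi> - ?U" using cover(2)[OF u K'(1)] K'(2) by blast
      next
        fix K assume "K \<in> \<pi> - ?U"
        then show "K \<in> \<Union>(?c ` \<pi>')" using u'(4)[of K] by blast
      qed
      show "disjnt R R'" if R: "R \<in> ?c ` \<pi>'" "R' \<in> ?c ` \<pi>'" "R \<noteq> R'" for R R'
      proof (rule ccontr)
        assume "\<not> disjnt R R'"
        then obtain K where K: "K \<in> R" "K \<in> R'" unfolding disjnt_def by blast
        obtain L L' where L: "L \<in> \<pi>'" "R = ?c L" "L' \<in> \<pi>'" "R' = ?c L'" using R(1,2) by blast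
        obtain z where "z \<in> K" using partition_on_ne[OF p, of K] K L by blast
        then have "L = L'" using partition_on_unique[OF D(1) L(1,3), of z] K L by blast
        then show False using R(3) L by simp
      qed
      show "{} \<notin> ?c ` \<pi>'"
      proof
        assume "{} \<in> ?c ` \<pi>'"
        then obtain K' where K': "K' \<in> \<pi>'" "?c K' = {}" by blast
        have "K' = \<Union>(?c K')" by (rule cu[OF K'(1), symmetric])
        then have "K' = {}" unfolding K'(2) by simp
        then show False using ne[OF K'(1)] by simp
      qed
    qed
    have B: "(`) (\<alpha> g) ` R \<in> ?c ` \<pi>'" if g: "g \<in> carrier G" and R: "R \<in> ?c ` \<pi>'" for g R
    proof -
      obtain K' where K': "K' \<in> \<pi>'" "R = ?c K'" using R by blast
      show ?thesis unfolding K'(2) img[OF K'(1) ia[OF g] P.a_surj[OF P.stable_T g]] using D(2)[OF g K'(1)] by blast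
    qed
    have C: "(`) ((`) x) R \<in> ?c ` \<pi>'" if R: "R \<in> ?c ` \<pi>'" for R
    proof -
      obtain K' where K': "K' \<in> \<pi>'" "R = ?c K'" using R by blast
      show ?thesis unfolding K'(2) img[OF K'(1) x_inj P.x_surj[OF P.stable_T]] using D(3)[OF K'(1)] by blast
    qed
    have E: "g = \<one>" if g: "g \<in> carrier G" and R: "R \<in> ?c ` \<pi>'" and fx: "(`) (\<alpha> g) ` R = R" for g R
    proof -
      obtain K' where K': "K' \<in> \<pi>'" "R = ?c K'" using R by blast
      have "\<alpha> g ` \<Union>R = \<Union>((`) (\<alpha> g) ` R)" by blast
      then have "\<alpha> g ` K' = K'" unfolding fx unfolding K'(2) cu[OF K'(1)] .
      then show ?thesis by (rule D(4)[OF g K'(1)])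
    qed
    have "?c ` \<pi>' \<in> P.free_partitions (\<pi> - ?U)"
      unfolding P.free_partitions_def by (intro CollectI conjI ballI impI A) (erule B C E; assumption)+
    then show "q \<in> ?S" using U q by simp
  qed
qed

end

text \<open>The \<open>x\<close>-stable \<open>G\<close>-orbits.\<close>

definition orbits1 :: "'t set set" where
  "orbits1 = {Q. stable Q \<and> card Q = order G}"

text \<open>The Moebius function from \<open>(J, \<pi>)\<close> to the top of the poset of \<open>x\<close>-fixed elements.\<close>

definition wt :: "'t set \<Rightarrow> 't set set \<Rightarrow> rat" where
  "wt J \<pi> = gval G (-1) (bty \<pi>) +
     (if J = {} then \<Sum>Q | Q \<in> orbits1 \<and> sing Q \<subseteq> \<pi>. gval G (-1) (bty (\<pi> - sing Q)) else 0)"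

lemma finite_orbits1: "finite orbits1"
  by (rule finite_subset[OF _ finite_stable_sets]) (auto simp: orbits1_def)

lemma orbits1_orb:
  assumes Q: "Q \<in> orbits1" and z: "z \<in> Q"
  shows "Q = orb z" "len z = 1"
proof -
  have st: "stable Q" and c: "card Q = order G" using Q by (auto simp: orbits1_def)
  have zT: "z \<in> T" using st z by (auto simp: stable_def)
  have sub: "orb z \<subseteq> Q" by (rule stable_orb_sub[OF st z])
  have "order G * len z \<le> order G * 1"
    using card_mono[OF stable_finite[OF st] sub] card_orb[OF zT] c by simp
  then have "len z \<le> 1" using order_pos by simp
  then show "len z = 1" using len_ret(1)[OF zT] by simp
  then show "Q = orb z" using card_subset_eq[OF stable_finite[OF st] sub] card_orb[OF zT] c by simp
qed

lemma orbits1_act: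
  assumes Q: "Q \<in> orbits1" and z: "z \<in> Q" "w \<in> Q"
  shows "\<exists>g\<in>carrier G. w = \<alpha> g z"
proof -
  have st: "stable Q" using Q by (auto simp: orbits1_def)
  have zT: "z \<in> T" using st z by (auto simp: stable_def)
  have "w \<in> orb z" using orbits1_orb(1)[OF Q z(1)] z(2) by simp
  then obtain g s where gs: "g \<in> carrier G" "s < len z" "w = \<alpha> g ((x ^^ s) z)"
    using orb_repr[OF zT] by blast
  then show ?thesis using orbits1_orb(2)[OF Q z(1)] by auto
qed

text \<open>If a block inside a single G-orbit contained z and g z, it would meet its translate by g
  and hence be fixed, so g is the unit. The absorptions forbidden by the deletion therefore
  correspond to the orbits made of singleton blocks.\<close>

lemma orbits1_bij:
  assumes \<pi>: "\<pi> \<in> free_partitions T"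
  shows "bij_betw sing {Q \<in> orbits1. sing Q \<subseteq> \<pi>} {U. bstable \<pi> U \<and> card (\<Union>U) = order G}"
proof -
  interpret P: gaut G "\<lambda>g. (`) (\<alpha> g)" "(`) x" \<pi> by (rule blocks_gaut[OF stable_T \<pi>])
  note D = free_partitionsD[OF \<pi>]
  have "sing Q \<in> {U. bstable \<pi> U \<and> card (\<Union>U) = order G}" if "Q \<in> orbits1" "sing Q \<subseteq> \<pi>" for Q
    using that unfolding P.stable_def orbits1_def stable_def by auto
  moreover have "U \<in> sing ` {Q \<in> orbits1. sing Q \<subseteq> \<pi>}" if U: "bstable \<pi> U" "card (\<Union>U) = order G" for U
  proof -
    have U\<pi>: "U \<subseteq> \<pi>" using U by (simp add: P.stable_def)
    have "\<pi> \<in> free_partitions (T - {})" using \<pi> by simp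
    from stable_Union[OF stable_empty this U(1)] have "stable (\<Union>U)" by simp
    then have Q: "\<Union>U \<in> orbits1" using U by (simp add: orbits1_def)
    have single: "K = {z}" if K: "K \<in> U" "z \<in> K" for K z
    proof -
      have "w = z" if w: "w \<in> K" for w
      proof -
        obtain g where g: "g \<in> carrier G" "w = \<alpha> g z" using orbits1_act[OF Q, of z w] K w by blast
        have "\<alpha> g ` K = K"
          by (rule partition_on_unique[OF D(1) D(2)[OF g(1)], of K K w]) (use K U\<pi> g w in auto)
        then have "g = \<one>" using D(4)[OF g(1)] K U\<pi> by blast
        then show ?thesis using g a_one[of z] partition_on_sub[OF D(1), of K] K U\<pi> by auto
      qed
      then show ?thesis using K by blast
    qed
    have "sing (\<Union>U) = U"
    proof (intro equalityI subsetI)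
      fix K assume "K \<in> sing (\<Union>U)"
      then obtain L z where L: "L \<in> U" "z \<in> L" "K = {z}" by blast
      then show "K \<in> U" using single[OF L(1,2)] by simp
    next
      fix K assume K: "K \<in> U"
      then obtain z where z: "z \<in> K" using partition_on_ne[OF D(1), of K] U\<pi> by blast
      then show "K \<in> sing (\<Union>U)" using single[OF K z] K by blast
    qed
    then show ?thesis using Q U\<pi> by (intro image_eqI[of _ _ "\<Union>U"]) auto
  qed
  moreover have "inj_on sing {Q \<in> orbits1. sing Q \<subseteq> \<pi>}"
  proof (rule inj_onI)
    fix Q Q' :: "'t set" assume "sing Q = sing Q'"
    then have "\<Union>(sing Q) = \<Union>(sing Q')" by simp
    then show "Q = Q'" by simp
  qed
  ultimately show ?thesis unfolding bij_betw_def by blast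
qed

text \<open>Exchanging the sums fixes \<open>Q\<close> first. The partitions of the blocks that keep
  the points of \<open>Q\<close> in singletons are the free partitions of the other blocks, and over
  these \<open>sum_free_partitions\<close> with \<kappa> = -1 gives a sign.\<close>

lemma sum_deleted_orbits:
  assumes \<pi>: "\<pi> \<in> free_partitions T"
  shows "(\<Sum>\<rho>\<in>bfree \<pi>. \<Sum>Q | Q \<in> orbits1 \<and> sing Q \<subseteq> Union ` \<rho>. gval G (-1) (bty (Union ` \<rho> - sing Q))) =
    (\<Sum>Q | Q \<in> orbits1 \<and> sing Q \<subseteq> \<pi>. (-1) ^ bncyc (\<pi> - sing Q))"
proof -
  interpret P: gaut G "\<lambda>g. (`) (\<alpha> g)" "(`) x" \<pi> by (rule blocks_gaut[OF stable_T \<pi>])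
  have \<pi>': "\<pi> \<in> free_partitions (T - {})" using \<pi> by simp
  note D = free_partitionsD[OF \<pi>]
  have finb: "finite (bfree \<pi>)" by (rule P.finite_free_partitions[OF P.stable_T])
  have single: "R = {{t}}" if \<rho>: "\<rho> \<in> bfree V" "V \<subseteq> \<pi>" and R: "R \<in> \<rho>" "\<Union>R = {t}" for \<rho> R t V
  proof -
    have "R \<noteq> {}" "R \<subseteq> \<pi>"
      using partition_on_ne[OF P.free_partitionsD(1)[OF \<rho>(1)] R(1)] partition_on_sub[OF P.free_partitionsD(1)[OF \<rho>(1)] R(1)] \<rho>(2) by auto
    moreover have "K = {t}" if "K \<in> R" for K
    proof -
      have "K \<subseteq> {t}" using Union_upper[OF that] R(2) by simp
      moreover have "K \<noteq> {}" by (rule partition_on_ne[OF D(1)]) (use \<open>R \<subseteq> \<pi>\<close> that in blast)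
      ultimately show ?thesis by (simp add: subset_singleton_iff)
    qed
    ultimately show ?thesis by blast
  qed
  have iff: "sing Q \<subseteq> Union ` \<rho> \<longleftrightarrow> sing (sing Q) \<subseteq> \<rho>" if \<rho>: "\<rho> \<in> bfree \<pi>" for \<rho> Q
  proof
    assume sub: "sing Q \<subseteq> Union ` \<rho>"
    show "sing (sing Q) \<subseteq> \<rho>"
    proof
      fix R assume "R \<in> sing (sing Q)"
      then obtain t where t: "t \<in> Q" "R = {{t}}" by blast
      then obtain R' where "R' \<in> \<rho>" "\<Union>R' = {t}" using sub by force
      then show "R \<in> \<rho>" using single[OF \<rho> subset_refl] t by blast
    qed
  next
    assume "sing (sing Q) \<subseteq> \<rho>"
    then have "{t} \<in> Union ` \<rho>" if "t \<in> Q" for t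
      using that by (intro image_eqI[of _ _ "{{t}}"]) auto
    then show "sing Q \<subseteq> Union ` \<rho>" by blast
  qed
  have inner: "(\<Sum>\<rho> | \<rho> \<in> bfree \<pi> \<and> sing Q \<subseteq> Union ` \<rho>. gval G (-1) (bty (Union ` \<rho> - sing Q))) = (-1) ^ bncyc (\<pi> - sing Q)"
    if Q: "Q \<in> orbits1" "sing Q \<subseteq> \<pi>" for Q
  proof -
    let ?U = "sing Q"
    have U: "P.stable ?U" using bij_betwE[OF orbits1_bij[OF \<pi>]] Q by blast
    have set: "{\<rho>. \<rho> \<in> bfree \<pi> \<and> sing Q \<subseteq> Union ` \<rho>} = {\<rho> \<in> bfree \<pi>. sing ?U \<subseteq> \<rho>}"
      by (rule Collect_cong, rule conj_cong[OF refl], rule iff)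
    have "(\<Sum>\<rho> | \<rho> \<in> bfree \<pi> \<and> sing Q \<subseteq> Union ` \<rho>. gval G (-1) (bty (Union ` \<rho> - sing Q))) =
        (\<Sum>\<rho>\<in>bfree (\<pi> - ?U). gval G (-1) (bty (Union ` (\<rho> \<union> sing ?U) - sing Q)))"
      unfolding set by (rule sum.reindex_bij_betw[OF P.add_singletons_bij[OF U], symmetric])
    also have "\<dots> = (\<Sum>\<rho>\<in>bfree (\<pi> - ?U). gval G (-1) (gaut.ty G (\<lambda>g. (`) ((`) (\<alpha> g))) ((`) ((`) x)) \<rho>))"
    proof (rule sum.cong[OF refl])
      fix \<rho> assume \<rho>: "\<rho> \<in> bfree (\<pi> - ?U)"
      have "\<Union>R \<notin> ?U" if R: "R \<in> \<rho>" for R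
      proof
        assume "\<Union>R \<in> ?U"
        then obtain t where t: "t \<in> Q" "\<Union>R = {t}" by blast
        then have "R = {{t}}" using single[OF \<rho> _ R] by blast
        then show False using partition_on_sub[OF P.free_partitionsD(1)[OF \<rho>] R] t by blast
      qed
      then have "Union ` (\<rho> \<union> sing ?U) - sing Q = Union ` \<rho>" by (auto simp: image_Un image_image)
      then show "gval G (-1) (bty (Union ` (\<rho> \<union> sing ?U) - sing Q)) =
          gval G (-1) (gaut.ty G (\<lambda>g. (`) ((`) (\<alpha> g))) ((`) ((`) x)) \<rho>)"
        using coarsen_free(2)[OF stable_empty \<pi>' U \<rho>] by simp
    qed
    also have "\<dots> = (-1) ^ bncyc (\<pi> - ?U)"
      by (rule P.sum_free_partitions[OF P.stable_Diff[OF P.stable_T U]])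
    finally show ?thesis .
  qed
  have none: "sing Q \<subseteq> \<pi>" if \<rho>: "\<rho> \<in> bfree \<pi>" "sing Q \<subseteq> Union ` \<rho>" for \<rho> Q
  proof -
    have "sing (sing Q) \<subseteq> \<rho>" using iff that by blast
    then show ?thesis using partition_on_sub[OF P.free_partitionsD(1)[OF \<rho>(1)]] by blast
  qed
  let ?h = "\<lambda>Q \<rho>. if sing Q \<subseteq> Union ` \<rho> then gval G (-1) (bty (Union ` \<rho> - sing Q)) else 0"
  have "(\<Sum>\<rho>\<in>bfree \<pi>. \<Sum>Q | Q \<in> orbits1 \<and> sing Q \<subseteq> Union ` \<rho>. gval G (-1) (bty (Union ` \<rho> - sing Q))) =
      (\<Sum>\<rho>\<in>bfree \<pi>. \<Sum>Q\<in>orbits1. ?h Q \<rho>)"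
    by (rule sum.cong[OF refl], rule sum.inter_filter[OF finite_orbits1])
  also have "\<dots> = (\<Sum>Q\<in>orbits1. \<Sum>\<rho>\<in>bfree \<pi>. ?h Q \<rho>)" by (rule sum.swap)
  also have "\<dots> = (\<Sum>Q\<in>orbits1. if sing Q \<subseteq> \<pi> then (-1) ^ bncyc (\<pi> - sing Q) else 0)"
  proof (rule sum.cong[OF refl])
    fix Q assume Q: "Q \<in> orbits1"
    show "(\<Sum>\<rho>\<in>bfree \<pi>. ?h Q \<rho>) = (if sing Q \<subseteq> \<pi> then (-1) ^ bncyc (\<pi> - sing Q) else 0)"
    proof (cases "sing Q \<subseteq> \<pi>")
      case True
      then show ?thesis using inner[OF Q True] sum.inter_filter[OF finb, of "\<lambda>\<rho>. gval G (-1) (bty (Union ` \<rho> - sing Q))" "\<lambda>\<rho>. sing Q \<subseteq> Union ` \<rho>"]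
        by simp
    next
      case False
      then have "(\<Sum>\<rho>\<in>bfree \<pi>. ?h Q \<rho>) = 0" using none by (intro sum.neutral) auto
      then show ?thesis using False by simp
    qed
  qed
  also have "\<dots> = (\<Sum>Q | Q \<in> orbits1 \<and> sing Q \<subseteq> \<pi>. (-1) ^ bncyc (\<pi> - sing Q))"
    by (rule sum.inter_filter[OF finite_orbits1, symmetric])
  finally show ?thesis .
qed

text \<open>The recursion of the Moebius function. By \<open>coarsen_bij\<close> and
  \<open>sum_free_partitions\<close> with \<kappa> = -1 every stable set \<open>U\<close> of
  absorbed blocks contributes a sign, and over all \<open>U\<close> the signs sum to zero unless
  \<open>\<pi> = {}\<close>. Missing are the \<open>U\<close> that lead to a single orbit, which
  happens for \<open>J = {}\<close> only; by \<open>sum_deleted_orbits\<close> the correction terms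
  of \<open>wt\<close> add up to exactly these missing signs.\<close>

theorem sum_weights:
  assumes T: "T \<noteq> {}" and J: "stable J" "card J \<noteq> order G" and \<pi>: "\<pi> \<in> free_partitions (T - J)"
  shows "(\<Sum>q | q \<in> up J \<pi> \<and> card (fst q) \<noteq> order G. wt (fst q) (snd q)) = (if \<pi> = {} then 1 else 0)"
proof -
  interpret P: gaut G "\<lambda>g. (`) (\<alpha> g)" "(`) x" \<pi> by (rule blocks_gaut[OF stable_Diff[OF stable_T J(1)] \<pi>])
  note p = free_partitionsD(1)[OF \<pi>]
  let ?S = "{U. P.stable U}" and ?o = "order G"
  let ?F = "\<lambda>U. (-1) ^ P.ncyc (\<pi> - U) :: rat"
  have finS: "finite ?S" by (rule P.finite_stable_sets)
  have finf: "finite (bfree (\<pi> - U))" if "U \<in> ?S" for U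
    using P.finite_free_partitions[OF P.stable_Diff[OF P.stable_T]] that by blast
  have finup: "finite (up J \<pi>)"
    using bij_betw_finite[OF coarsen_bij[OF J(1) \<pi>]] finS finf by auto
  let ?E = "\<lambda>\<rho>. \<Sum>Q | Q \<in> orbits1 \<and> sing Q \<subseteq> Union ` \<rho>. gval G (-1) (bty (Union ` \<rho> - sing Q))"
  let ?G = "\<lambda>U \<rho>. if card (J \<union> \<Union>U) \<noteq> ?o then wt (J \<union> \<Union>U) (Union ` \<rho>) else 0"
  have "(\<Sum>q | q \<in> up J \<pi> \<and> card (fst q) \<noteq> ?o. wt (fst q) (snd q)) =
      (\<Sum>q\<in>up J \<pi>. if card (fst q) \<noteq> ?o then wt (fst q) (snd q) else 0)"
    by (rule sum.inter_filter[OF finup])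
  also have "\<dots> = (\<Sum>q\<in>Sigma ?S (\<lambda>U. bfree (\<pi> - U)). case q of (U, \<rho>) \<Rightarrow> ?G U \<rho>)"
    unfolding sum.reindex_bij_betw[OF coarsen_bij[OF J(1) \<pi>], symmetric] by (rule sum.cong) auto
  also have "\<dots> = (\<Sum>U\<in>?S. \<Sum>\<rho>\<in>bfree (\<pi> - U). ?G U \<rho>)"
    by (rule sum.Sigma[symmetric]) (use finS finf in auto)
  also have "\<dots> = (\<Sum>U\<in>?S. (if card (J \<union> \<Union>U) \<noteq> ?o then ?F U else 0) +
      (if U = {} then (if J = {} then \<Sum>\<rho>\<in>bfree \<pi>. ?E \<rho> else 0) else 0))"
  proof (rule sum.cong[OF refl])
    fix U assume "U \<in> ?S"
    then have U: "P.stable U" by simp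
    have emp: "J \<union> \<Union>U = {} \<longleftrightarrow> J = {} \<and> U = {}"
    proof -
      have "\<Union>U \<noteq> {}" if ne: "U \<noteq> {}"
      proof -
        obtain K where K: "K \<in> U" using ne by blast
        then have "K \<noteq> {}" using partition_on_ne[OF p, of K] U unfolding P.stable_def by blast
        then show ?thesis using K by blast
      qed
      then show ?thesis by auto
    qed
    have o: "card {} \<noteq> ?o" using order_pos by simp
    show "(\<Sum>\<rho>\<in>bfree (\<pi> - U). ?G U \<rho>) = (if card (J \<union> \<Union>U) \<noteq> ?o then ?F U else 0) +
      (if U = {} then (if J = {} then \<Sum>\<rho>\<in>bfree \<pi>. ?E \<rho> else 0) else 0)"
    proof (cases "card (J \<union> \<Union>U) \<noteq> ?o")
      case True
      have "(\<Sum>\<rho>\<in>bfree (\<pi> - U). ?G U \<rho>) =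
          (\<Sum>\<rho>\<in>bfree (\<pi> - U). gval G (-1) (gaut.ty G (\<lambda>g. (`) ((`) (\<alpha> g))) ((`) ((`) x)) \<rho>) +
            (if J = {} \<and> U = {} then ?E \<rho> else 0))"
        by (rule sum.cong[OF refl]) (simp only: True simp_thms if_True wt_def emp coarsen_free(2)[OF J(1) \<pi> U])
      also have "\<dots> = ?F U + (\<Sum>\<rho>\<in>bfree (\<pi> - U). if J = {} \<and> U = {} then ?E \<rho> else 0)"
        unfolding sum.distrib P.sum_free_partitions[OF P.stable_Diff[OF P.stable_T U]] ..
      finally show ?thesis using True by auto
    next
      case False
      then have "\<not> (J = {} \<and> U = {})" using emp o by metis
      then show ?thesis using False by auto
    qed
  qed
  also have "\<dots> = (\<Sum>U\<in>?S. if card (J \<union> \<Union>U) \<noteq> ?o then ?F U else 0) + (if J = {} then \<Sum>\<rho>\<in>bfree \<pi>. ?E \<rho> else 0)"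
    using finS P.stable_empty by (simp add: sum.distrib sum.delta)
  also have "\<dots> = (if \<pi> = {} then 1 else 0)"
  proof (cases "J = {}")
    case False
    \<comment> \<open>A nonempty stable set has a multiple of \<open>order G\<close> points, so
      \<open>J\<close> alone has more than \<open>order G\<close> of them.\<close>
    have "card (J \<union> \<Union>U) \<noteq> ?o" if "U \<in> ?S" for U
    proof
      assume c: "card (J \<union> \<Union>U) = ?o"
      have st: "stable (J \<union> \<Union>U)" using stable_Union[OF J(1) \<pi>] that by simp
      have "card J \<le> ?o" using card_mono[OF stable_finite[OF st], of J] c by simp
      moreover have "card J > 0" using False stable_finite[OF J(1)] by (simp add: card_gt_0_iff)
      moreover have "?o dvd card J" using pweight_ty[OF J(1)] by (metis dvd_triv_left)
      ultimately show False using J(2) dvd_imp_le[of ?o "card J"] by simp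
    qed
    then have "(\<Sum>U\<in>?S. if card (J \<union> \<Union>U) \<noteq> ?o then ?F U else 0) = (\<Sum>U\<in>?S. ?F U)"
      by (intro sum.cong) auto
    then show ?thesis using False P.sum_stable_sign by simp
  next
    case True
    have \<pi>T: "\<pi> \<in> free_partitions T" using \<pi> True by simp
    have ne: "\<pi> \<noteq> {}" using T partition_on_block[OF free_partitionsD(1)[OF \<pi>T]] by blast
    let ?X = "{U. P.stable U \<and> card (\<Union>U) = ?o}"
    have "(\<Sum>U\<in>?S. if card (J \<union> \<Union>U) \<noteq> ?o then ?F U else 0) =
        (\<Sum>U\<in>?S. ?F U - (if card (\<Union>U) = ?o then ?F U else 0))"
      by (rule sum.cong[OF refl]) (simp add: True)
    also have "\<dots> = (\<Sum>U\<in>?S. ?F U) - (\<Sum>U\<in>?S. if card (\<Union>U) = ?o then ?F U else 0)"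
      by (rule sum_subtractf)
    also have "(\<Sum>U\<in>?S. ?F U) = 0" using P.sum_stable_sign ne by simp
    also have "(\<Sum>U\<in>?S. if card (\<Union>U) = ?o then ?F U else 0) = (\<Sum>U\<in>?X. ?F U)"
      using sum.inter_filter[OF finS, of ?F "\<lambda>U. card (\<Union>U) = ?o"] by simp
    also have "\<dots> = (\<Sum>Q | Q \<in> orbits1 \<and> sing Q \<subseteq> \<pi>. ?F (sing Q))"
      by (rule sum.reindex_bij_betw[OF orbits1_bij[OF \<pi>T], symmetric])
    also have "\<dots> = (\<Sum>\<rho>\<in>bfree \<pi>. ?E \<rho>)" by (rule sum_deleted_orbits[OF \<pi>T, symmetric])
    finally show ?thesis using True ne by simp
  qed
  finally show ?thesis .
qed

text \<open>At the bottom every set in \<open>orbits1\<close> consists of singleton blocks. Its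
  correction depends on its class only, and \<open>lookup (ty T) (1, c)\<close> of them have class
  \<open>c\<close>.\<close>

theorem bottom_weight:
  "wt {} (sing T) = gval G (-1) (ty T) +
    (\<Sum>c\<in>conj_classes G. of_nat (lookup (ty T) (1, c)) * gval G (-1) (ty T - single (1, c) 1))"
proof -
  define cl where "cl Q = snd (tp (SOME z. z \<in> Q))" for Q
  have ne: "\<exists>z. z \<in> Q" if "Q \<in> orbits1" for Q
    using that order_pos unfolding orbits1_def by (metis (mono_tags, lifting) card.empty ex_in_conv less_irrefl mem_Collect_eq)
  have QT: "z \<in> T" if "Q \<in> orbits1" "z \<in> Q" for Q z using that by (auto simp: orbits1_def stable_def)
  have tp: "tp z = (1, cl Q)" if Q: "Q \<in> orbits1" "z \<in> Q" for Q z
  proof -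
    have s: "(SOME z. z \<in> Q) \<in> Q" using ne[OF Q(1)] by (rule someI_ex)
    have "tp (SOME z. z \<in> Q) = tp z"
      using tp_orb[OF QT[OF Q]] s orbits1_orb(1)[OF Q] by blast
    moreover have "fst (tp z) = 1" using orbits1_orb(2)[OF Q] by (simp add: tp_def)
    ultimately show ?thesis by (simp add: cl_def prod_eq_iff)
  qed
  have minus: "ty (T - Q) = ty T - single (1, cl Q) 1" if Q: "Q \<in> orbits1" for Q
  proof -
    obtain z where z: "z \<in> Q" using ne[OF Q] by blast
    note o = orbits1_orb(1)[OF Q z]
    have "ty (T - Q \<union> orb z) = ty (T - Q) + single (tp z) 1"
      using finT o by (intro ty_add_orbit QT[OF Q z]) auto
    moreover have "T - Q \<union> orb z = T" using o orb_subset[OF QT[OF Q z]] by blast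
    ultimately show ?thesis using tp[OF Q z] by simp
  qed
  have "{Q \<in> orbits1. sing Q \<subseteq> sing T} = orbits1"
    by (auto simp: orbits1_def stable_def)
  moreover have "bty (sing T - sing Q) = ty (T - Q)" if "Q \<in> orbits1" for Q
  proof -
    have "sing T - sing Q = sing (T - Q)" by blast
    then show ?thesis using sing_free(2)[OF stable_Diff[OF stable_T, of Q]] that by (simp add: orbits1_def)
  qed
  ultimately have "wt {} (sing T) = gval G (-1) (ty T) + (\<Sum>Q\<in>orbits1. gval G (-1) (ty T - single (1, cl Q) 1))"
    unfolding wt_def by (simp add: sing_free(2)[OF stable_T] minus cong: sum.cong)
  also have "(\<Sum>Q\<in>orbits1. gval G (-1) (ty T - single (1, cl Q) 1)) =
      (\<Sum>c\<in>conj_classes G. \<Sum>Q | Q \<in> orbits1 \<and> cl Q = c. gval G (-1) (ty T - single (1, cl Q) 1))"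
  proof (rule sum.group[OF finite_orbits1, symmetric])
    show "finite (conj_classes G)" using finG by (simp add: conj_classes_def)
    show "cl ` orbits1 \<subseteq> conj_classes G"
    proof
      fix c assume "c \<in> cl ` orbits1"
      then obtain Q z where Q: "Q \<in> orbits1" "c = cl Q" "z \<in> Q" using ne by blast
      then show "c \<in> conj_classes G" using tp_in[OF QT[OF Q(1,3)]] tp[OF Q(1,3)] by simp
    qed
  qed
  also have "\<dots> = (\<Sum>c\<in>conj_classes G. of_nat (lookup (ty T) (1, c)) * gval G (-1) (ty T - single (1, c) 1))"
  proof (rule sum.cong[OF refl])
    fix c
    let ?Q = "{Q \<in> orbits1. cl Q = c}"
    have "{z \<in> T. tp z = (1, c)} = (\<Union>Q\<in>?Q. Q)"
    proof (intro equalityI subsetI)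
      fix z assume z: "z \<in> {z \<in> T. tp z = (1, c)}"
      then have "orb z \<in> orbits1" using stable_orb[of z] card_orb[of z] by (simp add: orbits1_def tp_def)
      moreover from this have "cl (orb z) = c" using tp[of "orb z" z] orb_self[of z] z by simp
      ultimately show "z \<in> (\<Union>Q\<in>?Q. Q)" using orb_self[of z] z by blast
    next
      fix z assume "z \<in> (\<Union>Q\<in>?Q. Q)"
      then show "z \<in> {z \<in> T. tp z = (1, c)}" using tp QT by blast
    qed
    moreover have "card (\<Union>Q\<in>?Q. Q) = (\<Sum>Q\<in>?Q. card Q)"
    proof (rule card_UN_disjoint)
      show "finite ?Q" using finite_orbits1 by simp
      show "\<forall>Q\<in>?Q. finite Q" by (simp add: orbits1_def stable_finite)
      show "\<forall>Q\<in>?Q. \<forall>Q'\<in>?Q. Q \<noteq> Q' \<longrightarrow> Q \<inter> Q' = {}" using orbits1_orb(1) by blast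
    qed
    moreover have "(\<Sum>Q\<in>?Q. card Q) = card ?Q * order G" by (simp add: orbits1_def)
    ultimately have "card {z \<in> T. tp z = (1, c)} = card ?Q * order G" by simp
    then have "card ?Q = lookup (ty T) (1, c)"
      using lookup_ty_mult[OF stable_T, of "(1, c)"] order_pos by simp
    then show "(\<Sum>Q | Q \<in> orbits1 \<and> cl Q = c. gval G (-1) (ty T - single (1, cl Q) 1)) =
        of_nat (lookup (ty T) (1, c)) * gval G (-1) (ty T - single (1, c) 1)"
      by simp
  qed
  finally show ?thesis .
qed

end

section \<open>The Dowling poset\<close>

context gaut
begin

definition gorb :: "'t \<Rightarrow> 't set" where
  "gorb z = (\<lambda>g. \<alpha> g z) ` carrier G"

lemma gorb_sub: "z \<in> T \<Longrightarrow> gorb z \<subseteq> T"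
  using a_closed by (auto simp: gorb_def)

lemma gorb_self: "z \<in> T \<Longrightarrow> z \<in> gorb z"
  using a_one[of z] unfolding gorb_def by (metis imageI one_closed)

lemma gorb_a: "z \<in> T \<Longrightarrow> w \<in> gorb z \<Longrightarrow> g \<in> carrier G \<Longrightarrow> \<alpha> g w \<in> gorb z"
  unfolding gorb_def using a_mult[of g _ z, symmetric] by auto

lemma card_gorb: "z \<in> T \<Longrightarrow> card (gorb z) = order G"
  unfolding gorb_def order_def by (rule card_image) (auto intro: inj_onI a_eq)

lemma gorb_disjoint:
  assumes "z \<in> T" "w \<in> T" "w \<notin> gorb z"
  shows "gorb z \<inter> gorb w = {}"
proof (rule ccontr)
  assume "gorb z \<inter> gorb w \<noteq> {}"
  then obtain g h where gh: "g \<in> carrier G" "h \<in> carrier G" "\<alpha> g z = \<alpha> h w" by (auto simp: gorb_def)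
  have "w = \<alpha> (inv h) (\<alpha> g z)" using gh assms a_inv[OF gh(2) assms(2)] by simp
  also have "\<dots> = \<alpha> (inv h \<otimes> g) z" using gh assms by (simp add: a_mult)
  finally show False using assms(3) gh unfolding gorb_def by blast
qed

lemma stable_gorb_sub: "stable U \<Longrightarrow> z \<in> U \<Longrightarrow> gorb z \<subseteq> U"
  by (auto simp: stable_def gorb_def)

context
  assumes x_id: "\<And>z. z \<in> T \<Longrightarrow> x z = z"
begin

lemma stable_gorb: "z \<in> T \<Longrightarrow> stable (gorb z)"
proof -
  assume z: "z \<in> T"
  have "x w = w" if "w \<in> gorb z" for w using x_id gorb_sub[OF z] that by blast
  then show ?thesis unfolding stable_def using gorb_sub[OF z] gorb_a[OF z] by simp
qed

text \<open>The pairs are disjoint because the two orbits are, and freely permuted because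
  \<open>G\<close> is free on each. Applied to blocks in place of points, this merges two orbits of
  blocks.\<close>

lemma pair_free:
  assumes k: "k \<in> T" and l: "l \<in> T" "l \<notin> gorb k"
  shows "(\<lambda>g. {\<alpha> g k, \<alpha> g l}) ` carrier G \<in> free_partitions (gorb k \<union> gorb l)"
proof -
  let ?p = "\<lambda>g. {\<alpha> g k, \<alpha> g l}"
  have ne: "\<alpha> g k \<noteq> \<alpha> h l" if "g \<in> carrier G" "h \<in> carrier G" for g h
    using gorb_disjoint[OF k l] that unfolding gorb_def by blast
  have eq: "g = h" if gh: "g \<in> carrier G" "h \<in> carrier G" "?p g \<inter> ?p h \<noteq> {}" for g h
  proof -
    have "\<alpha> g k = \<alpha> h k \<or> \<alpha> g l = \<alpha> h l" using gh(3) ne[OF gh(1,2)] ne[OF gh(2,1)] by auto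
    then show ?thesis using a_eq[OF gh(1,2) k] a_eq[OF gh(1,2) l(1)] by blast
  qed
  have im: "\<alpha> h ` ?p g = ?p (h \<otimes> g)" if "g \<in> carrier G" "h \<in> carrier G" for g h
    using that k l by (simp add: a_mult)
  have A: "partition_on (gorb k \<union> gorb l) (?p ` carrier G)"
  proof (rule partition_onI)
    show "\<Union>(?p ` carrier G) = gorb k \<union> gorb l" by (auto simp: gorb_def)
    show "disjnt P Q" if PQ: "P \<in> ?p ` carrier G" "Q \<in> ?p ` carrier G" "P \<noteq> Q" for P Q
    proof -
      obtain g h where gh: "g \<in> carrier G" "P = ?p g" "h \<in> carrier G" "Q = ?p h" using PQ(1,2) by blast
      then show ?thesis using eq[OF gh(1,3)] PQ(3) unfolding disjnt_def by blast
    qed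
    show "{} \<notin> ?p ` carrier G" by auto
  qed
  have B: "\<alpha> h ` K \<in> ?p ` carrier G" if h: "h \<in> carrier G" "K \<in> ?p ` carrier G" for h K
    using h im by auto
  have C: "x ` K \<in> ?p ` carrier G" if K: "K \<in> ?p ` carrier G" for K
  proof -
    have "K \<subseteq> T" using K k l a_closed by auto
    then have "x ` K = K" using x_id by force
    then show ?thesis using K by simp
  qed
  have E: "h = \<one>" if h: "h \<in> carrier G" "K \<in> ?p ` carrier G" "\<alpha> h ` K = K" for h K
  proof -
    obtain g where g: "g \<in> carrier G" "K = ?p g" using h(2) by blast
    have "?p (h \<otimes> g) = ?p g" using h(3) unfolding g(2) im[OF g(1) h(1)] .
    then have "h \<otimes> g = g" using eq[of "h \<otimes> g" g] g h by simp
    then show ?thesis using g h by (metis r_cancel_one')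
  qed
  show ?thesis
    unfolding free_partitions_def by (intro CollectI conjI ballI impI A) (erule B C E; assumption)+
qed

end

end

lemma dowling_le_iff:
  "dowling_le y z \<longleftrightarrow> fst y \<subseteq> fst z \<and> (\<forall>K\<in>snd y. K \<subseteq> fst z \<or> (\<exists>K'\<in>snd z. K \<subseteq> K'))"
  by (cases y; cases z) simp

locale dowling = fin_group G for G :: "('a, 'b) monoid_scheme" (structure) +
  fixes n :: nat
  assumes n: "2 \<le> n"
begin

definition pts :: "('a \<times> nat) set" where
  "pts = carrier G \<times> {1..n}"

text \<open>With \<open>id\<close> in place of \<open>x\<close>, the description of fixed elements
  becomes one of the whole poset.\<close>

sublocale D: gaut G "act G" id pts
  unfolding pts_def by (rule wreath_gaut) (auto simp: label_wreath_def permutes_id)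

definition elts :: "'a dowling_elt set" where
  "elts = {y. D.stable (fst y) \<and> snd y \<in> D.free_partitions (pts - fst y) \<and> card (fst y) \<noteq> order G}"

lemma eltsD:
  assumes "y \<in> elts"
  shows "D.stable (fst y)" "snd y \<in> D.free_partitions (pts - fst y)" "card (fst y) \<noteq> order G"
    "fst y \<subseteq> pts" "partition_on (pts - fst y) (snd y)"
  using assms D.free_partitionsD(1)[of "snd y"] by (auto simp: elts_def D.stable_def)

lemma carrier_tilde: "carrier (dowling_tilde G n) = elts"
proof -
  have "y \<in> dowling_elts G n \<longleftrightarrow> D.stable (fst y) \<and> snd y \<in> D.free_partitions (pts - fst y)" for y
  proof -
    obtain J \<pi> where y: "y = (J, \<pi>)" by (cases y)
    let ?cl = "\<forall>g\<in>carrier G. \<forall>K\<in>\<pi>. act G g ` K \<in> \<pi>"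
    have 1: "(J \<subseteq> pts \<and> (\<forall>g\<in>carrier G. act G g ` J = J)) = D.stable J"
    proof
      assume st: "D.stable J"
      then show "J \<subseteq> pts \<and> (\<forall>g\<in>carrier G. act G g ` J = J)"
        using D.a_surj[OF st] by (simp add: D.stable_def)
    next
      assume "J \<subseteq> pts \<and> (\<forall>g\<in>carrier G. act G g ` J = J)"
      then show "D.stable J" unfolding D.stable_def by auto
    qed
    have 2: "(\<forall>g\<in>carrier G - {\<one>}. \<forall>K\<in>\<pi>. K \<noteq> act G g ` K) =
        (\<forall>g\<in>carrier G. \<forall>K\<in>\<pi>. act G g ` K = K \<longrightarrow> g = \<one>)"
    proof (intro iffI ballI impI)
      fix g K assume A: "\<forall>g\<in>carrier G - {\<one>}. \<forall>K\<in>\<pi>. K \<noteq> act G g ` K" "g \<in> carrier G" "K \<in> \<pi>" "act G g ` K = K"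
      show "g = \<one>"
      proof (rule ccontr)
        assume "g \<noteq> \<one>"
        then have "K \<noteq> act G g ` K" using A(1-3) by blast
        then show False using A(4) by simp
      qed
    next
      fix g K assume A: "\<forall>g\<in>carrier G. \<forall>K\<in>\<pi>. act G g ` K = K \<longrightarrow> g = \<one>" "g \<in> carrier G - {\<one>}" "K \<in> \<pi>"
      show "K \<noteq> act G g ` K"
      proof
        assume "K = act G g ` K"
        then have "act G g ` K = K" by (rule sym)
        moreover have "g \<in> carrier G" using A(2) by simp
        ultimately have "g = \<one>" using A(1,3) by blast
        then show False using A(2) by simp
      qed
    qed
    have "y \<in> dowling_elts G n \<longleftrightarrow> (J \<subseteq> pts \<and> (\<forall>g\<in>carrier G. act G g ` J = J)) \<and> partition_on (pts - J) \<pi> \<and>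
        ?cl \<and> (\<forall>g\<in>carrier G - {\<one>}. \<forall>K\<in>\<pi>. K \<noteq> act G g ` K)"
      unfolding y dowling_elts_def pts_def[symmetric] by (simp only: mem_Collect_eq prod.case conj_assoc)
    also have "\<dots> \<longleftrightarrow> D.stable J \<and> \<pi> \<in> D.free_partitions (pts - J)"
      unfolding 1 2 D.free_partitions_def by simp
    finally show ?thesis by (simp add: y)
  qed
  moreover have "(of_nat (card J) / of_nat (order G) :: rat) \<noteq> 1 \<longleftrightarrow> card J \<noteq> order G" for J :: "('a \<times> nat) set"
    using D.order_pos by (auto simp: divide_eq_1_iff)
  ultimately show ?thesis
    by (auto simp: dowling_tilde_def dowling_lattice_def elts_def)
qed

lemma le_block:
  assumes y: "y \<in> elts" and z: "z \<in> elts" and le: "dowling_le y z" and K: "K \<in> snd y" "v \<in> K"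
  shows "v \<in> fst z \<Longrightarrow> K \<subseteq> fst z" "M \<in> snd z \<Longrightarrow> v \<in> M \<Longrightarrow> K \<subseteq> M"
proof -
  have d: "K \<subseteq> fst z \<or> (\<exists>K'\<in>snd z. K \<subseteq> K')" using le K by (auto simp: dowling_le_iff)
  note p = eltsD(5)[OF z]
  show "K \<subseteq> fst z" if v: "v \<in> fst z"
  proof (rule ccontr)
    assume "\<not> K \<subseteq> fst z"
    then obtain K' where K': "K' \<in> snd z" "K \<subseteq> K'" using d by blast
    then show False using partition_on_sub[OF p K'(1)] K(2) v by blast
  qed
  show "K \<subseteq> M" if M: "M \<in> snd z" "v \<in> M"
  proof -
    have "\<not> K \<subseteq> fst z" using partition_on_sub[OF p M(1)] M(2) K(2) by blast
    then obtain K' where K': "K' \<in> snd z" "K \<subseteq> K'" using d by blast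
    have "K' = M" by (rule partition_on_unique[OF p K'(1) M(1) _ M(2)]) (use K' K in blast)
    then show ?thesis using K' by simp
  qed
qed

lemma le_covers:
  assumes y: "y \<in> elts" and z: "z \<in> elts" and le: "dowling_le y z" and M: "M \<in> snd z" "v \<in> M"
  shows "\<exists>K\<in>snd y. v \<in> K \<and> K \<subseteq> M"
proof -
  have "v \<in> pts - fst z" using partition_on_sub[OF eltsD(5)[OF z] M(1)] M(2) by blast
  then have "v \<in> pts - fst y" using le by (auto simp: dowling_le_iff)
  then obtain K where K: "K \<in> snd y" "v \<in> K" using partition_on_block[OF eltsD(5)[OF y]] by blast
  then show ?thesis using le_block(2)[OF y z le K M] by blast
qed

lemma elts_poset: "fin_poset elts dowling_le"
proof
  have "elts \<subseteq> Pow pts \<times> Pow (Pow pts)"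
  proof
    fix y assume y: "y \<in> elts"
    have "snd y \<subseteq> Pow pts" using partition_on_sub[OF eltsD(5)[OF y]] by blast
    then show "y \<in> Pow pts \<times> Pow (Pow pts)" using eltsD(4)[OF y] by (simp add: mem_Times_iff)
  qed
  then show "finite elts" by (rule finite_subset) (simp add: D.finT)
  show "dowling_le y y" for y by (auto simp: dowling_le_iff)
  show "dowling_le y w" if yzw: "z \<in> elts" "dowling_le y z" "dowling_le z w" for y z w
    unfolding dowling_le_iff
  proof (intro conjI ballI)
    show "fst y \<subseteq> fst w" using yzw by (auto simp: dowling_le_iff)
    fix K assume "K \<in> snd y"
    then have "K \<subseteq> fst z \<or> (\<exists>K'\<in>snd z. K \<subseteq> K')" using yzw by (simp add: dowling_le_iff)
    then show "K \<subseteq> fst w \<or> (\<exists>K'\<in>snd w. K \<subseteq> K')"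
    proof
      assume "K \<subseteq> fst z"
      then show ?thesis using yzw by (auto simp: dowling_le_iff)
    next
      assume "\<exists>K'\<in>snd z. K \<subseteq> K'"
      then obtain K' where K': "K' \<in> snd z" "K \<subseteq> K'" by blast
      then have "K' \<subseteq> fst w \<or> (\<exists>K''\<in>snd w. K' \<subseteq> K'')" using yzw by (simp add: dowling_le_iff)
      then show ?thesis using K'(2) by blast
    qed
  qed
  show "y = z" if yz: "y \<in> elts" "z \<in> elts" "dowling_le y z" "dowling_le z y" for y z
  proof -
    have sub: "snd y \<subseteq> snd z" if y: "y \<in> elts" and z: "z \<in> elts" and "dowling_le y z" "dowling_le z y" for y z
    proof
      fix K assume K: "K \<in> snd y"
      then obtain v where v: "v \<in> K" using partition_on_ne[OF eltsD(5)[OF y]] by blast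
      obtain M where M: "M \<in> snd z" "v \<in> M" "M \<subseteq> K" using le_covers[OF z y \<open>dowling_le z y\<close> K v] by blast
      then have "K \<subseteq> M" using le_block(2)[OF y z \<open>dowling_le y z\<close> K v] by blast
      then show "K \<in> snd z" using M by auto
    qed
    have "fst y = fst z" using yz by (auto simp: dowling_le_iff)
    moreover have "snd y = snd z" using sub[OF yz] sub[OF yz(2,1,4,3)] by blast
    ultimately show ?thesis by (rule prod_eqI)
  qed
qed

text \<open>The number of G-orbits of blocks lost since the bottom element; the division is exact
  because blocks come in free orbits.\<close>

definition rk :: "'a dowling_elt \<Rightarrow> nat" where
  "rk y = n - card (snd y) div order G"

lemma blocks:
  "y \<in> elts \<Longrightarrow> gaut G (\<lambda>g. (`) (act G g)) ((`) id) (snd y)"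
  by (rule D.blocks_gaut[OF D.stable_Diff[OF D.stable_T eltsD(1)] eltsD(2)])

lemma card_blocks:
  assumes y: "y \<in> elts"
  shows "order G dvd card (snd y)" "card (snd y) \<le> order G * n"
proof -
  interpret P: gaut G "\<lambda>g. (`) (act G g)" "(`) id" "snd y" by (rule blocks[OF y])
  show "order G dvd card (snd y)" using P.pweight_ty[OF P.stable_T] by (metis dvd_triv_left)
  note p = eltsD(5)[OF y]
  let ?f = "\<lambda>K. SOME v. v \<in> K"
  have f: "?f K \<in> K" if "K \<in> snd y" for K
    using partition_on_ne[OF p that] by (simp add: some_in_eq)
  have "inj_on ?f (snd y)"
  proof (rule inj_onI)
    fix K L assume "K \<in> snd y" "L \<in> snd y" "?f K = ?f L"
    then show "K = L" using partition_on_unique[OF p, of K L "?f K"] f[of K] f[of L] by simp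
  qed
  moreover have "?f ` snd y \<subseteq> pts" using f partition_on_sub[OF p] by blast
  ultimately have "card (snd y) \<le> card pts" by (rule card_inj_on_le) (simp add: D.finT)
  then show "card (snd y) \<le> order G * n" by (simp add: pts_def card_cartesian_product order_def)
qed

lemma finite_blocks: "y \<in> elts \<Longrightarrow> finite (snd y)"
  using gaut.finT[OF blocks] .

text \<open>Every block of \<open>z\<close> contains a block of \<open>y\<close>, and the ones
  chosen are distinct. If there are equally many blocks, these are all the blocks of
  \<open>y\<close>, and by \<open>le_covers\<close> they fill the blocks of
  \<open>z\<close>.\<close>

lemma card_less:
  assumes y: "y \<in> elts" and z: "z \<in> elts" and le: "dowling_le y z" "y \<noteq> z"
  shows "card (snd z) < card (snd y)"
proof (rule ccontr)
  assume ge: "\<not> card (snd z) < card (snd y)"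
  have "\<exists>K\<in>snd y. K \<subseteq> M" if M: "M \<in> snd z" for M
  proof -
    obtain v where "v \<in> M" using partition_on_ne[OF eltsD(5)[OF z] M] by blast
    then show ?thesis using le_covers[OF y z le(1) M] by blast
  qed
  then obtain f where f: "\<And>M. M \<in> snd z \<Longrightarrow> f M \<in> snd y \<and> f M \<subseteq> M" by metis
  have fM: "M = M'" if M: "M \<in> snd z" "M' \<in> snd z" "f M \<subseteq> M'" for M M'
  proof -
    obtain v where v: "v \<in> f M" using partition_on_ne[OF eltsD(5)[OF y]] f[OF M(1)] by blast
    show ?thesis by (rule partition_on_unique[OF eltsD(5)[OF z] M(1,2), of v]) (use v f[OF M(1)] M(3) in auto)
  qed
  have inj: "inj_on f (snd z)"
  proof (rule inj_onI)
    fix M M' assume "M \<in> snd z" "M' \<in> snd z" "f M = f M'"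
    then show "M = M'" using fM[of M M'] f[of M'] by simp
  qed
  have im: "f ` snd z = snd y"
    by (rule card_subset_eq[OF finite_blocks[OF y]])
      (use f ge card_image[OF inj] card_inj_on_le[OF inj _ finite_blocks[OF y]] in \<open>auto simp: not_less\<close>)
  have id: "f M = M" if M: "M \<in> snd z" for M
  proof
    show "M \<subseteq> f M"
    proof
      fix v assume v: "v \<in> M"
      obtain K where K: "K \<in> snd y" "v \<in> K" "K \<subseteq> M" using le_covers[OF y z le(1) M v] by blast
      then obtain M' where M': "M' \<in> snd z" "K = f M'" using im by blast
      then have "M' = M" using fM[OF M'(1) M] K by simp
      then show "v \<in> f M" using K M' by simp
    qed
  qed (use f M in blast)
  have sn: "snd z = snd y" using im id by auto
  have "fst z = fst y"
  proof -
    have "pts - fst z = pts - fst y"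
      using partition_onD1[OF eltsD(5)[OF y]] partition_onD1[OF eltsD(5)[OF z]] sn by simp
    then show ?thesis using eltsD(4)[OF y] eltsD(4)[OF z] by blast
  qed
  then show False using sn le(2) by (simp add: prod_eq_iff)
qed

lemma rk_less:
  assumes y: "y \<in> elts" and z: "z \<in> elts" and le: "dowling_le y z" "y \<noteq> z"
  shows "rk y < rk z"
proof -
  obtain a where a: "card (snd y) = order G * a" using card_blocks(1)[OF y] by (auto elim: dvdE)
  obtain c where c: "card (snd z) = order G * c" using card_blocks(1)[OF z] by (auto elim: dvdE)
  have "c < a" using card_less[OF assms] D.order_pos by (simp add: a c)
  moreover have "a \<le> n" using card_blocks(2)[OF y] D.order_pos by (simp add: a)
  ultimately show ?thesis using D.order_pos by (simp add: rk_def a c)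
qed

text \<open>The first component acts as one more block, the zero block. Atoms are handled through a
  pair of points that they link: the join of \<open>y\<close> with such an atom is the least element
  above \<open>y\<close> linking the pair, so the atoms need no explicit description.\<close>

definition linked :: "'a dowling_elt \<Rightarrow> 'a \<times> nat \<Rightarrow> 'a \<times> nat \<Rightarrow> bool" where
  "linked y s t \<longleftrightarrow> s \<in> fst y \<and> t \<in> fst y \<or> (\<exists>K\<in>snd y. s \<in> K \<and> t \<in> K)"

lemma linked_sym: "linked y s t \<longleftrightarrow> linked y t s"
  by (auto simp: linked_def)

lemma linked_mono: "linked y s t \<Longrightarrow> dowling_le y z \<Longrightarrow> linked z s t"
proof -
  assume l: "linked y s t" and le: "dowling_le y z"
  have J: "fst y \<subseteq> fst z" and B: "\<And>K. K \<in> snd y \<Longrightarrow> K \<subseteq> fst z \<or> (\<exists>K'\<in>snd z. K \<subseteq> K')"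
    using le by (auto simp: dowling_le_iff)
  from l show "linked z s t"
    unfolding linked_def
  proof
    assume "\<exists>K\<in>snd y. s \<in> K \<and> t \<in> K"
    then obtain K where K: "K \<in> snd y" "s \<in> K" "t \<in> K" by blast
    show "s \<in> fst z \<and> t \<in> fst z \<or> (\<exists>K\<in>snd z. s \<in> K \<and> t \<in> K)" using B[OF K(1)] K(2,3) by blast
  qed (use J in blast)
qed

abbreviation "borb \<equiv> gaut.gorb G (\<lambda>g. (`) (act G g))"

text \<open>The zero block swallows the G-orbit of \<open>K\<close>, at the cost of
  \<open>order G\<close> blocks.\<close>

lemma absorb_join:
  assumes y: "y \<in> elts" and K: "K \<in> snd y"
    and st: "s \<in> fst y \<union> \<Union>(borb K)" "t \<in> fst y \<union> \<Union>(borb K)" "snd s \<noteq> snd t"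
  shows "\<exists>j\<in>elts. dowling_le y j \<and> linked j s t \<and> card (snd y) \<le> card (snd j) + order G \<and>
    (\<forall>z\<in>elts. dowling_le y z \<longrightarrow> K \<subseteq> fst z \<longrightarrow> dowling_le j z)"
proof -
  interpret P: gaut G "\<lambda>g. (`) (act G g)" "(`) id" "snd y" by (rule blocks[OF y])
  let ?U = "P.gorb K" and ?J = "fst y \<union> \<Union>(P.gorb K)"
  have U: "P.stable ?U" by (rule P.stable_gorb) (simp_all add: K)
  have U\<pi>: "?U \<subseteq> snd y" by (rule P.gorb_sub[OF K])
  note cf = D.coarsen_free(1)[OF eltsD(1,2)[OF y] U P.sing_free(1)[OF P.stable_Diff[OF P.stable_T U]]]
  have us: "Union ` sing (snd y - ?U) = snd y - ?U" by (simp add: image_image)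
  have J: "D.stable ?J" by (rule D.stable_Union[OF eltsD(1,2)[OF y] U])
  \<comment> \<open>A zero block of this size would be a single G-orbit, where all labels agree. The
    different labels of \<open>s\<close> and \<open>t\<close> thus keep the join inside the
    poset.\<close>
  have "card ?J \<noteq> order G"
  proof
    assume "card ?J = order G"
    then have "?J \<in> D.orbits1" using J by (simp add: D.orbits1_def)
    then obtain g where "t = act G g s" using D.orbits1_act[of ?J s t] st by blast
    then show False using st(3) by (simp add: act_def)
  qed
  then have j: "(?J, snd y - ?U) \<in> elts" using J cf us by (simp add: elts_def)
  have "card (snd y - ?U) = card (snd y) - order G"
    using card_Diff_subset[OF finite_subset[OF U\<pi> finite_blocks[OF y]] U\<pi>] P.card_gorb[OF K] by simp
  moreover have "dowling_le y (?J, snd y - ?U)" by (auto simp: dowling_le_iff)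
  moreover have "linked (?J, snd y - ?U) s t" using st by (simp add: linked_def)
  moreover have "dowling_le (?J, snd y - ?U) z" if z: "z \<in> elts" "dowling_le y z" "K \<subseteq> fst z" for z
  proof -
    have "L \<subseteq> fst z" if "L \<in> ?U" for L
      using that z(3) eltsD(1)[OF z(1)] unfolding P.gorb_def D.stable_def by auto
    then show ?thesis using z(2) by (auto simp: dowling_le_iff)
  qed
  ultimately show ?thesis using j by (intro bexI[of _ "(?J, snd y - ?U)"]) auto
qed

text \<open>Every translate of \<open>K\<close> is merged with the same translate of
  \<open>L\<close>, which equivariance forces once \<open>s\<close> and \<open>t\<close> share a
  block; \<open>order G\<close> blocks disappear.\<close>

lemma merge_join:
  assumes y: "y \<in> elts" and K: "K \<in> snd y" "s \<in> K" and L: "L \<in> snd y" "t \<in> L" "L \<notin> borb K"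
  shows "\<exists>j\<in>elts. dowling_le y j \<and> linked j s t \<and> card (snd y) \<le> card (snd j) + order G \<and>
    (\<forall>z\<in>elts. dowling_le y z \<longrightarrow> linked z s t \<longrightarrow> dowling_le j z)"
proof -
  interpret P: gaut G "\<lambda>g. (`) (act G g)" "(`) id" "snd y" by (rule blocks[OF y])
  have xid: "id ` M = M" for M :: "('a \<times> nat) set" by simp
  note p = eltsD(5)[OF y]
  let ?V = "P.gorb K \<union> P.gorb L" and ?p = "\<lambda>g. {act G g ` K, act G g ` L}" and ?m = "\<lambda>g. act G g ` K \<union> act G g ` L"
  let ?\<rho> = "sing (snd y - ?V) \<union> ?p ` carrier G"
  have V: "P.stable ?V" by (intro P.stable_Un P.stable_gorb xid K L)
  have "?\<rho> \<in> P.free_partitions (snd y - ?V \<union> ?V)"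
    by (rule P.free_partitions_Un[OF P.stable_Diff[OF P.stable_T V] V _ P.sing_free(1)[OF P.stable_Diff[OF P.stable_T V]]
        P.pair_free[OF xid K(1) L(1,3)]]) blast
  moreover have Vsub: "?V \<subseteq> snd y" using P.gorb_sub K L by blast
  ultimately have \<rho>: "?\<rho> \<in> P.free_partitions (snd y - {})" by (simp add: Un_absorb2)
  let ?\<pi> = "(snd y - ?V) \<union> ?m ` carrier G"
  have us: "Union ` ?\<rho> = ?\<pi>" by (simp add: image_Un image_image)
  have "?\<pi> \<in> D.free_partitions (pts - (fst y \<union> \<Union>{}))"
    using D.coarsen_free(1)[OF eltsD(1,2)[OF y] P.stable_empty \<rho>] unfolding us .
  then have j: "(fst y, ?\<pi>) \<in> elts" using y by (simp add: elts_def)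
  have orbm: "act G g ` K \<in> P.gorb K" "act G g ` L \<in> P.gorb L" if "g \<in> carrier G" for g
    using that by (auto simp: P.gorb_def)
  have disj: "P.gorb K \<inter> P.gorb L = {}" by (rule P.gorb_disjoint[OF K(1) L(1,3)])
  have meet: "M = act G g ` K \<or> M = act G g ` L" if M: "M \<in> snd y" "M \<inter> ?m g \<noteq> {}" "g \<in> carrier G" for M g
  proof -
    obtain v where "v \<in> M" "v \<in> act G g ` K \<or> v \<in> act G g ` L" using M(2) by blast
    then show ?thesis
      using partition_on_unique[OF p M(1), of _ v] P.a_closed[OF M(3) K(1)] P.a_closed[OF M(3) L(1)] by blast
  qed
  have ne: "M \<noteq> {}" if "M \<in> snd y" for M using partition_on_ne[OF p that] .
  have injm: "inj_on ?m (carrier G)"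
  proof (rule inj_onI)
    fix g h assume gh: "g \<in> carrier G" "h \<in> carrier G" "?m g = ?m h"
    have gK: "act G g ` K \<in> snd y" using P.a_closed[OF gh(1) K(1)] .
    have "act G g ` K \<inter> ?m h \<noteq> {}" using ne[OF gK] unfolding gh(3)[symmetric] by blast
    then have "act G g ` K = act G h ` K \<or> act G g ` K = act G h ` L" by (rule meet[OF gK _ gh(2)])
    moreover have "act G g ` K \<noteq> act G h ` L" using orbm[OF gh(1)] orbm[OF gh(2)] disj by auto
    ultimately show "g = h" using P.a_eq[OF gh(1,2) K(1)] by blast
  qed
  have dis: "(snd y - ?V) \<inter> ?m ` carrier G = {}"
  proof (rule ccontr)
    assume "(snd y - ?V) \<inter> ?m ` carrier G \<noteq> {}"
    then obtain g where g: "g \<in> carrier G" "?m g \<in> snd y" "?m g \<notin> ?V" by blast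
    have "?m g \<inter> ?m g \<noteq> {}" using ne[OF g(2)] by simp
    then have "?m g = act G g ` K \<or> ?m g = act G g ` L" by (rule meet[OF g(2) _ g(1)])
    then show False using g(3) orbm[OF g(1)] by auto
  qed
  have finV: "finite ?V" using Vsub finite_blocks[OF y] by (rule finite_subset)
  have "card ?V = order G + order G"
    using card_Un_disjoint[OF _ _ disj] finV P.card_gorb K L by simp
  moreover have "card ?V \<le> card (snd y)" by (rule card_mono[OF finite_blocks[OF y] Vsub])
  moreover have "card (snd y - ?V) = card (snd y) - card ?V" by (rule card_Diff_subset[OF finV Vsub])
  moreover have "card ?\<pi> = card (snd y - ?V) + order G"
    using card_Un_disjoint[OF _ _ dis] finite_blocks[OF y] D.finG card_image[OF injm] by (simp add: order_def)
  ultimately have c: "card (snd y) \<le> card ?\<pi> + order G" by linarith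
  have le: "dowling_le y (fst y, ?\<pi>)"
    unfolding dowling_le_iff
  proof (intro conjI ballI)
    fix M assume M: "M \<in> snd y"
    have "\<exists>M'\<in>?\<pi>. M \<subseteq> M'"
    proof (cases "M \<in> ?V")
      case True
      then obtain g where "g \<in> carrier G" "M \<subseteq> ?m g" unfolding P.gorb_def by blast
      then show ?thesis by blast
    qed (use M in blast)
    then show "M \<subseteq> fst (fst y, ?\<pi>) \<or> (\<exists>M'\<in>snd (fst y, ?\<pi>). M \<subseteq> M')" by simp
  qed simp
  have lk: "linked (fst y, ?\<pi>) s t"
  proof -
    have "act G \<one> ` K = K" "act G \<one> ` L = L" using P.a_one K L by auto
    then have "?m \<one> = K \<union> L" by simp
    moreover have "?m \<one> \<in> ?\<pi>" by (rule UnI2, rule imageI, rule one_closed)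
    ultimately have "K \<union> L \<in> ?\<pi>" by (simp only:)
    moreover have "s \<in> K \<union> L \<and> t \<in> K \<union> L" using K L by auto
    ultimately show ?thesis unfolding linked_def snd_conv by (intro disjI2 bexI[of _ "K \<union> L"])
  qed
  have "dowling_le (fst y, ?\<pi>) z" if z: "z \<in> elts" "dowling_le y z" "linked z s t" for z
  proof -
    have m: "?m g \<subseteq> fst z \<or> (\<exists>M'\<in>snd z. ?m g \<subseteq> M')" if g: "g \<in> carrier G" for g
      using z(3) unfolding linked_def
    proof
      assume "s \<in> fst z \<and> t \<in> fst z"
      then have "K \<subseteq> fst z" "L \<subseteq> fst z"
        using le_block(1)[OF y z(1,2)] K L by blast+
      then have "?m g \<subseteq> fst z" using eltsD(1)[OF z(1)] g unfolding D.stable_def by blast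
      then show ?thesis by blast
    next
      assume "\<exists>M\<in>snd z. s \<in> M \<and> t \<in> M"
      then obtain M where M: "M \<in> snd z" "s \<in> M" "t \<in> M" by blast
      then have "K \<subseteq> M" "L \<subseteq> M" using le_block(2)[OF y z(1,2)] K L by blast+
      then have "?m g \<subseteq> act G g ` M" by blast
      moreover have "act G g ` M \<in> snd z" by (rule D.free_partitionsD(2)[OF eltsD(2)[OF z(1)] g M(1)])
      ultimately show ?thesis by blast
    qed
    show ?thesis unfolding dowling_le_iff fst_conv snd_conv
    proof (intro conjI ballI)
      show "fst y \<subseteq> fst z" using z(2) by (simp add: dowling_le_iff)
      fix M assume "M \<in> ?\<pi>"
      then show "M \<subseteq> fst z \<or> (\<exists>M'\<in>snd z. M \<subseteq> M')"
      proof
        assume "M \<in> snd y - ?V"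
        then show ?thesis using z(2) by (simp add: dowling_le_iff)
      next
        assume "M \<in> ?m ` carrier G"
        then obtain g where g: "M = ?m g" "g \<in> carrier G" by (elim imageE)
        show ?thesis unfolding g(1) by (rule m[OF g(2)])
      qed
    qed
  qed
  then show ?thesis using j le lk c by (intro bexI[of _ "(fst y, ?\<pi>)"]) auto
qed

text \<open>If both points lie in different blocks of one G-orbit, say \<open>K\<close> and its
  translate by \<open>g\<close>, a common block would meet its own translate by \<open>g\<close> and
  violate freeness; so every element linking them has \<open>K\<close> in its zero block. If one
  point is in the zero block already, the block of the other must follow.\<close>

lemma join_exists:
  assumes y: "y \<in> elts" and st: "s \<in> pts" "t \<in> pts" "snd s \<noteq> snd t"
  shows "\<exists>j\<in>elts. dowling_le y j \<and> linked j s t \<and> card (snd y) \<le> card (snd j) + order G \<and>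
    (\<forall>z\<in>elts. dowling_le y z \<longrightarrow> linked z s t \<longrightarrow> dowling_le j z)"
proof -
  interpret P: gaut G "\<lambda>g. (`) (act G g)" "(`) id" "snd y" by (rule blocks[OF y])
  note p = eltsD(5)[OF y]
  have mixed: ?thesis if s: "u \<in> fst y" and t: "v \<in> pts" "v \<notin> fst y" and uv: "{u, v} = {s, t}" for u v
  proof -
    obtain K where K: "K \<in> snd y" "v \<in> K" using partition_on_block[OF p, of v] t by blast
    have "K \<in> borb K" by (rule P.gorb_self[OF K(1)])
    then have mem: "s \<in> fst y \<union> \<Union>(borb K)" "t \<in> fst y \<union> \<Union>(borb K)"
      using uv s K(2) by (auto simp: doubleton_eq_iff)
    have "K \<subseteq> fst z" if z: "z \<in> elts" "dowling_le y z" "linked z s t" for z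
    proof -
      have "u \<in> fst z" using s z(2) by (auto simp: dowling_le_iff)
      moreover have "linked z u v" using z(3) uv linked_sym[of z s t] by (auto simp: doubleton_eq_iff)
      ultimately have "v \<in> fst z" unfolding linked_def using partition_on_sub[OF eltsD(5)[OF z(1)]] by blast
      then show ?thesis using le_block(1)[OF y z(1,2) K] by blast
    qed
    then show ?thesis using absorb_join[OF y K(1) mem st(3)] by blast
  qed
  show ?thesis
  proof (cases "s \<in> fst y \<or> t \<in> fst y")
    case True
    show ?thesis
    proof (cases "s \<in> fst y \<and> t \<in> fst y")
      case True
      then show ?thesis using y fin_poset.po_refl[OF elts_poset y] by (auto simp: linked_def)
    next
      case False
      then show ?thesis using True mixed[of s t] mixed[of t s] st by (auto simp: insert_commute)
    qed
  next
    case False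
    obtain K where K: "K \<in> snd y" "s \<in> K" using partition_on_block[OF p, of s] st False by blast
    obtain L where L: "L \<in> snd y" "t \<in> L" using partition_on_block[OF p, of t] st False by blast
    show ?thesis
    proof (cases "L = K")
      case True
      then have "linked y s t" using K L by (auto simp: linked_def)
      then show ?thesis using y fin_poset.po_refl[OF elts_poset y] by auto
    next
      case neq: False
      show ?thesis
      proof (cases "L \<in> borb K")
        case False
        then show ?thesis by (rule merge_join[OF y K L])
      next
        case True
        then obtain g where g: "g \<in> carrier G" "L = act G g ` K" by (auto simp: P.gorb_def)
        have "K \<in> borb K" by (rule P.gorb_self[OF K(1)])
        then have mem: "s \<in> fst y \<union> \<Union>(borb K)" "t \<in> fst y \<union> \<Union>(borb K)" using K L True by blast+
        have "K \<subseteq> fst z" if z: "z \<in> elts" "dowling_le y z" "linked z s t" for z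
        proof (rule ccontr)
          assume nK: "\<not> K \<subseteq> fst z"
          then have "s \<notin> fst z" using le_block(1)[OF y z(1,2) K] by blast
          then obtain M where M: "M \<in> snd z" "s \<in> M" "t \<in> M" using z(3) by (auto simp: linked_def)
          have KM: "K \<subseteq> M" using le_block(2)[OF y z(1,2) K] M by blast
          note F = D.free_partitionsD[OF eltsD(2)[OF z(1)]]
          have "t \<in> act G g ` M" using L(2) KM unfolding g(2) by blast
          then have "act G g ` M = M"
            using partition_on_unique[OF F(1) F(2)[OF g(1) M(1)] M(1)] M(3) by blast
          then have "g = \<one>" by (rule F(4)[OF g(1) M(1)])
          then have "L = K" using P.a_one[OF K(1)] g(2) by simp
          then show False using neq by simp
        qed
        then show ?thesis using absorb_join[OF y K(1) mem st(3)] by blast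
      qed
    qed
  qed
qed

definition dbot :: "'a dowling_elt" where
  "dbot = ({}, sing pts)"

definition dtop :: "'a dowling_elt" where
  "dtop = (pts, {})"

lemma dbot_in: "dbot \<in> elts"
  using D.sing_free(1)[OF D.stable_T] D.stable_empty D.order_pos by (simp add: dbot_def elts_def)

lemma dtop_in: "dtop \<in> elts"
proof -
  have "card pts = order G * n" by (simp add: pts_def card_cartesian_product order_def)
  then have "card pts \<noteq> order G" using n D.order_pos by simp
  moreover have "{} \<in> D.free_partitions {}" by (simp add: D.free_partitions_def partition_on_empty)
  ultimately show ?thesis using D.stable_T by (simp add: dtop_def elts_def)
qed

lemma dbot_le: "z \<in> elts \<Longrightarrow> dowling_le dbot z"
proof -
  assume z: "z \<in> elts"
  have "{v} \<subseteq> fst z \<or> (\<exists>K'\<in>snd z. {v} \<subseteq> K')" if "v \<in> pts" for v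
    using partition_on_block[OF eltsD(5)[OF z], of v] that by auto
  then show ?thesis by (auto simp: dowling_le_iff dbot_def)
qed

lemma le_dtop: "z \<in> elts \<Longrightarrow> dowling_le z dtop"
proof -
  assume z: "z \<in> elts"
  have "K \<subseteq> pts" if "K \<in> snd z" for K using partition_on_sub[OF eltsD(5)[OF z] that] by blast
  then show ?thesis using eltsD(4)[OF z] by (auto simp: dowling_le_iff dtop_def)
qed

text \<open>A nonempty zero block exceeds a single G-orbit by the deletion, hence contains two
  labels. A block with two points has two labels, because points with the same label differ by a
  nontrivial group element, which would fix the block.\<close>

lemma linked_exists:
  assumes h: "h \<in> elts" "h \<noteq> dbot"
  shows "\<exists>s\<in>pts. \<exists>t\<in>pts. snd s \<noteq> snd t \<and> linked h s t"
proof -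
  have same: "\<exists>g\<in>carrier G. t = act G g s" if "s \<in> pts" "t \<in> pts" "snd s = snd t" for s t
    using that by (intro bexI[of _ "fst t \<otimes> inv (fst s)"]) (auto simp: pts_def act_def m_assoc prod_eq_iff)
  show ?thesis
  proof (cases "fst h = {}")
    case False
    then obtain s where s: "s \<in> fst h" by blast
    have sp: "s \<in> pts" using s eltsD(4)[OF h(1)] by blast
    have "D.gorb s \<subseteq> fst h" by (rule D.stable_gorb_sub[OF eltsD(1)[OF h(1)] s])
    moreover have "D.gorb s \<noteq> fst h" using D.card_gorb[OF sp] eltsD(3)[OF h(1)] by auto
    ultimately obtain t where t: "t \<in> fst h" "t \<notin> D.gorb s" by blast
    have "snd s \<noteq> snd t" using same[OF sp, of t] t eltsD(4)[OF h(1)] unfolding D.gorb_def by blast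
    then show ?thesis using s t eltsD(4)[OF h(1)] unfolding linked_def by blast
  next
    case True
    note p = eltsD(5)[OF h(1)]
    have "\<exists>K\<in>snd h. \<exists>s\<in>K. \<exists>t\<in>K. s \<noteq> t"
    proof (rule ccontr)
      assume no: "\<not> ?thesis"
      have one: "K = {v}" if "K \<in> snd h" "v \<in> K" for K v using no that by blast
      have "snd h = sing pts"
      proof (intro equalityI subsetI)
        fix K assume K: "K \<in> snd h"
        then obtain v where v: "v \<in> K" using partition_on_ne[OF p] by blast
        then show "K \<in> sing pts" using one[OF K v] partition_on_sub[OF p K] by blast
      next
        fix K assume "K \<in> sing pts"
        then obtain v where v: "v \<in> pts" "K = {v}" by blast
        then obtain M where M: "M \<in> snd h" "v \<in> M" using partition_on_block[OF p, of v] True by auto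
        then show "K \<in> snd h" using one[OF M] v by simp
      qed
      then show False using h(2) True by (simp add: dbot_def prod_eq_iff)
    qed
    then obtain K s t where K: "K \<in> snd h" "s \<in> K" "t \<in> K" "s \<noteq> t" by blast
    have pt: "s \<in> pts" "t \<in> pts" using partition_on_sub[OF p K(1)] K by blast+
    have "snd s \<noteq> snd t"
    proof
      assume "snd s = snd t"
      then obtain g where g: "g \<in> carrier G" "t = act G g s" using same[OF pt] by blast
      note F = D.free_partitionsD[OF eltsD(2)[OF h(1)]]
      have "act G g ` K = K"
        by (rule partition_on_unique[OF F(1) F(2)[OF g(1) K(1)] K(1) _ K(3)]) (use K g in blast)
      then have "g = \<one>" by (rule F(4)[OF g(1) K(1)])
      then show False using g K(4) D.a_one[OF pt(1)] by simp
    qed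
    then show ?thesis using K pt unfolding linked_def by blast
  qed
qed

text \<open>The element under \<open>h\<close> is the least one linking a pair of points that
  \<open>h\<close> links. Its join with \<open>y\<close> comes from \<open>join_exists\<close> at
  \<open>y\<close>, and it lies above the atom because it links the same pair.\<close>

lemma elts_semimodular: "semimodular_poset elts dowling_le rk dbot"
proof (intro semimodular_poset.intro semimodular_poset_axioms.intro elts_poset dbot_in dbot_le)
  interpret F: fin_poset elts dowling_le by (rule elts_poset)
  have "inj_on (\<lambda>t. {t}) pts" by (simp add: inj_on_def)
  then have "card (sing pts) = n * order G" by (simp add: pts_def card_image card_cartesian_product order_def mult.commute)
  then show "rk dbot = 0" using D.order_pos by (simp add: rk_def dbot_def)
  show "rk y < rk z" if "y \<in> elts" "z \<in> elts" "F.less y z" for y z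
    using rk_less that by (simp add: F.less_def)
  fix h assume h: "h \<in> elts" "h \<noteq> dbot"
  obtain s t where st: "s \<in> pts" "t \<in> pts" "snd s \<noteq> snd t" "linked h s t" using linked_exists[OF h] by blast
  obtain a where a: "a \<in> elts" "linked a s t" "\<And>z. z \<in> elts \<Longrightarrow> linked z s t \<Longrightarrow> dowling_le a z"
    using join_exists[OF dbot_in st(1-3)] dbot_le by blast
  have "\<not> linked dbot s t" using st(3) by (auto simp: linked_def dbot_def)
  then have "a \<noteq> dbot" using a(2) by blast
  moreover have "dowling_le a h" by (rule a(3)[OF h(1) st(4)])
  moreover have "\<exists>j\<in>elts. dowling_le j h \<and> dowling_le y j \<and> dowling_le a j \<and> rk j \<le> Suc (rk y) \<and>
      (\<forall>z\<in>elts. dowling_le y z \<longrightarrow> dowling_le a z \<longrightarrow> dowling_le j z)" if y: "y \<in> elts" "dowling_le y h" for y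
  proof -
    obtain j where j: "j \<in> elts" "dowling_le y j" "linked j s t" "card (snd y) \<le> card (snd j) + order G"
      "\<And>z. z \<in> elts \<Longrightarrow> dowling_le y z \<Longrightarrow> linked z s t \<Longrightarrow> dowling_le j z"
      using join_exists[OF y(1) st(1-3)] by blast
    have "card (snd y) div order G \<le> (card (snd j) + order G) div order G" by (rule div_le_mono[OF j(4)])
    then have "rk j \<le> Suc (rk y)" using D.order_pos by (simp add: rk_def)
    moreover have "dowling_le j h" by (rule j(5)[OF h(1) y(2) st(4)])
    moreover have "dowling_le a j" by (rule a(3)[OF j(1,3)])
    ultimately show ?thesis using j(1,2,5) linked_mono[OF a(2)] by blast
  qed
  ultimately show "\<exists>a\<in>elts. a \<noteq> dbot \<and> dowling_le a h \<and>
      (\<forall>y\<in>elts. dowling_le y h \<longrightarrow> (\<exists>j\<in>elts. dowling_le j h \<and> dowling_le y j \<and> dowling_le a j \<and> rk j \<le> Suc (rk y) \<and>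
        (\<forall>z\<in>elts. dowling_le y z \<longrightarrow> dowling_le a z \<longrightarrow> dowling_le j z)))"
    using a(1) by blast
qed

end

section \<open>The generating function\<close>

context dowling
begin

lemma dowling_act_simps [simp]:
  "fst (dowling_act x y) = x ` fst y" "snd (dowling_act x y) = (`) x ` snd y"
  by (simp_all add: dowling_act_def case_prod_unfold)

lemma dowling_act_inv:
  assumes "\<And>z. x' (x z) = z"
  shows "dowling_act x' (dowling_act x y) = y"
  by (rule prod_eqI) (simp_all add: image_image assms)

lemma dowling_act_mono: "dowling_le y z \<Longrightarrow> dowling_le (dowling_act x y) (dowling_act x z)"
  unfolding dowling_le_iff dowling_act_simps
proof (intro conjI ballI)
  assume le: "fst y \<subseteq> fst z \<and> (\<forall>K\<in>snd y. K \<subseteq> fst z \<or> (\<exists>K'\<in>snd z. K \<subseteq> K'))"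
  then show "x ` fst y \<subseteq> x ` fst z" by blast
  fix L assume "L \<in> (`) x ` snd y"
  then obtain K where K: "K \<in> snd y" "L = x ` K" by blast
  then have "K \<subseteq> fst z \<or> (\<exists>K'\<in>snd z. K \<subseteq> K')" using le by blast
  then show "L \<subseteq> x ` fst z \<or> (\<exists>K'\<in>(`) x ` snd z. L \<subseteq> K')" unfolding K(2) by blast
qed

lemma wreath_pts:
  assumes "x \<in> wreath G n"
  shows "x permutes pts" "\<And>g z. g \<in> carrier G \<Longrightarrow> z \<in> pts \<Longrightarrow> x (act G g z) = act G g (x z)"
    "gaut G (act G) x pts" "inv_into UNIV x \<in> wreath G n"
proof -
  show p: "x permutes pts" and c: "\<And>g z. g \<in> carrier G \<Longrightarrow> z \<in> pts \<Longrightarrow> x (act G g z) = act G g (x z)"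
    using assms by (auto simp: wreath_def pts_def)
  show "gaut G (act G) x pts"
    unfolding pts_def by (rule wreath_gaut) (use assms in \<open>simp_all add: wreath_label\<close>)
  have p': "inv_into UNIV x permutes pts" by (rule permutes_inv[OF p])
  have "inv_into UNIV x (act G g z) = act G g (inv_into UNIV x z)" if g: "g \<in> carrier G" and z: "z \<in> pts" for g z
  proof -
    have "inv_into UNIV x z \<in> pts" using permutes_in_image[OF p'] z by blast
    then have "x (act G g (inv_into UNIV x z)) = act G g z" using c[OF g] permutes_inverses(1)[OF p] by simp
    then show ?thesis using permutes_inverses(2)[OF p] by metis
  qed
  then show "inv_into UNIV x \<in> wreath G n" using p' unfolding wreath_def pts_def by blast
qed

lemma dowling_act_elts:
  assumes x: "x \<in> wreath G n" and y: "y \<in> elts"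
  shows "dowling_act x y \<in> elts"
proof -
  note p = wreath_pts(1)[OF x] and c = wreath_pts(2)[OF x]
  have inj: "inj x" by (rule permutes_inj[OF p])
  have im: "act G g ` x ` K = x ` act G g ` K" if "g \<in> carrier G" "K \<subseteq> pts" for g K
    using c[OF that(1)] that(2) unfolding image_image by (intro image_cong) (auto simp: subset_iff)
  note J = eltsD(4)[OF y] and st = eltsD(1)[OF y] and F = D.free_partitionsD[OF eltsD(2)[OF y]]
  have xp: "x ` pts = pts" by (rule permutes_image[OF p])
  have K: "K \<subseteq> pts" if "K \<in> snd y" for K using partition_on_sub[OF F(1) that] by blast
  have st': "D.stable (x ` fst y)"
    unfolding D.stable_def
  proof (intro conjI ballI)
    show "x ` fst y \<subseteq> pts" using J xp by blast
    fix g z assume gz: "g \<in> carrier G" "z \<in> x ` fst y"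
    have "act G g ` x ` fst y = x ` fst y" unfolding im[OF gz(1) J] D.a_surj[OF st gz(1)] ..
    then show "act G g z \<in> x ` fst y" using gz(2) by blast
  qed simp
  have A: "partition_on (pts - x ` fst y) ((`) x ` snd y)"
  proof -
    have "partition_on (x ` (pts - fst y)) ((`) x ` snd y - {{}})"
      by (rule partition_on_inj_image[OF F(1)]) (use inj in \<open>auto intro: inj_on_subset\<close>)
    moreover have "x ` (pts - fst y) = pts - x ` fst y" using xp inj by (simp add: image_set_diff)
    moreover have "{} \<notin> (`) x ` snd y" using partition_onD3[OF F(1)] by auto
    ultimately show ?thesis by simp
  qed
  have B: "act G g ` L \<in> (`) x ` snd y" if g: "g \<in> carrier G" and L: "L \<in> (`) x ` snd y" for g L
  proof -
    obtain M where M: "M \<in> snd y" "L = x ` M" using L by blast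
    show ?thesis unfolding M(2) im[OF g K[OF M(1)]] using F(2)[OF g M(1)] by blast
  qed
  have C: "id ` L \<in> (`) x ` snd y" if "L \<in> (`) x ` snd y" for L using that by simp
  have E: "g = \<one>" if g: "g \<in> carrier G" and L: "L \<in> (`) x ` snd y" "act G g ` L = L" for g L
  proof -
    obtain M where M: "M \<in> snd y" "L = x ` M" using L(1) by blast
    have "x ` act G g ` M = x ` M" using L(2) unfolding M(2) im[OF g K[OF M(1)]] .
    then have "act G g ` M = M" by (rule iffD1[OF inj_image_eq_iff[OF inj]])
    then show ?thesis by (rule F(4)[OF g M(1)])
  qed
  have "(`) x ` snd y \<in> D.free_partitions (pts - x ` fst y)"
    unfolding D.free_partitions_def by (intro CollectI conjI ballI impI A) (erule B C E; assumption)+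
  moreover have "card (x ` fst y) = card (fst y)" by (rule card_image) (use inj in \<open>auto intro: inj_on_subset\<close>)
  ultimately show ?thesis using st' eltsD(3)[OF y] by (simp add: elts_def)
qed

text \<open>\<open>x\<close> is injective on a finite set, so being mapped into itself and being
  mapped onto itself are the same for the first component and for the set of blocks.\<close>

lemma fixed_elts:
  assumes x: "x \<in> wreath G n"
  shows "y \<in> elts \<and> dowling_act x y = y \<longleftrightarrow>
    gaut.stable G (act G) x pts (fst y) \<and> snd y \<in> gaut.free_partitions G (act G) x (pts - fst y) \<and> card (fst y) \<noteq> order G"
proof -
  interpret A: gaut G "act G" x pts by (rule wreath_pts(3)[OF x])
  show ?thesis
  proof
    assume y: "y \<in> elts \<and> dowling_act x y = y"
    then have e: "x ` fst y = fst y" "(`) x ` snd y = snd y" by (simp_all add: prod_eq_iff)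
    have "x z \<in> fst y" if "z \<in> fst y" for z using imageI[OF that, of x] unfolding e(1) .
    then have "A.stable (fst y)" using eltsD(1)[of y] y unfolding A.stable_def D.stable_def by simp
    moreover have "x ` L \<in> snd y" if "L \<in> snd y" for L using imageI[OF that, of "(`) x"] unfolding e(2) .
    then have "snd y \<in> A.free_partitions (pts - fst y)"
      using eltsD(2)[of y] y unfolding A.free_partitions_def D.free_partitions_def by simp
    ultimately show "A.stable (fst y) \<and> snd y \<in> A.free_partitions (pts - fst y) \<and> card (fst y) \<noteq> order G"
      using y eltsD(3) by blast
  next
    assume y: "A.stable (fst y) \<and> snd y \<in> A.free_partitions (pts - fst y) \<and> card (fst y) \<noteq> order G"
    then have st: "A.stable (fst y)" and f: "snd y \<in> A.free_partitions (pts - fst y)" by auto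
    interpret P: gaut G "\<lambda>g. (`) (act G g)" "(`) x" "snd y"
      by (rule A.blocks_gaut[OF A.stable_Diff[OF A.stable_T st] f])
    have "dowling_act x y = y"
      using A.x_surj[OF st] P.x_surj[OF P.stable_T] by (simp add: prod_eq_iff)
    moreover have "y \<in> elts"
      using y unfolding elts_def A.stable_def D.stable_def A.free_partitions_def D.free_partitions_def by simp
    ultimately show "y \<in> elts \<and> dowling_act x y = y" by blast
  qed
qed

lemma tilde_order: "gorder.le (dowling_tilde G n) = dowling_le" "eq (dowling_tilde G n) = (=)"
  by (simp_all add: dowling_tilde_def dowling_lattice_def)

lemma proper_part_carrier: "carrier (proper_part (dowling_tilde G n)) = elts - {dbot, dtop}"
proof -
  interpret F: fin_poset elts dowling_le by (rule elts_poset)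
  let ?P = "dowling_tilde G n"
  have "least ?P l (carrier ?P) \<longleftrightarrow> l = dbot" for l
    unfolding least_def carrier_tilde tilde_order
    using dbot_in dbot_le F.po_antisym[of l dbot] by auto
  then have "\<bottom>\<^bsub>?P\<^esub> = dbot" by (simp add: bottom_def)
  moreover have "greatest ?P l (carrier ?P) \<longleftrightarrow> l = dtop" for l
    unfolding greatest_def carrier_tilde tilde_order
    using dtop_in le_dtop F.po_antisym[of l dtop] by auto
  then have "\<top>\<^bsub>?P\<^esub> = dtop" by (simp add: Order.top_def)
  ultimately show ?thesis by (simp add: proper_part_def carrier_tilde)
qed

lemma proper_part_order:
  "gorder.le (proper_part (dowling_tilde G n)) = dowling_le" "eq (proper_part (dowling_tilde G n)) = (=)"
  by (simp_all add: proper_part_def tilde_order)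

text \<open>Hall's theorem is applied on the poset of fixed elements with the weights
  \<open>wt\<close>, whose recursion is \<open>sum_weights\<close>. Its minus sign turns the sign
  (-1)^(n-1) of \<open>trace_homology\<close> into (-1)^n, and \<open>bottom_weight\<close>
  evaluates the weight of the bottom.\<close>

theorem trace_eq:
  assumes x: "x \<in> wreath G n"
  shows "lin_trace (reduced_homology (proper_part (dowling_tilde G n)) (int n - 2)) (homology_map (dowling_act x)) =
    (-1) ^ n * (gval G (-1) (wty G {1..n} x) + (\<Sum>c\<in>conj_classes G.
      of_nat (lookup (wty G {1..n} x) (1, c)) * gval G (-1) (wty G {1..n} x - single (1, c) 1)))"
proof -
  interpret S: semimodular_poset elts dowling_le rk dbot by (rule elts_semimodular)
  interpret A: gaut G "act G" x pts by (rule wreath_pts(3)[OF x])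
  let ?P = "proper_part (dowling_tilde G n)" and ?x' = "inv_into UNIV x"
  note p = wreath_pts(1)[OF x] and x' = wreath_pts(4)[OF x]
  have ix: "x (?x' z) = z" "?x' (x z) = z" for z using permutes_inverses[OF p] by auto
  have inv: "dowling_act x (dowling_act ?x' y) = y" "dowling_act ?x' (dowling_act x y) = y" for y
    by (rule dowling_act_inv, rule ix)+
  have rt: "rk dtop = n" by (simp add: rk_def dtop_def)
  have V: "S.below dtop = elts - {dbot, dtop}"
    using le_dtop by (auto simp: S.below_def S.less_def)
  have fix_bt: "dowling_act u dbot = dbot" "dowling_act u dtop = dtop" if "u \<in> wreath G n" for u
  proof -
    have "u ` pts = pts" by (rule permutes_image[OF wreath_pts(1)[OF that]])
    then have "sing pts = (`) u ` sing pts" by (force simp: image_image)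
    then show "dowling_act u dbot = dbot" by (simp add: prod_eq_iff dbot_def)
    show "dowling_act u dtop = dtop" using \<open>u ` pts = pts\<close> by (simp add: prod_eq_iff dtop_def)
  qed
  have clV: "dowling_act u y \<in> S.below dtop"
    if u: "u \<in> wreath G n" "\<And>z. u' (u z) = z" "u' \<in> wreath G n" and y: "y \<in> S.below dtop" for u u' y
  proof -
    have "dowling_act u' (dowling_act u y) = y" by (rule dowling_act_inv) (rule u(2))
    moreover have "y \<noteq> dbot" "y \<noteq> dtop" "y \<in> elts" using y V by auto
    ultimately have "dowling_act u y \<noteq> dbot" "dowling_act u y \<noteq> dtop"
      using fix_bt[OF u(3)] by metis+
    then show ?thesis using dowling_act_elts[OF u(1) \<open>y \<in> elts\<close>] V by simp
  qed
  \<comment> \<open>Degree \<open>n - 2\<close> belongs to faces with \<open>n - 1\<close> vertices,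
    the maximal number in the open interval.\<close>
  have N: "int n - 2 = int (n - 1) - 1" using n by simp
  have tr: "lin_trace (reduced_homology ?P (int (n - 1) - 1)) (homology_map (dowling_act x)) =
      (-1) ^ (n - 1) * S.euler {y \<in> S.below dtop. dowling_act x y = y}"
  proof (rule S.trace_homology)
    show "carrier ?P = S.below dtop" using proper_part_carrier V by simp
    show "S.below dtop \<subseteq> elts" by (rule S.below_subset)
    show "S.acyclic_at (S.below dtop) i" if "i < n - 1" for i
      by (rule S.acyclic_below[OF dtop_in]) (use that rt in simp)
    show "S.faces (S.below dtop) k = {}" if "n - 1 < k" for k
      using S.faces_below_card[OF _ dtop_in, of _ k] that rt n by fastforce
    show "dowling_act x y \<in> S.below dtop" if "y \<in> S.below dtop" for y by (rule clV[OF x ix(2) x' that])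
    show "dowling_act ?x' y \<in> S.below dtop" if "y \<in> S.below dtop" for y by (rule clV[OF x' ix(1) x that])
    show "dowling_le (dowling_act ?x' y) (dowling_act ?x' z) \<longleftrightarrow> dowling_le y z" for y z
      using dowling_act_mono[of "dowling_act ?x' y" "dowling_act ?x' z" x] dowling_act_mono[of y z ?x'] inv by auto
  qed (simp_all add: proper_part_order inv)
  let ?A = "{y \<in> elts. dowling_act x y = y}" and ?w = "\<lambda>y. A.wt (fst y) (snd y)"
  have fx: "y \<in> ?A \<longleftrightarrow> A.stable (fst y) \<and> snd y \<in> A.free_partitions (pts - fst y) \<and> card (fst y) \<noteq> order G" for y
    using fixed_elts[OF x, of y] by simp
  interpret F: fin_poset ?A dowling_le
  proof
    show "finite ?A" using S.fin by simp
    show "dowling_le y y" if "y \<in> ?A" for y using S.po_refl that by simp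
    show "y = z" if "y \<in> ?A" "z \<in> ?A" "dowling_le y z" "dowling_le z y" for y z
      by (rule S.po_antisym) (use that in simp_all)
    show "dowling_le y w" if "y \<in> ?A" "z \<in> ?A" "w \<in> ?A" "dowling_le y z" "dowling_le z w" for y z w
      by (rule S.po_trans[of y z w]) (use that in simp_all)
  qed
  have bt: "dbot \<noteq> dtop" using n D.order_pos by (auto simp: dbot_def dtop_def pts_def order_def card_gt_0_iff)
  have pne: "pts \<noteq> {}" using bt by (auto simp: dbot_def dtop_def)
  have "?w dbot = - F.euler {z \<in> ?A. F.less dbot z \<and> z \<noteq> dtop}"
  proof (rule F.hall)
    show "dtop \<in> ?A" using dtop_in fix_bt(2)[OF x] by simp
    show "dowling_le y dtop" if "y \<in> ?A" for y using le_dtop that by simp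
    show "?w dtop = 1"
    proof -
      have "A.bty {} = 0"
        using gaut.ty_empty[OF A.blocks_gaut[OF A.stable_empty, of "{}"]]
        by (simp add: A.free_partitions_def partition_on_empty)
      then show ?thesis using pne by (simp add: A.wt_def dtop_def)
    qed
    show "dbot \<in> ?A" using dbot_in fix_bt(1)[OF x] by simp
    show "dbot \<noteq> dtop" by (rule bt)
    show "(\<Sum>z\<in>{z \<in> ?A. dowling_le y z}. ?w z) = 0" if y: "y \<in> ?A" "y \<noteq> dtop" for y
    proof -
      have y': "A.stable (fst y)" "card (fst y) \<noteq> order G" "snd y \<in> A.free_partitions (pts - fst y)"
        using y(1) unfolding fx by auto
      have "{z \<in> ?A. dowling_le y z} = {q. q \<in> A.up (fst y) (snd y) \<and> card (fst q) \<noteq> order G}"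
        unfolding set_eq_iff mem_Collect_eq fx[unfolded mem_Collect_eq] dowling_le_iff A.up_def
        by (auto simp: case_prod_unfold)
      moreover have "snd y \<noteq> {}"
      proof
        assume e: "snd y = {}"
        then have "pts - fst y = {}" using partition_onD1[OF A.free_partitionsD(1)[OF y'(3)]] by simp
        moreover have "fst y \<subseteq> pts" using y'(1) by (simp add: A.stable_def)
        ultimately show False using e y(2) by (auto simp: dtop_def prod_eq_iff)
      qed
      ultimately show ?thesis using A.sum_weights[OF pne y'] by simp
    qed
  qed
  moreover have "{z \<in> ?A. F.less dbot z \<and> z \<noteq> dtop} = {y \<in> S.below dtop. dowling_act x y = y}"
    using dbot_le V by (auto simp: F.less_def)
  ultimately have "S.euler {y \<in> S.below dtop. dowling_act x y = y} = - A.wt {} (sing pts)"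
    by (simp add: dbot_def)
  moreover have "(-1 :: rat) ^ n = - ((-1) ^ (n - 1))" using n by (cases n) auto
  ultimately show ?thesis
    unfolding N tr pts_def[symmetric] A.bottom_weight[symmetric] by simp
qed

end

text \<open>Taking Z_v out of each factor leaves a falling factorial of -A_v, that is, k! times a
  binomial coefficient. Here the Moebius values meet the coefficients of the inverse series.\<close>

lemma gval_neg_one:
  "gval G (-1) m = centralizer_order G m * mprod (\<lambda>v k. - binom_exp G v gchoose k) m"
proof -
  have "(\<Prod>t<k. -1 * bcoef G v - of_nat t * class_weight G v) =
      class_weight G v ^ k * fact k * (- binom_exp G v gchoose k)" for v k
  proof -
    have "(\<Prod>t<k. -1 * bcoef G v - of_nat t * class_weight G v) =
        (\<Prod>t<k. class_weight G v * (- binom_exp G v - of_nat t))"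
      by (rule prod.cong) (simp_all add: bcoef_def algebra_simps)
    also have "\<dots> = class_weight G v ^ k * (\<Prod>t<k. - binom_exp G v - of_nat t)"
      by (simp add: prod.distrib)
    also have "(\<Prod>t<k. - binom_exp G v - of_nat t) = fact k * (- binom_exp G v gchoose k)"
      by (simp add: gbinomial_prod_rev atLeast0LessThan)
    finally show ?thesis by (simp add: mult.assoc)
  qed
  then show ?thesis unfolding gval_def centralizer_order_def mprod_def by (simp add: prod.distrib)
qed

theorem theorem2p4:
  fixes G :: "('a, 'b) monoid_scheme"
  assumes "group G" and "finite (carrier G)" and "carrier G \<noteq> {\<one>\<^bsub>G\<^esub>}"
  shows "1 + formal_sum (\<lambda>n. (-1) ^ n *
             ch G n (reduced_homology (proper_part (dowling_tilde G n)) (int n - 2))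
               (\<lambda>x. homology_map (dowling_act x))) {2..}
       = (1 + (\<Sum>c\<in>conj_classes G.
              mps_const (of_nat (card c) / of_nat (order G)) * pvar 1 c))
         * mps_inverse (pleth G (Exp_series G) L_series)"
proof -
  interpret F: fin_group G using assms(1,2) by (simp add: fin_group_def fin_group_axioms_def)
  let ?C = "conj_classes G" and ?V = "mprod (\<lambda>v k. - binom_exp G v gchoose k)"
  let ?z = "centralizer_order G" and ?e = "\<lambda>c. single (1 :: nat, c) (1 :: nat)"
  let ?tr = "\<lambda>m. gval G (-1) m + (\<Sum>c\<in>?C. of_nat (lookup m (1, c)) * gval G (-1) (m - ?e c))"
  let ?H = "\<lambda>n. (-1) ^ n * ch G n (reduced_homology (proper_part (dowling_tilde G n)) (int n - 2))
               (\<lambda>x. homology_map (dowling_act x))"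
  let ?adm = "\<lambda>m. keys m \<subseteq> {1..} \<times> ?C"
  have finC: "finite ?C" using assms(2) by (simp add: conj_classes_def)
  have cw: "class_weight G (1, c) = of_nat (order G) / of_nat (card c)" for c by (simp add: class_weight_def)
  \<comment> \<open>The inverse of the plethysm has the exponents -A_v, and multiplication by p_1(c)
    shifts its coefficients by one variable.\<close>
  have R: "mps_coeff ((1 + (\<Sum>c\<in>?C. mps_const (of_nat (card c) / of_nat (order G)) * pvar 1 c))
         * mps_inverse (pleth G (Exp_series G) L_series)) m =
      ?V m + (\<Sum>c\<in>?C. if lookup m (1, c) = 0 then 0 else ?V (m - ?e c) / class_weight G (1, c))" for m
  proof -
    note th = theta_pleth_L[OF finC F.mps_coeff_Exp] and c0 = mps_coeff_pleth_L_0[OF finC F.mps_coeff_Exp]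
    have i: "mps_inverse (pleth G (Exp_series G) L_series) = Abs_mps ?V"
      by (rule mps_inverse_binomial[OF c0]) (simp add: th binom_exp_def)
    have "mps_coeff ((1 + (\<Sum>c\<in>?C. mps_const (of_nat (card c) / of_nat (order G)) * pvar 1 c)) * Abs_mps ?V) m =
        ?V m + (\<Sum>c\<in>?C. of_nat (card c) / of_nat (order G) * mps_coeff (pvar 1 c * Abs_mps ?V) m)"
      by (simp add: distrib_right sum_distrib_right mps_coeff_sum mult.assoc)
    also have "(\<Sum>c\<in>?C. of_nat (card c) / of_nat (order G) * mps_coeff (pvar 1 c * Abs_mps ?V) m) =
        (\<Sum>c\<in>?C. if lookup m (1, c) = 0 then 0 else ?V (m - ?e c) / class_weight G (1, c))"
      by (rule sum.cong) (simp_all add: mps_coeff_var_times cw[unfolded One_nat_def])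
    finally show ?thesis unfolding i .
  qed
  \<comment> \<open>Removing one variable (1, c) divides the centralizer order by Z_v times the
    exponent. The exponent cancels against the number of orbits of that class, and 1 / Z_v = |c| /
    |G| is the coefficient in the linear factor.\<close>
  have ratio: "?tr m / ?z m =
      ?V m + (\<Sum>c\<in>?C. if lookup m (1, c) = 0 then 0 else ?V (m - ?e c) / class_weight G (1, c))"
    if adm: "?adm m" for m
  proof -
    have z: "?z m \<noteq> 0" by (rule F.centralizer_order_nonzero[OF adm])
    have "of_nat (lookup m (1, c)) * gval G (-1) (m - ?e c) / ?z m =
        (if lookup m (1, c) = 0 then 0 else ?V (m - ?e c) / class_weight G (1, c))" for c
    proof (cases "lookup m (1, c) = 0")
      case False
      define m' where "m' = m - ?e c"
      have m: "m = m' + ?e c"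
        using False by (intro poly_mapping_eqI) (auto simp: m'_def lookup_add lookup_minus lookup_single when_def)
      have zm: "?z m = ?z m' * (class_weight G (1, c) * of_nat (lookup m (1, c)))"
        unfolding m centralizer_order_add_single by (simp add: lookup_add)
      then have "?z m' \<noteq> 0" using z by auto
      then show ?thesis unfolding m'_def[symmetric] gval_neg_one zm using False by simp
    qed simp
    then show ?thesis unfolding add_divide_distrib sum_divide_distrib using z by (simp add: gval_neg_one)
  qed
  \<comment> \<open>The sign in the sum cancels the sign of the trace.\<close>
  have L: "mps_coeff (?H n) m = (if ?adm m \<and> pweight m = n then ?tr m / ?z m else 0)" if n: "2 \<le> n" for n m
  proof -
    interpret Q: dowling G n using n by unfold_locales
    have "mps_coeff (ch G n (reduced_homology (proper_part (dowling_tilde G n)) (int n - 2))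
               (\<lambda>x. homology_map (dowling_act x))) m =
        (if ?adm m \<and> pweight m = n then (-1) ^ n * ?tr m / ?z m else 0)"
      by (rule F.mps_coeff_ch[where f = "\<lambda>m. (-1) ^ n * ?tr m"]) (rule Q.trace_eq)
    moreover have "(-1 :: rat) ^ n * (-1) ^ n = 1" by (simp add: power_mult_distrib[symmetric])
    ultimately show ?thesis
      unfolding mps_const_neg_one_power mps_coeff_const_times
      by (simp add: mult.assoc[symmetric] times_divide_eq_right[symmetric] del: times_divide_eq_right)
  qed
  \<comment> \<open>Variables that do not belong to the ring of \<open>G\<close> have exponent zero,
    so they are absent from the inverse series as well.\<close>
  have b0: "binom_exp G v = 0" if "v \<notin> {1..} \<times> ?C" for v
  proof (cases "1 \<le> fst v")
    case True
    then have "snd v \<notin> ?C" using that by (auto simp: mem_Times_iff)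
    have "mobius_coeff G v w = 0" if w: "w \<in> {1..fst v} \<times> ?C" for w
    proof -
      obtain h where h: "h \<in> carrier G" "snd w = conj_class G h" using w by (auto simp: conj_classes_def)
      have "class_pow G (snd w) e \<in> ?C" for e
        unfolding h(2) F.class_pow_class[OF h(1)] using h(1) by (simp add: conj_classes_def)
      then have "class_pow G (snd w) (fst v div fst w) \<noteq> snd v" using \<open>snd v \<notin> ?C\<close> by metis
      then show ?thesis by (simp add: mobius_coeff_def Let_def)
    qed
    then show ?thesis by (simp add: binom_exp_def)
  next
    case False
    then show ?thesis by (simp add: binom_exp_def)
  qed
  have V0: "?V m = 0" if "v \<in> keys m" "v \<notin> {1..} \<times> ?C" for v m
  proof -
    have "(- binom_exp G v gchoose lookup m v) = 0"
      using that b0[OF that(2)] by (cases "lookup m v") (auto simp: in_keys_iff)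
    then show ?thesis unfolding mprod_def using that(1) by (intro prod_zero) auto
  qed
  show ?thesis
  proof (rule mps_eqI)
    fix m :: "nat \<times> 'a set \<Rightarrow>\<^sub>0 nat"
    let ?r = "?V m + (\<Sum>c\<in>?C. if lookup m (1, c) = 0 then 0 else ?V (m - ?e c) / class_weight G (1, c))"
    have fs: "mps_coeff (formal_sum ?H {2..}) m = (if ?adm m \<and> 2 \<le> pweight m then ?tr m / ?z m else 0)"
    proof -
      have "mps_coeff (formal_sum ?H {2..}) m = (\<Sum>n\<in>{pweight m} \<inter> {2..}. mps_coeff (?H n) m)"
        by (rule mps_coeff_formal_sum) (auto simp: L split: if_splits)
      also have "\<dots> = (if ?adm m \<and> 2 \<le> pweight m then ?tr m / ?z m else 0)"
        by (cases "2 \<le> pweight m") (auto simp: L)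
      finally show ?thesis .
    qed
    \<comment> \<open>The sum on the left starts in degree two, so degree one must vanish on the
      right: there the inverse series and the linear factor contribute opposite terms, because A_v
      Z_v = 1 for v = (1, c).\<close>
    have "(if m = 0 then 1 else 0) + (if ?adm m \<and> 2 \<le> pweight m then ?tr m / ?z m else 0) = ?r"
    proof (cases "?adm m")
      case False
      then obtain v where v: "v \<in> keys m" "v \<notin> {1..} \<times> ?C" by blast
      have "?V (m - ?e c) = 0" if "c \<in> ?C" for c
      proof (rule V0[OF _ v(2)])
        have "v \<noteq> (1, c)" using v(2) that by auto
        then show "v \<in> keys (m - ?e c)" using v(1) by (auto simp: in_keys_iff lookup_minus lookup_single)
      qed
      then have "?r = 0" using V0[OF v] by (simp add: sum.neutral)
      moreover have "m \<noteq> 0" using v(1) by auto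
      ultimately show ?thesis using False by simp
    next
      case adm: True
      show ?thesis
      proof (cases "2 \<le> pweight m")
        case True
        then have "m \<noteq> 0" by auto
        then show ?thesis using adm True ratio[OF adm] by simp
      next
        case small: False
        show ?thesis
        proof (cases "m = 0")
          case True
          then show ?thesis by simp
        next
          case False
          then have "keys m \<noteq> {}" by simp
          then obtain v where v: "v \<in> keys m" by blast
          then have v1: "1 \<le> fst v" "snd v \<in> ?C" using adm by auto
          define m' where "m' = m - single v 1"
          have m: "m = m' + single v 1"
            using v by (intro poly_mapping_eqI) (auto simp: m'_def lookup_add lookup_minus lookup_single when_def in_keys_iff)
          have "pweight m' + fst v \<le> 1" using small by (simp add: m pweight_add)
          then have w: "pweight m' = 0" "fst v = 1" using v1 by auto
          have "m' = 0"
          proof (rule ccontr)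
            assume "m' \<noteq> 0"
            then have "keys m' \<noteq> {}" by simp
            then obtain u where u: "u \<in> keys m'" by blast
            then have "fst u * lookup m' u = 0" using w(1) by (simp add: pweight_def)
            moreover have "u \<in> keys m" using u by (simp add: m in_keys_iff lookup_add)
            then have "u \<in> {1..} \<times> ?C" using adm by blast
            ultimately show False using u by (simp add: in_keys_iff mem_Times_iff)
          qed
          then obtain c where c: "m = ?e c" "c \<in> ?C" using m v1 w(2) by (cases v) auto
          then obtain h where h: "h \<in> carrier G" "c = conj_class G h" by (auto simp: conj_classes_def)
          have "{g \<in> carrier G. \<one>\<^bsub>G\<^esub> \<otimes>\<^bsub>G\<^esub> g = h} = {h}" using h(1) by auto
          then have "bcoef G (1, c) = 1"
            unfolding h(2) F.bcoef_class[OF assms(2) h(1) order_refl]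
            by (simp add: F.nroots_def moebius_mu_def)
          then have b1: "binom_exp G (1, c) * class_weight G (1, c) = 1" by (simp only: bcoef_def)
          have b2: "class_weight G (1, c) \<noteq> 0" by (rule F.class_weight_nonzero) (use c in simp)
          have b: "binom_exp G (1, c) = 1 / class_weight G (1, c)" by (rule eq_divide_imp[OF b2 b1])
          have Vm: "?V m = - (1 / class_weight G (1, c))" by (simp add: c(1) mprod_def b[unfolded One_nat_def])
          have "(\<Sum>d\<in>?C. if lookup m (1, d) = 0 then 0 else ?V (m - ?e d) / class_weight G (1, d)) =
              (\<Sum>d\<in>?C. if d = c then 1 / class_weight G (1, c) else 0)"
            by (rule sum.cong) (auto simp: c(1) lookup_single when_def)
          also have "\<dots> = 1 / class_weight G (1, c)" using finC c(2) by (simp add: sum.delta)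
          finally show ?thesis using Vm False small by simp
        qed
      qed
    qed
    then show "mps_coeff (1 + formal_sum ?H {2..}) m =
        mps_coeff ((1 + (\<Sum>c\<in>?C. mps_const (of_nat (card c) / of_nat (order G)) * pvar 1 c))
         * mps_inverse (pleth G (Exp_series G) L_series)) m"
      unfolding R using fs by (simp add: mps_coeff_1)
  qed
qed

end
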